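(* Let $n\in\{2,3\}$, let $X^{2n}$ be a compact complex manifold of complex dimension $n$ with Kähler form $\omega$ and holomorphic volume form $\Omega$, and put $K=2^{n/3}$. Let $u_t$, $t\in[0,\infty)$, be the smooth solution of the $\mathrm{MA}^{1/3}$ flow $$\frac{du_t}{dt}=6K\Big(e^{-2\log|\Omega|_\omega}\frac{\det(\omega+i\partial\bar\partial u_t)}{\det\omega}\Big)^{\frac13},\qquad \omega+i\partial\bar\partial u_t>0,\qquad u_0=0,$$ on $X^{2n}$, let $\widetilde\omega_t=\omega+i\partial\bar\partial u_t$ with associated Riemannian metric $\widetilde h_t$, and let $\Theta_t:X^{2n}\to X^{2n}$ be the family of diffeomorphisms defined by $$\frac{d}{dt}\Theta_t(p)=Y_t(\Theta_t(p)),\quad\Theta_0=\mathrm{id},\qquad Y_t=-K\,\nabla_{\widetilde h_t}\big(|\Omega|_{\widetilde\omega_t}^{-\frac23}\big).$$ Then the $G_2$-structures $$\varphi_t=-dr^1\wedge dr^2\wedge dr^3+dr^1\wedge\Theta_t^*\widetilde\omega_t+dr^2\wedge\operatorname{Re}(\Theta_t^*\Omega)+dr^3\wedge\operatorname{Im}(\Theta_t^*\Omega)\quad\text{on }M^7=T^3\times X^4\text{ if }n=2,$$ $$\varphi_t=\operatorname{Re}(\Theta_t^*\Omega)-dr\wedge\Theta_t^*\widetilde\omega_t\quad\text{on }M^7=S^1\times X^6\text{ if }n=3,$$ solve the $G_2$-Laplacian flow $\frac{d\varphi_t}{dt}=\Delta_{d_t}\varphi_t$ for all $t\in[0,\infty)$,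 with initial data $\varphi_0=-dr^1\wedge dr^2\wedge dr^3+dr^1\wedge\omega+dr^2\wedge\operatorname{Re}(\Omega)+dr^3\wedge\operatorname{Im}(\Omega)$, respectively $\varphi_0=\operatorname{Re}(\Omega)-dr\wedge\omega$. Consequently, the $G_2$-Laplacian flow starting from this initial data is given by $\varphi_t$.
   Context: A holomorphic volume form is a nowhere vanishing holomorphic $(n,0)$-form. In local holomorphic coordinates write $\omega=i\,h_{p\bar q}dz^p\wedge d\bar z^q$ and $\Omega=f\,dz^1\wedge\dots\wedge dz^n$; then $|\Omega|_\omega^2=|f|^2/\det(h_{p\bar q})$, and $\det(\omega+i\partial\bar\partial u)/\det\omega=(\omega+i\partial\bar\partial u)^n/\omega^n$. The Riemannian metric $h$ of a Kähler form $\omega$ with complex structure $J$ is given by $\omega(\cdot,\cdot)=h(J\cdot,\cdot)$. $\nabla_h$ is the Riemannian gradient. It is known that the $\mathrm{MA}^{1/3}$ flow above has a smooth solution for all $t\in[0,\infty)$. $r^1,r^2,r^3$ are the angle coordinates on $T^3$, $r$ is the angle coordinate on $S^1$; forms on the factors are pulled back to $M^7$. A $G_2$-structure on a 7-manifold is a smooth 3-form $\varphi$ that is positive, i.e. $(Y\lrcorner\varphi)\wedge(Y\lrcorner\varphi)\wedge\varphi\neq0$ for every nonzero tangent vector $Y$. It induces a unique Riemannian metric $g$ and volume form $\mathrm{vol}$ (the Riemannian volume form of $g$) by $-\frac16(Y\lrcorner\varphi)\wedge(Z\lrcorner\varphi)\wedge\varphi=g(Y,Z)\,\mathrm{vol}$.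 $\Delta_{d_t}=dd_t^*+d_t^*d$ is the Hodge Laplacian of the metric induced by $\varphi_t$. For closed initial data on a compact manifold, the $G_2$-Laplacian flow is known to have short-time existence and uniqueness. *)

theory Defs
  imports "HOL-Analysis.Analysis" "HOL-Combinatorics.Permutations"
begin

section \<open>Smooth and holomorphic functions on subsets of Euclidean spaces\<close>

text \<open>
  Derivatives are taken within the set.  On open sets they are the usual ones.  On relatively
  open subsets of sets like \<open>{0..} \<times> U\<close> with \<open>U\<close> open (time intervals with left
  end point) they are still unique and one-sided in time at the boundary.
\<close>

fun Ck_on :: "nat \<Rightarrow> 'e::real_normed_vector set \<Rightarrow> ('e \<Rightarrow> 'f::real_normed_vector) \<Rightarrow> bool" where
  "Ck_on 0 S f \<longleftrightarrow> continuous_on S f"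
| "Ck_on (Suc k) S f \<longleftrightarrow> (\<forall>x\<in>S. f differentiable (at x within S)) \<and>
     (\<forall>v. Ck_on k S (\<lambda>x. frechet_derivative f (at x within S) v))"

definition smooth_on :: "'e::real_normed_vector set \<Rightarrow> ('e \<Rightarrow> 'f::real_normed_vector) \<Rightarrow> bool" where
  "smooth_on S f \<longleftrightarrow> (\<forall>k. Ck_on k S f)"

definition holomorphic_fun_on :: "(complex^'n) set \<Rightarrow> (complex^'n \<Rightarrow> complex) \<Rightarrow> bool" where
  "holomorphic_fun_on S f \<longleftrightarrow> smooth_on S f \<and>
     (\<forall>x\<in>S. \<forall>v. frechet_derivative f (at x) (\<i> *s v) = \<i> * frechet_derivative f (at x) v)"

text \<open>Wirtinger operators $\partial/\partial z^p$ and $\partial/\partial\bar z^q$.\<close>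

definition d_z :: "'n::finite \<Rightarrow> (complex^'n \<Rightarrow> complex) \<Rightarrow> complex^'n \<Rightarrow> complex" where
  "d_z p f x = (frechet_derivative f (at x) (axis p 1) - \<i> * frechet_derivative f (at x) (axis p \<i>)) / 2"

definition d_zbar :: "'n::finite \<Rightarrow> (complex^'n \<Rightarrow> complex) \<Rightarrow> complex^'n \<Rightarrow> complex" where
  "d_zbar q f x = (frechet_derivative f (at x) (axis q 1) + \<i> * frechet_derivative f (at x) (axis q \<i>)) / 2"


section \<open>Multilinear algebra on a Euclidean space\<close>

text \<open>
  An alternating \<open>k\<close>-form on a vector space is represented by a function on lists of vectors.
  Only its values on lists of length \<open>k\<close> are meaningful.
\<close>

type_synonym ('e, 'b) mform = "'e list \<Rightarrow> 'b"

definition alternating :: "nat \<Rightarrow> ('e::real_vector, 'b::real_vector) mform \<Rightarrow> bool" where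
  "alternating k \<alpha> \<longleftrightarrow>
     (\<forall>vs i. length vs = k \<longrightarrow> i < k \<longrightarrow> linear (\<lambda>v. \<alpha> (vs[i := v]))) \<and>
     (\<forall>vs i j. length vs = k \<longrightarrow> i < j \<longrightarrow> j < k \<longrightarrow> vs ! i = vs ! j \<longrightarrow> \<alpha> vs = 0)"

text \<open>
  Wedge product of a \<open>k\<close>-form with a form of any degree, normalised such that
  $(dx\wedge dy)(\partial_x,\partial_y)=1$.
\<close>

definition wedge :: "nat \<Rightarrow> ('e, 'b::field_char_0) mform \<Rightarrow> ('e, 'b) mform \<Rightarrow> ('e, 'b) mform" where
  "wedge k \<alpha> \<beta> = (\<lambda>vs.
     (\<Sum>\<sigma> | \<sigma> permutes {..<length vs}. of_int (sign \<sigma>) *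
        \<alpha> (map (\<lambda>i. vs ! \<sigma> i) [0..<k]) * \<beta> (map (\<lambda>i. vs ! \<sigma> i) [k..<length vs]))
     / (fact k * fact (length vs - k)))"

definition interior_product :: "'e \<Rightarrow> ('e, 'b) mform \<Rightarrow> ('e, 'b) mform" where
  "interior_product Y \<alpha> = (\<lambda>vs. \<alpha> (Y # vs))"

definition inner_product_form :: "('e::real_vector \<Rightarrow> 'e \<Rightarrow> real) \<Rightarrow> bool" where
  "inner_product_form g \<longleftrightarrow> bilinear g \<and> (\<forall>v w. g v w = g w v) \<and> (\<forall>v. v \<noteq> 0 \<longrightarrow> g v v > 0)"

definition orthonormal_frame :: "('e::euclidean_space \<Rightarrow> 'e \<Rightarrow> real) \<Rightarrow> 'e list \<Rightarrow> bool" where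
  "orthonormal_frame g es \<longleftrightarrow> length es = DIM('e) \<and>
     (\<forall>i<DIM('e). \<forall>j<DIM('e). g (es ! i) (es ! j) = (if i = j then 1 else 0))"

definition volume_form_of :: "('e::euclidean_space \<Rightarrow> 'e \<Rightarrow> real) \<Rightarrow> ('e, real) mform \<Rightarrow> bool" where
  "volume_form_of g vol \<longleftrightarrow> alternating (DIM('e)) vol \<and>
     (\<forall>es. orthonormal_frame g es \<longrightarrow> \<bar>vol es\<bar> = 1)"

text \<open>
  Hodge star of a \<open>k\<close>-form, $(\star\beta)_{J}=\frac1{k!}\sum_I\beta_I\,\mathrm{vol}_{IJ}$ in an orthonormal
  frame; it does not depend on the frame and satisfies
  $\alpha\wedge\star\beta=\langle\alpha,\beta\rangle\,\mathrm{vol}$.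
\<close>

definition hodge_star ::
  "('e::euclidean_space \<Rightarrow> 'e \<Rightarrow> real) \<Rightarrow> ('e, real) mform \<Rightarrow> nat \<Rightarrow> ('e, real) mform \<Rightarrow> ('e, real) mform" where
  "hodge_star g vol k \<beta> = (\<lambda>ws.
     let es = (SOME es. orthonormal_frame g es) in
     (\<Sum>I\<in>{I. length I = k \<and> set I \<subseteq> {..<DIM('e)}}.
        \<beta> (map ((!) es) I) * vol (map ((!) es) I @ ws)) / fact k)"

text \<open>Positive 3-forms on a 7-dimensional space; the induced metric and volume form.\<close>

definition positive_3form :: "('e::euclidean_space, real) mform \<Rightarrow> bool" where
  "positive_3form P \<longleftrightarrow> DIM('e) = 7 \<and> alternating 3 P \<and>
     (\<forall>Y. Y \<noteq> 0 \<longrightarrow> (\<exists>vs. length vs = 7 \<and>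
        wedge 4 (wedge 2 (interior_product Y P) (interior_product Y P)) P vs \<noteq> 0))"

definition induces_metric_volume ::
  "('e::euclidean_space, real) mform \<Rightarrow> ('e \<Rightarrow> 'e \<Rightarrow> real) \<Rightarrow> ('e, real) mform \<Rightarrow> bool" where
  "induces_metric_volume P g vol \<longleftrightarrow> inner_product_form g \<and> volume_form_of g vol \<and>
     (\<forall>Y Z vs. length vs = 7 \<longrightarrow>
        - (1/6) * wedge 4 (wedge 2 (interior_product Y P) (interior_product Z P)) P vs = g Y Z * vol vs)"

definition g2_metric :: "('e::euclidean_space, real) mform \<Rightarrow> 'e \<Rightarrow> 'e \<Rightarrow> real" where
  "g2_metric P = (SOME g. \<exists>vol. induces_metric_volume P g vol)"

definition g2_volume :: "('e::euclidean_space, real) mform \<Rightarrow> ('e, real) mform" where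
  "g2_volume P = (SOME vol. induces_metric_volume P (g2_metric P) vol)"


section \<open>Manifolds\<close>

text \<open>
  A manifold is given by its atlas; the underlying set is the union of the chart domains, with
  the subspace topology of the ambient Hausdorff type.
\<close>

datatype ('m, 'e) chart = Chart (cdom: "'m set") (cmap: "'m \<Rightarrow> 'e")

type_synonym ('m, 'e) atlas = "('m, 'e) chart set"

definition cimg :: "('m, 'e) chart \<Rightarrow> 'e set" where
  "cimg c = cmap c ` cdom c"

definition cinv :: "('m, 'e) chart \<Rightarrow> 'e \<Rightarrow> 'm" where
  "cinv c = inv_into (cdom c) (cmap c)"

definition points :: "('m, 'e) atlas \<Rightarrow> 'm set" where
  "points A = (\<Union>c\<in>A. cdom c)"

definition valid_chart :: "'m::topological_space set \<Rightarrow> ('m, 'e::euclidean_space) chart \<Rightarrow> bool" where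
  "valid_chart S c \<longleftrightarrow> openin (top_of_set S) (cdom c) \<and> open (cimg c) \<and>
     homeomorphism (cdom c) (cimg c) (cmap c) (cinv c)"

definition overlap :: "('m, 'e) chart \<Rightarrow> ('m, 'e) chart \<Rightarrow> 'e set" where
  "overlap c c' = cmap c ` (cdom c \<inter> cdom c')"

definition transition :: "('m, 'e) chart \<Rightarrow> ('m, 'e) chart \<Rightarrow> 'e \<Rightarrow> 'e" where
  "transition c c' = cmap c' \<circ> cinv c"

definition complex_manifold :: "('m::t2_space, complex^'n) atlas \<Rightarrow> bool" where
  "complex_manifold A \<longleftrightarrow> (\<forall>c\<in>A. valid_chart (points A) c) \<and>
     (\<forall>c\<in>A. \<forall>c'\<in>A. \<forall>j. holomorphic_fun_on (overlap c c') (\<lambda>x. transition c c' x $ j))"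

definition prod_chart :: "('m, 'e) chart \<Rightarrow> ('k, 'f) chart \<Rightarrow> ('m \<times> 'k, 'e \<times> 'f) chart" where
  "prod_chart c d = Chart (cdom c \<times> cdom d) (map_prod (cmap c) (cmap d))"

definition prod_atlas :: "('m, 'e) atlas \<Rightarrow> ('k, 'f) atlas \<Rightarrow> ('m \<times> 'k, 'e \<times> 'f) atlas" where
  "prod_atlas A B = {prod_chart c d | c d. c \<in> A \<and> d \<in> B}"

text \<open>
  The circle is the unit circle in the complex plane; its charts are the branches of the angle
  coordinate with values in open intervals of length $2\pi$.
\<close>

definition circle :: "(complex, real) atlas" where
  "circle = range (\<lambda>a. Chart (cis ` {a<..<a + 2 * pi}) (inv_into {a<..<a + 2 * pi} cis))"

definition smooth_map :: "('m::topological_space, 'e::euclidean_space) atlas \<Rightarrow>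
    ('k::topological_space, 'f::euclidean_space) atlas \<Rightarrow> ('m \<Rightarrow> 'k) \<Rightarrow> bool" where
  "smooth_map A B F \<longleftrightarrow> continuous_on (points A) F \<and> F ` points A \<subseteq> points B \<and>
     (\<forall>c\<in>A. \<forall>c'\<in>B. smooth_on {x \<in> cimg c. F (cinv c x) \<in> cdom c'} (\<lambda>x. cmap c' (F (cinv c x))))"

definition diffeomorphism :: "('m::topological_space, 'e::euclidean_space) atlas \<Rightarrow> ('m \<Rightarrow> 'm) \<Rightarrow> bool" where
  "diffeomorphism A F \<longleftrightarrow> bij_betw F (points A) (points A) \<and>
     smooth_map A A F \<and> smooth_map A A (inv_into (points A) F)"

text \<open>Families of functions and of maps, smooth jointly in time \<open>t \<ge> 0\<close> and space.\<close>

definition smooth_function_family ::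
    "('m::topological_space, 'e::euclidean_space) atlas \<Rightarrow> (real \<Rightarrow> 'm \<Rightarrow> real) \<Rightarrow> bool" where
  "smooth_function_family A u \<longleftrightarrow>
     (\<forall>c\<in>A. smooth_on ({0..} \<times> cimg c) (\<lambda>(t, x). u t (cinv c x)))"

definition smooth_family_of_diffeomorphisms ::
    "('m::topological_space, 'e::euclidean_space) atlas \<Rightarrow> (real \<Rightarrow> 'm \<Rightarrow> 'm) \<Rightarrow> bool" where
  "smooth_family_of_diffeomorphisms A F \<longleftrightarrow> (\<forall>t\<ge>0. diffeomorphism A (F t)) \<and>
     continuous_on ({0..} \<times> points A) (\<lambda>(t, p). F t p) \<and>
     (\<forall>c\<in>A. \<forall>c'\<in>A. smooth_on {(t, x). 0 \<le> t \<and> x \<in> cimg c \<and> F t (cinv c x) \<in> cdom c'}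
                            (\<lambda>(t, x). cmap c' (F t (cinv c x))))"


section \<open>Differential forms on manifolds\<close>

text \<open>
  A differential form is given by its coordinate representations: \<open>\<alpha> c x vs\<close> is its value at
  the point with coordinates \<open>x\<close> in the chart \<open>c\<close>, on tangent vectors with coordinates \<open>vs\<close>.
\<close>

type_synonym ('m, 'e, 'b) form = "('m, 'e) chart \<Rightarrow> 'e \<Rightarrow> ('e, 'b) mform"

definition smooth_form :: "('m, 'e::euclidean_space) atlas \<Rightarrow> nat \<Rightarrow>
    ('m, 'e, 'b::real_normed_vector) form \<Rightarrow> bool" where
  "smooth_form A k \<alpha> \<longleftrightarrow>
     (\<forall>c\<in>A. (\<forall>x\<in>cimg c. alternating k (\<alpha> c x)) \<and>
             (\<forall>vs. length vs = k \<longrightarrow> smooth_on (cimg c) (\<lambda>x. \<alpha> c x vs))) \<and>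
     (\<forall>c\<in>A. \<forall>c'\<in>A. \<forall>x\<in>overlap c c'. \<forall>vs. length vs = k \<longrightarrow>
        \<alpha> c x vs = \<alpha> c' (transition c c' x) (map (frechet_derivative (transition c c') (at x)) vs))"

definition form_eq :: "('m, 'e) atlas \<Rightarrow> nat \<Rightarrow> ('m, 'e, 'b) form \<Rightarrow> ('m, 'e, 'b) form \<Rightarrow> bool" where
  "form_eq A k \<alpha> \<beta> \<longleftrightarrow> (\<forall>c\<in>A. \<forall>x\<in>cimg c. \<forall>vs. length vs = k \<longrightarrow> \<alpha> c x vs = \<beta> c x vs)"

definition ext_d :: "('m, 'e::euclidean_space, 'b::real_normed_field) form \<Rightarrow> ('m, 'e, 'b) form" where
  "ext_d \<alpha> c x vs = (\<Sum>i<length vs. (-1) ^ i *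
      frechet_derivative (\<lambda>y. \<alpha> c y (take i vs @ drop (Suc i) vs)) (at x) (vs ! i))"

definition closed_form :: "('m, 'e::euclidean_space) atlas \<Rightarrow> nat \<Rightarrow>
    ('m, 'e, 'b::real_normed_field) form \<Rightarrow> bool" where
  "closed_form A k \<alpha> \<longleftrightarrow> form_eq A (Suc k) (ext_d \<alpha>) (\<lambda>c x vs. 0)"

text \<open>
  Pullback of a form on \<open>B\<close> under \<open>F\<close>; the chart of \<open>B\<close> used around the image point is
  irrelevant by the transformation law in \<open>smooth_form\<close>.
\<close>

definition pullback :: "('k, 'f::real_normed_vector) atlas \<Rightarrow> ('m \<Rightarrow> 'k) \<Rightarrow>
    ('k, 'f, 'b) form \<Rightarrow> ('m, 'e::real_normed_vector, 'b) form" where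
  "pullback B F \<alpha> c x vs =
     (let c' = (SOME c'. c' \<in> B \<and> F (cinv c x) \<in> cdom c') in
      \<alpha> c' (cmap c' (F (cinv c x)))
        (map (frechet_derivative (\<lambda>y. cmap c' (F (cinv c y))) (at x)) vs))"

definition wedge_form :: "nat \<Rightarrow> ('m, 'e, 'b::field_char_0) form \<Rightarrow> ('m, 'e, 'b) form \<Rightarrow> ('m, 'e, 'b) form" where
  "wedge_form k \<alpha> \<beta> c x = wedge k (\<alpha> c x) (\<beta> c x)"

definition Re_form :: "('m, 'e, complex) form \<Rightarrow> ('m, 'e, real) form" where
  "Re_form \<alpha> c x vs = Re (\<alpha> c x vs)"

definition Im_form :: "('m, 'e, complex) form \<Rightarrow> ('m, 'e, real) form" where
  "Im_form \<alpha> c x vs = Im (\<alpha> c x vs)"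

text \<open>The form \<open>dr\<close> on the circle, whose charts all have the angle as their coordinate.\<close>

definition dangle :: "(complex, real, real) form" where
  "dangle c x vs = vs ! 0"


section \<open>The $G_2$-Laplacian flow\<close>

definition codiff :: "('m, 'e::euclidean_space, real) form \<Rightarrow> nat \<Rightarrow>
    ('m, 'e, real) form \<Rightarrow> ('m, 'e, real) form" where
  "codiff \<phi> k \<alpha> c x vs = (-1) ^ (DIM('e) * (k + 1) + 1) *
     (let star = (\<lambda>j \<beta> c x. hodge_star (g2_metric (\<phi> c x)) (g2_volume (\<phi> c x)) j (\<beta> c x)) in
      star (DIM('e) - k + 1) (ext_d (star k \<alpha>)) c x vs)"

text \<open>
  Hodge Laplacian on \<open>k\<close>-forms, \<open>k \<ge> 1\<close>, of the metric induced by \<open>\<phi>\<close>.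
\<close>

definition hodge_laplacian :: "('m, 'e::euclidean_space, real) form \<Rightarrow> nat \<Rightarrow>
    ('m, 'e, real) form \<Rightarrow> ('m, 'e, real) form" where
  "hodge_laplacian \<phi> k \<alpha> c x vs =
     ext_d (codiff \<phi> k \<alpha>) c x vs + codiff \<phi> (k + 1) (ext_d \<alpha>) c x vs"

definition g2_structure :: "('m, 'e::euclidean_space) atlas \<Rightarrow> ('m, 'e, real) form \<Rightarrow> bool" where
  "g2_structure A \<phi> \<longleftrightarrow> smooth_form A 3 \<phi> \<and> (\<forall>c\<in>A. \<forall>x\<in>cimg c. positive_3form (\<phi> c x))"

text \<open>Smooth solutions of the flow on a time interval \<open>I\<close>.\<close>

definition g2_laplacian_flow :: "('m, 'e::euclidean_space) atlas \<Rightarrow> real set \<Rightarrow>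
    (real \<Rightarrow> ('m, 'e, real) form) \<Rightarrow> bool" where
  "g2_laplacian_flow A I \<phi> \<longleftrightarrow>
     (\<forall>t\<in>I. g2_structure A (\<phi> t)) \<and>
     (\<forall>c\<in>A. \<forall>vs. length vs = 3 \<longrightarrow> smooth_on (I \<times> cimg c) (\<lambda>(t, x). \<phi> t c x vs)) \<and>
     (\<forall>t\<in>I. \<forall>c\<in>A. \<forall>x\<in>cimg c. \<forall>vs. length vs = 3 \<longrightarrow>
        ((\<lambda>s. \<phi> s c x vs) has_real_derivative hodge_laplacian (\<phi> t) 3 (\<phi> t) c x vs) (at t within I))"

text \<open>
  Short-time uniqueness of the flow for closed initial data on a given manifold (a theorem of
  Bryant and Xu if the manifold is compact).
\<close>

definition short_time_uniqueness :: "('m, 'e::euclidean_space) atlas \<Rightarrow> bool" where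
  "short_time_uniqueness A \<longleftrightarrow>
     (\<forall>T>0. \<forall>\<phi> \<psi>. g2_laplacian_flow A {0..<T} \<phi> \<longrightarrow> g2_laplacian_flow A {0..<T} \<psi> \<longrightarrow>
        closed_form A 3 (\<phi> 0) \<longrightarrow> form_eq A 3 (\<phi> 0) (\<psi> 0) \<longrightarrow>
        (\<exists>\<epsilon>>0. \<epsilon> \<le> T \<and> (\<forall>t\<in>{0..<\<epsilon>}. form_eq A 3 (\<phi> t) (\<psi> t))))"


section \<open>Kaehler geometry\<close>

text \<open>
  In holomorphic charts the complex structure \<open>J\<close> is multiplication by \<open>\<i>\<close>.
\<close>

definition kaehler_form :: "('m, complex^'n) atlas \<Rightarrow> ('m, complex^'n, real) form \<Rightarrow> bool" where
  "kaehler_form A \<omega> \<longleftrightarrow> smooth_form A 2 \<omega> \<and> closed_form A 2 \<omega> \<and>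
     (\<forall>c\<in>A. \<forall>x\<in>cimg c. (\<forall>v w. \<omega> c x [\<i> *s v, \<i> *s w] = \<omega> c x [v, w]) \<and>
                          (\<forall>v. v \<noteq> 0 \<longrightarrow> \<omega> c x [v, \<i> *s v] > 0))"

text \<open>The metric \<open>h\<close> with \<open>\<omega>(v, w) = h(Jv, w)\<close>.\<close>

definition metric_of :: "(complex^'n, real) mform \<Rightarrow> complex^'n \<Rightarrow> complex^'n \<Rightarrow> real" where
  "metric_of B v w = B [- (\<i> *s v), w]"

text \<open>
  The coefficients $h_{p\bar q}=-i\,\omega(\partial_p,\partial_{\bar q})$ (complex bilinear extension,
  $\partial_p=\frac12(\partial_{x^p}-i\partial_{y^p})$,
  $\partial_{\bar q}=\frac12(\partial_{x^q}+i\partial_{y^q})$) of a real (1,1)-form; the lemma below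
  is $\omega=i\,h_{p\bar q}dz^p\wedge d\bar z^q$.
\<close>

definition herm_coeff :: "(complex^'n, real) mform \<Rightarrow> complex^'n^'n" where
  "herm_coeff B = (\<chi> p q. - \<i> / 4 *
      (Complex (B [axis p 1, axis q 1] + B [axis p \<i>, axis q \<i>])
               (B [axis p 1, axis q \<i>] - B [axis p \<i>, axis q 1])))"

lemma herm_coeff_expansion:
  fixes B :: "(complex^'n, real) mform"
  assumes alt: "alternating 2 B"
    and inv: "\<And>v w. B [\<i> *s v, \<i> *s w] = B [v, w]"
  shows "complex_of_real (B [v, w]) =
    \<i> * (\<Sum>p\<in>UNIV. \<Sum>q\<in>UNIV. herm_coeff B $ p $ q * (v $ p * cnj (w $ q) - w $ p * cnj (v $ q)))"
proof -
  have lin: "linear (\<lambda>v. B [v, w])" "linear (\<lambda>w. B [v, w])" for v w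
    using alt[unfolded alternating_def, THEN conjunct1, rule_format, of "[v,w]" 0]
      alt[unfolded alternating_def, THEN conjunct1, rule_format, of "[v,w]" 1] by auto
  have nil: "B [v, v] = 0" for v
    using alt[unfolded alternating_def, THEN conjunct2, rule_format, of "[v,v]" 0 1] by simp
  have anti: "B [v, w] = - B [w, v]" for v w
  proof -
    have "B [v + w, v + w] = B [v, v] + B [v, w] + B [w, v] + B [w, w]"
      using linear_add[OF lin(1), of v w "v + w"] linear_add[OF lin(2), of v v w] linear_add[OF lin(2), of w v w]
      by simp
    then show ?thesis by (simp add: nil)
  qed
  define a where "a p q = B [axis p 1, axis q 1]" for p q
  define b where "b p q = B [axis p 1, axis q \<i>]" for p q
  have i1: "\<i> *s axis p 1 = (axis p \<i> :: complex^'n)" for p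
    by (simp add: vec_eq_iff axis_def)
  have i2: "\<i> *s axis p \<i> = - (axis p 1 :: complex^'n)" for p
    by (simp add: vec_eq_iff axis_def)
  have yy: "B [axis p \<i>, axis q \<i>] = a p q" for p q
    unfolding a_def using inv[of "axis p 1" "axis q 1"] by (simp add: i1)
  have yx: "B [axis p \<i>, axis q 1] = - b p q" for p q
  proof -
    have "B [\<i> *s axis p \<i>, \<i> *s axis q 1] = - B [axis p 1, axis q \<i>]"
      unfolding i1 i2 using linear_neg[OF lin(1)] by simp
    then show ?thesis unfolding b_def using inv[of "axis p \<i>" "axis q 1"] by simp
  qed
  have aa: "a p q = - a q p" for p q unfolding a_def by (rule anti)
  have bb: "b p q = b q p" for p q
    using anti[of "axis p 1" "axis q \<i>"] yx[of q p] unfolding b_def by simp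
  have H: "herm_coeff B $ p $ q = Complex (b p q / 2) (- a p q / 2)" for p q
    unfolding herm_coeff_def by (simp add: yy yx a_def[symmetric] b_def[symmetric] complex_eq_iff)
  have dec: "v = (\<Sum>p\<in>UNIV. Re (v $ p) *\<^sub>R axis p 1 + Im (v $ p) *\<^sub>R axis p \<i>)" for v :: "complex^'n"
    by (simp add: vec_eq_iff axis_def complex_eq_iff if_distrib sum.distrib cong: if_cong)
  define Q where "Q p q = (Re (v$p) * Re (w$q) + Im (v$p) * Im (w$q)) * a p q
      + (Re (v$p) * Im (w$q) - Im (v$p) * Re (w$q)) * b p q" for p q
  have "B [v, w] = (\<Sum>p\<in>UNIV. Re (v$p) * B [axis p 1, w] + Im (v$p) * B [axis p \<i>, w])"
    using arg_cong[OF dec[of v], of "\<lambda>v. B [v, w]"]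
    by (simp add: linear_sum[OF lin(1)] linear_add[OF lin(1)] linear_scale[OF lin(1)])
  also have "\<dots> = (\<Sum>p\<in>UNIV. \<Sum>q\<in>UNIV. Q p q)"
  proof (rule sum.cong[OF refl])
    fix p :: 'n
    have e: "B [z, w] = (\<Sum>q\<in>UNIV. Re (w$q) * B [z, axis q 1] + Im (w$q) * B [z, axis q \<i>])" for z
      using arg_cong[OF dec[of w], of "\<lambda>w. B [z, w]"]
      by (simp add: linear_sum[OF lin(2)] linear_add[OF lin(2)] linear_scale[OF lin(2)])
    show "Re (v$p) * B [axis p 1, w] + Im (v$p) * B [axis p \<i>, w] = (\<Sum>q\<in>UNIV. Q p q)"
      unfolding e[of "axis p 1"] e[of "axis p \<i>"] Q_def yy yx a_def[symmetric] b_def[symmetric]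
      by (simp add: sum_distrib_left sum.distrib[symmetric] algebra_simps)
  qed
  finally have BQ: "B [v, w] = (\<Sum>p\<in>UNIV. \<Sum>q\<in>UNIV. Q p q)" .
  define R where "R p q = Complex (a p q / 2) (b p q / 2) * (v $ p * cnj (w $ q))" for p q
  define R' where "R' p q = Complex (a p q / 2) (b p q / 2) * (w $ p * cnj (v $ q))" for p q
  have "\<i> * (\<Sum>p\<in>UNIV. \<Sum>q\<in>UNIV. herm_coeff B $ p $ q * (v $ p * cnj (w $ q) - w $ p * cnj (v $ q)))
      = (\<Sum>p\<in>UNIV. \<Sum>q\<in>UNIV. R p q - R' p q)"
    unfolding sum_distrib_left R_def R'_def H
    by (intro sum.cong refl) (simp add: complex_eq_iff algebra_simps)
  also have "\<dots> = (\<Sum>p\<in>UNIV. \<Sum>q\<in>UNIV. R p q) - (\<Sum>p\<in>UNIV. \<Sum>q\<in>UNIV. R' p q)"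
    by (simp add: sum_subtractf)
  also have "(\<Sum>p\<in>UNIV. \<Sum>q\<in>UNIV. R' p q) = (\<Sum>p\<in>UNIV. \<Sum>q\<in>UNIV. R' q p)"
    by (rule sum.swap)
  also have "(\<Sum>p\<in>UNIV. \<Sum>q\<in>UNIV. R p q) - \<dots> = (\<Sum>p\<in>UNIV. \<Sum>q\<in>UNIV. R p q - R' q p)"
    by (simp add: sum_subtractf)
  also have "\<dots> = (\<Sum>p\<in>UNIV. \<Sum>q\<in>UNIV. complex_of_real (Q p q))"
  proof (intro sum.cong refl)
    fix p q :: 'n
    show "R p q - R' q p = complex_of_real (Q p q)"
      unfolding R_def R'_def Q_def aa[of q p] bb[of q p] by (simp add: complex_eq_iff field_simps)
  qed
  finally show ?thesis by (simp add: BQ)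
qed

text \<open>$i\partial\bar\partial u=i\,\partial_p\partial_{\bar q}u\;dz^p\wedge d\bar z^q$, a real form.\<close>

definition i_ddbar :: "('m \<Rightarrow> real) \<Rightarrow> ('m, complex^'n, real) form" where
  "i_ddbar u c x vs = Re (\<i> * (\<Sum>p\<in>UNIV. \<Sum>q\<in>UNIV.
      d_z p (d_zbar q (\<lambda>y. complex_of_real (u (cinv c y)))) x *
      (vs ! 0 $ p * cnj (vs ! 1 $ q) - vs ! 1 $ p * cnj (vs ! 0 $ q))))"

definition add_i_ddbar :: "('m, complex^'n, real) form \<Rightarrow> ('m \<Rightarrow> real) \<Rightarrow> ('m, complex^'n, real) form" where
  "add_i_ddbar \<omega> u c x vs = \<omega> c x vs + i_ddbar u c x vs"

definition positive_form :: "('m, complex^'n) atlas \<Rightarrow> ('m, complex^'n, real) form \<Rightarrow> bool" where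
  "positive_form A \<omega> \<longleftrightarrow> (\<forall>c\<in>A. \<forall>x\<in>cimg c. \<forall>v. v \<noteq> 0 \<longrightarrow> \<omega> c x [v, \<i> *s v] > 0)"

text \<open>
  Forms of type \<open>(n, 0)\<close>, \<open>n\<close> the complex dimension, are complex multilinear in coordinates;
  holomorphic ones have holomorphic coefficients.
\<close>

definition holomorphic_volume_form :: "('m, complex^'n) atlas \<Rightarrow> ('m, complex^'n, complex) form \<Rightarrow> bool" where
  "holomorphic_volume_form A \<Omega> \<longleftrightarrow> smooth_form A (CARD('n)) \<Omega> \<and>
     (\<forall>c\<in>A. \<forall>x\<in>cimg c. \<forall>vs a i. length vs = CARD('n) \<longrightarrow> i < CARD('n) \<longrightarrow>
        \<Omega> c x (vs[i := a *s (vs ! i)]) = a * \<Omega> c x vs) \<and>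
     (\<forall>c\<in>A. \<forall>vs. length vs = CARD('n) \<longrightarrow> holomorphic_fun_on (cimg c) (\<lambda>x. \<Omega> c x vs)) \<and>
     (\<forall>c\<in>A. \<forall>x\<in>cimg c. \<exists>vs. length vs = CARD('n) \<and> \<Omega> c x vs \<noteq> 0)"

text \<open>
  The coefficient \<open>f\<close> in $\Omega=f\,dz^1\wedge\dots\wedge dz^n$ is the value on the standard basis.
  The index type carries no order, so an enumeration is chosen; \<open>|f|\<close> does not depend on it.
\<close>

definition std_basis :: "(complex^'n) list" where
  "std_basis = map (\<lambda>p. axis p 1) (SOME ps. distinct ps \<and> set ps = UNIV)"

definition norm_Omega :: "('m, complex^'n, real) form \<Rightarrow> ('m, complex^'n, complex) form \<Rightarrow>
    ('m, complex^'n) chart \<Rightarrow> complex^'n \<Rightarrow> real" where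
  "norm_Omega \<omega> \<Omega> c x = sqrt ((cmod (\<Omega> c x std_basis))\<^sup>2 / Re (det (herm_coeff (\<omega> c x))))"

definition gradient :: "('e::real_normed_vector \<Rightarrow> 'e \<Rightarrow> real) \<Rightarrow> ('e \<Rightarrow> real) \<Rightarrow> 'e \<Rightarrow> 'e" where
  "gradient h f x = (THE Y. \<forall>w. h Y w = frechet_derivative f (at x) w)"


section \<open>The Monge-Ampere flow and the associated 3-forms\<close>

definition K_const :: "nat \<Rightarrow> real" where
  "K_const n = 2 powr (real n / 3)"

definition ma13_flow :: "('m::topological_space, complex^'n) atlas \<Rightarrow> ('m, complex^'n, real) form \<Rightarrow>
    ('m, complex^'n, complex) form \<Rightarrow> (real \<Rightarrow> 'm \<Rightarrow> real) \<Rightarrow> bool" where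
  "ma13_flow A \<omega> \<Omega> u \<longleftrightarrow>
     smooth_function_family A u \<and>
     (\<forall>t\<ge>0. positive_form A (add_i_ddbar \<omega> (u t))) \<and>
     (\<forall>p\<in>points A. u 0 p = 0) \<and>
     (\<forall>t\<ge>0. \<forall>c\<in>A. \<forall>x\<in>cimg c.
        ((\<lambda>s. u s (cinv c x)) has_real_derivative
           6 * K_const (CARD('n)) *
             root 3 (exp (- 2 * ln (norm_Omega \<omega> \<Omega> c x)) *
                     Re (det (herm_coeff (add_i_ddbar \<omega> (u t) c x)) / det (herm_coeff (\<omega> c x)))))
          (at t within {0..}))"

text \<open>The coordinate representation of $Y_t=-K\,\nabla_{\widetilde h}(|\Omega|_{\widetilde\omega}^{-2/3})$.\<close>

definition Y_field :: "('m, complex^'n, real) form \<Rightarrow> ('m, complex^'n, complex) form \<Rightarrow>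
    ('m, complex^'n) chart \<Rightarrow> complex^'n \<Rightarrow> complex^'n" where
  "Y_field \<omega>' \<Omega> c x = - K_const (CARD('n)) *\<^sub>R
     gradient (metric_of (\<omega>' c x)) (\<lambda>y. norm_Omega \<omega>' \<Omega> c y powr (- 2 / 3)) x"

definition flow_of_time_dependent_field :: "('m::topological_space, 'e::euclidean_space) atlas \<Rightarrow>
    (real \<Rightarrow> ('m, 'e) chart \<Rightarrow> 'e \<Rightarrow> 'e) \<Rightarrow> (real \<Rightarrow> 'm \<Rightarrow> 'm) \<Rightarrow> bool" where
  "flow_of_time_dependent_field A Y \<Theta> \<longleftrightarrow>
     smooth_family_of_diffeomorphisms A \<Theta> \<and> (\<forall>p\<in>points A. \<Theta> 0 p = p) \<and>
     (\<forall>t\<ge>0. \<forall>p\<in>points A. \<forall>c\<in>A. \<Theta> t p \<in> cdom c \<longrightarrow>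
        ((\<lambda>s. cmap c (\<Theta> s p)) has_vector_derivative Y t c (cmap c (\<Theta> t p))) (at t within {0..}))"

abbreviation T3 :: "(complex \<times> complex \<times> complex, real \<times> real \<times> real) atlas" where
  "T3 \<equiv> prod_atlas circle (prod_atlas circle circle)"

text \<open>
  The 3-forms on the products built from a 2-form \<open>\<omega>\<close> and a complex form \<open>\<Omega>\<close> on \<open>X\<close>.
\<close>

definition phi_T3 :: "('m, complex^'n) atlas \<Rightarrow> ('m, complex^'n, real) form \<Rightarrow> ('m, complex^'n, complex) form \<Rightarrow>
    ((complex \<times> complex \<times> complex) \<times> 'm, (real \<times> real \<times> real) \<times> (complex^'n), real) form" where
  "phi_T3 X \<omega> \<Omega> c x vs =
     (let dr1 = pullback circle (\<lambda>(r, p). fst r) dangle;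
          dr2 = pullback circle (\<lambda>(r, p). fst (snd r)) dangle;
          dr3 = pullback circle (\<lambda>(r, p). snd (snd r)) dangle
      in - wedge_form 1 dr1 (wedge_form 1 dr2 dr3) c x vs
         + wedge_form 1 dr1 (pullback X snd \<omega>) c x vs
         + wedge_form 1 dr2 (pullback X snd (Re_form \<Omega>)) c x vs
         + wedge_form 1 dr3 (pullback X snd (Im_form \<Omega>)) c x vs)"

definition phi_S1 :: "('m, complex^'n) atlas \<Rightarrow> ('m, complex^'n, real) form \<Rightarrow> ('m, complex^'n, complex) form \<Rightarrow>
    (complex \<times> 'm, real \<times> (complex^'n), real) form" where
  "phi_S1 X \<omega> \<Omega> c x vs =
     pullback X snd (Re_form \<Omega>) c x vs
     - wedge_form 1 (pullback circle fst dangle) (pullback X snd \<omega>) c x vs"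

end

theory Submission
  imports Defs "HOL-Combinatorics.Multiset_Permutations"
begin

text \<open>
  Both 3-forms are $\mathrm{Re}\,b-r\wedge a$ on a 7-dimensional space: for $n=3$ with
  $a=\widetilde\omega$, $b=\Omega$; for $n=2$ with $a=\widetilde\omega-dr^2\wedge dr^3$,
  $b=(dr^2-i\,dr^3)\wedge\Omega$ and $r=-dr^1$.  Put $F=\frac16\partial_tu$.  The flow equation says
  $F=K|\Omega|_{\widetilde\omega}^{-2/3}$, which makes a unitary frame for $\widetilde\omega$, rescaled by
  powers of $F$, adapted to the 3-form.  In this frame the codifferential of the closed form
  $\varphi$ is $\iota_Y\mathrm{Re}\,b-2r\wedge\iota_Ya$, because $\iota_Y\widetilde\omega=dF\circ J$ is the equation
  $Y=-\nabla F$.  Its exterior derivative is $\partial_t\varphi$ by Cartan's formula, because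
  $\partial_t\widetilde\omega=6i\partial\bar\partial F=-3\,d(dF\circ J)$.  Since $d$ commutes with pullbacks, applied on
  space-time, the diffeomorphisms $\Theta_t$ do not change this computation.  Uniqueness for all
  times follows from short-time uniqueness at the first time of disagreement.
\<close>

subsection \<open>Smooth functions on sets\<close>

text \<open>Adapted frames are chosen point by point and need not vary smoothly, so nothing can be
  differentiated in them. They only serve to prove a frame-free formula for the Hodge dual of the
  3-form, - F r \<and> Im b - a \<and> a / (2 F^2), on an open set. This expression is
  differentiated; closedness of a and b leaves the terms with dF, and a second pointwise computation
  in one frame finishes the codifferential. The constants fit as follows. Cartan's formula adds
  d(\<iota>_Y w) to the time derivative of the pulled back Kaehler form w, the potential adds - 3
  d(dF o J) = - 3 d(\<iota>_Y w), and the sum - 2 d(\<iota>_Y w) matches the factor 2 in the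
  codifferential. On a unitary frame where \<Omega> has the value f > 0 the flow equation reads F^3
  f^2 = 1, so stretching by the square root of F normalises \<Omega>. Two obstacles shape the text.
  Time has the end point 0, so derivatives are taken within sets and symmetry of second derivatives
  reaches the boundary by continuity. Metric, volume, Hodge frame and the charts in pullbacks are
  choice terms, so each needs an independence or uniqueness argument first.\<close>

abbreviation dirD :: "'a::real_normed_vector set \<Rightarrow> ('a \<Rightarrow> 'b::real_normed_vector) \<Rightarrow> 'a \<Rightarrow> 'a \<Rightarrow> 'b" where
  "dirD S f v x \<equiv> frechet_derivative f (at x within S) v"

text \<open>
  The first condition lets identities between continuous functions pass from the interior to the
  whole set, the second makes derivatives within the set unique.
\<close>

definition nice :: "'a::euclidean_space set \<Rightarrow> bool" where
  "nice S \<longleftrightarrow> S \<subseteq> closure (interior S) \<and>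
     (\<forall>x\<in>S. \<forall>i\<in>Basis. \<forall>e>0. \<exists>d. 0 < \<bar>d\<bar> \<and> \<bar>d\<bar> < e \<and> x + d *\<^sub>R i \<in> S)"

lemma nice_Int_open:
  assumes "nice S" "open O'" shows "nice (S \<inter> O')"
  unfolding nice_def
proof (intro conjI ballI allI impI)
  have "S \<inter> O' \<subseteq> closure (interior S) \<inter> O'" using assms(1) by (auto simp: nice_def)
  also have "\<dots> \<subseteq> closure (interior S \<inter> O')"
    by (metis assms(2) open_Int_closure_subset inf_commute)
  also have "interior S \<inter> O' = interior (S \<inter> O')" using assms(2) by (simp add: interior_open)
  finally show "S \<inter> O' \<subseteq> closure (interior (S \<inter> O'))" .
next
  fix x i :: 'a and e :: real assume x: "x \<in> S \<inter> O'" and i: "i \<in> Basis" and e: "0 < e"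
  obtain r where r: "r > 0" "ball x r \<subseteq> O'" using assms(2) x openE by blast
  obtain d where d: "0 < \<bar>d\<bar>" "\<bar>d\<bar> < min e r" "x + d *\<^sub>R i \<in> S"
    using assms(1) x i e r unfolding nice_def by (meson IntD1 min_less_iff_conj)
  moreover have "x + d *\<^sub>R i \<in> ball x r" using d i by (simp add: dist_norm)
  ultimately show "\<exists>d. 0 < \<bar>d\<bar> \<and> \<bar>d\<bar> < e \<and> x + d *\<^sub>R i \<in> S \<inter> O'" using r by (intro exI[of _ d]) auto
qed

lemma nice_UNIV: "nice (UNIV :: 'a::euclidean_space set)"
proof -
  have "\<exists>d::real. 0 < \<bar>d\<bar> \<and> \<bar>d\<bar> < e" if "e > 0" for e
    using that by (intro exI[of _ "e/2"]) auto
  then show ?thesis by (auto simp: nice_def)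
qed

lemma nice_open: "open S \<Longrightarrow> nice S"
  using nice_Int_open[OF nice_UNIV] by simp

lemma nice_half_line:
  fixes U :: "'a::euclidean_space set" assumes "open U" shows "nice ({0::real..} \<times> U)"
proof -
  have "nice ({0::real..} \<times> (UNIV::'a set))"
    unfolding nice_def
  proof (intro conjI ballI allI impI)
    have "{0::real<..} \<times> (UNIV::'a set) \<subseteq> interior ({0..} \<times> UNIV)"
      by (rule interior_maximal) (auto intro: open_Times)
    then have "closure ({0::real<..} \<times> (UNIV::'a set)) \<subseteq> closure (interior ({0..} \<times> UNIV))"
      by (rule closure_mono)
    then show "{0::real..} \<times> (UNIV::'a set) \<subseteq> closure (interior ({0..} \<times> UNIV))"
      by (simp add: closure_Times)
    fix x i :: "real \<times> 'a" and e :: real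
    assume "x \<in> {0..} \<times> UNIV" and i: "i \<in> Basis" and "0 < e"
    moreover from i have "fst i \<ge> 0" by (auto simp: Basis_prod_def)
    ultimately show "\<exists>d. 0 < \<bar>d\<bar> \<and> \<bar>d\<bar> < e \<and> x + d *\<^sub>R i \<in> {0..} \<times> UNIV"
      by (intro exI[of _ "e/2"]) (auto simp: mem_Times_iff)
  qed
  from nice_Int_open[OF this open_Times[OF open_UNIV assms]] show ?thesis
    by (simp add: Times_Int_Times)
qed

lemma nice_interval:
  fixes U :: "'a::euclidean_space set" assumes "open U" shows "nice ({0::real..<T} \<times> U)"
proof -
  have "({0..} \<times> U) \<inter> ({..<T} \<times> UNIV) = {0::real..<T} \<times> U" by auto
  with nice_Int_open[OF nice_half_line[OF assms] open_Times[OF open_lessThan open_UNIV], of T]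
  show ?thesis by simp
qed

text \<open>The second condition of \<open>nice\<close> offers arbitrarily small steps along every
  basis vector, which is what uniqueness of the derivative within a set requires; hence the choice
  behind \<open>frechet_derivative\<close> is determined.\<close>

lemma fd_eq:
  fixes f :: "'a::euclidean_space \<Rightarrow> 'b::real_normed_vector"
  assumes "nice S" "x \<in> S" "(f has_derivative f') (at x within S)"
  shows "frechet_derivative f (at x within S) = f'"
proof -
  have "(f has_derivative frechet_derivative f (at x within S)) (at x within S)"
    using assms(3) frechet_derivative_works differentiable_def by blast
  then show ?thesis
    by (rule frechet_derivative_unique_within[OF _ assms(3)]) (use assms(1,2) in \<open>auto simp: nice_def\<close>)
qed

lemma has_fd: "f differentiable (at x within S) \<Longrightarrow>
    (f has_derivative frechet_derivative f (at x within S)) (at x within S)"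
  using frechet_derivative_works by blast

text \<open>Both functions have the same derivatives within S, so the choice behind
  \<open>frechet_derivative\<close> returns the same one for both.\<close>

lemma fd_cong:
  assumes "x \<in> S" "\<And>y. y \<in> S \<Longrightarrow> f y = g y"
  shows "frechet_derivative f (at x within S) = frechet_derivative g (at x within S)"
    and "f differentiable (at x within S) \<longleftrightarrow> g differentiable (at x within S)"
proof -
  have *: "(f has_derivative f') (at x within S) \<longleftrightarrow> (g has_derivative f') (at x within S)" for f'
    using has_derivative_transform[of x S f g f'] has_derivative_transform[of x S g f f'] assms by auto
  show "frechet_derivative f (at x within S) = frechet_derivative g (at x within S)"
    unfolding frechet_derivative_def * ..
  show "f differentiable (at x within S) \<longleftrightarrow> g differentiable (at x within S)"
    unfolding differentiable_def * ..
qed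

lemma fd_cong_open:
  assumes "open O'" "x \<in> O'" "\<And>y. y \<in> O' \<Longrightarrow> f y = g y"
  shows "frechet_derivative f (at x) = frechet_derivative g (at x)"
  using fd_cong(1)[of x O' f g] assms at_within_open[of x O'] by simp

lemma Ck_on_cong:
  assumes "\<And>x. x \<in> S \<Longrightarrow> f x = g x" shows "Ck_on k S f \<longleftrightarrow> Ck_on k S g"
  using assms
proof (induction k arbitrary: f g)
  case 0 then show ?case using continuous_on_cong by fastforce
next
  case (Suc k)
  have "Ck_on k S (\<lambda>x. dirD S f v x) \<longleftrightarrow> Ck_on k S (\<lambda>x. dirD S g v x)" for v
    by (rule Suc.IH) (simp add: fd_cong(1)[OF _ Suc.prems])
  moreover have "f differentiable (at x within S) \<longleftrightarrow> g differentiable (at x within S)" if "x \<in> S" for x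
    by (rule fd_cong(2)[OF that Suc.prems])
  ultimately show ?case by simp
qed

lemma smooth_on_cong:
  assumes "\<And>x. x \<in> S \<Longrightarrow> f x = g x" shows "smooth_on S f \<longleftrightarrow> smooth_on S g"
  unfolding smooth_on_def using Ck_on_cong[of S f g] assms by simp

lemma Ck_SucI:
  fixes f :: "'a::euclidean_space \<Rightarrow> 'b::real_normed_vector"
  assumes "nice S" "\<And>x. x \<in> S \<Longrightarrow> (f has_derivative f' x) (at x within S)"
    "\<And>v. Ck_on k S (\<lambda>x. f' x v)"
  shows "Ck_on (Suc k) S f"
proof -
  have "Ck_on k S (\<lambda>x. dirD S f v x) \<longleftrightarrow> Ck_on k S (\<lambda>x. f' x v)" for v
    by (rule Ck_on_cong) (simp add: fd_eq[OF assms(1) _ assms(2)])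
  then show ?thesis using assms(2,3) by (auto simp: differentiable_def)
qed

lemma Ck_on_Suc: "Ck_on (Suc k) S f \<Longrightarrow> Ck_on k S f"
proof (induction k arbitrary: f)
  case 0 then show ?case
    by (auto simp: continuous_on_eq_continuous_within intro: differentiable_imp_continuous_within)
next
  case (Suc k) from Suc.prems Suc.IH show ?case by (simp del: Ck_on.simps add: Ck_on.simps(2))
qed

lemma Ck_on_const:
  fixes S :: "'a::euclidean_space set" assumes "nice S" shows "Ck_on k S (\<lambda>x. c)"
proof (induction k arbitrary: c)
  case (Suc k) show ?case
    by (rule Ck_SucI[OF assms, where f'="\<lambda>x v. 0"]) (auto intro: Suc.IH)
qed simp

lemma Ck_on_bl:
  fixes f :: "'a::euclidean_space \<Rightarrow> 'b::real_normed_vector"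
  assumes L: "bounded_linear L" and S: "nice S" and "Ck_on k S f"
  shows "Ck_on k S (\<lambda>x. L (f x))"
  using assms(3)
proof (induction k arbitrary: f)
  case 0 then show ?case using L by (simp add: bounded_linear.continuous_on)
next
  case (Suc k) show ?case
  proof (rule Ck_SucI[OF S])
    show "((\<lambda>x. L (f x)) has_derivative (\<lambda>v. L (dirD S f v x))) (at x within S)" if "x \<in> S" for x
      using Suc.prems that by (auto intro!: bounded_linear.has_derivative[OF L] has_fd)
    show "Ck_on k S (\<lambda>x. L (dirD S f v x))" for v
      using Suc by (auto intro!: Suc.IH)
  qed
qed

lemma Ck_on_add:
  fixes f :: "'a::euclidean_space \<Rightarrow> 'b::real_normed_vector"
  assumes S: "nice S" and "Ck_on k S f" "Ck_on k S g"
  shows "Ck_on k S (\<lambda>x. f x + g x)"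
  using assms(2,3)
proof (induction k arbitrary: f g)
  case 0 then show ?case by (simp add: continuous_on_add)
next
  case (Suc k) show ?case
  proof (rule Ck_SucI[OF S])
    show "((\<lambda>x. f x + g x) has_derivative (\<lambda>v. dirD S f v x + dirD S g v x)) (at x within S)" if "x \<in> S" for x
      using Suc.prems that by (auto intro!: has_derivative_add has_fd)
    show "Ck_on k S (\<lambda>x. dirD S f v x + dirD S g v x)" for v
      using Suc by (auto intro!: Suc.IH)
  qed
qed

lemma Ck_on_sum:
  fixes f :: "'i \<Rightarrow> 'a::euclidean_space \<Rightarrow> 'b::real_normed_vector"
  assumes S: "nice S" and "\<And>i. i \<in> I \<Longrightarrow> Ck_on k S (f i)"
  shows "Ck_on k S (\<lambda>x. \<Sum>i\<in>I. f i x)"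
  using assms(2)
  by (induction I rule: infinite_finite_induct) (auto intro: Ck_on_add[OF S] Ck_on_const[OF S])

lemma Ck_on_bilinear:
  fixes f :: "'a::euclidean_space \<Rightarrow> 'b::real_normed_vector" and g :: "'a \<Rightarrow> 'c::real_normed_vector"
  assumes P: "bounded_bilinear P" and S: "nice S" and "Ck_on k S f" "Ck_on k S g"
  shows "Ck_on k S (\<lambda>x. P (f x) (g x))"
  using assms(3,4)
proof (induction k arbitrary: f g)
  case 0 then show ?case using P by (simp add: bounded_bilinear.continuous_on)
next
  case (Suc k) show ?case
  proof (rule Ck_SucI[OF S])
    show "((\<lambda>x. P (f x) (g x)) has_derivative (\<lambda>v. P (f x) (dirD S g v x) + P (dirD S f v x) (g x))) (at x within S)"
      if "x \<in> S" for x
      using Suc.prems that by (auto intro!: bounded_bilinear.FDERIV[OF P] has_fd)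
    show "Ck_on k S (\<lambda>x. P (f x) (dirD S g v x) + P (dirD S f v x) (g x))" for v
      using Suc.prems Ck_on_Suc[OF Suc.prems(1)] Ck_on_Suc[OF Suc.prems(2)]
      by (intro Ck_on_add[OF S] Suc.IH) auto
  qed
qed

lemmas Ck_on_scaleR = Ck_on_bilinear[OF bounded_bilinear_scaleR]

lemma Ck_on_compose:
  fixes f :: "'a::euclidean_space \<Rightarrow> 'b::euclidean_space" and g :: "'b \<Rightarrow> 'c::real_normed_vector"
  assumes S: "nice S" and "Ck_on k S f" "Ck_on k T g" and ST: "\<And>x. x \<in> S \<Longrightarrow> f x \<in> T"
  shows "Ck_on k S (\<lambda>x. g (f x))"
  using assms(2,3)
proof (induction k arbitrary: g)
  case 0 then show ?case
    using continuous_on_compose2[of T g S f] ST by (auto simp: image_subset_iff)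
next
  case (Suc k) show ?case
  proof (rule Ck_SucI[OF S])
    fix x assume x: "x \<in> S"
    let ?G = "frechet_derivative g (at (f x) within T)"
    have df: "(f has_derivative (\<lambda>v. dirD S f v x)) (at x within S)"
      using Suc.prems(1) x by (auto intro: has_fd)
    have dg: "(g has_derivative ?G) (at (f x) within T)" using Suc.prems(2) ST[OF x] by (auto intro: has_fd)
    have "((\<lambda>x. g (f x)) has_derivative (\<lambda>v. ?G (dirD S f v x))) (at x within S)"
      by (rule has_derivative_in_compose[OF df has_derivative_subset[OF dg]]) (use ST in auto)
    \<comment> \<open>\<open>Ck_on\<close> speaks of derivatives in fixed directions, while the
      chain rule differentiates g in the moving direction \<open>dirD S f v x\<close>. Expanding
      that direction in \<open>Basis\<close> leaves fixed directions only, to which the induction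
      hypothesis applies.\<close>
    moreover have "(\<lambda>v. ?G (dirD S f v x)) = (\<lambda>v. \<Sum>b\<in>Basis. (dirD S f v x \<bullet> b) *\<^sub>R dirD T g b (f x))"
    proof
      fix v let ?u = "dirD S f v x"
      show "?G ?u = (\<Sum>b\<in>Basis. (?u \<bullet> b) *\<^sub>R dirD T g b (f x))"
      proof -
        have l: "linear ?G" using dg has_derivative_linear by blast
        have "?G (\<Sum>b\<in>Basis. (?u \<bullet> b) *\<^sub>R b) = (\<Sum>b\<in>Basis. (?u \<bullet> b) *\<^sub>R ?G b)"
          by (simp only: linear_sum[OF l] linear_scale[OF l])
        then show ?thesis by (simp only: euclidean_representation)
      qed
    qed
    ultimately show "((\<lambda>x. g (f x)) has_derivative
        (\<lambda>v. \<Sum>b\<in>Basis. (dirD S f v x \<bullet> b) *\<^sub>R dirD T g b (f x))) (at x within S)" by simp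
  next
    fix v
    show "Ck_on k S (\<lambda>x. \<Sum>b\<in>Basis. (dirD S f v x \<bullet> b) *\<^sub>R dirD T g b (f x))"
    proof (intro Ck_on_sum[OF S] Ck_on_scaleR[OF S] Suc.IH Ck_on_Suc[OF Suc.prems(1)])
      fix b :: 'b
      show "Ck_on k S (\<lambda>x. dirD S f v x \<bullet> b)"
        using Suc.prems(1) by (intro Ck_on_bl[OF bounded_linear_inner_left S]) auto
      show "Ck_on k T (\<lambda>x. dirD T g b x)" using Suc.prems(2) by auto
    qed
  qed
qed

lemma Ck_on_id:
  fixes S :: "'a::euclidean_space set" assumes "nice S" shows "Ck_on k S (\<lambda>x. x)"
proof (cases k)
  case 0 then show ?thesis by simp
next
  case (Suc j) show ?thesis unfolding Suc
    by (rule Ck_SucI[OF assms, where f'="\<lambda>x v. v"]) (auto intro: Ck_on_const[OF assms])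
qed

text \<open>At points of an open set O' the filters \<open>at y within S\<close> and
  \<open>at y within (S \<inter> O')\<close> agree, so derivatives within S can be computed locally
  at every order.\<close>

lemma Ck_on_local:
  fixes f :: "'a::euclidean_space \<Rightarrow> 'b::real_normed_vector"
  assumes "\<And>x. x \<in> S \<Longrightarrow> \<exists>O'. open O' \<and> x \<in> O' \<and> Ck_on k (S \<inter> O') f"
  shows "Ck_on k S f"
  using assms
proof (induction k arbitrary: f)
  case 0
  show ?case unfolding Ck_on.simps continuous_on_eq_continuous_within
  proof
    fix x assume "x \<in> S"
    with 0 obtain O' where "open O'" "x \<in> O'" "continuous_on (S \<inter> O') f" by force
    then have "continuous (at x within (S \<inter> O')) f" using \<open>x \<in> S\<close> by (simp add: continuous_on_eq_continuous_within)
    then show "continuous (at x within S) f"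
      using \<open>x \<in> S\<close> at_within_nhd[of x O' "S \<inter> O'" S]
      by (simp add: \<open>open O'\<close> \<open>x \<in> O'\<close> Int_absorb1)
  qed
next
  case (Suc k)
  have *: "\<exists>O'. open O' \<and> x \<in> O' \<and> (\<forall>y\<in>S\<inter>O'. at y within (S \<inter> O') = at y within S)
      \<and> f differentiable (at x within S) \<and> (\<forall>v. Ck_on k (S \<inter> O') (\<lambda>x. dirD S f v x))" if x: "x \<in> S" for x
  proof -
    from Suc.prems[OF x] obtain O' where O: "open O'" "x \<in> O'" "Ck_on (Suc k) (S \<inter> O') f" by blast
    have e: "at y within (S \<inter> O') = at y within S" if "y \<in> S \<inter> O'" for y
      by (rule at_within_nhd[of y O']) (use that O in auto)
    have "Ck_on k (S \<inter> O') (\<lambda>x. dirD S f v x) \<longleftrightarrow> Ck_on k (S \<inter> O') (\<lambda>x. dirD (S \<inter> O') f v x)" for v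
      by (rule Ck_on_cong) (simp add: e)
    moreover have "f differentiable (at x within (S \<inter> O'))" using O x by simp
    then have "f differentiable (at x within S)" using O x e[of x] by simp
    ultimately show ?thesis using O e by auto
  qed
  have "Ck_on k S (\<lambda>x. dirD S f v x)" for v
  proof (rule Suc.IH)
    fix x assume "x \<in> S"
    from *[OF this] show "\<exists>O'. open O' \<and> x \<in> O' \<and> Ck_on k (S \<inter> O') (\<lambda>x. dirD S f v x)" by blast
  qed
  moreover have "f differentiable (at x within S)" if "x \<in> S" for x using *[OF that] by blast
  ultimately show ?case by simp
qed

lemma smooth_onD: "smooth_on S f \<Longrightarrow> Ck_on k S f"
  by (simp add: smooth_on_def)

lemma smooth_on_dirD:
  assumes "smooth_on S f" shows "smooth_on S (dirD S f v)"
proof -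
  have "Ck_on (Suc k) S f" for k by (rule smooth_onD[OF assms])
  then show ?thesis by (simp add: smooth_on_def)
qed

lemma smooth_on_has_fd:
  assumes "smooth_on S f" "x \<in> S"
  shows "(f has_derivative frechet_derivative f (at x within S)) (at x within S)"
  using smooth_onD[OF assms(1), of "Suc 0"] assms(2) by (simp add: has_fd)

lemma smooth_on_linear_fd: "smooth_on S f \<Longrightarrow> x \<in> S \<Longrightarrow> linear (frechet_derivative f (at x within S))"
  by (rule has_derivative_linear[OF smooth_on_has_fd])

lemma smooth_on_continuous: "smooth_on S f \<Longrightarrow> continuous_on S f"
  using smooth_onD[of S f 0] by simp

lemma smooth_on_const: "nice S \<Longrightarrow> smooth_on S (\<lambda>x. c)" by (simp add: smooth_on_def Ck_on_const)
lemma smooth_on_id: "nice S \<Longrightarrow> smooth_on S (\<lambda>x. x)" by (simp add: smooth_on_def Ck_on_id)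
lemma smooth_on_bl: "bounded_linear L \<Longrightarrow> nice S \<Longrightarrow> smooth_on S f \<Longrightarrow> smooth_on S (\<lambda>x. L (f x))"
  by (simp add: smooth_on_def Ck_on_bl)
lemma smooth_on_linear:
  fixes L :: "'a::euclidean_space \<Rightarrow> 'b::real_normed_vector"
  shows "linear L \<Longrightarrow> nice S \<Longrightarrow> smooth_on S L"
  using smooth_on_bl[of L S "\<lambda>x. x"] by (simp add: smooth_on_id linear_conv_bounded_linear)
lemma smooth_on_add: "nice S \<Longrightarrow> smooth_on S f \<Longrightarrow> smooth_on S g \<Longrightarrow> smooth_on S (\<lambda>x. f x + g x)"
  by (simp add: smooth_on_def Ck_on_add)
lemma smooth_on_sum: "nice S \<Longrightarrow> (\<And>i. i \<in> I \<Longrightarrow> smooth_on S (f i)) \<Longrightarrow> smooth_on S (\<lambda>x. \<Sum>i\<in>I. f i x)"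
  by (simp add: smooth_on_def Ck_on_sum)
lemma smooth_on_bilinear: "bounded_bilinear P \<Longrightarrow> nice S \<Longrightarrow> smooth_on S f \<Longrightarrow> smooth_on S g \<Longrightarrow>
    smooth_on S (\<lambda>x. P (f x) (g x))"
  by (simp add: smooth_on_def Ck_on_bilinear)
lemma smooth_on_minus:
  assumes "nice S" "smooth_on S f" shows "smooth_on S (\<lambda>x. - f x)"
  by (rule smooth_on_bl[OF bounded_linear_minus[OF bounded_linear_ident] assms])
lemma smooth_on_diff:
  assumes "nice S" "smooth_on S f" "smooth_on S g" shows "smooth_on S (\<lambda>x. f x - g x)"
  using smooth_on_add[OF assms(1,2) smooth_on_minus[OF assms(1,3)]] by simp
lemma smooth_on_compose: 
  fixes f :: "'a::euclidean_space \<Rightarrow> 'b::euclidean_space" and g :: "'b \<Rightarrow> 'c::real_normed_vector"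
  shows "nice S \<Longrightarrow> smooth_on S f \<Longrightarrow> smooth_on T g \<Longrightarrow> (\<And>x. x \<in> S \<Longrightarrow> f x \<in> T) \<Longrightarrow> smooth_on S (\<lambda>x. g (f x))"
  unfolding smooth_on_def by (intro allI Ck_on_compose[of S _ f T g]) auto
lemma smooth_on_subset:
  fixes g :: "'b::euclidean_space \<Rightarrow> 'c::real_normed_vector"
  shows "smooth_on T g \<Longrightarrow> S \<subseteq> T \<Longrightarrow> nice S \<Longrightarrow> smooth_on S g"
  by (rule smooth_on_compose[of S "\<lambda>x. x" T g]) (auto intro: smooth_on_id)
lemma smooth_on_local:
  fixes f :: "'a::euclidean_space \<Rightarrow> 'b::real_normed_vector"
  assumes "\<And>x. x \<in> S \<Longrightarrow> \<exists>O'. open O' \<and> x \<in> O' \<and> smooth_on (S \<inter> O') f"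
  shows "smooth_on S f"
  unfolding smooth_on_def
proof (intro allI Ck_on_local)
  fix k x assume "x \<in> S"
  from assms[OF this] show "\<exists>O'. open O' \<and> x \<in> O' \<and> Ck_on k (S \<inter> O') f"
    by (auto intro: smooth_onD)
qed

section \<open>Symmetry of second derivatives\<close>

lemma second_difference:
  fixes f :: "'a::real_normed_vector \<Rightarrow> real"
  assumes h: "0 < h"
    and B: "\<And>s t. 0 \<le> s \<Longrightarrow> s \<le> h \<Longrightarrow> 0 \<le> t \<Longrightarrow> t \<le> h \<Longrightarrow> x + s *\<^sub>R v + t *\<^sub>R w \<in> S"
    and f: "\<And>y. y \<in> S \<Longrightarrow> (f has_derivative f' y) (at y)"
    and fv: "\<And>y. y \<in> S \<Longrightarrow> ((\<lambda>y. f' y v) has_derivative fv y) (at y)"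
  obtains s t where "0 < s" "s < h" "0 < t" "t < h"
    "f (x + h *\<^sub>R v + h *\<^sub>R w) - f (x + h *\<^sub>R v) - f (x + h *\<^sub>R w) + f x = h * h * fv (x + s *\<^sub>R v + t *\<^sub>R w) w"
proof -
  \<comment> \<open>The increment of f in direction w, as a function of the position along v. The
    mean value theorem is applied to it in s and then to the resulting derivative in t.\<close>
  define \<phi> where "\<phi> s = f (x + s *\<^sub>R v + h *\<^sub>R w) - f (x + s *\<^sub>R v + 0 *\<^sub>R w)" for s
  have line: "((\<lambda>s. g (c + s *\<^sub>R u)) has_field_derivative g' u) (at s)"
    if "(g has_derivative g') (at (c + s *\<^sub>R u))" for g :: "'a \<Rightarrow> real" and g' c u s
  proof -
    have "((\<lambda>s. g (c + s *\<^sub>R u)) has_derivative (\<lambda>d. g' (d *\<^sub>R u))) (at s)"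
      by (rule has_derivative_compose[where f = "\<lambda>s. c + s *\<^sub>R u" and s = UNIV and f' = "\<lambda>d. d *\<^sub>R u", OF _ that])
        (auto intro!: derivative_eq_intros)
    moreover have "g' (d *\<^sub>R u) = g' u * d" for d
      using linear_scale[OF has_derivative_linear[OF that]] by simp
    ultimately show ?thesis by (simp add: has_field_derivative_def)
  qed
  have e: "x + s *\<^sub>R v + t *\<^sub>R w = (x + t *\<^sub>R w) + s *\<^sub>R v" for s t by simp
  have "(\<phi> has_field_derivative (f' (x + s *\<^sub>R v + h *\<^sub>R w) v - f' (x + s *\<^sub>R v + 0 *\<^sub>R w) v)) (at s)"
    if "0 \<le> s" "s \<le> h" for s
    unfolding \<phi>_def e
    by (intro DERIV_diff line) (use f B[of s h] B[of s 0] that h in \<open>auto simp: algebra_simps\<close>)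
  then obtain s where s: "0 < s" "s < h"
    "\<phi> h - \<phi> 0 = (h - 0) * (f' (x + s *\<^sub>R v + h *\<^sub>R w) v - f' (x + s *\<^sub>R v + 0 *\<^sub>R w) v)"
    using MVT2[OF h, of \<phi> "\<lambda>s. f' (x + s *\<^sub>R v + h *\<^sub>R w) v - f' (x + s *\<^sub>R v + 0 *\<^sub>R w) v"] by blast
  have "((\<lambda>t. f' (x + s *\<^sub>R v + t *\<^sub>R w) v) has_field_derivative fv (x + s *\<^sub>R v + t *\<^sub>R w) w) (at t)"
    if "0 \<le> t" "t \<le> h" for t
    by (rule line) (use fv B[of s t] s that in auto)
  then obtain t where t: "0 < t" "t < h"
    "f' (x + s *\<^sub>R v + h *\<^sub>R w) v - f' (x + s *\<^sub>R v + 0 *\<^sub>R w) v = (h - 0) * fv (x + s *\<^sub>R v + t *\<^sub>R w) w"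
    using MVT2[OF h, of "\<lambda>t. f' (x + s *\<^sub>R v + t *\<^sub>R w) v" "\<lambda>t. fv (x + s *\<^sub>R v + t *\<^sub>R w) w"] by blast
  show ?thesis
    by (rule that[OF s(1,2) t(1,2)]) (use s(3) t(3) in \<open>simp add: \<phi>_def\<close>)
qed

text \<open>Schwarz's theorem: the second difference of f over a small parallelogram is symmetric in
  v and w, and \<open>second_difference\<close> turns it into a nearby value of either mixed
  derivative. Continuity excludes that these differ at x.\<close>

lemma second_derivative_symmetric_open:
  fixes f :: "'a::real_normed_vector \<Rightarrow> real"
  assumes S: "open S" "x \<in> S"
    and f: "\<And>y. y \<in> S \<Longrightarrow> (f has_derivative f' y) (at y)"
    and fv: "\<And>y. y \<in> S \<Longrightarrow> ((\<lambda>y. f' y v) has_derivative fv y) (at y)"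
    and fw: "\<And>y. y \<in> S \<Longrightarrow> ((\<lambda>y. f' y w) has_derivative fw y) (at y)"
    and c: "continuous_on S (\<lambda>y. fv y w)" "continuous_on S (\<lambda>y. fw y v)"
  shows "fv x w = fw x v"
proof (rule ccontr)
  assume ne: "fv x w \<noteq> fw x v"
  define e where "e = \<bar>fv x w - fw x v\<bar> / 2"
  have e: "e > 0" using ne by (simp add: e_def)
  have "continuous (at x) (\<lambda>y. fv y w)" "continuous (at x) (\<lambda>y. fw y v)"
    using c S continuous_on_eq_continuous_at by blast+
  then have "\<exists>d>0. \<forall>y. dist y x < d \<longrightarrow> dist (fv y w) (fv x w) < e"
    "\<exists>d>0. \<forall>y. dist y x < d \<longrightarrow> dist (fw y v) (fw x v) < e"
    unfolding continuous_at_eps_delta using e by (auto simp: dist_norm)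
  then obtain d1 d2 where d: "d1 > 0" "\<And>y. dist y x < d1 \<Longrightarrow> dist (fv y w) (fv x w) < e"
     "d2 > 0" "\<And>y. dist y x < d2 \<Longrightarrow> dist (fw y v) (fw x v) < e" by auto
  obtain d3 where d3: "d3 > 0" "ball x d3 \<subseteq> S" using S openE by blast
  define d0 where "d0 = min d1 (min d2 d3)"
  have d0: "d0 > 0" using d d3 by (simp add: d0_def)
  \<comment> \<open>Small enough for the parallelogram with sides h v and h w to stay within
    distance d0 of x; the summand 1 keeps the denominator positive.\<close>
  define h where "h = d0 / (2 * (norm v + norm w + 1))"
  have pos: "norm v + norm w + 1 > 0" by (simp add: add_nonneg_pos)
  have h: "h > 0" using d0 pos by (simp add: h_def)
  have "h * (norm v + norm w + 1) = d0 / 2"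
    unfolding h_def using pos by (metis nonzero_mult_divide_mult_cancel_right times_divide_eq_left less_irrefl)
  then have hb: "h * (norm v + norm w + 1) < d0" using d0 by simp
  have near: "dist (x + s *\<^sub>R v + t *\<^sub>R w) x < d0" if "0 \<le> s" "s \<le> h" "0 \<le> t" "t \<le> h" for s t
  proof -
    have "dist (x + s *\<^sub>R v + t *\<^sub>R w) x = norm (s *\<^sub>R v + t *\<^sub>R w)" by (simp add: dist_norm)
    also have "\<dots> \<le> s * norm v + t * norm w" using that norm_triangle_ineq[of "s *\<^sub>R v" "t *\<^sub>R w"] by simp
    also have "\<dots> \<le> h * norm v + h * norm w" using that by (intro add_mono mult_right_mono) auto
    also have "\<dots> \<le> h * (norm v + norm w + 1)" using h by (simp add: algebra_simps)
    finally show ?thesis using hb by simp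
  qed
  have inS: "x + s *\<^sub>R v + t *\<^sub>R w \<in> S" if "0 \<le> s" "s \<le> h" "0 \<le> t" "t \<le> h" for s t
    using near[OF that] d3 by (auto simp: d0_def dist_commute)
  obtain s t where st: "0 < s" "s < h" "0 < t" "t < h"
    "f (x + h *\<^sub>R v + h *\<^sub>R w) - f (x + h *\<^sub>R v) - f (x + h *\<^sub>R w) + f x = h * h * fv (x + s *\<^sub>R v + t *\<^sub>R w) w"
    using second_difference[OF h inS f fv] by blast
  have inS': "x + s *\<^sub>R w + t *\<^sub>R v \<in> S" if "0 \<le> s" "s \<le> h" "0 \<le> t" "t \<le> h" for s t
    using inS[OF that(3,4,1,2)] by (simp add: add_ac)
  obtain s' t' where st': "0 < s'" "s' < h" "0 < t'" "t' < h"
    "f (x + h *\<^sub>R w + h *\<^sub>R v) - f (x + h *\<^sub>R w) - f (x + h *\<^sub>R v) + f x = h * h * fw (x + s' *\<^sub>R w + t' *\<^sub>R v) v"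
    using second_difference[OF h inS' f fw] by blast
  have "h * h * fv (x + s *\<^sub>R v + t *\<^sub>R w) w = h * h * fw (x + t' *\<^sub>R v + s' *\<^sub>R w) v"
  proof -
    have "x + h *\<^sub>R w + h *\<^sub>R v = x + h *\<^sub>R v + h *\<^sub>R w" "x + s' *\<^sub>R w + t' *\<^sub>R v = x + t' *\<^sub>R v + s' *\<^sub>R w" by simp_all
    with st(5) st'(5) show ?thesis by (simp only:)
  qed
  then have "fv (x + s *\<^sub>R v + t *\<^sub>R w) w = fw (x + t' *\<^sub>R v + s' *\<^sub>R w) v"
    using h by (metis mult_cancel_left mult_eq_0_iff less_irrefl)
  moreover have "dist (fv (x + s *\<^sub>R v + t *\<^sub>R w) w) (fv x w) < e"
    using near[of s t] st by (intro d) (auto simp: d0_def)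
  moreover have "dist (fw (x + t' *\<^sub>R v + s' *\<^sub>R w) v) (fw x v) < e"
    using near[of t' s'] st' by (intro d) (auto simp: d0_def)
  ultimately have "\<bar>fv x w - fw x v\<bar> < 2 * e" unfolding dist_real_def by linarith
  then show False by (simp add: e_def)
qed

lemma dirD_bl:
  assumes "nice S" "x \<in> S" "bounded_linear L" "f differentiable (at x within S)"
  shows "dirD S (\<lambda>y. L (f y)) v x = L (dirD S f v x)"
  using fd_eq[OF assms(1,2) bounded_linear.has_derivative[OF assms(3) has_fd[OF assms(4)]]] by simp

lemma smooth_dirD_bl:
  "nice S \<Longrightarrow> x \<in> S \<Longrightarrow> bounded_linear L \<Longrightarrow> smooth_on S f \<Longrightarrow> dirD S (\<lambda>y. L (f y)) v x = L (dirD S f v x)"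
  by (rule dirD_bl) (auto intro: differentiableI smooth_on_has_fd)

text \<open>Real components reduce this to the open case on the interior. Boundary points are
  reached by continuity, as a \<open>nice\<close> set lies in the closure of its interior.\<close>

lemma second_derivative_symmetric:
  fixes f :: "'a::euclidean_space \<Rightarrow> 'b::euclidean_space"
  assumes S: "nice S" "x \<in> S" and f: "smooth_on S f"
  shows "dirD S (dirD S f v) w x = dirD S (dirD S f w) v x"
proof (rule euclidean_eqI)
  fix b :: 'b assume "b \<in> Basis"
  define g where "g y = f y \<bullet> b" for y
  have g: "smooth_on S g" unfolding g_def by (rule smooth_on_bl[OF bounded_linear_inner_left S(1) f])
  have e: "dirD S f u y \<bullet> b = dirD S g u y" if "y \<in> S" for u y
    unfolding g_def using smooth_dirD_bl[OF S(1) that bounded_linear_inner_left f, of b u] by simp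
  have e2: "dirD S (dirD S f u) u' y \<bullet> b = dirD S (dirD S g u) u' y" if "y \<in> S" for u u' y
  proof -
    have "dirD S (dirD S f u) u' y \<bullet> b = dirD S (\<lambda>y. dirD S f u y \<bullet> b) u' y"
      by (rule smooth_dirD_bl[OF S(1) that bounded_linear_inner_left smooth_on_dirD[OF f], symmetric])
    also have "\<dots> = dirD S (dirD S g u) u' y"
      using fd_cong(1)[of y S "\<lambda>y. dirD S f u y \<bullet> b" "dirD S g u"] e that by simp
    finally show ?thesis .
  qed
  define k where "k y = dirD S (dirD S g v) w y - dirD S (dirD S g w) v y" for y
  have k: "continuous_on S k" unfolding k_def
    by (intro continuous_on_diff smooth_on_continuous smooth_on_dirD g)
  have at: "at y within S = at y" if "y \<in> interior S" for y
    using that by (rule at_within_interior)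
  have "k y = 0" if y: "y \<in> interior S" for y
  proof -
    have sub: "interior S \<subseteq> S" by (rule interior_subset)
    have A: "(g has_derivative (\<lambda>v. dirD S g v y)) (at y)" if "y \<in> interior S" for y
      using smooth_on_has_fd[OF g, of y] that sub unfolding at[OF that, symmetric] by blast
    have B: "((\<lambda>y. dirD S g u y) has_derivative (\<lambda>w. dirD S (dirD S g u) w y)) (at y)" if "y \<in> interior S" for y u
      using smooth_on_has_fd[OF smooth_on_dirD[OF g], of y] that sub unfolding at[OF that, symmetric] by blast
    have C: "continuous_on (interior S) (\<lambda>y. dirD S (dirD S g u) u' y)" for u u'
      by (rule continuous_on_subset[OF _ sub]) (intro smooth_on_continuous smooth_on_dirD g)
    have "dirD S (dirD S g v) w y = dirD S (dirD S g w) v y"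
      by (rule second_derivative_symmetric_open[OF open_interior y A B B C C])
    then show ?thesis by (simp add: k_def)
  qed
  note k0 = this
  have "x \<in> closure (interior S)" using S by (auto simp: nice_def)
  then obtain p where p: "\<And>n. p n \<in> interior S" "p \<longlonglongrightarrow> x" unfolding closure_sequential by blast
  have "(\<lambda>n. k (p n)) \<longlonglongrightarrow> k x"
  proof (rule continuous_on_tendsto_compose[OF k p(2) S(2)])
    have "p n \<in> S" for n using p(1)[of n] interior_subset[of S] by blast
    then show "\<forall>\<^sub>F n in sequentially. p n \<in> S" by simp
  qed
  then have "(\<lambda>n. 0) \<longlonglongrightarrow> k x" by (simp add: k0[OF p(1)])
  then have "k x = 0" by (simp add: LIMSEQ_const_iff)
  then show "dirD S (dirD S f v) w x \<bullet> b = dirD S (dirD S f w) v x \<bullet> b"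
    by (simp add: k_def e2[OF S(2)])
qed

subsection \<open>Alternating forms\<close>

lemma alt_linear:
  "alternating k \<alpha> \<Longrightarrow> length vs = k \<Longrightarrow> i < k \<Longrightarrow> linear (\<lambda>v. \<alpha> (vs[i := v]))"
  by (simp add: alternating_def)

lemma alt_linear_mid:
  assumes "alternating k \<alpha>" "length xs + length ys + 1 = k" shows "linear (\<lambda>v. \<alpha> (xs @ v # ys))"
  using alt_linear[OF assms(1), of "xs @ undefined # ys" "length xs"] assms(2) by simp

lemma alt_linear_hd:
  assumes "alternating k \<alpha>" "length ys + 1 = k" shows "linear (\<lambda>v. \<alpha> (v # ys))"
  using alt_linear_mid[OF assms(1), of "[]" ys] assms(2) by simp

lemma alt_eq_0_nth:
  assumes "alternating k \<alpha>" "length vs = k" "i < k" "j < k" "i \<noteq> j" "vs ! i = vs ! j" shows "\<alpha> vs = 0"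
proof -
  consider "i < j" | "j < i" using assms(5) by linarith
  then show ?thesis
    by cases (use assms in \<open>auto simp: alternating_def\<close>)
qed

lemma alt_eq_0:
  assumes "alternating k \<alpha>" "length vs = k" "\<not> distinct vs" shows "\<alpha> vs = 0"
proof -
  obtain i j where ij: "i < length vs" "j < length vs" "i \<noteq> j" "vs ! i = vs ! j"
    using assms(3) by (auto simp: distinct_conv_nth)
  then show ?thesis using alt_eq_0_nth[OF assms(1,2)] assms(2) by simp
qed

lemma alt_swap_update:
  fixes \<alpha> :: "('e::real_vector, 'b::real_vector) mform"
  assumes "alternating k \<alpha>" "length vs = k" "i < k" "j < k" "i \<noteq> j"
  shows "\<alpha> (vs[i := x, j := y]) = - \<alpha> (vs[i := y, j := x])"
proof -
  have z: "\<alpha> (vs[i := u, j := u]) = 0" for u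
    by (rule alt_eq_0_nth[OF assms(1) _ assms(3-5)]) (use assms in \<open>auto simp: nth_list_update\<close>)
  have l1: "linear (\<lambda>u. \<alpha> (vs[i := u, j := w]))" for w
    using alt_linear[OF assms(1), of "vs[j := w]" i] assms by (simp add: list_update_swap)
  have l2: "linear (\<lambda>w. \<alpha> (vs[i := u, j := w]))" for u
    using alt_linear[OF assms(1), of "vs[i := u]" j] assms by simp
  have "\<alpha> (vs[i := x + y, j := x + y]) = \<alpha> (vs[i := x, j := x]) + \<alpha> (vs[i := x, j := y])
      + \<alpha> (vs[i := y, j := x]) + \<alpha> (vs[i := y, j := y])"
    by (simp add: linear_add[OF l1] linear_add[OF l2])
  then show ?thesis by (simp add: z add_eq_0_iff)
qed

lemma alt_swap:
  fixes \<alpha> :: "('e::real_vector, 'b::real_vector) mform"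
  assumes "alternating k \<alpha>" "length xs + length ys + 2 = k"
  shows "\<alpha> (xs @ a # b # ys) = - \<alpha> (xs @ b # a # ys)"
  using alt_swap_update[OF assms(1), of "xs @ a # b # ys" "length xs" "Suc (length xs)" a b] assms(2)
  by (simp add: list_update_append)

lemma alt_move:
  fixes \<alpha> :: "('e::real_vector, 'b::real_vector) mform"
  assumes "alternating k \<alpha>" "length A + length B + length C + 1 = k"
  shows "\<alpha> (A @ B @ h # C) = (-1) ^ length B *\<^sub>R \<alpha> (A @ h # B @ C)"
  using assms(2)
proof (induction B arbitrary: A)
  case (Cons b B)
  have "\<alpha> (A @ (b # B) @ h # C) = (-1) ^ length B *\<^sub>R \<alpha> ((A @ [b]) @ h # B @ C)"
    using Cons.IH[of "A @ [b]"] Cons.prems by simp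
  also have "\<alpha> ((A @ [b]) @ h # B @ C) = - \<alpha> (A @ h # b # B @ C)"
    using alt_swap[OF assms(1), of A "B @ C" b h] Cons.prems by simp
  finally show ?case by simp
qed simp

lemma alt_ip:
  assumes "alternating (Suc k) \<alpha>" shows "alternating k (interior_product v \<alpha>)"
  unfolding alternating_def interior_product_def
proof (intro conjI allI impI)
  fix vs :: "'a list" and i assume "length vs = k" "i < k"
  then show "linear (\<lambda>u. \<alpha> (v # vs[i := u]))" using alt_linear[OF assms, of "v # vs" "Suc i"] by simp
next
  fix vs :: "'a list" and i j assume *: "length vs = k" "i < j" "j < k" "vs ! i = vs ! j"
  then show "\<alpha> (v # vs) = 0"
    by (intro alt_eq_0_nth[OF assms, where i = "Suc i" and j = "Suc j"]) auto
qed

lemma alt_subst: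
  assumes "alternating k \<alpha>" "\<And>vs. length vs = k \<Longrightarrow> \<beta> vs = \<alpha> vs" shows "alternating k \<beta>"
  using assms unfolding alternating_def by simp

lemma alt_sum_list_form:
  assumes "alternating k \<alpha>" "alternating k \<beta>" shows "alternating k (\<lambda>vs. \<alpha> vs + \<beta> vs)"
  using assms unfolding alternating_def by (auto intro!: linear_compose_add)

lemma alt_bl:
  assumes "alternating k \<alpha>" "linear L" shows "alternating k (\<lambda>vs. L (\<alpha> vs))"
  using assms linear_compose[OF _ assms(2)] unfolding alternating_def
  by (auto simp: o_def linear_0)

lemma alt_map:
  assumes "alternating k \<alpha>" "linear L" shows "alternating k (\<lambda>vs. \<alpha> (map L vs))"
  unfolding alternating_def
proof (intro conjI allI impI)
  fix vs :: "'c list" and i assume "length vs = k" "i < k"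
  then have "linear (\<lambda>v. \<alpha> ((map L vs)[i := v]))" by (intro alt_linear[OF assms(1)]) auto
  from linear_compose[OF assms(2) this] show "linear (\<lambda>v. \<alpha> (map L (vs[i := v])))"
    by (simp add: o_def map_update)
next
  fix vs :: "'c list" and i j assume *: "length vs = k" "i < j" "j < k" "vs ! i = vs ! j"
  then show "\<alpha> (map L vs) = 0"
    by (intro alt_eq_0_nth[OF assms(1), where i = i and j = j]) auto
qed

text \<open>Adjacent swaps generate all permutations. The length condition is there because f will
  be built from forms, which behave well only on lists of their own degree.\<close>

lemma swap_invariant_perm:
  assumes "\<And>xs a b ys. length xs + length ys + 2 = length zs \<Longrightarrow> f (xs @ a # b # ys) = f (xs @ b # a # ys)"
    and "mset zs = mset zs'"
  shows "f zs = f zs'"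
  using assms
proof (induction zs arbitrary: f zs')
  case (Cons z zs)
  note sw = Cons.prems(1)
  have "z \<in> set zs'" using Cons.prems(2) by (metis list.set_intros(1) mset_eq_setD)
  then obtain p q where pq: "zs' = p @ z # q" by (meson split_list)
  have ms: "mset zs = mset (p @ q)" using Cons.prems(2) pq by simp
  have len: "length zs = length p + length q" using ms by (metis length_append size_mset)
  have "f (z # zs) = f (z # p @ q)"
  proof (rule Cons.IH[of "\<lambda>l. f (z # l)", OF _ ms])
    fix xs ys :: "'a list" and a b assume "length xs + length ys + 2 = length zs"
    then show "f (z # xs @ a # b # ys) = f (z # xs @ b # a # ys)"
      using Cons.prems(1)[of "z # xs" ys a b] by simp
  qed
  also have "f (z # p @ q) = f zs'"
  proof -
    have "f (r @ z # p @ q) = f (r @ p @ z # q)" if "length r + length p + length q = length zs" for r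
      using that
    proof (induction p arbitrary: r)
      case (Cons y p)
      have "f (r @ z # y # (p @ q)) = f (r @ y # z # (p @ q))"
        by (rule sw) (use Cons.prems in simp)
      also have "\<dots> = f ((r @ [y]) @ p @ z # q)" using Cons.IH[of "r @ [y]"] Cons.prems by simp
      finally show ?case by simp
    qed simp
    from this[of "[]"] len show ?thesis by (simp add: pq)
  qed
  finally show ?case .
qed simp

subsection \<open>Wedge products\<close>

text \<open>The permutation acts on the letters 1, ..., M and fixes 0; recognising it as a
  \<open>map_permutation\<close> yields its sign.\<close>

lemma shift_eq_map_permutation:
  assumes "\<tau> permutes {..<M}"
  shows "(\<lambda>i. case i of 0 \<Rightarrow> 0 | Suc n \<Rightarrow> Suc (\<tau> n)) = map_permutation {..<M} Suc \<tau>"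
proof
  fix i
  show "(case i of 0 \<Rightarrow> 0 | Suc n \<Rightarrow> Suc (\<tau> n)) = map_permutation {..<M} Suc \<tau> i"
    using permutes_not_in[OF assms] inv_into_f_f[of Suc "{..<M}"]
    by (cases i) (auto simp: map_permutation_def restrict_id_def)
qed

lemma sign_shift:
  "\<tau> permutes {..<M} \<Longrightarrow> sign (\<lambda>i. case i of 0 \<Rightarrow> 0 | Suc n \<Rightarrow> Suc (\<tau> n)) = sign \<tau>"
  using sign_map_permutation[of Suc "{..<M}" \<tau>] by (simp add: shift_eq_map_permutation)

lemma shift_permutes:
  assumes "\<tau> permutes {..<M}"
  shows "(\<lambda>i. case i of 0 \<Rightarrow> 0 | Suc n \<Rightarrow> Suc (\<tau> n)) permutes {..<Suc M}"
proof -
  have "map_permutation {..<M} Suc \<tau> permutes Suc ` {..<M}"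
    by (rule map_permutation_permutes[OF _ assms]) (simp add: bij_betw_def)
  then show ?thesis unfolding shift_eq_map_permutation[OF assms] by (rule permutes_subset) auto
qed

lemma sum_perm_fixing_0:
  fixes f :: "(nat \<Rightarrow> nat) \<Rightarrow> 'b::comm_monoid_add"
  shows "(\<Sum>\<sigma> | \<sigma> permutes {..<Suc M} \<and> \<sigma> 0 = 0. f \<sigma>)
    = (\<Sum>\<tau> | \<tau> permutes {..<M}. f (\<lambda>i. case i of 0 \<Rightarrow> 0 | Suc n \<Rightarrow> Suc (\<tau> n)))"
proof (rule sum.reindex_bij_witness[where i = "\<lambda>\<tau> i. case i of 0 \<Rightarrow> 0 | Suc n \<Rightarrow> Suc (\<tau> n)" and j = "\<lambda>\<sigma> n. \<sigma> (Suc n) - 1"], goal_cases)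
  case (1 \<sigma>)
  then have "\<sigma> (Suc n) \<noteq> 0" for n
    using permutes_inj[of \<sigma> "{..<Suc M}"] by (metis (mono_tags, lifting) injD mem_Collect_eq nat.distinct(1))
  then show ?case using 1 by (auto simp: fun_eq_iff split: nat.split)
next
  case (2 \<sigma>)
  then have p: "\<sigma> permutes {..<Suc M}" and 0: "\<sigma> 0 = 0" by auto
  have inj: "inj \<sigma>" by (rule permutes_inj[OF p])
  have nz: "\<sigma> (Suc n) \<noteq> 0" for n using inj 0 by (metis injD nat.distinct(1))
  have inj': "inj (\<lambda>n. \<sigma> (Suc n) - 1)"
  proof (rule injI)
    fix x y assume "\<sigma> (Suc x) - 1 = \<sigma> (Suc y) - 1"
    then have "\<sigma> (Suc x) = \<sigma> (Suc y)" using nz[of x] nz[of y] by linarith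
    then show "x = y" using inj by (auto dest: injD)
  qed
  have lt: "\<sigma> (Suc n) < Suc M" if "n < M" for n using permutes_in_image[OF p, of "Suc n"] that by simp
  have "(\<lambda>n. \<sigma> (Suc n) - 1) permutes {..<M}"
  proof (rule bij_imp_permutes)
    have "(\<lambda>n. \<sigma> (Suc n) - 1) ` {..<M} \<subseteq> {..<M}" 
    proof (rule image_subsetI)
      fix n assume "n \<in> {..<M}" then show "\<sigma> (Suc n) - 1 \<in> {..<M}" using lt[of n] nz[of n] by auto
    qed
    then show "bij_betw (\<lambda>n. \<sigma> (Suc n) - 1) {..<M} {..<M}"
      using endo_inj_surj[of "{..<M}"] inj_on_subset[OF inj'] by (auto simp: bij_betw_def)
    fix x assume "x \<notin> {..<M}"
    then show "\<sigma> (Suc x) - 1 = x" using permutes_not_in[OF p, of "Suc x"] by simp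
  qed
  then show ?case by simp
next
  case (3 \<tau>) then show ?case by simp
next
  case (4 \<tau>)
  then have p: "\<tau> permutes {..<M}" by simp
  let ?s = "\<lambda>i. case i of 0 \<Rightarrow> 0 | Suc n \<Rightarrow> Suc (\<tau> n)"
  have "?s permutes {..<Suc M}" by (rule shift_permutes[OF p])
  then show ?case by simp
next
  case (5 \<sigma>)
  then have "\<sigma> (Suc n) \<noteq> 0" for n
    using permutes_inj[of \<sigma> "{..<Suc M}"] by (metis (mono_tags, lifting) injD mem_Collect_eq nat.distinct(1))
  then have "(\<lambda>i. case i of 0 \<Rightarrow> 0 | Suc n \<Rightarrow> Suc (\<sigma> (Suc n) - 1)) = \<sigma>" using 5 by (auto simp: fun_eq_iff split: nat.split)
  then show ?case by simp
qed

text \<open>Composition with an involution q moves the position at which the value c is taken. This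
  is how the possible positions of one argument of a wedge product are compared.\<close>

lemma sum_permutes_compose:
  assumes q: "q permutes S" "q \<circ> q = id"
  shows "(\<Sum>\<sigma> | \<sigma> permutes S \<and> \<sigma> a = c. f \<sigma>) = (\<Sum>\<sigma> | \<sigma> permutes S \<and> \<sigma> (q a) = c. f (\<sigma> \<circ> q))"
  by (rule sum.reindex_bij_witness[where i = "\<lambda>\<sigma>. \<sigma> \<circ> q" and j = "\<lambda>\<sigma>. \<sigma> \<circ> q"])
    (use q in \<open>auto simp: comp_assoc permutes_compose fun_cong[OF q(2), unfolded o_def id_def, simplified]\<close>)

lemma alt_transpose:
  fixes \<alpha> :: "('e::real_vector, 'b::real_vector) mform"
  assumes "alternating k \<alpha>" "a < k" "b < k" "a \<noteq> b"
  shows "\<alpha> (map (\<lambda>i. w (Transposition.transpose a b i)) [0..<k]) = - \<alpha> (map w [0..<k])"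
proof -
  have "map (\<lambda>i. w (Transposition.transpose a b i)) [0..<k] = (map w [0..<k])[a := w b, b := w a]"
    using assms by (intro nth_equalityI) (auto simp: nth_list_update Transposition.transpose_def)
  moreover have "map w [0..<k] = (map w [0..<k])[a := w a, b := w b]"
    using assms by (intro nth_equalityI) (auto simp: nth_list_update)
  ultimately show ?thesis using alt_swap_update[OF assms(1) _ assms(2-4), of "map w [0..<k]" "w b" "w a"] by simp
qed

lemma map_upt_offset: "map f [k..<k+l] = map (\<lambda>i. f (k + i)) [0..<l]"
  by (rule nth_equalityI) auto

text \<open>
  The terms of the permutation sum are grouped by the position of \<open>v\<close>; all positions inside
  \<open>\<alpha>\<close> contribute equally, and so do all positions inside \<open>\<beta>\<close>.
\<close>

lemma wedge_Cons:
  fixes \<alpha> \<beta> :: "('e::real_vector, real) mform"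
  assumes al: "alternating k \<alpha>" and be: "alternating l \<beta>" and len: "Suc (length vs) = k + l"
  shows "wedge k \<alpha> \<beta> (v # vs) = (if k = 0 then 0 else wedge (k - 1) (interior_product v \<alpha>) \<beta> vs)
     + (if l = 0 then 0 else (-1) ^ k * wedge k \<alpha> (interior_product v \<beta>) vs)"
proof -
  note [simp del] = upt_Suc map_eq_conv
  define M where "M = length vs"
  define L where "L i = (v # vs) ! i" for i
  have M: "Suc M = k + l" using len by (simp add: M_def)
  define t where "t \<sigma> = real_of_int (sign \<sigma>) * \<alpha> (map (\<lambda>i. L (\<sigma> i)) [0..<k]) * \<beta> (map (\<lambda>i. L (\<sigma> i)) [k..<Suc M])"
    for \<sigma> :: "nat \<Rightarrow> nat"
  \<comment> \<open>Entry 0 of \<open>v # vs\<close> is v, so \<open>S j\<close> collects the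
    permutations that put v at position j.\<close>
  define S where "S j = (\<Sum>\<sigma> | \<sigma> permutes {..<Suc M} \<and> \<sigma> j = 0. t \<sigma>)" for j
  let ?P = "{\<sigma>::nat\<Rightarrow>nat. \<sigma> permutes {..<Suc M}}"
  have fin: "finite ?P" by (simp add: finite_permutations)
  have tr: "Transposition.transpose a b permutes {..<Suc M}" if "a < Suc M" "b < Suc M" for a b
    using that by (intro permutes_swap_id) auto
  have sg: "sign (\<sigma> \<circ> Transposition.transpose a b) = - sign \<sigma>" if "\<sigma> \<in> ?P" "a \<noteq> b" for \<sigma> a b
  proof -
    have "permutation \<sigma>" using that permutation_permutes by blast
    then show ?thesis
      using that(2) sign_compose[of \<sigma> "Transposition.transpose a b"] by (simp add: sign_swap_id permutation_swap_id)
  qed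
  have "(\<Sum>\<sigma>\<in>?P. t \<sigma>) = (\<Sum>j\<in>{..<Suc M}. S j)"
  proof -
    have "(\<Sum>\<sigma>\<in>?P. t \<sigma>) = (\<Sum>j\<in>{..<Suc M}. \<Sum>\<sigma>\<in>{\<sigma>\<in>?P. inv \<sigma> 0 = j}. t \<sigma>)"
    proof (rule sum.group[symmetric, OF fin])
      have "inv \<sigma> 0 < Suc M" if "\<sigma> permutes {..<Suc M}" for \<sigma>
        using permutes_in_image[OF permutes_inv[OF that], of 0] by simp
      then show "(\<lambda>\<sigma>. inv \<sigma> 0) ` ?P \<subseteq> {..<Suc M}" by blast
    qed simp
    moreover have "{\<sigma>\<in>?P. inv \<sigma> 0 = j} = {\<sigma>. \<sigma> permutes {..<Suc M} \<and> \<sigma> j = 0}" for j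
    proof -
      have "inv \<sigma> 0 = j \<longleftrightarrow> \<sigma> j = 0" if "\<sigma> permutes {..<Suc M}" for \<sigma>
        using permutes_inv_eq[OF that, of 0 j] by simp
      then have "(\<sigma> \<in> ?P \<and> inv \<sigma> 0 = j) = (\<sigma> permutes {..<Suc M} \<and> \<sigma> j = 0)" for \<sigma>
        by (cases "\<sigma> permutes {..<Suc M}") simp_all
      then show ?thesis by (simp only:)
    qed
    ultimately show ?thesis unfolding S_def by (simp only:)
  qed
  also have "(\<Sum>j\<in>{..<Suc M}. S j) = (\<Sum>j\<in>{..<k}. S j) + (\<Sum>j\<in>{k..<Suc M}. S j)"
  proof -
    have "{..<Suc M} = {..<k} \<union> {k..<Suc M}" using M by auto
    moreover have disj: "{..<k} \<inter> {k..<Suc M} = {}" by auto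
    ultimately show ?thesis using sum.union_disjoint[OF finite_lessThan finite_atLeastLessThan disj, of S] by (simp only:)
  qed
  also have "(\<Sum>j\<in>{..<k}. S j) = real k * S 0"
  proof -
    \<comment> \<open>Transposing two slots of \<alpha> changes the sign of the permutation and the
      sign of \<alpha>, so each term is preserved.\<close>
    have E: "S j = S 0" if j: "j < k" for j
    proof (cases "j = 0")
      case False
      have "S j = (\<Sum>\<sigma> | \<sigma> permutes {..<Suc M} \<and> \<sigma> (Transposition.transpose 0 j j) = 0. t (\<sigma> \<circ> Transposition.transpose 0 j))"
        unfolding S_def by (rule sum_permutes_compose) (use j M tr in auto)
      also have "\<dots> = S 0"
        unfolding S_def
      proof (rule sum.cong)
        fix \<sigma> assume "\<sigma> \<in> {\<sigma>. \<sigma> permutes {..<Suc M} \<and> \<sigma> 0 = 0}"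
        moreover have "map (\<lambda>i. L (\<sigma> (Transposition.transpose 0 j i))) [k..<Suc M] = map (\<lambda>i. L (\<sigma> i)) [k..<Suc M]"
          using j by (auto simp: Transposition.transpose_def map_eq_conv)
        ultimately show "t (\<sigma> \<circ> Transposition.transpose 0 j) = t \<sigma>"
          using alt_transpose[OF al, of 0 j "\<lambda>i. L (\<sigma> i)"] j False sg[of \<sigma> 0 j] by (simp add: t_def)
      qed simp
      finally show ?thesis .
    qed simp
    have "(\<Sum>j\<in>{..<k}. S j) = (\<Sum>j\<in>{..<k}. S 0)" by (intro sum.cong refl E) simp
    then show ?thesis by (simp only: sum_constant card_lessThan)
  qed
  also have "(\<Sum>j\<in>{k..<Suc M}. S j) = real l * S k"
  proof -
    have E: "S j = S k" if j: "k \<le> j" "j < Suc M" for j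
    proof (cases "j = k")
      case False
      have "S j = (\<Sum>\<sigma> | \<sigma> permutes {..<Suc M} \<and> \<sigma> (Transposition.transpose k j j) = 0. t (\<sigma> \<circ> Transposition.transpose k j))"
        unfolding S_def by (rule sum_permutes_compose) (use j M tr in auto)
      also have "\<dots> = S k"
        unfolding S_def
      proof (rule sum.cong)
        fix \<sigma> assume s: "\<sigma> \<in> {\<sigma>. \<sigma> permutes {..<Suc M} \<and> \<sigma> k = 0}"
        have 1: "map (\<lambda>i. L (\<sigma> (Transposition.transpose k j i))) [0..<k] = map (\<lambda>i. L (\<sigma> i)) [0..<k]"
          using j by (auto simp: Transposition.transpose_def map_eq_conv)
        have e: "Transposition.transpose k j (k + i) = k + Transposition.transpose 0 (j - k) i" for i
          using j by (auto simp: Transposition.transpose_def map_eq_conv)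
        have 2: "\<beta> (map (\<lambda>i. L (\<sigma> (Transposition.transpose k j i))) [k..<Suc M]) = - \<beta> (map (\<lambda>i. L (\<sigma> i)) [k..<Suc M])"
          using alt_transpose[OF be, of 0 "j - k" "\<lambda>i. L (\<sigma> (k + i))"] j M False
          unfolding M map_upt_offset e by simp
        show "t (\<sigma> \<circ> Transposition.transpose k j) = t \<sigma>"
          using s False sg[of \<sigma> k j] 1 2 by (simp add: t_def)
      qed simp
      finally show ?thesis .
    qed simp
    have "(\<Sum>j\<in>{k..<Suc M}. S j) = (\<Sum>j\<in>{k..<Suc M}. S k)" by (intro sum.cong refl E) simp_all
    moreover have "card {k..<Suc M} = l" using M by simp
    ultimately show ?thesis by (simp only: sum_constant)
  qed
  finally have tot: "(\<Sum>\<sigma>\<in>?P. t \<sigma>) = real k * S 0 + real l * S k" .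
  have LS: "L (Suc i) = vs ! i" for i by (simp add: L_def)
  have S0: "real k * S 0 / (fact k * fact l) = (if k = 0 then 0 else wedge (k - 1) (interior_product v \<alpha>) \<beta> vs)"
  proof (cases k)
    case (Suc k')
    have "S 0 = (\<Sum>\<tau> | \<tau> permutes {..<M}. of_int (sign \<tau>) * interior_product v \<alpha> (map (\<lambda>i. vs ! \<tau> i) [0..<k'])
        * \<beta> (map (\<lambda>i. vs ! \<tau> i) [k'..<M]))"
      unfolding S_def sum_perm_fixing_0
    proof (rule sum.cong)
      fix \<tau> assume "\<tau> \<in> {\<tau>. \<tau> permutes {..<M}}"
      moreover have "[0..<k] = 0 # map Suc [0..<k']" "[k..<Suc M] = map Suc [k'..<M]"
        unfolding Suc by (auto simp: map_Suc_upt upt_conv_Cons)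
      ultimately show "t (\<lambda>i. case i of 0 \<Rightarrow> 0 | Suc n \<Rightarrow> Suc (\<tau> n)) = of_int (sign \<tau>) * interior_product v \<alpha> (map (\<lambda>i. vs ! \<tau> i) [0..<k'])
        * \<beta> (map (\<lambda>i. vs ! \<tau> i) [k'..<M])"
        by (simp add: t_def sign_shift LS interior_product_def o_def) (simp add: L_def)
    qed simp
    moreover have "M - k' = l" using M Suc by simp
    ultimately show ?thesis using Suc by (simp add: wedge_def M_def)
  qed simp
  \<comment> \<open>One transposition brings v from position k to position 0 but leaves the last
    argument of \<alpha> at its front. Returning that argument costs k - 1 signs and the
    transposition one more, hence (-1)^k.\<close>
  have Sk: "real l * S k / (fact k * fact l) = (if l = 0 then 0 else (-1) ^ k * wedge k \<alpha> (interior_product v \<beta>) vs)"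
  proof (cases l)
    case (Suc l')
    have kM: "k < Suc M" using M Suc by simp
    have "S k = (\<Sum>\<sigma> | \<sigma> permutes {..<Suc M} \<and> \<sigma> (Transposition.transpose 0 k k) = 0. t (\<sigma> \<circ> Transposition.transpose 0 k))"
      unfolding S_def by (rule sum_permutes_compose) (use kM tr in auto)
    also have "\<dots> = (\<Sum>\<tau> | \<tau> permutes {..<M}. t ((\<lambda>i. case i of 0 \<Rightarrow> 0 | Suc n \<Rightarrow> Suc (\<tau> n)) \<circ> Transposition.transpose 0 k))"
      by (simp add: sum_perm_fixing_0)
    also have "\<dots> = (\<Sum>\<tau> | \<tau> permutes {..<M}. (-1) ^ k * (of_int (sign \<tau>) * \<alpha> (map (\<lambda>i. vs ! \<tau> i) [0..<k])
        * interior_product v \<beta> (map (\<lambda>i. vs ! \<tau> i) [k..<M])))"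
    proof (rule sum.cong)
      fix \<tau> assume "\<tau> \<in> {\<tau>. \<tau> permutes {..<M}}"
      then have p: "\<tau> permutes {..<M}" by simp
      let ?s = "\<lambda>i. case i of 0 \<Rightarrow> 0 | Suc n \<Rightarrow> Suc (\<tau> n)"
      let ?q = "Transposition.transpose 0 k"
      have ps: "?s \<in> ?P" using shift_permutes[OF p] by simp
      have "[k..<Suc M] = k # map Suc [k..<M]" using kM by (simp add: upt_conv_Cons map_Suc_upt)
      then have b: "map (\<lambda>i. L (?s (?q i))) [k..<Suc M] = v # map (\<lambda>i. vs ! \<tau> i) [k..<M]"
        by (auto simp: L_def Transposition.transpose_def map_eq_conv)
      show "t (?s \<circ> ?q) = (-1) ^ k * (of_int (sign \<tau>) * \<alpha> (map (\<lambda>i. vs ! \<tau> i) [0..<k]) * interior_product v \<beta> (map (\<lambda>i. vs ! \<tau> i) [k..<M]))"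
      proof (cases k)
        case 0 then show ?thesis using b p by (simp add: t_def sign_shift interior_product_def)
      next
        case (Suc k')
        have "[0..<k] = 0 # map Suc [0..<k']" unfolding Suc by (simp add: map_Suc_upt upt_conv_Cons)
        then have a: "map (\<lambda>i. L (?s (?q i))) [0..<k] = (vs ! \<tau> k') # map (\<lambda>i. vs ! \<tau> i) [0..<k']"
          unfolding Suc by (auto simp: L_def Transposition.transpose_def map_eq_conv)
        have a': "map (\<lambda>i. vs ! \<tau> i) [0..<k] = map (\<lambda>i. vs ! \<tau> i) [0..<k'] @ [vs ! \<tau> k']" by (simp add: Suc upt_Suc)
        have "\<alpha> (map (\<lambda>i. vs ! \<tau> i) [0..<k]) = (-1) ^ k' * \<alpha> (map (\<lambda>i. L (?s (?q i))) [0..<k])"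
          unfolding a a' using alt_move[OF al, of "[]" "map (\<lambda>i. vs ! \<tau> i) [0..<k']" "[]" "vs ! \<tau> k'"] by (simp add: Suc)
        then have "\<alpha> (map (\<lambda>i. L (?s (?q i))) [0..<k]) = (-1) ^ k' * \<alpha> (map (\<lambda>i. vs ! \<tau> i) [0..<k])"
          by (simp add: mult.assoc[symmetric] flip: power_add)
        then show ?thesis using b sg[OF ps, of 0 k] p by (simp add: t_def sign_shift interior_product_def Suc)
      qed
    qed simp
    also have "\<dots> = (-1) ^ k * (\<Sum>\<tau> | \<tau> permutes {..<M}. (of_int (sign \<tau>) * \<alpha> (map (\<lambda>i. vs ! \<tau> i) [0..<k])
        * interior_product v \<beta> (map (\<lambda>i. vs ! \<tau> i) [k..<M])))" by (simp only: sum_distrib_left)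
    finally show ?thesis using M Suc by (simp add: wedge_def M_def)
  qed simp
  have "wedge k \<alpha> \<beta> (v # vs) = (\<Sum>\<sigma>\<in>?P. t \<sigma>) / (fact k * fact l)"
    using M by (simp add: wedge_def t_def L_def M_def)
  then show ?thesis by (simp add: tot add_divide_distrib S0[symmetric] Sk[symmetric])
qed

lemma wedge_Nil: "wedge 0 \<alpha> \<beta> [] = \<alpha> [] * \<beta> []"
  by (simp add: wedge_def)

lemma map_update_permutes:
  assumes \<sigma>: "\<sigma> permutes {..<length vs}" and i: "i < length vs" and "b \<le> length vs"
  shows "map (\<lambda>q. vs[i := v] ! \<sigma> q) [a..<b] =
    (if a \<le> inv \<sigma> i \<and> inv \<sigma> i < b then (map (\<lambda>q. vs ! \<sigma> q) [a..<b])[inv \<sigma> i - a := v] else map (\<lambda>q. vs ! \<sigma> q) [a..<b])"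
proof -
  have eq: "\<sigma> q = i \<longleftrightarrow> q = inv \<sigma> i" for q using permutes_inv_eq[OF \<sigma>, of i q] by metis
  have "vs[i := v] ! \<sigma> q = (if q = inv \<sigma> i then v else vs ! \<sigma> q)" if "q < b" for q
    using eq[of q] i nth_list_update_eq[OF i, of v] nth_list_update_neq[of i "\<sigma> q" vs v] by auto
  then show ?thesis by (intro nth_equalityI) (auto simp: nth_list_update)
qed

text \<open>Each slot is used by exactly one of the two factors, which gives linearity in it. If
  entries i and j agree, composing with their transposition changes only the sign of a term, so the
  sum equals its own negative.\<close>

lemma alternating_wedge:
  fixes \<alpha> \<beta> :: "('e::real_vector, real) mform"
  assumes al: "alternating k \<alpha>" and be: "alternating l \<beta>"
  shows "alternating (k + l) (wedge k \<alpha> \<beta>)"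
  unfolding alternating_def
proof (intro conjI allI impI)
  fix vs :: "'e list" and i assume vs: "length vs = k + l" and i: "i < k + l"
  have "linear (\<lambda>v. of_int (sign \<sigma>) * \<alpha> (map (\<lambda>q. vs[i := v] ! \<sigma> q) [0..<k]) * \<beta> (map (\<lambda>q. vs[i := v] ! \<sigma> q) [k..<length vs]))"
    if \<sigma>: "\<sigma> permutes {..<length vs}" for \<sigma>
  proof -
    have p: "inv \<sigma> i < length vs" using permutes_in_image[OF permutes_inv[OF \<sigma>], of i] i vs by simp
    show ?thesis
    proof (cases "inv \<sigma> i < k")
      case True
      have "linear (\<lambda>v. \<alpha> ((map (\<lambda>q. vs ! \<sigma> q) [0..<k])[inv \<sigma> i := v]))"
        by (rule alt_linear[OF al]) (use True in auto)
      then have "linear (\<lambda>v. (of_int (sign \<sigma>) * \<beta> (map (\<lambda>q. vs ! \<sigma> q) [k..<length vs])) *\<^sub>R \<alpha> ((map (\<lambda>q. vs ! \<sigma> q) [0..<k])[inv \<sigma> i := v]))"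
        by (rule linear_compose_scale_right)
      with True i vs show ?thesis by (simp add: map_update_permutes[OF \<sigma>] mult_ac)
    next
      case False
      have "linear (\<lambda>v. \<beta> ((map (\<lambda>q. vs ! \<sigma> q) [k..<length vs])[inv \<sigma> i - k := v]))"
        by (rule alt_linear[OF be]) (use False p vs in auto)
      then have "linear (\<lambda>v. (of_int (sign \<sigma>) * \<alpha> (map (\<lambda>q. vs ! \<sigma> q) [0..<k])) *\<^sub>R \<beta> ((map (\<lambda>q. vs ! \<sigma> q) [k..<length vs])[inv \<sigma> i - k := v]))"
        by (rule linear_compose_scale_right)
      with False p i vs show ?thesis by (simp add: map_update_permutes[OF \<sigma>] mult_ac)
    qed
  qed
  then have "linear (\<lambda>v. \<Sum>\<sigma> | \<sigma> permutes {..<length vs}. of_int (sign \<sigma>) * \<alpha> (map (\<lambda>q. vs[i := v] ! \<sigma> q) [0..<k]) * \<beta> (map (\<lambda>q. vs[i := v] ! \<sigma> q) [k..<length vs]))"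
    by (intro linear_compose_sum) auto
  then have "linear (\<lambda>v. (1 / (fact k * fact (length vs - k))) *\<^sub>R (\<Sum>\<sigma> | \<sigma> permutes {..<length vs}. of_int (sign \<sigma>) * \<alpha> (map (\<lambda>q. vs[i := v] ! \<sigma> q) [0..<k]) * \<beta> (map (\<lambda>q. vs[i := v] ! \<sigma> q) [k..<length vs])))"
    by (rule linear_compose_scale_right)
  then show "linear (\<lambda>v. wedge k \<alpha> \<beta> (vs[i := v]))" by (simp add: wedge_def)
next
  fix vs :: "'e list" and i j assume vs: "length vs = k + l" "i < j" "j < k + l" "vs ! i = vs ! j"
  let ?q = "Transposition.transpose i j"
  define t where "t \<sigma> = real_of_int (sign \<sigma>) * \<alpha> (map (\<lambda>i. vs ! \<sigma> i) [0..<k]) * \<beta> (map (\<lambda>i. vs ! \<sigma> i) [k..<length vs])"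
    for \<sigma> :: "nat \<Rightarrow> nat"
  have q: "?q permutes {..<length vs}" using vs by (intro permutes_swap_id) auto
  have "vs ! ?q x = vs ! x" for x using vs(4) by (auto simp: Transposition.transpose_def)
  then have "t (?q \<circ> \<sigma>) = - t \<sigma>" if "\<sigma> permutes {..<length vs}" for \<sigma>
  proof -
    have "permutation \<sigma>" using that permutation_permutes by blast
    then have "sign (?q \<circ> \<sigma>) = - sign \<sigma>"
      using vs sign_compose[of ?q \<sigma>] by (simp add: sign_swap_id permutation_swap_id)
    then show ?thesis using \<open>\<And>x. vs ! ?q x = vs ! x\<close> by (simp add: t_def)
  qed
  then have "(\<Sum>\<sigma> | \<sigma> permutes {..<length vs}. t \<sigma>) = - (\<Sum>\<sigma> | \<sigma> permutes {..<length vs}. t \<sigma>)"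
    using setum_permutations_compose_left[OF q, of t] by (simp add: sum_negf)
  then show "wedge k \<alpha> \<beta> vs = 0" by (simp add: wedge_def t_def)
qed

subsection \<open>Alternating forms in a basis\<close>

definition dual_basis :: "(nat \<Rightarrow> 'a::euclidean_space) \<Rightarrow> (nat \<Rightarrow> 'a \<Rightarrow> real) \<Rightarrow> bool" where
  "dual_basis e c \<longleftrightarrow> (\<forall>i<DIM('a). linear (c i)) \<and>
     (\<forall>i<DIM('a). \<forall>j<DIM('a). c i (e j) = (if i = j then 1 else 0))"

text \<open>Dual functionals force the vectors to be independent, and as many independent vectors as
  the dimension span the space.\<close>

lemma dual_basis_expand:
  fixes e :: "nat \<Rightarrow> 'a::euclidean_space"
  assumes "dual_basis e c" shows "v = (\<Sum>i<DIM('a). c i v *\<^sub>R e i)"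
proof -
  let ?N = "DIM('a)"
  have lin: "linear (c i)" if "i < ?N" for i using assms that by (simp add: dual_basis_def)
  have ce: "c i (e j) = (if i = j then 1 else 0)" if "i < ?N" "j < ?N" for i j
    using assms that by (simp add: dual_basis_def)
  have csum: "c i (\<Sum>j<?N. a j *\<^sub>R e j) = a i" if i: "i < ?N" for i a
  proof -
    have "c i (\<Sum>j<?N. a j *\<^sub>R e j) = (\<Sum>j<?N. a j * c i (e j))"
      by (simp add: linear_sum[OF lin[OF i]] linear_scale[OF lin[OF i]])
    also have "\<dots> = (\<Sum>j<?N. if j = i then a i else 0)" by (rule sum.cong) (use ce i in auto)
    finally show ?thesis using i by simp
  qed
  have inj: "inj_on e {..<?N}"
  proof (rule inj_onI)
    fix i j assume ij: "i \<in> {..<?N}" "j \<in> {..<?N}" "e i = e j"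
    then have "c i (e j) = 1" using ce[of i i] by simp
    then show "i = j" using ij ce[of i j] by (auto split: if_splits)
  qed
  have "independent (e ` {..<?N})"
  proof (rule real_vector.independent_if_scalars_zero)
    fix f x assume 0: "(\<Sum>x\<in>e ` {..<?N}. f x *\<^sub>R x) = 0" and "x \<in> e ` {..<?N}"
    then obtain i where i: "i < ?N" "x = e i" by auto
    have "0 = c i (\<Sum>j<?N. f (e j) *\<^sub>R e j)"
      using 0 linear_0[OF lin[OF i(1)]] by (simp add: sum.reindex[OF inj] o_def)
    then show "f x = 0" using csum[OF i(1), of "\<lambda>j. f (e j)"] i by simp
  qed simp
  moreover have "card (e ` {..<?N}) = ?N" using card_image[OF inj] by simp
  ultimately have span: "UNIV \<subseteq> span (e ` {..<?N})"
    by (intro card_ge_dim_independent) (auto simp: dim_UNIV)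
  have "id v = (\<Sum>i<?N. c i v *\<^sub>R e i)"
  proof (rule linear_eq_on_span[where B = "e ` {..<?N}" and f = id and g = "\<lambda>v. \<Sum>i<?N. c i v *\<^sub>R e i"])
    show "linear (id :: 'a \<Rightarrow> 'a)" by (simp add: linear_iff)
    show "linear (\<lambda>v. \<Sum>i<?N. c i v *\<^sub>R e i)"
      by (intro linear_compose_sum ballI) (use lin in \<open>auto simp: linear_iff algebra_simps\<close>)
    show "v \<in> span (e ` {..<?N})" using span by auto
    fix b assume "b \<in> e ` {..<?N}"
    then obtain j where j: "j < ?N" "b = e j" by auto
    have "(\<Sum>i<?N. c i b *\<^sub>R e i) = (\<Sum>i<?N. if i = j then e j else 0)"
      by (rule sum.cong) (use ce j in auto)
    then show "id b = (\<Sum>i<?N. c i b *\<^sub>R e i)" using j by simp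
  qed
  then show ?thesis by simp
qed

lemma alt_expand_hd:
  fixes e :: "nat \<Rightarrow> 'a::euclidean_space"
  assumes "dual_basis e c" "alternating (Suc k) \<alpha>" "length vs = k"
  shows "\<alpha> (v # vs) = (\<Sum>i<DIM('a). c i v *\<^sub>R \<alpha> (e i # vs))"
proof -
  have l: "linear (\<lambda>v. \<alpha> (v # vs))" by (rule alt_linear_hd[OF assms(2)]) (simp add: assms)
  have "\<alpha> (v # vs) = \<alpha> ((\<Sum>i<DIM('a). c i v *\<^sub>R e i) # vs)" using dual_basis_expand[OF assms(1), of v] by simp
  also have "\<dots> = (\<Sum>i<DIM('a). c i v *\<^sub>R \<alpha> (e i # vs))"
    by (simp add: linear_sum[OF l] linear_scale[OF l])
  finally show ?thesis .
qed

lemma alt_eq_on_lists: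
  fixes e :: "nat \<Rightarrow> 'a::euclidean_space"
  assumes "dual_basis e c" "alternating k \<alpha>" "alternating k \<beta>"
    and "\<And>I. length I = k \<Longrightarrow> set I \<subseteq> {..<DIM('a)} \<Longrightarrow> \<alpha> (map e I) = \<beta> (map e I)"
    and "length vs = k"
  shows "\<alpha> vs = \<beta> vs"
  using assms(2-5)
proof (induction vs arbitrary: k \<alpha> \<beta>)
  case Nil then show ?case using Nil(3)[of "[]"] by simp
next
  case (Cons v vs)
  obtain k' where k: "k = Suc k'" "length vs = k'" using Cons.prems(4) by auto
  have "\<alpha> (e i # vs) = \<beta> (e i # vs)" if i: "i < DIM('a)" for i
  proof -
    have "interior_product (e i) \<alpha> vs = interior_product (e i) \<beta> vs"
    proof (rule Cons.IH[OF alt_ip alt_ip _ k(2)])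
      show "alternating (Suc k') \<alpha>" "alternating (Suc k') \<beta>" using Cons.prems k by auto
      fix I assume "length I = k'" "set I \<subseteq> {..<DIM('a)}"
      then show "interior_product (e i) \<alpha> (map e I) = interior_product (e i) \<beta> (map e I)"
        using Cons.prems(3)[of "i # I"] i k by (simp add: interior_product_def)
    qed
    then show ?thesis by (simp add: interior_product_def)
  qed
  moreover have "\<alpha> (v # vs) = (\<Sum>i<DIM('a). c i v *\<^sub>R \<alpha> (e i # vs))" "\<beta> (v # vs) = (\<Sum>i<DIM('a). c i v *\<^sub>R \<beta> (e i # vs))"
    using alt_expand_hd[OF assms(1), of k' _ vs v] Cons.prems(1,2) k by auto
  ultimately show ?case by simp
qed

text \<open>Parity of the number of inversions, which is the sign of the sorting permutation if the
  entries are distinct. The recursion on lists makes it possible to evaluate it on concrete index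
  lists.\<close>

fun list_sign :: "nat list \<Rightarrow> int" where
  "list_sign [] = 1"
| "list_sign (x # xs) = (-1) ^ length (filter (\<lambda>y. y < x) xs) * list_sign xs"

lemma insort_takeWhile: "insort (x::nat) ys = takeWhile (\<lambda>y. y < x) ys @ x # dropWhile (\<lambda>y. y < x) ys"
  by (induction ys) auto

lemma length_filter_sort: "length (filter P (sort xs)) = length (filter P xs)"
  by (metis mset_filter mset_sort size_mset)

lemma sorted_takeWhile_less: "sorted ys \<Longrightarrow> takeWhile (\<lambda>y. y < x) ys = filter (\<lambda>y. y < (x::nat)) ys"
proof (induction ys)
  case (Cons y ys)
  show ?case
  proof (cases "y < x")
    case False
    with Cons.prems have "\<not> z < x" if "z \<in> set ys" for z using that by auto
    then have "filter (\<lambda>y. y < x) ys = []" by (simp add: filter_empty_conv)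
    with False show ?thesis by simp
  qed (use Cons in simp)
qed simp

text \<open>Insertion sort: the head passes exactly the smaller entries behind it, at the cost of
  one sign each.\<close>

lemma alt_sort:
  fixes \<alpha> :: "('e::real_vector, 'b::real_vector) mform"
  assumes "alternating k \<alpha>" "length I = k"
  shows "\<alpha> (map e I) = of_int (list_sign I) *\<^sub>R \<alpha> (map e (sort I))"
  using assms
proof (induction I arbitrary: k \<alpha>)
  case (Cons x I)
  then obtain k' where k: "k = Suc k'" "length I = k'" by auto
  let ?A = "takeWhile (\<lambda>y. y < x) (sort I)" and ?B = "dropWhile (\<lambda>y. y < x) (sort I)"
  have "\<alpha> (map e (x # I)) = of_int (list_sign I) *\<^sub>R \<alpha> (e x # map e (sort I))"
    using Cons.IH[OF alt_ip k(2), of \<alpha> "e x"] Cons.prems(1) k by (simp add: interior_product_def)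
  also have "map e (sort I) = map e ?A @ map e ?B" by (metis map_append takeWhile_dropWhile_id)
  also have "\<alpha> (e x # map e ?A @ map e ?B) = (-1) ^ length ?A *\<^sub>R \<alpha> (map e ?A @ e x # map e ?B)"
  proof -
    have "length ?A + length ?B = k'" using k by (metis length_append length_sort takeWhile_dropWhile_id)
    then show ?thesis
      using alt_move[OF Cons.prems(1), of "[]" "map e ?A" "map e ?B" "e x"] k by (simp flip: power_add)
  qed
  also have "map e ?A @ e x # map e ?B = map e (sort (x # I))" by (simp add: insort_takeWhile)
  also have "length ?A = length (filter (\<lambda>y. y < x) I)"
    by (simp add: sorted_takeWhile_less length_filter_sort)
  finally show ?case by (simp add: mult.commute)
qed simp

lemma filter_in_subseqs: "filter P xs \<in> set (subseqs xs)"
  by (induction xs) (auto simp: Let_def)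

lemma sort_in_subseqs:
  assumes "distinct I" "set I \<subseteq> {..<N}" shows "sort I \<in> set (subseqs [0..<N])"
proof -
  have E: "sort I = filter (\<lambda>i. i \<in> set I) [0..<N]"
  proof (rule sorted_distinct_set_unique)
    show "sorted (filter (\<lambda>i. i \<in> set I) [0..<N])" by (rule sorted_wrt_filter) (rule sorted_upt)
    show "set (sort I) = set (filter (\<lambda>i. i \<in> set I) [0..<N])" using assms(2) by (auto simp only: set_sort set_filter set_upt atLeastLessThan_iff lessThan_iff)
    show "sorted (sort I)" by (rule sorted_sort)
    show "distinct (sort I)" using assms(1) by (simp only: distinct_sort)
    show "distinct (filter (\<lambda>i. i \<in> set I) [0..<N])" by (rule distinct_filter) (rule distinct_upt)
  qed
  show ?thesis unfolding E by (rule filter_in_subseqs)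
qed

text \<open>By multilinearity and sorting only increasing index lists matter; \<open>subseqs\<close>
  presents them as an explicit list that can be evaluated.\<close>

lemma alt_eq_on_sorted:
  fixes e :: "nat \<Rightarrow> 'a::euclidean_space"
  assumes "dual_basis e c" and al: "alternating k \<alpha>" and be: "alternating k \<beta>"
    and eq: "\<And>I. I \<in> set (filter (\<lambda>I. length I = k) (subseqs [0..<DIM('a)])) \<Longrightarrow> \<alpha> (map e I) = \<beta> (map e I)"
    and "length vs = k"
  shows "\<alpha> vs = \<beta> vs"
proof (rule alt_eq_on_lists[OF assms(1) al be _ assms(5)])
  fix I assume I: "length I = k" "set I \<subseteq> {..<DIM('a)}"
  show "\<alpha> (map e I) = \<beta> (map e I)"
  proof (cases "distinct I")
    case True
    have "\<alpha> (map e (sort I)) = \<beta> (map e (sort I))"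
      by (rule eq) (use sort_in_subseqs[OF True I(2)] I(1) in simp)
    then show ?thesis by (simp only: alt_sort[OF al I(1), of e] alt_sort[OF be I(1), of e])
  next
    case False
    then have "\<not> distinct (map e I)" by (simp add: distinct_map)
    then show ?thesis using alt_eq_0[OF al] alt_eq_0[OF be] I by simp
  qed
qed

subsection \<open>Contractions and the Hodge star\<close>

definition index_lists :: "nat \<Rightarrow> nat \<Rightarrow> nat list set" where
  "index_lists N k = {I. length I = k \<and> set I \<subseteq> {..<N}}"

lemma finite_index_lists: "finite (index_lists N k)"
  using finite_lists_length_eq[of "{..<N}" k] by (simp add: index_lists_def conj_commute)

lemma index_lists_0: "index_lists N 0 = {[]}" by (auto simp: index_lists_def)

lemma sum_index_lists_Suc:
  "(\<Sum>I\<in>index_lists N (Suc k). f I) = (\<Sum>i<N. \<Sum>I\<in>index_lists N k. f (i # I))"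
proof -
  have "index_lists N (Suc k) = (\<lambda>(i, I). i # I) ` ({..<N} \<times> index_lists N k)"
    by (auto simp: index_lists_def length_Suc_conv image_iff)
  moreover have "inj_on (\<lambda>(i, I). i # I) ({..<N} \<times> index_lists N k)" by (auto simp: inj_on_def)
  ultimately show ?thesis by (simp add: sum.reindex sum.cartesian_product case_prod_unfold)
qed

lemma orthonormal_frame_dual_basis:
  assumes "inner_product_form g" "orthonormal_frame g es"
  shows "dual_basis ((!) es) (\<lambda>i. g (es ! i))"
  using assms by (auto simp: dual_basis_def inner_product_form_def orthonormal_frame_def bilinear_def)

text \<open>This is the trace of T with respect to g: expand one argument in the other frame, move
  the coefficients across by symmetry of g, and sum up again.\<close>

lemma contraction_frame_independent:
  fixes es es' :: "'a::euclidean_space list" and T :: "'a \<Rightarrow> 'a \<Rightarrow> real"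
  assumes g: "inner_product_form g" "orthonormal_frame g es" "orthonormal_frame g es'"
    and l1: "\<And>w. linear (\<lambda>v. T v w)" and l2: "\<And>v. linear (T v)"
  shows "(\<Sum>i<DIM('a). T (es ! i) (es ! i)) = (\<Sum>i<DIM('a). T (es' ! i) (es' ! i))"
proof -
  have x: "v = (\<Sum>j<DIM('a). g (fs ! j) v *\<^sub>R fs ! j)" if "orthonormal_frame g fs" for v fs
    by (rule dual_basis_expand[OF orthonormal_frame_dual_basis[OF g(1) that]])
  have sym: "g v w = g w v" for v w using g(1) by (simp add: inner_product_form_def)
  have "(\<Sum>i<DIM('a). T (es' ! i) (es' ! i)) = (\<Sum>i<DIM('a). T (\<Sum>j<DIM('a). g (es ! j) (es' ! i) *\<^sub>R es ! j) (es' ! i))"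
    by (simp only: x[OF g(2), symmetric])
  also have "\<dots> = (\<Sum>i<DIM('a). \<Sum>j<DIM('a). T (es ! j) (g (es' ! i) (es ! j) *\<^sub>R es' ! i))"
    by (simp add: linear_sum[OF l1] linear_scale[OF l1] linear_scale[OF l2] sym)
  also have "\<dots> = (\<Sum>j<DIM('a). \<Sum>i<DIM('a). T (es ! j) (g (es' ! i) (es ! j) *\<^sub>R es' ! i))"
    by (rule sum.swap)
  also have "\<dots> = (\<Sum>j<DIM('a). T (es ! j) (\<Sum>i<DIM('a). g (es' ! i) (es ! j) *\<^sub>R es' ! i))"
    by (simp add: linear_sum[OF l2])
  also have "\<dots> = (\<Sum>j<DIM('a). T (es ! j) (es ! j))" by (simp only: x[OF g(3), symmetric])
  finally show ?thesis ..
qed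

text \<open>\<open>hodge_star\<close> contracts a form with the volume form in a frame picked by
  \<open>SOME\<close>. Contracting one pair of slots after the other shows that every orthonormal
  frame gives the same value.\<close>

lemma list_contraction_frame_independent:
  fixes es es' :: "'a::euclidean_space list" and \<beta> \<gamma> :: "('a, real) mform"
  assumes g: "inner_product_form g" "orthonormal_frame g es" "orthonormal_frame g es'"
    and "alternating k \<beta>" "alternating (k + length ws) \<gamma>"
  shows "(\<Sum>I\<in>index_lists DIM('a) k. \<beta> (map ((!) es) I) * \<gamma> (map ((!) es) I @ ws))
    = (\<Sum>I\<in>index_lists DIM('a) k. \<beta> (map ((!) es') I) * \<gamma> (map ((!) es') I @ ws))"
  using assms(4,5)
proof (induction k arbitrary: \<beta> \<gamma>)
  case 0 then show ?case by (simp add: index_lists_0)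
next
  case (Suc k)
  have IH: "(\<Sum>I\<in>index_lists DIM('a) k. \<beta> (v # map ((!) es) I) * \<gamma> (v # map ((!) es) I @ ws))
    = (\<Sum>I\<in>index_lists DIM('a) k. \<beta> (v # map ((!) es') I) * \<gamma> (v # map ((!) es') I @ ws))" for v
    using Suc.IH[OF alt_ip[OF Suc.prems(1), of v] alt_ip, of \<gamma> v] Suc.prems(2) by (simp add: interior_product_def)
  have C: "(\<Sum>i<DIM('a). \<beta> ((es ! i) # map ((!) es') I) * \<gamma> ((es ! i) # map ((!) es') I @ ws))
     = (\<Sum>i<DIM('a). \<beta> ((es' ! i) # map ((!) es') I) * \<gamma> ((es' ! i) # map ((!) es') I @ ws))"
    if I: "I \<in> index_lists DIM('a) k" for I
  proof (rule contraction_frame_independent[OF g, where T = "\<lambda>u v. \<beta> (u # map ((!) es') I) * \<gamma> (v # map ((!) es') I @ ws)"])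
    have len: "length I = k" using I by (simp add: index_lists_def)
    show "linear (\<lambda>v. \<beta> (v # map ((!) es') I) * \<gamma> (w # map ((!) es') I @ ws))" for w
      using linear_compose_scale_right[OF alt_linear_hd[OF Suc.prems(1), of "map ((!) es') I"], of "\<gamma> (w # map ((!) es') I @ ws)"] len
      by (simp add: mult.commute)
    show "linear (\<lambda>v. \<beta> (u # map ((!) es') I) * \<gamma> (v # map ((!) es') I @ ws))" for u
      using linear_compose_scale_right[OF alt_linear_hd[OF Suc.prems(2), of "map ((!) es') I @ ws"], of "\<beta> (u # map ((!) es') I)"] len
      by simp
  qed
  show ?case
    unfolding sum_index_lists_Suc list.map append_Cons IH
    by (subst (1 2) sum.swap) (rule sum.cong[OF refl C])
qed

text \<open>An adjacent swap of indices changes the sign of both factors.\<close>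

lemma swap_sign_invariant:
  fixes \<beta> \<gamma> :: "('a::real_vector, real) mform" and e :: "'i \<Rightarrow> 'a" and I I' :: "'i list"
  assumes "alternating k \<beta>" "alternating (k + length ws) \<gamma>" "length I = k" "mset I = mset I'"
  shows "\<beta> (map e I) * \<gamma> (map e I @ ws) = \<beta> (map e I') * \<gamma> (map e I' @ ws)"
proof (rule swap_invariant_perm[where f = "\<lambda>I. \<beta> (map e I) * \<gamma> (map e I @ ws)", OF _ assms(4)])
  fix xs ys :: "'i list" and a b assume *: "length xs + length ys + 2 = length I"
  then show "\<beta> (map e (xs @ a # b # ys)) * \<gamma> (map e (xs @ a # b # ys) @ ws) =
      \<beta> (map e (xs @ b # a # ys)) * \<gamma> (map e (xs @ b # a # ys) @ ws)"
    using alt_swap[OF assms(1), of "map e xs" "map e ys" "e a" "e b"]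
      alt_swap[OF assms(2), of "map e xs" "map e ys @ ws" "e a" "e b"] assms(3) by simp
qed

text \<open>Contracting vol with itself in all slots gives a fixed positive multiple of the square
  of its value on the frame, and contractions do not depend on the frame. This takes the place of
  the determinant of an orthogonal matrix.\<close>

lemma top_form_frames:
  fixes es es' :: "'a::euclidean_space list"
  assumes g: "inner_product_form g" "orthonormal_frame g es" "orthonormal_frame g es'"
    and vol: "alternating DIM('a) vol"
  shows "(vol es)\<^sup>2 = ((vol es')\<^sup>2 :: real)"
proof -
  let ?D = "{I \<in> index_lists DIM('a) DIM('a). distinct I}"
  have S: "(\<Sum>I\<in>index_lists DIM('a) DIM('a). vol (map ((!) fs) I) * vol (map ((!) fs) I @ [])) = real (card ?D) * (vol fs)\<^sup>2"
    if fs: "orthonormal_frame g fs" for fs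
  proof -
    have len: "length fs = DIM('a)" using fs by (simp add: orthonormal_frame_def)
    have "vol (map ((!) fs) I) * vol (map ((!) fs) I @ []) = (if distinct I then (vol fs)\<^sup>2 else 0)"
      if I: "I \<in> index_lists DIM('a) DIM('a)" for I
    proof (cases "distinct I")
      case True
      have "set I = {..<DIM('a)}"
        by (rule card_subset_eq) (use I True distinct_card[OF True] in \<open>simp_all add: index_lists_def\<close>)
      then have "set I = set [0..<DIM('a)]" by (simp only: set_upt atLeast0LessThan)
      then have "mset I = mset [0..<DIM('a)]"
        by (rule iffD1[OF set_eq_iff_mset_eq_distinct[OF True distinct_upt]])
      then have "vol (map ((!) fs) I) * vol (map ((!) fs) I @ []) =
          vol (map ((!) fs) [0..<DIM('a)]) * vol (map ((!) fs) [0..<DIM('a)] @ [])"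
        by (intro swap_sign_invariant[where k = "DIM('a)"]) (use I vol in \<open>simp_all add: index_lists_def\<close>)
      moreover have "map ((!) fs) [0..<DIM('a)] = fs" using map_nth[of fs] len by simp
      ultimately show ?thesis using True by (simp only: append_Nil2 power2_eq_square if_True)
    next
      case False
      then have "\<not> distinct (map ((!) fs) I)" by (simp add: distinct_map)
      then show ?thesis using alt_eq_0[OF vol] I False by (simp add: index_lists_def)
    qed
    then have "(\<Sum>I\<in>index_lists DIM('a) DIM('a). vol (map ((!) fs) I) * vol (map ((!) fs) I @ [])) =
       (\<Sum>I\<in>index_lists DIM('a) DIM('a). if distinct I then (vol fs)\<^sup>2 else 0)" by (rule sum.cong[OF refl])
    also have "\<dots> = (\<Sum>I\<in>?D. (vol fs)\<^sup>2)" by (rule sum.inter_filter[symmetric, OF finite_index_lists])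
    finally show ?thesis by simp
  qed
  have "real (card ?D) * (vol es)\<^sup>2 = real (card ?D) * (vol es')\<^sup>2"
    unfolding S[OF g(2), symmetric] S[OF g(3), symmetric]
    by (rule list_contraction_frame_independent[OF g]) (use vol in auto)
  moreover have "card ?D > 0"
  proof -
    have "finite ?D" using finite_index_lists[of "DIM('a)" "DIM('a)"] by simp
    moreover have "[0..<DIM('a)] \<in> ?D" by (simp add: index_lists_def atLeast0LessThan)
    ultimately show ?thesis using card_gt_0_iff by blast
  qed
  ultimately show ?thesis by simp
qed

lemma hodge_star_frame:
  fixes es :: "'a::euclidean_space list"
  assumes "inner_product_form g" "orthonormal_frame g es" "alternating k \<beta>" "alternating (k + length ws) vol"
  shows "hodge_star g vol k \<beta> ws =
    (\<Sum>I\<in>index_lists DIM('a) k. \<beta> (map ((!) es) I) * vol (map ((!) es) I @ ws)) / fact k"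
proof -
  have "orthonormal_frame g (SOME es. orthonormal_frame g es)" using assms(2) by (rule someI)
  from list_contraction_frame_independent[OF assms(1) this assms(2-4)]
  show ?thesis unfolding hodge_star_def index_lists_def Let_def by simp
qed

lemma alternating_hodge_star:
  assumes "k + l = n" "alternating n vol"
  shows "alternating l (hodge_star g vol k \<beta>)"
  unfolding alternating_def
proof (intro conjI allI impI)
  define es where "es = (SOME es. orthonormal_frame g es)"
  note hs = hodge_star_def[of g vol k \<beta>, folded es_def, unfolded Let_def]
  fix vs :: "'a list" and i assume vs: "length vs = l" and i: "i < l"
  have "linear (\<lambda>v. \<beta> (map ((!) es) I) * vol (map ((!) es) I @ vs[i := v]))"
    if "length I = k" for I
  proof -
    have "linear (\<lambda>v. vol ((map ((!) es) I @ vs)[length I + i := v]))"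
      by (rule alt_linear[OF assms(2)]) (use that vs i assms(1) in auto)
    from linear_compose_scale_right[OF this, of "\<beta> (map ((!) es) I)"] show ?thesis
      by (simp add: list_update_append)
  qed
  then have "linear (\<lambda>v. \<Sum>I\<in>{I. length I = k \<and> set I \<subseteq> {..<DIM('a)}}. \<beta> (map ((!) es) I) * vol (map ((!) es) I @ vs[i := v]))"
    by (intro linear_compose_sum) auto
  from linear_compose_scale_right[OF this, of "1 / fact k"]
  show "linear (\<lambda>v. hodge_star g vol k \<beta> (vs[i := v]))" by (simp add: hs)
next
  fix vs :: "'a list" and i j assume vs: "length vs = l" "i < j" "j < l" "vs ! i = vs ! j"
  have "vol (xs @ vs) = 0" if "length xs = k" for xs
    by (rule alt_eq_0_nth[OF assms(2), where i = "k + i" and j = "k + j"]) (use that vs assms(1) in \<open>auto simp: nth_append\<close>)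
  then show "hodge_star g vol k \<beta> vs = 0" by (simp add: hodge_star_def Let_def)
qed

text \<open>Only the rearrangements of the complement I0 of J survive in the sum, all with the same
  value. There are k! of them, which cancels the normalisation of \<open>hodge_star\<close>.\<close>

lemma hodge_star_on_basis:
  fixes es :: "'a::euclidean_space list"
  assumes g: "inner_product_form g" "orthonormal_frame g es" and be: "alternating k \<beta>" and vol: "alternating DIM('a) vol"
    and J: "distinct J" "set J \<subseteq> {..<DIM('a)}" "k + length J = DIM('a)"
    and I0: "distinct I0" "set I0 = {..<DIM('a)} - set J"
  shows "hodge_star g vol k \<beta> (map ((!) es) J) = \<beta> (map ((!) es) I0) * vol (map ((!) es) (I0 @ J))"
proof -
  let ?f = "\<lambda>I. \<beta> (map ((!) es) I) * vol (map ((!) es) I @ map ((!) es) J)"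
  have vol': "alternating (k + length (map ((!) es) J)) vol" using vol J(3) by simp
  have lenI0: "length I0 = k"
    using distinct_card[OF I0(1)] I0(2) J card_Diff_subset[of "set J" "{..<DIM('a)}"] distinct_card[OF J(1)] by simp
  have f: "?f I = (if distinct I \<and> set I = set I0 then ?f I0 else 0)" if I: "I \<in> index_lists DIM('a) k" for I
  proof (cases "distinct I \<and> set I = set I0")
    case True
    then have "mset I = mset I0" using I0(1) set_eq_iff_mset_eq_distinct by blast
    then show ?thesis using True I swap_sign_invariant[OF be vol', of I I0 "(!) es"] by (simp add: index_lists_def)
  next
    case False
    have "\<not> distinct (I @ J)"
    proof
      assume d: "distinct (I @ J)"
      have "set I = set I0"
        by (rule card_subset_eq) (use d I I0 lenI0 distinct_card[of I] distinct_card[of I0] in \<open>auto simp: index_lists_def\<close>)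
      then show False using False d by simp
    qed
    then have "\<not> distinct (map ((!) es) (I @ J))" by (simp only: distinct_map) simp
    then have "\<not> distinct (map ((!) es) I @ map ((!) es) J)" unfolding map_append .
    moreover have "length (map ((!) es) I @ map ((!) es) J) = k + length (map ((!) es) J)" using I by (simp add: index_lists_def)
    ultimately have "vol (map ((!) es) I @ map ((!) es) J) = 0" by (rule alt_eq_0[OF vol', rotated])
    then show ?thesis using False by (simp only: if_False mult_zero_right)
  qed
  have "(\<Sum>I\<in>index_lists DIM('a) k. ?f I) = (\<Sum>I\<in>index_lists DIM('a) k. if distinct I \<and> set I = set I0 then ?f I0 else 0)"
    by (rule sum.cong[OF refl f])
  also have "\<dots> = (\<Sum>I\<in>{I \<in> index_lists DIM('a) k. distinct I \<and> set I = set I0}. ?f I0)"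
    by (rule sum.inter_filter[symmetric, OF finite_index_lists])
  also have "{I \<in> index_lists DIM('a) k. distinct I \<and> set I = set I0} = permutations_of_set (set I0)"
  proof -
    have "length x = k" if "distinct x" "set x = set I0" for x
      using distinct_card[OF that(1)] distinct_card[OF I0(1)] that(2) lenI0 by simp
    moreover have "set I0 \<subseteq> {..<DIM('a)}" using I0(2) by blast
    ultimately show ?thesis by (auto simp: index_lists_def permutations_of_set_def)
  qed
  also have "(\<Sum>I\<in>permutations_of_set (set I0). ?f I0) = fact k * ?f I0"
    using distinct_card[OF I0(1)] lenI0 by (simp add: card_permutations_of_set)
  finally show ?thesis using hodge_star_frame[OF g be vol'] by simp
qed

subsection \<open>Wedge products by splits\<close>

text \<open>The shuffles: all ways of choosing k entries in order for the first factor, with their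
  signs. An entry that goes to the second factor has to pass the \<open>Suc k\<close> later entries
  still destined for the first one.\<close>

fun splits :: "nat \<Rightarrow> 'a list \<Rightarrow> ('a list \<times> 'a list \<times> int) list" where
  "splits 0 [] = [([], [], 1)]"
| "splits (Suc k) [] = []"
| "splits 0 (v # vs) = map (\<lambda>(xs, ys, s). (xs, v # ys, s)) (splits 0 vs)"
| "splits (Suc k) (v # vs) = map (\<lambda>(xs, ys, s). (v # xs, ys, s)) (splits k vs) @
     map (\<lambda>(xs, ys, s). (xs, v # ys, (-1) ^ Suc k * s)) (splits (Suc k) vs)"

lemma splits_too_short: "length vs < k \<Longrightarrow> splits k vs = []"
  by (induction k vs rule: splits.induct) auto

text \<open>The recursion of \<open>splits\<close> is the one in \<open>wedge_Cons\<close>. It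
  replaces the sum over all permutations of 7 arguments by one over at most 35 shuffles, which is
  small enough to evaluate.\<close>

lemma wedge_splits:
  fixes \<alpha> \<beta> :: "('e::real_vector, real) mform"
  assumes "alternating k \<alpha>" "alternating l \<beta>" "length vs = k + l"
  shows "wedge k \<alpha> \<beta> vs = (\<Sum>(xs, ys, s)\<leftarrow>splits k vs. of_int s * \<alpha> xs * \<beta> ys)"
  using assms
proof (induction k vs arbitrary: \<alpha> \<beta> l rule: splits.induct)
  case 1 then show ?case by (simp add: wedge_Nil)
next
  case (2 k) then show ?case by simp
next
  case (3 v vs)
  obtain l' where l: "l = Suc l'" "length vs = 0 + l'" using 3 by auto
  have "wedge 0 \<alpha> \<beta> (v # vs) = wedge 0 \<alpha> (interior_product v \<beta>) vs"
    using wedge_Cons[OF 3(2,3)] 3(4) l by simp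
  also have "\<dots> = (\<Sum>(xs, ys, s)\<leftarrow>splits 0 vs. of_int s * \<alpha> xs * interior_product v \<beta> ys)"
    by (rule 3(1)[OF 3(2) alt_ip l(2)]) (use 3(3) l in simp)
  finally show ?case by (simp add: interior_product_def o_def case_prod_unfold)
next
  case (4 k v vs)
  have A: "wedge k (interior_product v \<alpha>) \<beta> vs = (\<Sum>(xs, ys, s)\<leftarrow>splits k vs. of_int s * \<alpha> (v # xs) * \<beta> ys)"
    using 4(1)[OF alt_ip[OF 4(3)] 4(4), of v] 4(5) by (simp add: interior_product_def)
  have B: "(if l = 0 then 0 else (-1) ^ Suc k * wedge (Suc k) \<alpha> (interior_product v \<beta>) vs) =
      (\<Sum>(xs, ys, s)\<leftarrow>splits (Suc k) vs. of_int ((-1) ^ Suc k * s) * \<alpha> xs * \<beta> (v # ys))"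
  proof (cases l)
    case 0 then show ?thesis using 4(5) by (simp add: splits_too_short)
  next
    case (Suc l')
    then have "wedge (Suc k) \<alpha> (interior_product v \<beta>) vs = (\<Sum>(xs, ys, s)\<leftarrow>splits (Suc k) vs. of_int s * \<alpha> xs * \<beta> (v # ys))"
      using 4(2)[OF 4(3) alt_ip, of l' \<beta> v] 4(4,5) by (simp add: interior_product_def)
    then show ?thesis using Suc by (simp add: sum_list_const_mult[symmetric] case_prod_unfold mult.assoc)
  qed
  show ?case
    using wedge_Cons[OF 4(3,4), of vs v] 4(5) unfolding B A[symmetric]
    by (simp add: o_def case_prod_unfold A)
qed

lemma splits_map: "splits k (map f I) = map (\<lambda>(xs, ys, s). (map f xs, map f ys, s)) (splits k I)"
  by (induction k I rule: splits.induct) (auto simp: case_prod_unfold)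

subsection \<open>The standard 3-form\<close>

definition phi_coeff_sorted :: "nat list \<Rightarrow> int" where
  "phi_coeff_sorted I = (if I \<in> {[1,2,3], [2,4,6]} then 1
     else if I \<in> {[1,5,6], [3,4,5], [0,1,4], [0,2,5], [0,3,6]} then - 1 else 0)"

definition phi_coeff :: "nat list \<Rightarrow> int" where
  "phi_coeff I = list_sign I * phi_coeff_sorted (sort I)"

text \<open>
  The coefficients are those of $\mathrm{Re}(\zeta^1\wedge\zeta^2\wedge\zeta^3)
  -e^0\wedge\sum_j e^j\wedge e^{j+3}$ with $\zeta^j=e^j+i\,e^{j+3}$.
\<close>

definition standard_frame :: "(nat \<Rightarrow> 'a::euclidean_space) \<Rightarrow> ('a, real) mform \<Rightarrow> bool" where
  "standard_frame e P \<longleftrightarrow> alternating 3 P \<and>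
     (\<forall>I\<in>set (filter (\<lambda>I. length I = 3) (subseqs [0..<7])). P (map e I) = of_int (phi_coeff_sorted I))"

lemma phi_coeff_eq:
  assumes "standard_frame e P" "length I = 3" "set I \<subseteq> {..<7}"
  shows "P (map e I) = of_int (phi_coeff I)"
proof -
  have al: "alternating 3 P" using assms by (simp add: standard_frame_def)
  show ?thesis
  proof (cases "distinct I")
    case True
    have "P (map e (sort I)) = of_int (phi_coeff_sorted (sort I))"
      using assms sort_in_subseqs[OF True assms(3)] by (simp add: standard_frame_def)
    then show ?thesis by (simp only: alt_sort[OF al assms(2), of e] phi_coeff_def of_int_mult real_scaleR_def)
  next
    case False
    then have "\<not> distinct (map e I)" by (simp add: distinct_map)
    then have "P (map e I) = 0" using alt_eq_0[OF al] assms(2) by simp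
    moreover have "phi_coeff_sorted (sort I) = 0"
    proof (rule ccontr)
      assume "phi_coeff_sorted (sort I) \<noteq> 0"
      then have "sort I \<in> {[1,2,3], [2,4,6], [1,5,6], [3,4,5], [0,1,4], [0,2,5], [0,3,6]}"
        by (auto simp: phi_coeff_sorted_def split: if_splits)
      then have "distinct (sort I)" by (elim insertE emptyE) simp_all
      then show False using False by (simp only: distinct_sort)
    qed
    ultimately show ?thesis by (simp add: phi_coeff_def)
  qed
qed

lemma splits_props:
  "(xs, ys, s) \<in> set (splits k vs) \<Longrightarrow> length xs = k \<and> length xs + length ys = length vs \<and> set xs \<subseteq> set vs \<and> set ys \<subseteq> set vs"
  by (induction k vs arbitrary: xs ys s rule: splits.induct) fastforce+

text \<open>The value of \<iota>_a \<phi> \<and> \<iota>_b \<phi> \<and> \<phi> on the frame, in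
  integers and ready for evaluation. Testing the coefficient of the last factor first discards most
  of the shuffles.\<close>

definition g2_bilinear_coeff :: "nat \<Rightarrow> nat \<Rightarrow> int" where
  "g2_bilinear_coeff a b = (\<Sum>(xs, ys, s)\<leftarrow>splits 4 [0..<7]. if phi_coeff ys = 0 then 0 else
     (\<Sum>(xs', ys', s')\<leftarrow>splits 2 xs. s * s' * phi_coeff (a # xs') * phi_coeff (b # ys') * phi_coeff ys))"

text \<open>All 49 values are evaluated. Together with the factor - 1/6 in
  \<open>induces_metric_volume\<close>, the value 6 makes the frame orthonormal and gives it the
  volume - 1.\<close>

lemma g2_bilinear_coeff_eq:
  assumes "a < 7" "b < 7" shows "g2_bilinear_coeff a b = (if a = b then 6 else 0)"
proof -
  have "\<forall>a\<in>set [0..<7]. \<forall>b\<in>set [0..<7]. g2_bilinear_coeff a b = (if a = b then 6 else 0)"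
    by code_simp
  then show ?thesis using assms by simp
qed

lemma sum_list_sum_swap: "(\<Sum>x\<leftarrow>xs. \<Sum>a\<in>A. f a x) = (\<Sum>a\<in>A. \<Sum>x\<leftarrow>xs. f a x)"
  by (induction xs) (auto simp: sum.distrib)

lemma of_int_sum_list': "of_int (\<Sum>x\<leftarrow>xs. f x) = (\<Sum>x\<leftarrow>xs. of_int (f x))"
  by (induction xs) auto

lemma g2_bilinear_form:
  fixes e :: "nat \<Rightarrow> 'a::euclidean_space"
  assumes P: "standard_frame e P" and c: "dual_basis e c" and dim: "DIM('a) = 7"
  shows "wedge 4 (wedge 2 (interior_product Y P) (interior_product Z P)) P (map e [0..<7]) = 6 * (\<Sum>a<7. c a Y * c a Z)"
proof -
  have al: "alternating 3 P" using P by (simp add: standard_frame_def)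
  have ip: "alternating 2 (interior_product v P)" for v using alt_ip[of 2 P v] al by simp
  have ipc: "interior_product v P (map e I) = (\<Sum>a<7. c a v * of_int (phi_coeff (a # I)))"
    if "length I = 2" "set I \<subseteq> {..<7}" for v I
  proof -
    have "interior_product v P (map e I) = (\<Sum>a<7. c a v *\<^sub>R P (e a # map e I))"
      unfolding interior_product_def using alt_expand_hd[OF c, of 2 P "map e I" v] al that dim by simp
    also have "\<dots> = (\<Sum>a<7. c a v * of_int (phi_coeff (a # I)))"
      by (rule sum.cong) (use phi_coeff_eq[OF P, of "_ # I"] that in auto)
    finally show ?thesis .
  qed
  define A where "A = interior_product Y P"
  define C where "C = interior_product Z P"
  have "wedge 4 (wedge 2 A C) P (map e [0..<7]) =
     (\<Sum>(xs, ys, s)\<leftarrow>splits 4 (map e [0..<7]). of_int s * wedge 2 A C xs * P ys)"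
    by (rule wedge_splits[where l = 3]) (use al ip alternating_wedge[of 2 A 2 C] in \<open>auto simp: A_def C_def\<close>)
  also have "\<dots> = (\<Sum>(xs, ys, s)\<leftarrow>splits 4 [0..<7]. of_int s * wedge 2 A C (map e xs) * P (map e ys))"
    by (simp only: splits_map map_map o_def case_prod_unfold fst_conv snd_conv)
  also have "\<dots> = (\<Sum>(xs, ys, s)\<leftarrow>splits 4 [0..<7]. \<Sum>a<7. \<Sum>b<7. c a Y * c b Z *
     of_int (if phi_coeff ys = 0 then 0 else
      \<Sum>(xs', ys', s')\<leftarrow>splits 2 xs. s * s' * phi_coeff (a # xs') * phi_coeff (b # ys') * phi_coeff ys))"
  proof (rule arg_cong[where f = sum_list], rule map_cong[OF refl], clarify)
    fix xs ys s assume m: "(xs, ys, s) \<in> set (splits 4 [0..<7])"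
    from splits_props[OF m] have xs: "length xs = 4" "length ys = 3" "set xs \<subseteq> {..<7}" "set ys \<subseteq> {..<7}"
      by (auto simp: atLeast0LessThan)
    have W: "wedge 2 A C (map e xs) = (\<Sum>(xs', ys', s')\<leftarrow>splits 2 xs. of_int s' * A (map e xs') * C (map e ys'))"
    proof -
      have "wedge 2 A C (map e xs) = (\<Sum>(xs', ys', s')\<leftarrow>splits 2 (map e xs). of_int s' * A xs' * C ys')"
        by (rule wedge_splits[where l = 2]) (use ip xs in \<open>auto simp: A_def C_def\<close>)
      then show ?thesis by (simp only: splits_map map_map o_def case_prod_unfold fst_conv snd_conv)
    qed
    also have "\<dots> = (\<Sum>(xs', ys', s')\<leftarrow>splits 2 xs. \<Sum>a<7. \<Sum>b<7. of_int s' * (c a Y * of_int (phi_coeff (a # xs'))) * (c b Z * of_int (phi_coeff (b # ys'))))"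
    proof (rule arg_cong[where f = sum_list], rule map_cong[OF refl], clarify)
      fix xs' ys' s' assume "(xs', ys', s') \<in> set (splits 2 xs)"
      from splits_props[OF this] xs have "length xs' = 2" "length ys' = 2" "set xs' \<subseteq> {..<7}" "set ys' \<subseteq> {..<7}" by auto
      then show "of_int s' * A (map e xs') * C (map e ys') =
         (\<Sum>a<7. \<Sum>b<7. of_int s' * (c a Y * of_int (phi_coeff (a # xs'))) * (c b Z * of_int (phi_coeff (b # ys'))))"
        by (simp only: A_def C_def ipc mult.assoc[of "of_int s'"], simp only: sum_product, simp only: sum_distrib_left)
    qed
    finally have W': "wedge 2 A C (map e xs) = \<dots>" .
    show "of_int s * wedge 2 A C (map e xs) * P (map e ys) = (\<Sum>a<7. \<Sum>b<7. c a Y * c b Z *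
     of_int (if phi_coeff ys = 0 then 0 else
      \<Sum>(xs', ys', s')\<leftarrow>splits 2 xs. s * s' * phi_coeff (a # xs') * phi_coeff (b # ys') * phi_coeff ys))"
    proof (cases "phi_coeff ys = 0")
      case True
      then show ?thesis using phi_coeff_eq[OF P xs(2,4)] by simp
    next
      case False
      show ?thesis unfolding W' phi_coeff_eq[OF P xs(2,4)] case_prod_unfold sum_list_sum_swap
        using False
        by (simp add: of_int_sum_list' sum_distrib_left sum_distrib_right sum_list_const_mult[symmetric] sum_list_mult_const[symmetric] mult_ac)
    qed
  qed
  also have "\<dots> = (\<Sum>a<7. \<Sum>b<7. c a Y * c b Z * of_int (g2_bilinear_coeff a b))"
    unfolding g2_bilinear_coeff_def of_int_sum_list' case_prod_unfold sum_list_sum_swap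
    by (simp add: sum_list_const_mult)
  also have "\<dots> = (\<Sum>a<7. \<Sum>b<7. if b = a then 6 * (c a Y * c a Z) else 0)"
    by (intro sum.cong refl) (auto simp: g2_bilinear_coeff_eq)
  also have "\<dots> = 6 * (\<Sum>a<7. c a Y * c a Z)"
  proof -
    have "(\<Sum>b<7. if b = a then 6 * (c a Y * c a Z) else 0) = 6 * (c a Y * c a Z)" if "a < 7" for a
      using that by (subst sum.delta) auto
    then have "(\<Sum>a<7. \<Sum>b<7. if b = a then 6 * (c a Y * c a Z) else 0) = (\<Sum>a<7. 6 * (c a Y * c a Z))"
      by (intro sum.cong refl) simp
    then show ?thesis by (simp only: sum_distrib_left)
  qed
  finally show ?thesis by (simp add: A_def C_def)
qed

lemma sorted_top: "filter (\<lambda>I. length I = 7) (subseqs [0..<7]) = [[0..<7]]"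
  by code_simp

lemma alt_top_eq:
  fixes e :: "nat \<Rightarrow> 'a::euclidean_space"
  assumes "DIM('a) = 7" "dual_basis e c" "alternating 7 \<alpha>" "alternating 7 \<beta>" "\<alpha> (map e [0..<7]) = \<beta> (map e [0..<7])" "length vs = 7"
  shows "\<alpha> vs = \<beta> vs"
proof (rule alt_eq_on_sorted[OF assms(2-4) _ assms(6)])
  fix I assume "I \<in> set (filter (\<lambda>I. length I = 7) (subseqs [0..<DIM('a)]))"
  then have "I \<in> set [[0..<7]]" unfolding assms(1) sorted_top .
  then have "I = [0..<7]" by (simp only: set_simps insert_iff empty_iff simp_thms)
  then show "\<alpha> (map e I) = \<beta> (map e I)" using assms(5) by (simp only:)
qed

text \<open>\<open>g2_metric\<close> and \<open>g2_volume\<close> are choice terms, so a solution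
  must be exhibited and shown to be determined on the frame. The metric with e orthonormal is a
  solution. Any other solution has a positive multiple of it as its metric, and the unit volume of a
  rescaled frame fixes the multiple.\<close>

lemma g2_standard:
  fixes e :: "nat \<Rightarrow> 'a::euclidean_space"
  assumes P: "standard_frame e P" and c: "dual_basis e c" and dim: "DIM('a) = 7"
  shows "positive_3form P" and "inner_product_form (g2_metric P)"
    and "orthonormal_frame (g2_metric P) (map e [0..<7])"
    and "alternating 7 (g2_volume P)" and "g2_volume P (map e [0..<7]) = - 1"
proof -
  define es where "es = map e [0..<7]"
  define g where "g Y Z = (\<Sum>a<7. c a Y * c a Z)" for Y Z
  define W where "W Y Z = wedge 4 (wedge 2 (interior_product Y P) (interior_product Z P)) P" for Y Z
  \<comment> \<open>Forced by the defining equation with Y = Z = \<open>e 0\<close>, where the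
    metric is to have the value 1.\<close>
  define vol where "vol vs = - (1/6) * W (e 0) (e 0) vs" for vs
  have al: "alternating 3 P" using P by (simp add: standard_frame_def)
  have ip: "alternating 2 (interior_product v P)" for v using alt_ip[of 2 P v] al by simp
  have W7: "alternating 7 (W Y Z)" for Y Z
    using alternating_wedge[OF alternating_wedge[OF ip[of Y] ip[of Z]] al] by (simp add: W_def)
  have We: "W Y Z es = 6 * g Y Z" for Y Z
    unfolding W_def es_def g_def by (rule g2_bilinear_form[OF P c dim])
  have lin: "linear (c i)" if "i < 7" for i using c that dim by (simp add: dual_basis_def)
  have ce: "c i (e j) = (if i = j then 1 else 0)" if "i < 7" "j < 7" for i j
    using c that dim by (simp add: dual_basis_def)
  have ge: "g (e i) (e j) = (if i = j then 1 else 0)" if "i < 7" "j < 7" for i j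
  proof -
    have "g (e i) (e j) = (\<Sum>a<7. if a = i then (if i = j then 1 else 0) else 0)"
      unfolding g_def by (rule sum.cong) (use ce that in auto)
    then show ?thesis using that by simp
  qed
  have gin: "inner_product_form g"
    unfolding inner_product_form_def bilinear_def
  proof (intro conjI allI impI)
    show "linear (g v)" for v unfolding g_def
      by (intro linear_compose_sum ballI) (use lin in \<open>auto simp: linear_iff algebra_simps\<close>)
    show "linear (\<lambda>v. g v w)" for w unfolding g_def
      by (intro linear_compose_sum ballI) (use lin in \<open>auto simp: linear_iff algebra_simps\<close>)
    show "g v w = g w v" for v w by (simp add: g_def mult.commute)
    fix v :: 'a assume v: "v \<noteq> 0"
    have "\<exists>a<7. c a v \<noteq> 0"
    proof (rule ccontr)
      assume "\<not> (\<exists>a<7. c a v \<noteq> 0)"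
      then have "(\<Sum>i<DIM('a). c i v *\<^sub>R e i) = 0" using dim by (intro sum.neutral) auto
      with dual_basis_expand[OF c, of v] v show False by simp
    qed
    then obtain a where "a < 7" "c a v \<noteq> 0" by blast
    then show "g v v > 0" unfolding g_def by (intro sum_pos2[where i = a]) (auto simp: zero_less_mult_iff linorder_neq_iff)
  qed
  have on: "orthonormal_frame g es" using ge dim by (simp add: orthonormal_frame_def es_def)
  have vol7: "alternating 7 vol" unfolding vol_def
    using alt_bl[OF W7[of "e 0" "e 0"], of "\<lambda>x. - (1/6) * x"] by (simp add: linear_iff algebra_simps)
  have vole: "vol es = - 1" using ge[of 0 0] by (simp add: vol_def We)
  have ind: "induces_metric_volume P g vol"
    unfolding induces_metric_volume_def
  proof (intro conjI allI impI gin)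
    show "volume_form_of g vol" unfolding volume_form_of_def
    proof (intro conjI allI impI)
      show "alternating DIM('a) vol" using vol7 dim by simp
      fix fs assume "orthonormal_frame g fs"
      then have "(vol es)\<^sup>2 = (vol fs)\<^sup>2" by (intro top_form_frames[OF gin on]) (use vol7 dim in auto)
      then show "\<bar>vol fs\<bar> = 1" using vole by (auto simp: power2_eq_1_iff)
    qed
    fix Y Z :: 'a and vs :: "'a list" assume "length vs = 7"
    have "- (1/6) * W Y Z vs = g Y Z * vol vs"
      by (rule alt_top_eq[OF dim c _ _ _ \<open>length vs = 7\<close>, where \<alpha> = "\<lambda>vs. - (1/6) * W Y Z vs" and \<beta> = "\<lambda>vs. g Y Z * vol vs"])
        (use alt_bl[OF W7[of Y Z], of "\<lambda>x. - (1/6) * x"] alt_bl[OF vol7, of "\<lambda>x. g Y Z * x"] vole We es_def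
          in \<open>auto simp: linear_iff algebra_simps\<close>)
    then show "- (1/6) * wedge 4 (wedge 2 (interior_product Y P) (interior_product Z P)) P vs = g Y Z * vol vs"
      by (simp add: W_def)
  qed
  have uniq: "g' = g \<and> vol' es = - 1" if ind': "induces_metric_volume P g' vol'" for g' vol'
  proof -
    have g': "inner_product_form g'" "volume_form_of g' vol'" using ind' by (auto simp: induces_metric_volume_def)
    define k where "k = vol' es"
    have eq: "- g Y Z = g' Y Z * k" for Y Z
    proof -
      have "- (1/6) * W Y Z es = g' Y Z * vol' es"
        using ind' by (simp add: induces_metric_volume_def W_def es_def)
      then show ?thesis by (simp add: We k_def)
    qed
    have "linear (g 0)" using gin by (simp add: inner_product_form_def bilinear_def)
    from linear_0[OF this] ge[of 0 0] have e0: "e 0 \<noteq> 0" by auto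
    have kn: "k < 0"
    proof -
      have "- 1 = g' (e 0) (e 0) * k" using eq[of "e 0" "e 0"] ge[of 0 0] by simp
      moreover have "g' (e 0) (e 0) > 0" using g'(1) e0 by (simp add: inner_product_form_def)
      ultimately show ?thesis by (smt (verit) mult_nonneg_nonneg)
    qed
    \<comment> \<open>The metric \<open>g'\<close> is g divided by - k, so stretching the frame by s
      makes it orthonormal for \<open>g'\<close>.\<close>
    define s where "s = sqrt (- k)"
    have s: "s > 0" "s * s = - k" using kn by (auto simp: s_def)
    have g'e: "g' Y Z = g Y Z / (- k)" for Y Z using eq[of Y Z] kn by (simp add: field_simps)
    have g'bl: "g' (s *\<^sub>R v) (s *\<^sub>R w) = s * s * g' v w" for v w
      using g'(1) by (simp add: inner_product_form_def bilinear_def linear_scale)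
    have "orthonormal_frame g' (map ((*\<^sub>R) s) es)"
    proof -
      have "g' (s *\<^sub>R e i) (s *\<^sub>R e j) = (if i = j then 1 else 0)" if "i < 7" "j < 7" for i j
        using g'bl[of "e i" "e j"] g'e[of "e i" "e j"] ge[OF that] s kn by auto
      then show ?thesis using dim by (simp add: orthonormal_frame_def es_def)
    qed
    then have 1: "\<bar>vol' (map ((*\<^sub>R) s) es)\<bar> = 1" using g'(2) by (simp add: volume_form_of_def)
    have al': "alternating 7 vol'" using g'(2) dim by (simp add: volume_form_of_def)
    have sc: "vol' (map ((*\<^sub>R) s) xs @ ys) = s ^ length xs * vol' (xs @ ys)" if "length xs + length ys = 7" for xs ys
      using that
    proof (induction xs arbitrary: ys rule: rev_induct)
      case (snoc x xs)
      have l: "linear (\<lambda>v. vol' (xs @ v # ys))" by (rule alt_linear_mid[OF al']) (use snoc.prems in auto)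
      show ?case using snoc.IH[of "s *\<^sub>R x # ys"] snoc.prems linear_scale[OF l, of s x] by simp
    qed simp
    \<comment> \<open>Seven factors s come from the arguments of \<open>vol'\<close> and two from k
      = - s s, so s = 1.\<close>
    have "s ^ 7 * (s * s) = 1"
      using 1 sc[of es "[]"] kn s by (simp add: es_def abs_mult k_def)
    then have "s ^ 9 = 1 ^ 9" by (simp add: numeral_eq_Suc)
    then have "s = 1" using s(1) power_eq_iff_eq_base[of 9 s 1] by simp
    then have "k = - 1" using s(2) by simp
    then show ?thesis using g'e k_def by (auto simp: fun_eq_iff)
  qed
  have gm: "g2_metric P = g"
  proof -
    have "\<exists>vol. induces_metric_volume P (g2_metric P) vol"
      unfolding g2_metric_def by (rule someI[where P = "\<lambda>g. \<exists>vol. induces_metric_volume P g vol"]) (use ind in blast)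
    then show ?thesis using uniq by blast
  qed
  have gv: "induces_metric_volume P g (g2_volume P)"
    unfolding g2_volume_def gm by (rule someI[where P = "induces_metric_volume P g"]) (rule ind)
  show "inner_product_form (g2_metric P)" using gin by (simp add: gm)
  show "orthonormal_frame (g2_metric P) (map e [0..<7])" using on by (simp add: gm es_def)
  show "alternating 7 (g2_volume P)" using gv dim by (simp add: induces_metric_volume_def volume_form_of_def)
  show "g2_volume P (map e [0..<7]) = - 1" using uniq[OF gv] by (simp add: es_def)
  show "positive_3form P" unfolding positive_3form_def
  proof (intro conjI allI impI dim al)
    fix Y :: 'a assume "Y \<noteq> 0"
    then have "g Y Y > 0" using gin by (simp add: inner_product_form_def)
    then have "W Y Y es \<noteq> 0" by (simp add: We)
    then show "\<exists>vs. length vs = 7 \<and> wedge 4 (wedge 2 (interior_product Y P) (interior_product Y P)) P vs \<noteq> 0"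
      unfolding W_def es_def by (intro exI[of _ "map e [0..<7]"]) simp
  qed
qed

text \<open>The leading minus sign is the volume - 1 of the frame; \<open>list_sign\<close> sorts
  the complement of J followed by J.\<close>

lemma g2_star:
  fixes e :: "nat \<Rightarrow> 'a::euclidean_space"
  assumes P: "standard_frame e P" and c: "dual_basis e c" and dim: "DIM('a) = 7" and be: "alternating k \<beta>"
    and J: "J \<in> set (subseqs [0..<7])" "k + length J = 7"
  defines "I0 \<equiv> filter (\<lambda>i. i \<notin> set J) [0..<7]"
  shows "hodge_star (g2_metric P) (g2_volume P) k \<beta> (map e J) = - of_int (list_sign (I0 @ J)) * \<beta> (map e I0)"
proof -
  note std = g2_standard[OF P c dim]
  define es where "es = map e [0..<7]"
  have sJ: "set J \<subseteq> {..<7}" using J(1) subseqs_powset[of "[0..<7]"] by (auto simp: atLeast0LessThan)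
  have dJ: "distinct J" using J(1) subseqs_distinctD[of J "[0..<7]"] by (simp only: distinct_upt)
  have sI: "set I0 = {..<7} - set J" by (auto simp: I0_def)
  have dI: "distinct I0" unfolding I0_def by (intro distinct_filter distinct_upt)
  have m: "map ((!) es) I = map e I" if "set I \<subseteq> {..<7}" for I using that by (auto simp: es_def nth_map)
  have "hodge_star (g2_metric P) (g2_volume P) k \<beta> (map ((!) es) J) = \<beta> (map ((!) es) I0) * g2_volume P (map ((!) es) (I0 @ J))"
    by (rule hodge_star_on_basis[OF std(2) _ be]) (use std dim J dJ sJ sI dI in \<open>simp_all add: es_def\<close>)
  moreover have "g2_volume P (map e (I0 @ J)) = of_int (list_sign (I0 @ J)) *\<^sub>R g2_volume P (map e (sort (I0 @ J)))"
  proof (rule alt_sort[OF std(4)])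
    have "length (I0 @ J) = card (set (I0 @ J))" using dI dJ sI by (intro distinct_card[symmetric]) auto
    also have "set (I0 @ J) = {..<7}" using sI sJ by auto
    finally show "length (I0 @ J) = 7" by simp
  qed
  moreover have "sort (I0 @ J) = [0..<7]"
  proof (rule sorted_distinct_set_unique)
    show "distinct (sort (I0 @ J))" unfolding distinct_sort using dI dJ sI by auto
    show "set (sort (I0 @ J)) = set [0..<7]" unfolding set_sort set_append sI set_upt atLeast0LessThan using sJ by blast
  qed (rule sorted_sort sorted_upt distinct_upt)+
  ultimately show ?thesis using std(5) m[of J] m[of I0] m[of "I0 @ J"] sJ sI by simp
qed

subsection \<open>The codifferential of the reduced 3-form\<close>

abbreviation covector_form :: "('a \<Rightarrow> real) \<Rightarrow> ('a, real) mform" where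
  "covector_form r \<equiv> \<lambda>vs. r (vs ! 0)"

lemma alternating_covector: "linear r \<Longrightarrow> alternating 1 (covector_form r)"
  unfolding alternating_def
proof (intro conjI allI impI)
  fix vs :: "'a list" and i :: nat assume "linear r" "length vs = 1" "i < 1"
  then show "linear (\<lambda>v. r (vs[i := v] ! 0))" by (cases vs) auto
qed auto

lemma wedge_1_2:
  fixes \<alpha> \<beta> :: "('e::real_vector, real) mform"
  assumes "alternating 1 \<alpha>" "alternating 2 \<beta>"
  shows "wedge 1 \<alpha> \<beta> [u, v, w] = \<alpha> [u] * \<beta> [v, w] - \<alpha> [v] * \<beta> [u, w] + \<alpha> [w] * \<beta> [u, v]"
  using wedge_splits[OF assms, of "[u, v, w]"] by (simp add: numeral_eq_Suc)

lemma wedge_1_1: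
  fixes \<alpha> \<beta> :: "('e::real_vector, real) mform"
  assumes "alternating 1 \<alpha>" "alternating 1 \<beta>"
  shows "wedge 1 \<alpha> \<beta> [u, v] = \<alpha> [u] * \<beta> [v] - \<alpha> [v] * \<beta> [u]"
  using wedge_splits[OF assms, of "[u, v]"] by (simp add: numeral_eq_Suc)

lemma wedge_1_3:
  fixes \<alpha> \<beta> :: "('e::real_vector, real) mform"
  assumes "alternating 1 \<alpha>" "alternating 3 \<beta>"
  shows "wedge 1 \<alpha> \<beta> [a, b, c, d] = \<alpha> [a] * \<beta> [b, c, d] - \<alpha> [b] * \<beta> [a, c, d] + \<alpha> [c] * \<beta> [a, b, d] - \<alpha> [d] * \<beta> [a, b, c]"
  using wedge_splits[OF assms, of "[a, b, c, d]"] by (simp add: numeral_eq_Suc)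

lemma wedge_1_4:
  fixes \<alpha> \<beta> :: "('e::real_vector, real) mform"
  assumes "alternating 1 \<alpha>" "alternating 4 \<beta>"
  shows "wedge 1 \<alpha> \<beta> [a, b, c, d, f] = \<alpha> [a] * \<beta> [b, c, d, f] - \<alpha> [b] * \<beta> [a, c, d, f] + \<alpha> [c] * \<beta> [a, b, d, f]
     - \<alpha> [d] * \<beta> [a, b, c, f] + \<alpha> [f] * \<beta> [a, b, c, d]"
  using wedge_splits[OF assms, of "[a, b, c, d, f]"] by (simp add: numeral_eq_Suc)

lemma wedge_square:
  fixes \<alpha> :: "('e::real_vector, real) mform"
  assumes "alternating 2 \<alpha>"
  shows "wedge 2 \<alpha> \<alpha> [a, b, c, d] = 2 * (\<alpha> [a, b] * \<alpha> [c, d] - \<alpha> [a, c] * \<alpha> [b, d] + \<alpha> [a, d] * \<alpha> [b, c])"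
  using wedge_splits[OF assms assms, of "[a, b, c, d]"] by (simp add: numeral_eq_Suc)

text \<open>Components of \<Sum>_j e^j \<and> e^(j+3) with j = 1, 2, 3.\<close>

definition kaehler_coeff :: "nat \<Rightarrow> nat \<Rightarrow> real" where
  "kaehler_coeff i j = (if 0 < i \<and> j = i + 3 then 1 else if 0 < j \<and> i = j + 3 then - 1 else 0)"

text \<open>Components of \<zeta>^1 \<and> \<zeta>^2 \<and> \<zeta>^3 with \<zeta>^j = e^j + i
  e^(j+3), on increasing index lists.\<close>

definition volume_coeff :: "nat list \<Rightarrow> complex" where
  "volume_coeff I = (if I \<in> {[1,2,3], [2,4,6]} then 1 else if I \<in> {[1,5,6], [3,4,5]} then - 1
     else if I \<in> {[1,2,6], [2,3,4]} then \<i> else if I \<in> {[1,3,5], [4,5,6]} then - \<i> else 0)"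

lemma increasing_3: "filter (\<lambda>I. length I = 3) (subseqs [0..<7]) =
  [[0,1,2],[0,1,3],[0,1,4],[0,1,5],[0,1,6],[0,2,3],[0,2,4],[0,2,5],[0,2,6],[0,3,4],[0,3,5],[0,3,6],
   [0,4,5],[0,4,6],[0,5,6],[1,2,3],[1,2,4],[1,2,5],[1,2,6],[1,3,4],[1,3,5],[1,3,6],[1,4,5],[1,4,6],
   [1,5,6],[2,3,4],[2,3,5],[2,3,6],[2,4,5],[2,4,6],[2,5,6],[3,4,5],[3,4,6],[3,5,6],[4,5,6]]"
  by code_simp

text \<open>Every increasing J with its complement and the sign that \<open>g2_star\<close> attaches
  to the pair.\<close>

definition complements :: "nat \<Rightarrow> (nat list \<times> nat list \<times> int) list" where
  "complements k = map (\<lambda>J. (J, filter (\<lambda>i. i \<notin> set J) [0..<7], list_sign (filter (\<lambda>i. i \<notin> set J) [0..<7] @ J)))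
    (filter (\<lambda>I. length I = k) (subseqs [0..<7]))"

lemma complements_4: "complements 4 =
  [([0, 1, 2, 3], [4, 5, 6], 1), ([0, 1, 2, 4], [3, 5, 6], - 1), ([0, 1, 2, 5], [3, 4, 6], 1), ([0, 1, 2, 6], [3, 4, 5], - 1),
   ([0, 1, 3, 4], [2, 5, 6], 1), ([0, 1, 3, 5], [2, 4, 6], - 1), ([0, 1, 3, 6], [2, 4, 5], 1), ([0, 1, 4, 5], [2, 3, 6], 1),
   ([0, 1, 4, 6], [2, 3, 5], - 1), ([0, 1, 5, 6], [2, 3, 4], 1), ([0, 2, 3, 4], [1, 5, 6], - 1), ([0, 2, 3, 5], [1, 4, 6], 1),
   ([0, 2, 3, 6], [1, 4, 5], - 1), ([0, 2, 4, 5], [1, 3, 6], - 1), ([0, 2, 4, 6], [1, 3, 5], 1), ([0, 2, 5, 6], [1, 3, 4], - 1),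
   ([0, 3, 4, 5], [1, 2, 6], 1), ([0, 3, 4, 6], [1, 2, 5], - 1), ([0, 3, 5, 6], [1, 2, 4], 1), ([0, 4, 5, 6], [1, 2, 3], - 1),
   ([1, 2, 3, 4], [0, 5, 6], 1), ([1, 2, 3, 5], [0, 4, 6], - 1), ([1, 2, 3, 6], [0, 4, 5], 1), ([1, 2, 4, 5], [0, 3, 6], 1),
   ([1, 2, 4, 6], [0, 3, 5], - 1), ([1, 2, 5, 6], [0, 3, 4], 1), ([1, 3, 4, 5], [0, 2, 6], - 1), ([1, 3, 4, 6], [0, 2, 5], 1),
   ([1, 3, 5, 6], [0, 2, 4], - 1), ([1, 4, 5, 6], [0, 2, 3], 1), ([2, 3, 4, 5], [0, 1, 6], 1), ([2, 3, 4, 6], [0, 1, 5], - 1),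
   ([2, 3, 5, 6], [0, 1, 4], 1), ([2, 4, 5, 6], [0, 1, 3], - 1), ([3, 4, 5, 6], [0, 1, 2], 1)]"
  by code_simp

lemma complements_2: "complements 2 =
  [([0, 1], [2, 3, 4, 5, 6], 1), ([0, 2], [1, 3, 4, 5, 6], - 1), ([0, 3], [1, 2, 4, 5, 6], 1), ([0, 4], [1, 2, 3, 5, 6], - 1),
   ([0, 5], [1, 2, 3, 4, 6], 1), ([0, 6], [1, 2, 3, 4, 5], - 1), ([1, 2], [0, 3, 4, 5, 6], 1), ([1, 3], [0, 2, 4, 5, 6], - 1),
   ([1, 4], [0, 2, 3, 5, 6], 1), ([1, 5], [0, 2, 3, 4, 6], - 1), ([1, 6], [0, 2, 3, 4, 5], 1), ([2, 3], [0, 1, 4, 5, 6], 1),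
   ([2, 4], [0, 1, 3, 5, 6], - 1), ([2, 5], [0, 1, 3, 4, 6], 1), ([2, 6], [0, 1, 3, 4, 5], - 1), ([3, 4], [0, 1, 2, 5, 6], 1),
   ([3, 5], [0, 1, 2, 4, 6], - 1), ([3, 6], [0, 1, 2, 4, 5], 1), ([4, 5], [0, 1, 2, 3, 6], 1), ([4, 6], [0, 1, 2, 3, 5], - 1),
   ([5, 6], [0, 1, 2, 3, 4], 1)]"
  by code_simp

lemma hodge_star_cong:
  "(\<And>vs. length vs = k \<Longrightarrow> \<beta> vs = \<beta>' vs) \<Longrightarrow> hodge_star g vol k \<beta> ws = hodge_star g vol k \<beta>' ws"
  unfolding hodge_star_def Let_def by (intro arg_cong2[where f="(/)"] sum.cong) auto

text \<open>An identity for the Hodge star becomes a finite table of scalar equations, 35 of them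
  for l = 4 and 21 for l = 2.\<close>

lemma star_eq_by_complements:
  fixes e :: "nat \<Rightarrow> 'a::euclidean_space"
  assumes P: "standard_frame e P" and c: "dual_basis e c" and dim: "DIM('a) = 7" and be: "alternating k \<beta>"
    and kl: "k + l = 7" and ga: "alternating l \<gamma>" and "length vs = l"
    and eq: "\<forall>(J, I, s)\<in>set (complements l). - of_int s * \<beta> (map e I) = \<gamma> (map e J)"
  shows "hodge_star (g2_metric P) (g2_volume P) k \<beta> vs = \<gamma> vs"
proof (rule alt_eq_on_sorted[OF c _ ga _ \<open>length vs = l\<close>])
  show "alternating l (hodge_star (g2_metric P) (g2_volume P) k \<beta>)"
    by (rule alternating_hodge_star[OF kl g2_standard(4)[OF P c dim]])
  fix J assume J: "J \<in> set (filter (\<lambda>I. length I = l) (subseqs [0..<DIM('a)]))"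
  let ?I = "filter (\<lambda>i. i \<notin> set J) [0..<7]"
  have "(J, ?I, list_sign (?I @ J)) \<in> set (complements l)"
    using J unfolding complements_def dim set_map by (rule imageI)
  with eq have "- of_int (list_sign (?I @ J)) * \<beta> (map e ?I) = \<gamma> (map e J)" by fast
  moreover have "J \<in> set (subseqs [0..<7])" "k + length J = 7" using J kl unfolding dim set_filter by blast+
  ultimately show "hodge_star (g2_metric P) (g2_volume P) k \<beta> (map e J) = \<gamma> (map e J)"
    using g2_star[OF P c dim be] by simp
qed

text \<open>Normal form at a point: r = q e^0, a = (1/q) \<Sum>_j e^j \<and> e^(j+3) and b =
  \<zeta>^1 \<and> \<zeta>^2 \<and> \<zeta>^3. The powers of q cancel in Re b - r \<and> a, so the
  frame is standard for the 3-form while q may vary from point to point.\<close>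

definition reduced_frame :: "('a::euclidean_space \<Rightarrow> real) \<Rightarrow> ('a, real) mform \<Rightarrow> ('a, complex) mform \<Rightarrow> real \<Rightarrow> (nat \<Rightarrow> 'a) \<Rightarrow> bool" where
  "reduced_frame r a b q e \<longleftrightarrow> q > 0 \<and> r (e 0) = q \<and> (\<forall>i<7. 0 < i \<longrightarrow> r (e i) = 0) \<and>
     (\<forall>i<7. \<forall>j<7. a [e i, e j] = kaehler_coeff i j / q) \<and>
     (\<forall>I\<in>set (filter (\<lambda>I. length I = 3) (subseqs [0..<7])). b (map e I) = volume_coeff I)"

text \<open>The dual frame read off from r and a, for instance e^j = q a(., e_(j+3)) for j = 1, 2,
  3, so that no matrix has to be inverted.\<close>

definition reduced_coframe :: "('a::euclidean_space \<Rightarrow> real) \<Rightarrow> ('a, real) mform \<Rightarrow> real \<Rightarrow> (nat \<Rightarrow> 'a) \<Rightarrow> nat \<Rightarrow> 'a \<Rightarrow> real" where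
  "reduced_coframe r a q e i v = (if i = 0 then r v / q else if i \<le> 3 then q * a [v, e (i + 3)] else q * a [e (i - 3), v])"

lemma all_less_7: "(\<forall>i<7. P i) \<longleftrightarrow> P 0 \<and> P 1 \<and> P 2 \<and> P 3 \<and> P 4 \<and> P 5 \<and> P (6::nat)"
  by (simp add: numeral_eq_Suc All_less_Suc conj_ac)

lemma reduced_coframe_dual:
  fixes e :: "nat \<Rightarrow> 'a::euclidean_space"
  assumes f: "reduced_frame r a b q e" and r: "linear r" and a: "alternating 2 a" and dim: "DIM('a) = 7"
  shows "dual_basis e (reduced_coframe r a q e)"
  unfolding dual_basis_def dim
proof
  have q: "q > 0" and r0: "r (e 0) = q" and ri: "\<And>i. i < 7 \<Longrightarrow> 0 < i \<Longrightarrow> r (e i) = 0"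
    and aij: "\<And>i j. i < 7 \<Longrightarrow> j < 7 \<Longrightarrow> a [e i, e j] = kaehler_coeff i j / q"
    using f by (auto simp: reduced_frame_def)
  have l1: "linear (\<lambda>v. a [v, w])" for w using alt_linear_hd[OF a, of "[w]"] by simp
  have l2: "linear (\<lambda>v. a [w, v])" for w using alt_linear_mid[OF a, of "[w]" "[]"] by simp
  have "linear (reduced_coframe r a q e i)" for i
    using linear_compose_scale_right[OF r, of "1/q"] linear_compose_scale_right[OF l1[of "e (i+3)"], of q]
      linear_compose_scale_right[OF l2[of "e (i-3)"], of q]
    by (cases "i = 0"; cases "i \<le> 3") (simp_all add: reduced_coframe_def[abs_def])
  then show "\<forall>i<7. linear (reduced_coframe r a q e i)" by blast
  show "\<forall>i<7. \<forall>j<7. reduced_coframe r a q e i (e j) = (if i = j then 1 else 0)"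
    unfolding all_less_7 using q by (simp add: reduced_coframe_def r0 ri aij kaehler_coeff_def)
qed

lemma reduced_standard_frame:
  fixes e :: "nat \<Rightarrow> 'a::euclidean_space"
  assumes f: "reduced_frame r a b q e" and r: "linear r" and a: "alternating 2 a" and P: "alternating 3 P"
    and Pe: "\<And>vs. length vs = 3 \<Longrightarrow> P vs = Re (b vs) - wedge 1 (covector_form r) a vs"
  shows "standard_frame e P"
  unfolding standard_frame_def
proof (rule conjI[OF P])
  have q: "q > 0" and r0: "r (e 0) = q" and ri: "\<And>i. i < 7 \<Longrightarrow> 0 < i \<Longrightarrow> r (e i) = 0"
    and aij: "\<And>i j. i < 7 \<Longrightarrow> j < 7 \<Longrightarrow> a [e i, e j] = kaehler_coeff i j / q"
    and b: "\<forall>I\<in>set (filter (\<lambda>I. length I = 3) (subseqs [0..<7])). b (map e I) = volume_coeff I"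
    using f by (auto simp: reduced_frame_def)
  have P3: "P [u, v, w] = Re (b [u, v, w]) - (r u * a [v, w] - r v * a [u, w] + r w * a [u, v])" for u v w
    using Pe[of "[u, v, w]"] wedge_1_2[OF alternating_covector[OF r] a, of u v w] by simp
  show "\<forall>I\<in>set (filter (\<lambda>I. length I = 3) (subseqs [0..<7])). P (map e I) = of_int (phi_coeff_sorted I)"
    using b q unfolding increasing_3
    by (simp add: P3 r0 ri aij kaehler_coeff_def volume_coeff_def phi_coeff_sorted_def)
qed

text \<open>All coefficients with indices i, j, k and j < k, evaluated once. They are needed when
  the first argument of the 3-form is a general vector expanded in the frame.\<close>

lemma phi_row_table: "\<forall>(I, c)\<in>set [([0,0,1], 0), ([1,0,1], 0), ([2,0,1], 0), ([3,0,1], 0), ([4,0,1], - 1), ([5,0,1], 0), ([6,0,1], 0),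
   ([0,0,2], 0), ([1,0,2], 0), ([2,0,2], 0), ([3,0,2], 0), ([4,0,2], 0), ([5,0,2], - 1), ([6,0,2], 0),
   ([0,0,3], 0), ([1,0,3], 0), ([2,0,3], 0), ([3,0,3], 0), ([4,0,3], 0), ([5,0,3], 0), ([6,0,3], - 1),
   ([0,0,4], 0), ([1,0,4], 1), ([2,0,4], 0), ([3,0,4], 0), ([4,0,4], 0), ([5,0,4], 0), ([6,0,4], 0),
   ([0,0,5], 0), ([1,0,5], 0), ([2,0,5], 1), ([3,0,5], 0), ([4,0,5], 0), ([5,0,5], 0), ([6,0,5], 0),
   ([0,0,6], 0), ([1,0,6], 0), ([2,0,6], 0), ([3,0,6], 1), ([4,0,6], 0), ([5,0,6], 0), ([6,0,6], 0),
   ([0,1,2], 0), ([1,1,2], 0), ([2,1,2], 0), ([3,1,2], 1), ([4,1,2], 0), ([5,1,2], 0), ([6,1,2], 0),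
   ([0,1,3], 0), ([1,1,3], 0), ([2,1,3], - 1), ([3,1,3], 0), ([4,1,3], 0), ([5,1,3], 0), ([6,1,3], 0),
   ([0,1,4], - 1), ([1,1,4], 0), ([2,1,4], 0), ([3,1,4], 0), ([4,1,4], 0), ([5,1,4], 0), ([6,1,4], 0),
   ([0,1,5], 0), ([1,1,5], 0), ([2,1,5], 0), ([3,1,5], 0), ([4,1,5], 0), ([5,1,5], 0), ([6,1,5], - 1),
   ([0,1,6], 0), ([1,1,6], 0), ([2,1,6], 0), ([3,1,6], 0), ([4,1,6], 0), ([5,1,6], 1), ([6,1,6], 0),
   ([0,2,3], 0), ([1,2,3], 1), ([2,2,3], 0), ([3,2,3], 0), ([4,2,3], 0), ([5,2,3], 0), ([6,2,3], 0),
   ([0,2,4], 0), ([1,2,4], 0), ([2,2,4], 0), ([3,2,4], 0), ([4,2,4], 0), ([5,2,4], 0), ([6,2,4], 1),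
   ([0,2,5], - 1), ([1,2,5], 0), ([2,2,5], 0), ([3,2,5], 0), ([4,2,5], 0), ([5,2,5], 0), ([6,2,5], 0),
   ([0,2,6], 0), ([1,2,6], 0), ([2,2,6], 0), ([3,2,6], 0), ([4,2,6], - 1), ([5,2,6], 0), ([6,2,6], 0),
   ([0,3,4], 0), ([1,3,4], 0), ([2,3,4], 0), ([3,3,4], 0), ([4,3,4], 0), ([5,3,4], - 1), ([6,3,4], 0),
   ([0,3,5], 0), ([1,3,5], 0), ([2,3,5], 0), ([3,3,5], 0), ([4,3,5], 1), ([5,3,5], 0), ([6,3,5], 0),
   ([0,3,6], - 1), ([1,3,6], 0), ([2,3,6], 0), ([3,3,6], 0), ([4,3,6], 0), ([5,3,6], 0), ([6,3,6], 0),
   ([0,4,5], 0), ([1,4,5], 0), ([2,4,5], 0), ([3,4,5], - 1), ([4,4,5], 0), ([5,4,5], 0), ([6,4,5], 0),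
   ([0,4,6], 0), ([1,4,6], 0), ([2,4,6], 1), ([3,4,6], 0), ([4,4,6], 0), ([5,4,6], 0), ([6,4,6], 0),
   ([0,5,6], 0), ([1,5,6], - 1), ([2,5,6], 0), ([3,5,6], 0), ([4,5,6], 0), ([5,5,6], 0), ([6,5,6], 0)]. phi_coeff I = c"
  by code_simp

lemmas phi_rows = phi_row_table[simplified]

lemma alternating_Im: "alternating k b \<Longrightarrow> alternating k (\<lambda>vs. Im (b vs))"
  by (rule alt_bl) (auto simp: linear_iff)
lemma alternating_Re: "alternating k b \<Longrightarrow> alternating k (\<lambda>vs. Re (b vs))"
  by (rule alt_bl) (auto simp: linear_iff)

lemma alternating_lincomb:
  fixes \<alpha> \<beta> :: "('e::real_vector, real) mform"
  assumes "alternating k \<alpha>" "alternating k \<beta>" shows "alternating k (\<lambda>vs. s * \<alpha> vs + t * \<beta> vs)"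
  using alt_sum_list_form[OF alt_bl[OF assms(1), of "\<lambda>x. s * x"] alt_bl[OF assms(2), of "\<lambda>x. t * x"]]
  by (simp add: linear_iff algebra_simps)

text \<open>In the frame and with its orientation the dual is - e^0 \<and> Im(\<zeta>^1 \<and>
  \<zeta>^2 \<and> \<zeta>^3) - (1/2) (\<Sum>_j e^j \<and> e^(j+3))^2. Rewriting this in terms of r,
  a and b produces the powers of q and eliminates the frame, so that the result can be
  differentiated.\<close>

lemma reduced_star_3:
  fixes e :: "nat \<Rightarrow> 'a::euclidean_space"
  assumes f: "reduced_frame r a b q e" and r: "linear r" and a: "alternating 2 a" and b: "alternating 3 b"
    and P: "alternating 3 P" and dim: "DIM('a) = 7" and "length vs = 4"
    and Pe: "\<And>vs. length vs = 3 \<Longrightarrow> P vs = Re (b vs) - wedge 1 (covector_form r) a vs"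
  shows "hodge_star (g2_metric P) (g2_volume P) 3 P vs =
    (- 1 / q) * wedge 1 (covector_form r) (\<lambda>vs. Im (b vs)) vs + (- q\<^sup>2 / 2) * wedge 2 a a vs"
proof (rule star_eq_by_complements[OF reduced_standard_frame[OF f r a P Pe] reduced_coframe_dual[OF f r a dim] dim P _ _ \<open>length vs = 4\<close>])
  note cov = alternating_covector[OF r]
  show "alternating 4 (\<lambda>vs. (- 1 / q) * wedge 1 (covector_form r) (\<lambda>vs. Im (b vs)) vs + (- q\<^sup>2 / 2) * wedge 2 a a vs)"
    using alternating_wedge[OF cov alternating_Im[OF b]] alternating_wedge[OF a a] by (intro alternating_lincomb) auto
  have q: "q > 0" and r0: "r (e 0) = q" and ri: "\<And>i. i < 7 \<Longrightarrow> 0 < i \<Longrightarrow> r (e i) = 0"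
    and aij: "\<And>i j. i < 7 \<Longrightarrow> j < 7 \<Longrightarrow> a [e i, e j] = kaehler_coeff i j / q"
    and bt: "\<forall>I\<in>set (filter (\<lambda>I. length I = 3) (subseqs [0..<7])). b (map e I) = volume_coeff I"
    using f by (auto simp: reduced_frame_def)
  have Pt: "\<forall>I\<in>set (filter (\<lambda>I. length I = 3) (subseqs [0..<7])). P (map e I) = of_int (phi_coeff_sorted I)"
    using reduced_standard_frame[OF f r a P Pe] by (simp add: standard_frame_def)
  show "\<forall>(J, I, s)\<in>set (complements 4). - of_int s * P (map e I) =
     (- 1 / q) * wedge 1 (covector_form r) (\<lambda>vs. Im (b vs)) (map e J) + (- q\<^sup>2 / 2) * wedge 2 a a (map e J)"
    using bt Pt q unfolding increasing_3 complements_4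
    by (simp add: wedge_1_3[OF cov alternating_Im[OF b], unfolded One_nat_def] wedge_square[OF a] r0 ri aij kaehler_coeff_def volume_coeff_def phi_coeff_sorted_def
        power2_eq_square)
qed simp_all

text \<open>The 5-form is G' \<and> (- r \<and> Im b + q^3 a \<and> a), which is what remains of the
  exterior derivative of the dual form. The conditions on G' express \<iota>_Z a = G' o J with J e_j
  = e_(j+3), tested on the frame.\<close>

lemma reduced_star_5:
  fixes e :: "nat \<Rightarrow> 'a::euclidean_space"
  assumes f: "reduced_frame r a b q e" and r: "linear r" and a: "alternating 2 a" and b: "alternating 3 b"
    and P: "alternating 3 P" and dim: "DIM('a) = 7"
    and Pe: "\<And>vs. length vs = 3 \<Longrightarrow> P vs = Re (b vs) - wedge 1 (covector_form r) a vs"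
    and G: "linear G'" "G' (e 0) = 0" "\<And>j. j \<in> {1..3} \<Longrightarrow> G' (e j) = - a [Z, e (j + 3)]" "\<And>j. j \<in> {1..3} \<Longrightarrow> G' (e (j + 3)) = a [Z, e j]"
    and Z: "r Z = 0"
  shows "hodge_star (g2_metric P) (g2_volume P) 5
      (\<lambda>vs. (- 1) * wedge 1 (covector_form G') (wedge 1 (covector_form r) (\<lambda>vs. Im (b vs))) vs
         + q ^ 3 * wedge 1 (covector_form G') (wedge 2 a a) vs) [v, w] =
    2 * (r v * a [Z, w] - r w * a [Z, v]) - Re (b [Z, v, w])"
proof -
  note cov = alternating_covector[OF r] and covG = alternating_covector[OF G(1)]
  have q: "q > 0" and r0: "r (e 0) = q" and ri: "\<And>i. i < 7 \<Longrightarrow> 0 < i \<Longrightarrow> r (e i) = 0"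
    and aij: "\<And>i j. i < 7 \<Longrightarrow> j < 7 \<Longrightarrow> a [e i, e j] = kaehler_coeff i j / q"
    and bt: "\<forall>I\<in>set (filter (\<lambda>I. length I = 3) (subseqs [0..<7])). b (map e I) = volume_coeff I"
    using f by (auto simp: reduced_frame_def)
  note std = reduced_standard_frame[OF f r a P Pe] and dual = reduced_coframe_dual[OF f r a dim]
  define z where "z i = reduced_coframe r a q e i Z" for i
  have z0: "z 0 = 0" using Z by (simp add: z_def reduced_coframe_def)
  have seven: "(\<Sum>i<7. h i) = h 0 + h 1 + h 2 + h 3 + h 4 + h 5 + h (6::nat)" for h :: "nat \<Rightarrow> real"
    by (simp add: numeral_eq_Suc)
  have aZ: "a [Z, e j] = (\<Sum>i<7. z i * (kaehler_coeff i j / q))" if "j < 7" for j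
    using alt_expand_hd[OF dual, of 1 a "[e j]" Z] a that by (simp add: dim z_def aij numeral_2_eq_2)
  have PZ: "P [Z, e j, e k] = (\<Sum>i<7. z i * of_int (phi_coeff [i, j, k]))" if "j < 7" "k < 7" for j k
  proof -
    have "P [Z, e j, e k] = (\<Sum>i<7. z i * P [e i, e j, e k])"
      using alt_expand_hd[OF dual, of 2 P "[e j, e k]" Z] P by (simp add: dim z_def)
    also have "\<dots> = (\<Sum>i<7. z i * of_int (phi_coeff [i, j, k]))"
      by (rule sum.cong) (use phi_coeff_eq[OF std, of "[_, j, k]"] that in auto)
    finally show ?thesis .
  qed
  have bZ: "Re (b [Z, v, w]) = P [Z, v, w] - r v * a [Z, w] + r w * a [Z, v]" for v w
    using Pe[of "[Z, v, w]"] wedge_1_2[OF cov a, of Z v w] Z by simp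
  \<comment> \<open>In the components z of Z the conditions say G' = - (1/q) \<Sum> z_i e^i: up to a
    positive factor, Z is minus the gradient.\<close>
  have Ge: "G' (e 1) = - z 1 / q" "G' (e 2) = - z 2 / q" "G' (e 3) = - z 3 / q"
     "G' (e 4) = - z 4 / q" "G' (e 5) = - z 5 / q" "G' (e 6) = - z 6 / q"
    using G(3)[of 1] G(3)[of 2] G(3)[of 3] G(4)[of 1] G(4)[of 2] G(4)[of 3]
    by (simp_all add: aZ seven kaehler_coeff_def)
  have w1: "alternating 4 (wedge 1 (covector_form r) (\<lambda>vs. Im (b vs)))"
    using alternating_wedge[OF cov alternating_Im[OF b]] by simp
  have w2: "alternating 4 (wedge 2 a a)" using alternating_wedge[OF a a] by simp
  define \<tau> where "\<tau> vs = (- 1) * wedge 1 (covector_form G') (wedge 1 (covector_form r) (\<lambda>vs. Im (b vs))) vs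
         + q ^ 3 * wedge 1 (covector_form G') (wedge 2 a a) vs" for vs
  define \<gamma> where "\<gamma> vs = 2 * wedge 1 (covector_form r) (interior_product Z a) vs + (- 1) * interior_product Z (\<lambda>vs. Re (b vs)) vs" for vs
  have ipa: "alternating 1 (interior_product Z a)" using alt_ip[of 1 a Z] a by (simp add: numeral_2_eq_2)
  have \<gamma>: "\<gamma> [v, w] = 2 * (r v * a [Z, w] - r w * a [Z, v]) - Re (b [Z, v, w])" for v w
    using wedge_1_1[OF cov ipa, of v w] by (simp add: \<gamma>_def interior_product_def)
  \<comment> \<open>The wedge products are expanded once for arbitrary arguments, so that the 21
    cases below are mere substitutions of table values.\<close>
  have c4: "\<tau> [x1, x2, x3, x4, x5] = 
      - (G' x1 * (r x2 * Im (b [x3, x4, x5]) - r x3 * Im (b [x2, x4, x5]) + r x4 * Im (b [x2, x3, x5]) - r x5 * Im (b [x2, x3, x4]))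
       - G' x2 * (r x1 * Im (b [x3, x4, x5]) - r x3 * Im (b [x1, x4, x5]) + r x4 * Im (b [x1, x3, x5]) - r x5 * Im (b [x1, x3, x4]))
       + G' x3 * (r x1 * Im (b [x2, x4, x5]) - r x2 * Im (b [x1, x4, x5]) + r x4 * Im (b [x1, x2, x5]) - r x5 * Im (b [x1, x2, x4]))
       - G' x4 * (r x1 * Im (b [x2, x3, x5]) - r x2 * Im (b [x1, x3, x5]) + r x3 * Im (b [x1, x2, x5]) - r x5 * Im (b [x1, x2, x3]))
       + G' x5 * (r x1 * Im (b [x2, x3, x4]) - r x2 * Im (b [x1, x3, x4]) + r x3 * Im (b [x1, x2, x4]) - r x4 * Im (b [x1, x2, x3])))
     + q ^ 3 * (G' x1 * (2 * (a [x2, x3] * a [x4, x5] - a [x2, x4] * a [x3, x5] + a [x2, x5] * a [x3, x4]))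
       - G' x2 * (2 * (a [x1, x3] * a [x4, x5] - a [x1, x4] * a [x3, x5] + a [x1, x5] * a [x3, x4]))
       + G' x3 * (2 * (a [x1, x2] * a [x4, x5] - a [x1, x4] * a [x2, x5] + a [x1, x5] * a [x2, x4]))
       - G' x4 * (2 * (a [x1, x2] * a [x3, x5] - a [x1, x3] * a [x2, x5] + a [x1, x5] * a [x2, x3]))
       + G' x5 * (2 * (a [x1, x2] * a [x3, x4] - a [x1, x3] * a [x2, x4] + a [x1, x4] * a [x2, x3])))"
    for x1 x2 x3 x4 x5
    unfolding \<tau>_def wedge_1_4[OF covG w1] wedge_1_4[OF covG w2] wedge_1_3[OF cov alternating_Im[OF b]] wedge_square[OF a]
    by simp
  have "hodge_star (g2_metric P) (g2_volume P) 5 \<tau> [v, w] = \<gamma> [v, w]"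
  proof (rule star_eq_by_complements[OF std dual dim, where l = 2])
    show "alternating 5 \<tau>" unfolding \<tau>_def
      using alternating_wedge[OF covG w1] alternating_wedge[OF covG w2] by (intro alternating_lincomb) auto
    show "alternating 2 \<gamma>" unfolding \<gamma>_def
      using alternating_wedge[OF cov ipa] alt_ip[of 2 "\<lambda>vs. Re (b vs)" Z] alternating_Re[OF b]
      by (intro alternating_lincomb) (auto simp: numeral_3_eq_3 numeral_2_eq_2)
    note rows = phi_rows
    show "\<forall>(J, I, s)\<in>set (complements 2). - of_int s * \<tau> (map e I) = \<gamma> (map e J)"
      using bt q unfolding increasing_3 complements_2
      apply (simp add: c4 \<gamma> r0 ri aij kaehler_coeff_def volume_coeff_def G(2) Ge[simplified] bZ PZ aZ seven z0 rows)
      apply (simp add: power3_eq_cube)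
      done
  qed simp_all
  then show ?thesis unfolding \<tau>_def \<gamma> .
qed

text \<open>By the product rule, d of the dual form - G r \<and> Im b - a \<and> a / (2 G^2)
  consists of terms with da and db, which vanish, and of dG wedged with a 4-form. The frame at x
  alone then suffices for the second star, by \<open>reduced_star_5\<close>.\<close>

lemma codiff_reduced:
  fixes \<phi> :: "('m, 'a::euclidean_space, real) form"
  assumes dim: "DIM('a) = 7" and U: "open U" "x \<in> U" and r: "linear r"
    and a: "\<And>y. y \<in> U \<Longrightarrow> alternating 2 (a y)" and b: "\<And>y. y \<in> U \<Longrightarrow> alternating 3 (b y)"
    and P: "\<And>y. y \<in> U \<Longrightarrow> alternating 3 (\<phi> c y)"
    and Pe: "\<And>y vs. y \<in> U \<Longrightarrow> length vs = 3 \<Longrightarrow> \<phi> c y vs = Re (b y vs) - wedge 1 (covector_form r) (a y) vs"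
    and fr: "\<And>y. y \<in> U \<Longrightarrow> \<exists>e. reduced_frame r (a y) (b y) (1 / G y) e"
    and da: "\<And>u v. ((\<lambda>y. a y [u, v]) has_derivative A u v) (at x)"
    and db: "\<And>u v w. ((\<lambda>y. b y [u, v, w]) has_derivative B u v w) (at x)"
    and dG: "(G has_derivative G') (at x)"
    and ca: "\<And>u v w. A v w u - A u w v + A u v w = 0"
    and cb: "\<And>u v w z. B v w z u - B u w z v + B u v z w - B u v w z = 0"
    and e: "reduced_frame r (a x) (b x) (1 / G x) e"
    and Ge: "G' (e 0) = 0" "\<And>j. j \<in> {1..3} \<Longrightarrow> G' (e j) = - a x [Z, e (j + 3)]" "\<And>j. j \<in> {1..3} \<Longrightarrow> G' (e (j + 3)) = a x [Z, e j]"
    and Z: "r Z = 0"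
  shows "codiff \<phi> 3 \<phi> c x [v, w] = Re (b x [Z, v, w]) - 2 * (r v * a x [Z, w] - r w * a x [Z, v])"
proof -
  note cov = alternating_covector[OF r]
  have lG: "linear G'" by (rule has_derivative_linear[OF dG])
  have Gpos: "G y > 0" if "y \<in> U" for y using fr[OF that] by (auto simp: reduced_frame_def)
  define I where "I y vs = Im (b y vs)" for y vs
  define RR where "RR y x1 x2 x3 x4 = r x1 * I y [x2, x3, x4] - r x2 * I y [x1, x3, x4] + r x3 * I y [x1, x2, x4] - r x4 * I y [x1, x2, x3]" for y x1 x2 x3 x4
  \<comment> \<open>Half of a \<and> a, by \<open>wedge_square\<close>.\<close>
  define SS where "SS y x1 x2 x3 x4 = a y [x1, x2] * a y [x3, x4] - a y [x1, x3] * a y [x2, x4] + a y [x1, x4] * a y [x2, x3]" for y x1 x2 x3 x4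
  let ?R = "RR x" and ?S = "SS x"
  define R' where "R' x1 x2 x3 x4 h = r x1 * Im (B x2 x3 x4 h) - r x2 * Im (B x1 x3 x4 h) + r x3 * Im (B x1 x2 x4 h) - r x4 * Im (B x1 x2 x3 h)" for x1 x2 x3 x4 h
  define S' where "S' x1 x2 x3 x4 h = (A x1 x2 h * a x [x3, x4] + a x [x1, x2] * A x3 x4 h) - (A x1 x3 h * a x [x2, x4] + a x [x1, x3] * A x2 x4 h)
    + (A x1 x4 h * a x [x2, x3] + a x [x1, x4] * A x2 x3 h)" for x1 x2 x3 x4 h
  define st where "st = (\<lambda>j \<beta> c x. hodge_star (g2_metric (\<phi> c x)) (g2_volume (\<phi> c x)) j (\<beta> c x))"
  \<comment> \<open>The frame depends on y and is forgotten at this point; the right hand side is an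
    explicit function on U.\<close>
  have star3: "st 3 \<phi> c y [x1, x2, x3, x4] = - (G y * RR y x1 x2 x3 x4) - 1 / (G y)\<^sup>2 * SS y x1 x2 x3 x4" if y: "y \<in> U" for y x1 x2 x3 x4
  proof -
    obtain e where e: "reduced_frame r (a y) (b y) (1 / G y) e" using fr[OF y] by blast
    show ?thesis unfolding st_def
      using reduced_star_3[OF e r a[OF y] b[OF y] P[OF y] dim _ Pe[OF y], of "[x1, x2, x3, x4]"]
        wedge_1_3[OF cov alternating_Im[OF b[OF y]], of x1 x2 x3 x4] wedge_square[OF a[OF y], of x1 x2 x3 x4] Gpos[OF y]
      by (simp add: RR_def SS_def I_def power_divide) (simp add: field_simps)
  qed
  have dI: "((\<lambda>y. I y [u, v, w]) has_derivative (\<lambda>h. Im (B u v w h))) (at x)" for u v w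
    unfolding I_def by (rule bounded_linear.has_derivative[OF bounded_linear_Im db])
  have dR: "((\<lambda>y. RR y x1 x2 x3 x4) has_derivative R' x1 x2 x3 x4) (at x)" for x1 x2 x3 x4
    unfolding RR_def R'_def[abs_def]
    by (intro has_derivative_add has_derivative_diff has_derivative_mult_right dI)
  have dS: "((\<lambda>y. SS y x1 x2 x3 x4) has_derivative S' x1 x2 x3 x4) (at x)" for x1 x2 x3 x4
    unfolding SS_def
    by (rule has_derivative_eq_rhs, (rule has_derivative_add has_derivative_diff has_derivative_mult da)+)
      (simp add: S'_def fun_eq_iff)
  have Gx: "G x > 0" using Gpos[OF U(2)] .
  have dGi: "((\<lambda>y. 1 / (G y)\<^sup>2) has_derivative (\<lambda>h. - 2 * G' h / (G x) ^ 3)) (at x)"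
  proof -
    have H: "((\<lambda>y. inverse (G y * G y)) has_derivative
       (\<lambda>h. - (inverse (G x * G x) * (G x * G' h + G' h * G x) * inverse (G x * G x)))) (at x)"
      by (intro Deriv.has_derivative_inverse has_derivative_mult dG) (use Gx in auto)
    have E: "(\<lambda>y. 1 / (G y)\<^sup>2) = (\<lambda>y. inverse (G y * G y))"
      by (simp add: fun_eq_iff power2_eq_square divide_inverse)
    show ?thesis unfolding E
      by (rule has_derivative_eq_rhs[OF H]) (use Gx in \<open>simp add: fun_eq_iff field_simps power3_eq_cube\<close>)
  qed
  have D: "frechet_derivative (\<lambda>y. st 3 \<phi> c y [x1, x2, x3, x4]) (at x) h =
     - (G x * R' x1 x2 x3 x4 h + G' h * ?R x1 x2 x3 x4) - (1 / (G x)\<^sup>2 * S' x1 x2 x3 x4 h + (- 2 * G' h / (G x) ^ 3) * ?S x1 x2 x3 x4)"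
    for x1 x2 x3 x4 h
  proof -
    have "frechet_derivative (\<lambda>y. st 3 \<phi> c y [x1, x2, x3, x4]) (at x) =
       frechet_derivative (\<lambda>y. - (G y * RR y x1 x2 x3 x4) - 1 / (G y)\<^sup>2 * SS y x1 x2 x3 x4) (at x)"
      by (rule fd_cong_open[OF U star3])
    also have "\<dots> = (\<lambda>h. - (G x * R' x1 x2 x3 x4 h + G' h * ?R x1 x2 x3 x4) - (1 / (G x)\<^sup>2 * S' x1 x2 x3 x4 h + (- 2 * G' h / (G x) ^ 3) * ?S x1 x2 x3 x4))"
      by (rule frechet_derivative_at[symmetric]) (intro has_derivative_diff has_derivative_minus has_derivative_mult dG dR dS dGi)
    finally show ?thesis by simp
  qed
  \<comment> \<open>\<open>cA\<close> and \<open>cB\<close> are da and d(Im b). The sums of R' and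
    S' below vanish because d(r \<and> Im b) = - r \<and> d(Im b) and d(a \<and> a) / 2 = da \<and>
    a.\<close>
  define cA where "cA u v w = A v w u - A u w v + A u v w" for u v w
  define cB where "cB u v w z = Im (B v w z u) - Im (B u w z v) + Im (B u v z w) - Im (B u v w z)" for u v w z
  have cA0: "cA u v w = 0" for u v w using ca by (simp add: cA_def)
  have cB0: "cB u v w z = 0" for u v w z using arg_cong[OF cb[of v w z u], of Im] by (simp add: cB_def)
  have sumR: "R' x2 x3 x4 x5 x1 - R' x1 x3 x4 x5 x2 + R' x1 x2 x4 x5 x3 - R' x1 x2 x3 x5 x4 + R' x1 x2 x3 x4 x5 = 0" for x1 x2 x3 x4 x5
  proof -
    have "R' x2 x3 x4 x5 x1 - R' x1 x3 x4 x5 x2 + R' x1 x2 x4 x5 x3 - R' x1 x2 x3 x5 x4 + R' x1 x2 x3 x4 x5 = - r x1 * (cB x2 x3 x4 x5) + r x2 * (cB x1 x3 x4 x5) - r x3 * (cB x1 x2 x4 x5) + r x4 * (cB x1 x2 x3 x5) - r x5 * (cB x1 x2 x3 x4)"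
      unfolding R'_def cB_def by (simp add: algebra_simps)
    then show ?thesis by (simp add: cB0)
  qed
  have sumS: "S' x2 x3 x4 x5 x1 - S' x1 x3 x4 x5 x2 + S' x1 x2 x4 x5 x3 - S' x1 x2 x3 x5 x4 + S' x1 x2 x3 x4 x5 = 0" for x1 x2 x3 x4 x5
  proof -
    have "S' x2 x3 x4 x5 x1 - S' x1 x3 x4 x5 x2 + S' x1 x2 x4 x5 x3 - S' x1 x2 x3 x5 x4 + S' x1 x2 x3 x4 x5 =  a x [x4, x5] * (cA x1 x2 x3) - a x [x3, x5] * (cA x1 x2 x4) + a x [x3, x4] * (cA x1 x2 x5) + a x [x2, x5] * (cA x1 x3 x4) - a x [x2, x4] * (cA x1 x3 x5) + a x [x2, x3] * (cA x1 x4 x5) - a x [x1, x5] * (cA x2 x3 x4) + a x [x1, x4] * (cA x2 x3 x5) - a x [x1, x3] * (cA x2 x4 x5) + a x [x1, x2] * (cA x3 x4 x5)"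
      unfolding S'_def cA_def by (simp add: algebra_simps)
    then show ?thesis by (simp add: cA0)
  qed
  define q where "q = 1 / G x"
  define ch where "ch vs = (- 1) * wedge 1 (covector_form G') (wedge 1 (covector_form r) (\<lambda>vs. Im (b x vs))) vs
         + q ^ 3 * wedge 1 (covector_form G') (wedge 2 (a x) (a x)) vs" for vs
  have w1: "alternating 4 (wedge 1 (covector_form r) (\<lambda>vs. Im (b x vs)))"
    using alternating_wedge[OF cov alternating_Im[OF b[OF U(2)]]] by simp
  have w2: "alternating 4 (wedge 2 (a x) (a x))" using alternating_wedge[OF a[OF U(2)] a[OF U(2)]] by simp
  have ext: "ext_d (st 3 \<phi>) c x vs = ch vs" if len: "length vs = 5" for vs
  proof -
    obtain x1 x2 x3 x4 x5 where vs: "vs = [x1, x2, x3, x4, x5]"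
      using len by (auto simp: numeral_eq_Suc length_Suc_conv)
    have "ext_d (st 3 \<phi>) c x vs = frechet_derivative (\<lambda>y. st 3 \<phi> c y [x2, x3, x4, x5]) (at x) x1
       - frechet_derivative (\<lambda>y. st 3 \<phi> c y [x1, x3, x4, x5]) (at x) x2
       + frechet_derivative (\<lambda>y. st 3 \<phi> c y [x1, x2, x4, x5]) (at x) x3
       - frechet_derivative (\<lambda>y. st 3 \<phi> c y [x1, x2, x3, x5]) (at x) x4
       + frechet_derivative (\<lambda>y. st 3 \<phi> c y [x1, x2, x3, x4]) (at x) x5"
      by (simp add: ext_d_def vs numeral_eq_Suc)
    also have "\<dots> = - G x * (R' x2 x3 x4 x5 x1 - R' x1 x3 x4 x5 x2 + R' x1 x2 x4 x5 x3 - R' x1 x2 x3 x5 x4 + R' x1 x2 x3 x4 x5) - 1 / (G x)\<^sup>2 * (S' x2 x3 x4 x5 x1 - S' x1 x3 x4 x5 x2 + S' x1 x2 x4 x5 x3 - S' x1 x2 x3 x5 x4 + S' x1 x2 x3 x4 x5) + (G' x1 * (- ?R x2 x3 x4 x5 + 2 / G x ^ 3 * ?S x2 x3 x4 x5) - G' x2 * (- ?R x1 x3 x4 x5 + 2 / G x ^ 3 * ?S x1 x3 x4 x5) + G' x3 * (- ?R x1 x2 x4 x5 + 2 / G x ^ 3 * ?S x1 x2 x4 x5) - G' x4 * (- ?R x1 x2 x3 x5 + 2 / G x ^ 3 * ?S x1 x2 x3 x5) + G' x5 * (- ?R x1 x2 x3 x4 + 2 / G x ^ 3 * ?S x1 x2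 x3 x4))"
      unfolding D by (simp add: algebra_simps)
    also have "\<dots> = G' x1 * (- ?R x2 x3 x4 x5 + 2 / G x ^ 3 * ?S x2 x3 x4 x5) - G' x2 * (- ?R x1 x3 x4 x5 + 2 / G x ^ 3 * ?S x1 x3 x4 x5) + G' x3 * (- ?R x1 x2 x4 x5 + 2 / G x ^ 3 * ?S x1 x2 x4 x5) - G' x4 * (- ?R x1 x2 x3 x5 + 2 / G x ^ 3 * ?S x1 x2 x3 x5) + G' x5 * (- ?R x1 x2 x3 x4 + 2 / G x ^ 3 * ?S x1 x2 x3 x4)" unfolding sumR sumS by simp
    also have "\<dots> = ch vs"
      unfolding ch_def vs wedge_1_4[OF alternating_covector[OF lG] w1] wedge_1_4[OF alternating_covector[OF lG] w2]
        wedge_1_3[OF cov alternating_Im[OF b[OF U(2)]]] wedge_square[OF a[OF U(2)]] RR_def SS_def I_def q_def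
      by (simp add: power_divide algebra_simps)
    finally show ?thesis .
  qed
  \<comment> \<open>The sign exponent 7 * 4 + 1 is odd, and the outer star acts in degree 7 - 3 + 1
    = 5.\<close>
  have "codiff \<phi> 3 \<phi> c x [v, w] = - hodge_star (g2_metric (\<phi> c x)) (g2_volume (\<phi> c x)) 5 (ext_d (st 3 \<phi>) c x) [v, w]"
    unfolding codiff_def Let_def st_def dim by simp
  also have "\<dots> = - hodge_star (g2_metric (\<phi> c x)) (g2_volume (\<phi> c x)) 5 ch [v, w]"
    by (simp only: hodge_star_cong[OF ext])
  also have "\<dots> = - (2 * (r v * a x [Z, w] - r w * a x [Z, v]) - Re (b x [Z, v, w]))"
    unfolding ch_def
    by (subst reduced_star_5[OF e[folded q_def] r a[OF U(2)] b[OF U(2)] P[OF U(2)] dim Pe[OF U(2)] lG Ge Z]) auto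
  finally show ?thesis by simp
qed

subsection \<open>Derivatives of forms along maps\<close>

lemma alt_expand_Basis:
  fixes \<alpha> :: "('a::euclidean_space, 'b::real_vector) mform"
  assumes "alternating (Suc k) \<alpha>" "length vs = k"
  shows "\<alpha> (v # vs) = (\<Sum>b\<in>Basis. (v \<bullet> b) *\<^sub>R \<alpha> (b # vs))"
proof -
  have l: "linear (\<lambda>v. \<alpha> (v # vs))" by (rule alt_linear_hd[OF assms(1)]) (simp add: assms)
  have "\<alpha> (v # vs) = \<alpha> ((\<Sum>b\<in>Basis. (v \<bullet> b) *\<^sub>R b) # vs)" by (simp only: euclidean_representation)
  also have "\<dots> = (\<Sum>b\<in>Basis. (v \<bullet> b) *\<^sub>R \<alpha> (b # vs))"
    by (simp only: linear_sum[OF l] linear_scale[OF l])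
  finally show ?thesis .
qed

text \<open>Product rule for a form evaluated on moving arguments. Forms are plain functions on
  lists, so each argument is expanded in \<open>Basis\<close> and only values on constant vectors
  are differentiated. The map f' assigns to each function in the list its derivative.\<close>

lemma has_derivative_form_map:
  fixes \<Phi> :: "'a::euclidean_space \<Rightarrow> ('b::euclidean_space, 'c::real_normed_vector) mform"
  assumes S: "nice S" "x \<in> S"
    and al: "\<And>y. y \<in> S \<Longrightarrow> alternating k (\<Phi> y)"
    and d\<Phi>: "\<And>vs. length vs = k \<Longrightarrow> ((\<lambda>y. \<Phi> y vs) has_derivative \<Phi>' vs) (at x within S)"
    and df: "\<And>f. f \<in> set fs \<Longrightarrow> (f has_derivative f' f) (at x within S)"
    and len: "length fs = k"
  shows "((\<lambda>y. \<Phi> y (map (\<lambda>f. f y) fs)) has_derivative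
    (\<lambda>h. \<Phi>' (map (\<lambda>f. f x) fs) h + (\<Sum>j<k. \<Phi> x ((map (\<lambda>f. f x) fs)[j := f' (fs ! j) h])))) (at x within S)"
  using al d\<Phi> df len
proof (induction fs arbitrary: k \<Phi> \<Phi>')
  case Nil
  then show ?case using Nil(2)[of "[]"] by simp
next
  case (Cons f fs)
  obtain k' where k: "k = Suc k'" "length fs = k'" using Cons.prems(4) by auto
  let ?F = "\<lambda>y. map (\<lambda>f. f y) fs"
  have al: "alternating (Suc k') (\<Phi> y)" if "y \<in> S" for y using Cons.prems(1)[OF that] k by simp
  have exp: "\<Phi> y (v # vs) = (\<Sum>b\<in>Basis. (v \<bullet> b) *\<^sub>R \<Phi> y (b # vs))" if "y \<in> S" "length vs = k'" for y v vs
    by (rule alt_expand_Basis[OF al[OF that(1)] that(2)])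
  have IH: "((\<lambda>y. \<Phi> y (b # ?F y)) has_derivative
      (\<lambda>h. \<Phi>' (b # ?F x) h + (\<Sum>j<k'. \<Phi> x (b # (?F x)[j := f' (fs ! j) h])))) (at x within S)" for b
    using Cons.IH[of k' "\<lambda>y. interior_product b (\<Phi> y)" "\<lambda>vs. \<Phi>' (b # vs)"] Cons.prems k alt_ip[OF al]
    by (simp add: interior_product_def)
  have df: "(f has_derivative f' f) (at x within S)" using Cons.prems(3) by simp
  have 1: "((\<lambda>y. \<Sum>b\<in>Basis. (f y \<bullet> b) *\<^sub>R \<Phi> y (b # ?F y)) has_derivative
     (\<lambda>h. \<Sum>b\<in>Basis. (f x \<bullet> b) *\<^sub>R (\<Phi>' (b # ?F x) h + (\<Sum>j<k'. \<Phi> x (b # (?F x)[j := f' (fs ! j) h])))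
        + (f' f h \<bullet> b) *\<^sub>R \<Phi> x (b # ?F x))) (at x within S)"
    by (intro has_derivative_sum has_derivative_scaleR IH bounded_linear.has_derivative[OF bounded_linear_inner_left df])
  \<comment> \<open>Linearity of \<Phi>' in its first argument is inherited from \<Phi> by
    uniqueness of derivatives.\<close>
  have lin': "\<Phi>' (v # ?F x) h = (\<Sum>b\<in>Basis. (v \<bullet> b) *\<^sub>R \<Phi>' (b # ?F x) h)" for v h
  proof -
    have "((\<lambda>y. \<Sum>b\<in>Basis. (v \<bullet> b) *\<^sub>R \<Phi> y (b # ?F x)) has_derivative (\<lambda>h. \<Sum>b\<in>Basis. (v \<bullet> b) *\<^sub>R \<Phi>' (b # ?F x) h)) (at x within S)"
      by (intro has_derivative_sum has_derivative_scaleR_right Cons.prems(2)) (simp add: k)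
    then have 2: "((\<lambda>y. \<Phi> y (v # ?F x)) has_derivative (\<lambda>h. \<Sum>b\<in>Basis. (v \<bullet> b) *\<^sub>R \<Phi>' (b # ?F x) h)) (at x within S)"
      by (rule has_derivative_transform[OF S(2), rotated]) (simp add: exp k)
    have 3: "((\<lambda>y. \<Phi> y (v # ?F x)) has_derivative \<Phi>' (v # ?F x)) (at x within S)"
      by (rule Cons.prems(2)) (simp add: k)
    show ?thesis using fd_eq[OF S 2] fd_eq[OF S 3] by metis
  qed
  have eq: "(\<Sum>b\<in>Basis. (f x \<bullet> b) *\<^sub>R (\<Phi>' (b # ?F x) h + (\<Sum>j<k'. \<Phi> x (b # (?F x)[j := f' (fs ! j) h])))
        + (f' f h \<bullet> b) *\<^sub>R \<Phi> x (b # ?F x))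
    = \<Phi>' (f x # ?F x) h + (\<Sum>j<k. \<Phi> x ((f x # ?F x)[j := f' ((f # fs) ! j) h]))" for h
  proof -
    have "(\<Sum>b\<in>Basis. (f x \<bullet> b) *\<^sub>R (\<Sum>j<k'. \<Phi> x (b # (?F x)[j := f' (fs ! j) h])))
       = (\<Sum>j<k'. \<Sum>b\<in>Basis. (f x \<bullet> b) *\<^sub>R \<Phi> x (b # (?F x)[j := f' (fs ! j) h]))"
      by (simp only: scaleR_sum_right) (rule sum.swap)
    also have "\<dots> = (\<Sum>j<k'. \<Phi> x (f x # (?F x)[j := f' (fs ! j) h]))"
      by (intro sum.cong refl exp[OF S(2), symmetric]) (simp add: k)
    finally have a: "(\<Sum>b\<in>Basis. (f x \<bullet> b) *\<^sub>R (\<Sum>j<k'. \<Phi> x (b # (?F x)[j := f' (fs ! j) h])))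
       = (\<Sum>j<k'. \<Phi> x (f x # (?F x)[j := f' (fs ! j) h]))" .
    have b: "(\<Sum>b\<in>Basis. (f' f h \<bullet> b) *\<^sub>R \<Phi> x (b # ?F x)) = \<Phi> x (f' f h # ?F x)"
      by (rule exp[OF S(2), symmetric]) (simp add: k)
    show ?thesis
      unfolding k(1) sum.lessThan_Suc_shift scaleR_add_right sum.distrib a b lin'[symmetric]
      by (simp add: add_ac)
  qed
  have "((\<lambda>y. \<Sum>b\<in>Basis. (f y \<bullet> b) *\<^sub>R \<Phi> y (b # ?F y)) has_derivative
     (\<lambda>h. \<Phi>' (f x # ?F x) h + (\<Sum>j<k. \<Phi> x ((f x # ?F x)[j := f' ((f # fs) ! j) h])))) (at x within S)"
    using 1 unfolding eq .
  then have "((\<lambda>y. \<Phi> y (f y # ?F y)) has_derivative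
     (\<lambda>h. \<Phi>' (f x # ?F x) h + (\<Sum>j<k. \<Phi> x ((f x # ?F x)[j := f' ((f # fs) ! j) h])))) (at x within S)"
    by (rule has_derivative_transform[OF S(2), rotated]) (simp add: exp k)
  then show ?case by simp
qed

lemma smooth_on_form_map:
  fixes \<Phi> :: "'a::euclidean_space \<Rightarrow> ('b::euclidean_space, 'c::real_normed_vector) mform"
  assumes S: "nice S"
    and "\<And>y. y \<in> S \<Longrightarrow> alternating k (\<Phi> y)"
    and "\<And>vs. length vs = k \<Longrightarrow> smooth_on S (\<lambda>y. \<Phi> y vs)"
    and "\<And>f. f \<in> set fs \<Longrightarrow> smooth_on S f" and "length fs = k"
  shows "smooth_on S (\<lambda>y. \<Phi> y (map (\<lambda>f. f y) fs))"
  using assms(2-5)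
proof (induction fs arbitrary: k \<Phi>)
  case Nil
  then show ?case using Nil(2)[of "[]"] by simp
next
  case (Cons f fs)
  obtain k' where k: "k = Suc k'" "length fs = k'" using Cons.prems(4) by auto
  let ?F = "\<lambda>y. map (\<lambda>f. f y) fs"
  have al: "alternating (Suc k') (\<Phi> y)" if "y \<in> S" for y using Cons.prems(1)[OF that] k by simp
  have IH: "smooth_on S (\<lambda>y. \<Phi> y (b # ?F y))" for b
    using Cons.IH[of k' "\<lambda>y. interior_product b (\<Phi> y)"] Cons.prems k alt_ip[OF al]
    by (simp add: interior_product_def)
  have "smooth_on S (\<lambda>y. \<Sum>b\<in>Basis. (f y \<bullet> b) *\<^sub>R \<Phi> y (b # ?F y))"
    using Cons.prems(3)
    by (intro smooth_on_sum[OF S] smooth_on_bilinear[OF bounded_bilinear_scaleR S] IH smooth_on_bl[OF bounded_linear_inner_left S]) auto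
  then show ?case
    by (subst smooth_on_cong[where g = "\<lambda>y. \<Sum>b\<in>Basis. (f y \<bullet> b) *\<^sub>R \<Phi> y (b # ?F y)"])
      (use alt_expand_Basis[OF al] k in auto)
qed

subsection \<open>Exterior derivatives commute with pullbacks\<close>

text \<open>\<open>ext_d\<close> without charts and with derivatives within a set, so that it makes
  sense up to the initial time.\<close>

definition extd_on :: "'a::real_normed_vector set \<Rightarrow> ('a \<Rightarrow> ('a, 'c::real_normed_vector) mform) \<Rightarrow> 'a \<Rightarrow> ('a, 'c) mform" where
  "extd_on S \<alpha> x vs = (\<Sum>i<length vs. (-1) ^ i *\<^sub>R dirD S (\<lambda>y. \<alpha> y (take i vs @ drop (Suc i) vs)) (vs ! i) x)"

text \<open>These are the terms with second derivatives of a map in d of a pullback. For j < i the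
  terms (i, j) and (j, i - 1) carry the same inserted vector, by symmetry of H, and moving it to the
  same place shows that they cancel.\<close>

lemma alternating_sum_cancel:
  fixes \<alpha> :: "('e::real_vector, 'b::real_vector) mform"
  assumes al: "alternating k \<alpha>" and W: "length W = Suc k" and sym: "\<And>i j. H i j = H j i"
  shows "(\<Sum>i<Suc k. (-1) ^ i *\<^sub>R (\<Sum>j<k. \<alpha> ((take i W @ drop (Suc i) W)[j := H i (if j < i then j else Suc j)]))) = 0"
proof -
  define t where "t i j = (-1) ^ i *\<^sub>R \<alpha> ((take i W @ drop (Suc i) W)[j := H i (if j < i then j else Suc j)])" for i j
  have anti: "t j (i - 1) = - t i j" if ij: "j < i" "i < Suc k" for i j
  proof -
    define A where "A = take j W"
    define B where "B = take (i - j - 1) (drop (Suc j) W)"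
    define C where "C = drop (Suc i) W"
    have len: "length A = j" "length B = i - j - 1" "length C = k - i" using ij W by (auto simp: A_def B_def C_def)
    have tj: "take i W = A @ W ! j # B"
    proof -
      have "take i W = take j W @ take (i - j) (drop j W)" using ij by (metis add_diff_inverse_nat less_imp_not_less take_add)
      also have "drop j W = W ! j # drop (Suc j) W" using ij W by (simp add: Cons_nth_drop_Suc)
      also have "take (i - j) (W ! j # drop (Suc j) W) = W ! j # B" using ij by (simp add: B_def take_Cons')
      finally show ?thesis by (simp add: A_def)
    qed
    have dj: "drop (Suc j) W = B @ W ! i # C"
    proof -
      have "drop (Suc j) W = B @ drop (i - j - 1) (drop (Suc j) W)"
        unfolding B_def by (rule append_take_drop_id[symmetric])
      also have "drop (i - j - 1) (drop (Suc j) W) = drop i W" using ij by simp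
      also have "drop i W = W ! i # C" using ij W by (simp add: Cons_nth_drop_Suc C_def)
      finally show ?thesis .
    qed
    have 1: "(take i W @ drop (Suc i) W)[j := h] = A @ h # B @ C" for h
      unfolding tj C_def[symmetric] using len by (simp add: list_update_append)
    have 2: "(take j W @ drop (Suc j) W)[i - 1 := h] = A @ B @ h # C" for h
      unfolding dj A_def[symmetric] using len ij by (auto simp: list_update_append)
    have 3: "\<alpha> (A @ B @ h # C) = (-1) ^ (i - j - 1) *\<^sub>R \<alpha> (A @ h # B @ C)" for h
      using alt_move[OF al, of A B C h] len ij by simp
    have "Suc (j + (i - j - 1)) = i" using ij by simp
    then have "(-1) ^ j * (-1) ^ (i - j - 1) = - ((-1) ^ i :: real)"
      by (metis power_Suc power_add mult_minus1 minus_minus)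
    moreover have "H j i = H i j" by (rule sym)
    moreover have "(if i - 1 < j then i - 1 else Suc (i - 1)) = i" "(if j < i then j else Suc j) = j" using ij by auto
    ultimately show ?thesis unfolding t_def 1 2 3 by simp
  qed
  let ?P = "{(i, j). i < Suc k \<and> j < k \<and> j < i}" and ?Q = "{(i, j). i < Suc k \<and> j < k \<and> \<not> j < i}"
  have fin: "finite ?P" "finite ?Q"
    by (rule finite_subset[of _ "{..<Suc k} \<times> {..<k}"], auto)+
  have "(\<Sum>i<Suc k. (-1) ^ i *\<^sub>R (\<Sum>j<k. \<alpha> ((take i W @ drop (Suc i) W)[j := H i (if j < i then j else Suc j)]))) = (\<Sum>i<Suc k. \<Sum>j<k. t i j)"
    by (simp only: t_def scaleR_sum_right)
  also have "\<dots> = (\<Sum>(i, j)\<in>{..<Suc k} \<times> {..<k}. t i j)" by (rule sum.cartesian_product)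
  also have "{..<Suc k} \<times> {..<k} = ?P \<union> ?Q" by auto
  also have "(\<Sum>(i, j)\<in>?P \<union> ?Q. t i j) = (\<Sum>(i, j)\<in>?P. t i j) + (\<Sum>(i, j)\<in>?Q. t i j)"
    by (rule sum.union_disjoint[OF fin]) auto
  also have "(\<Sum>(i, j)\<in>?Q. t i j) = (\<Sum>(i, j)\<in>?P. t j (i - 1))"
    by (rule sum.reindex_bij_witness[where i = "\<lambda>(i, j). (j, i - 1)" and j = "\<lambda>(i, j). (Suc j, i)"]) auto
  also have "\<dots> = (\<Sum>(i, j)\<in>?P. - t i j)" by (rule sum.cong) (use anti in auto)
  finally show ?thesis by (simp add: sum_negf case_prod_unfold)
qed

lemma nth_remove: "i < length vs \<Longrightarrow> j < length vs - 1 \<Longrightarrow>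
   (take i vs @ drop (Suc i) vs) ! j = vs ! (if j < i then j else Suc j)"
  by (auto simp: nth_append)

text \<open>The chain rule gives the pullback of d\<alpha> plus terms with second derivatives of
  \<Theta>, and the latter cancel by \<open>alternating_sum_cancel\<close>.\<close>

theorem extd_on_pullback:
  fixes \<Theta> :: "'a::euclidean_space \<Rightarrow> 'b::euclidean_space" and \<alpha> :: "'b \<Rightarrow> ('b, 'c::real_normed_vector) mform"
  assumes S: "nice S" and \<Theta>: "smooth_on S \<Theta>" and ST: "\<And>y. y \<in> S \<Longrightarrow> \<Theta> y \<in> T"
    and al: "\<And>y. y \<in> T \<Longrightarrow> alternating k (\<alpha> y)" and sm: "\<And>vs. length vs = k \<Longrightarrow> smooth_on T (\<lambda>y. \<alpha> y vs)"
    and x: "x \<in> S" and len: "length vs = Suc k"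
  shows "extd_on S (\<lambda>y us. \<alpha> (\<Theta> y) (map (\<lambda>u. dirD S \<Theta> u y) us)) x vs = extd_on T \<alpha> (\<Theta> x) (map (\<lambda>u. dirD S \<Theta> u x) vs)"
proof -
  define D where "D = frechet_derivative \<Theta> (at x within S)"
  define H where "H i j = dirD S (dirD S \<Theta> (vs ! j)) (vs ! i) x" for i j
  have der: "dirD S (\<lambda>y. \<alpha> (\<Theta> y) (map (\<lambda>u. dirD S \<Theta> u y) us)) h x =
      dirD T (\<lambda>z. \<alpha> z (map D us)) (D h) (\<Theta> x) + (\<Sum>j<k. \<alpha> (\<Theta> x) ((map D us)[j := dirD S (dirD S \<Theta> (us ! j)) h x]))"
    if us: "length us = k" for us h
  proof -
    let ?fs = "map (\<lambda>u. dirD S \<Theta> u) us"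
    have d: "((\<lambda>y. \<alpha> (\<Theta> y) vs) has_derivative (\<lambda>h. dirD T (\<lambda>z. \<alpha> z vs) (D h) (\<Theta> x))) (at x within S)" if "length vs = k" for vs
      unfolding D_def
      by (rule has_derivative_in_compose[where g = "\<lambda>z. \<alpha> z vs", OF smooth_on_has_fd[OF \<Theta> x] has_derivative_subset[OF smooth_on_has_fd[OF sm[OF that] ST[OF x]]]])
        (use ST in auto)
    have "((\<lambda>y. \<alpha> (\<Theta> y) (map (\<lambda>f. f y) ?fs)) has_derivative
      (\<lambda>h. dirD T (\<lambda>z. \<alpha> z (map (\<lambda>f. f x) ?fs)) (D h) (\<Theta> x) +
        (\<Sum>j<k. \<alpha> (\<Theta> x) ((map (\<lambda>f. f x) ?fs)[j := frechet_derivative (?fs ! j) (at x within S) h])))) (at x within S)"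
      by (rule has_derivative_form_map[OF S x al d, where f' = "\<lambda>f. frechet_derivative f (at x within S)"])
        (use ST us in \<open>auto intro!: smooth_on_has_fd smooth_on_dirD \<Theta> x\<close>)
    moreover have "(\<Sum>j<k. \<alpha> (\<Theta> x) ((map D us)[j := dirD S (?fs ! j) h x])) =
       (\<Sum>j<k. \<alpha> (\<Theta> x) ((map D us)[j := dirD S (dirD S \<Theta> (us ! j)) h x]))"
      by (intro sum.cong refl) (use us in simp)
    ultimately show ?thesis using fd_eq[OF S x, of "\<lambda>y. \<alpha> (\<Theta> y) (map (\<lambda>f. f y) ?fs)"]
      by (simp add: o_def D_def)
  qed
  have rem: "length (take i vs @ drop (Suc i) vs) = k" if "i < Suc k" for i using that len by simp
  have "extd_on S (\<lambda>y us. \<alpha> (\<Theta> y) (map (\<lambda>u. dirD S \<Theta> u y) us)) x vs =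
     (\<Sum>i<Suc k. (-1) ^ i *\<^sub>R dirD T (\<lambda>z. \<alpha> z (map D (take i vs @ drop (Suc i) vs))) (D (vs ! i)) (\<Theta> x)) +
     (\<Sum>i<Suc k. (-1) ^ i *\<^sub>R (\<Sum>j<k. \<alpha> (\<Theta> x) ((map D (take i vs @ drop (Suc i) vs))[j := dirD S (dirD S \<Theta> ((take i vs @ drop (Suc i) vs) ! j)) (vs ! i) x])))"
    unfolding extd_on_def len sum.distrib[symmetric] scaleR_add_right[symmetric]
    by (intro sum.cong refl arg_cong2[where f = scaleR] der rem) simp
  also have "(\<Sum>i<Suc k. (-1) ^ i *\<^sub>R (\<Sum>j<k. \<alpha> (\<Theta> x) ((map D (take i vs @ drop (Suc i) vs))[j := dirD S (dirD S \<Theta> ((take i vs @ drop (Suc i) vs) ! j)) (vs ! i) x])))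
    = (\<Sum>i<Suc k. (-1) ^ i *\<^sub>R (\<Sum>j<k. \<alpha> (\<Theta> x) ((take i (map D vs) @ drop (Suc i) (map D vs))[j := H i (if j < i then j else Suc j)])))"
  proof (intro sum.cong refl arg_cong2[where f = scaleR] arg_cong[where f = "\<alpha> (\<Theta> x)"])
    fix i j assume "i \<in> {..<Suc k}" "j \<in> {..<k}"
    then show "(map D (take i vs @ drop (Suc i) vs))[j := dirD S (dirD S \<Theta> ((take i vs @ drop (Suc i) vs) ! j)) (vs ! i) x] =
       (take i (map D vs) @ drop (Suc i) (map D vs))[j := H i (if j < i then j else Suc j)]"
      using nth_remove[of i vs j] len by (simp add: H_def take_map drop_map)
  qed
  also have "\<dots> = 0"
  proof (rule alternating_sum_cancel[OF al[OF ST[OF x]]])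
    show "length (map D vs) = Suc k" using len by simp
    show "H i j = H j i" for i j unfolding H_def by (rule second_derivative_symmetric[OF S x \<Theta>])
  qed
  also have "(\<Sum>i<Suc k. (-1) ^ i *\<^sub>R dirD T (\<lambda>z. \<alpha> z (map D (take i vs @ drop (Suc i) vs))) (D (vs ! i)) (\<Theta> x)) = extd_on T \<alpha> (\<Theta> x) (map D vs)"
    unfolding extd_on_def length_map len by (intro sum.cong refl) (use len in \<open>simp add: take_map drop_map\<close>)
  finally show ?thesis by (simp add: D_def)
qed

lemma smooth_on_Pair:
  fixes f :: "'a::euclidean_space \<Rightarrow> 'b::real_normed_vector" and g :: "'a \<Rightarrow> 'c::real_normed_vector"
  assumes "nice S" "smooth_on S f" "smooth_on S g" shows "smooth_on S (\<lambda>x. (f x, g x))"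
proof -
  have "smooth_on S (\<lambda>x. (f x, 0) + (0, g x))"
    by (intro smooth_on_add assms smooth_on_bl[of "\<lambda>u. (u, 0)"] smooth_on_bl[of "\<lambda>u. (0, u)"])
      (auto intro!: bounded_linear_intros bounded_linear_Pair)
  then show ?thesis by simp
qed

subsection \<open>Forms transported by time-dependent maps\<close>

text \<open>Space-time setting: the map \<theta> and the forms on the target may both depend on
  time, and S and T may contain points at time 0.\<close>

locale transported =
  fixes S T :: "(real \<times> 'a::euclidean_space) set" and \<theta> :: "real \<times> 'a \<Rightarrow> 'a"
  assumes S: "nice S" and T: "nice T" and \<theta>: "smooth_on S \<theta>" and ST: "\<And>p. p \<in> S \<Longrightarrow> (fst p, \<theta> p) \<in> T"
begin

definition \<Theta> :: "real \<times> 'a \<Rightarrow> real \<times> 'a" where "\<Theta> p = (fst p, \<theta> p)"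
definition D\<theta> :: "real \<times> 'a \<Rightarrow> 'a \<Rightarrow> 'a" where "D\<theta> p u = dirD S \<theta> (0, u) p"
definition vel :: "real \<times> 'a \<Rightarrow> 'a" where "vel p = dirD S \<theta> (1, 0) p"

definition pull :: "(real \<times> 'a \<Rightarrow> ('a, 'c) mform) \<Rightarrow> real \<times> 'a \<Rightarrow> ('a, 'c) mform" where
  "pull \<alpha> p us = \<alpha> (\<Theta> p) (map (D\<theta> p) us)"

text \<open>The exterior derivative at fixed time.\<close>

definition space_d :: "(real \<times> 'a) set \<Rightarrow> (real \<times> 'a \<Rightarrow> ('a, 'c::real_normed_vector) mform) \<Rightarrow> real \<times> 'a \<Rightarrow> ('a, 'c) mform" where
  "space_d R \<alpha> p vs = (\<Sum>i<length vs. (-1) ^ i *\<^sub>R dirD R (\<lambda>q. \<alpha> q (take i vs @ drop (Suc i) vs)) (0, vs ! i) p)"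

lemma smooth_\<Theta>: "smooth_on S \<Theta>"
  unfolding \<Theta>_def[abs_def] by (intro smooth_on_Pair S \<theta> smooth_on_bl[OF bounded_linear_fst] smooth_on_id)

lemma dirD_\<Theta>: "p \<in> S \<Longrightarrow> dirD S \<Theta> u p = (fst u, dirD S \<theta> u p)"
proof -
  assume p: "p \<in> S"
  have "(\<Theta> has_derivative (\<lambda>u. (fst u, dirD S \<theta> u p))) (at p within S)"
    unfolding \<Theta>_def[abs_def]
    by (intro has_derivative_Pair smooth_on_has_fd[OF \<theta> p] bounded_linear.has_derivative[OF bounded_linear_fst] has_derivative_ident)
  from fd_eq[OF S p this] show ?thesis by simp
qed

lemma \<Theta>_in: "p \<in> S \<Longrightarrow> \<Theta> p \<in> T" by (simp add: \<Theta>_def ST)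

lemma D\<theta>_linear: "p \<in> S \<Longrightarrow> linear (D\<theta> p)"
  using linear_compose[of "\<lambda>u. (0, u)" "frechet_derivative \<theta> (at p within S)"] smooth_on_linear_fd[OF \<theta>, of p]
  by (simp add: D\<theta>_def[abs_def] o_def linear_iff)

text \<open>Ignoring time components of vectors (\<open>map snd\<close>) turns \<alpha> into a form
  on space-time. Then \<open>extd_on_pullback\<close> treats derivatives in time and in space at
  once.\<close>

lemma extd_on_lift:
  assumes "p \<in> S" and al: "\<And>p. p \<in> T \<Longrightarrow> alternating k (\<alpha> p)" and sm: "\<And>vs. length vs = k \<Longrightarrow> smooth_on T (\<lambda>p. \<alpha> p vs)"
    and "length us = Suc k"
  shows "extd_on S (\<lambda>q us. \<alpha> (\<Theta> q) (map (\<lambda>u. dirD S \<theta> u q) us)) p us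
    = extd_on T (\<lambda>q us. \<alpha> q (map snd us)) (\<Theta> p) (map (\<lambda>u. (fst u, dirD S \<theta> u p)) us)"
proof -
  have 1: "extd_on S (\<lambda>y us. \<alpha> (\<Theta> y) (map snd (map (\<lambda>u. dirD S \<Theta> u y) us))) p us
     = extd_on T (\<lambda>q us. \<alpha> q (map snd us)) (\<Theta> p) (map (\<lambda>u. dirD S \<Theta> u p) us)"
    by (rule extd_on_pullback[OF S smooth_\<Theta> \<Theta>_in, where \<alpha> = "\<lambda>q us. \<alpha> q (map snd us)"])
      (use assms alt_map[OF al, of _ snd] in \<open>auto simp: linear_snd\<close>)
  have "extd_on S (\<lambda>q us. \<alpha> (\<Theta> q) (map (\<lambda>u. dirD S \<theta> u q) us)) p us =
      extd_on S (\<lambda>y us. \<alpha> (\<Theta> y) (map snd (map (\<lambda>u. dirD S \<Theta> u y) us))) p us"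
    unfolding extd_on_def
    by (intro sum.cong refl arg_cong2[where f = scaleR] fun_cong[OF fd_cong(1)[OF assms(1)]]) (simp add: dirD_\<Theta> o_def)
  moreover have "frechet_derivative \<Theta> (at p within S) = (\<lambda>u. (fst u, dirD S \<theta> u p))"
    using dirD_\<Theta>[OF assms(1)] by (rule ext)
  ultimately show ?thesis unfolding 1 by simp
qed

lemma remove_map: "take i (map f vs) @ drop (Suc i) (map f vs) = map f (take i vs @ drop (Suc i) vs)"
  by (simp add: take_map drop_map)

theorem space_d_pull:
  assumes "p \<in> S" and al: "\<And>p. p \<in> T \<Longrightarrow> alternating k (\<alpha> p)" and sm: "\<And>vs. length vs = k \<Longrightarrow> smooth_on T (\<lambda>p. \<alpha> p vs)"
    and "length vs = Suc k"
  shows "space_d S (pull \<alpha>) p vs = space_d T \<alpha> (\<Theta> p) (map (D\<theta> p) vs)"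
proof -
  let ?us = "map (\<lambda>v. (0::real, v)) vs"
  have "extd_on S (\<lambda>q us. \<alpha> (\<Theta> q) (map (\<lambda>u. dirD S \<theta> u q) us)) p ?us = space_d S (pull \<alpha>) p vs"
    unfolding extd_on_def space_d_def remove_map pull_def length_map
    by (intro sum.cong refl) (simp add: o_def D\<theta>_def[abs_def])
  moreover have "extd_on T (\<lambda>q us. \<alpha> q (map snd us)) (\<Theta> p) (map (\<lambda>u. (fst u, dirD S \<theta> u p)) ?us) = space_d T \<alpha> (\<Theta> p) (map (D\<theta> p) vs)"
    unfolding extd_on_def space_d_def map_map remove_map length_map
    by (intro sum.cong refl) (simp add: o_def D\<theta>_def[abs_def])
  ultimately show ?thesis using extd_on_lift[OF assms(1) al sm, of ?us] assms(4) by simp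
qed

text \<open>Cartan's formula, read off from d of the space-time form on (\<partial>_t, v_1, ...,
  v_k). On the source this is the time derivative of the pullback minus d of its contraction with
  the velocity; on the target closedness leaves the explicit time derivative of \<alpha>.\<close>

theorem time_derivative_pull:
  assumes p: "p \<in> S" and al: "\<And>p. p \<in> T \<Longrightarrow> alternating k (\<alpha> p)" and sm: "\<And>vs. length vs = k \<Longrightarrow> smooth_on T (\<lambda>p. \<alpha> p vs)"
    and closed: "\<And>vs. length vs = Suc k \<Longrightarrow> space_d T \<alpha> (\<Theta> p) vs = 0"
    and len: "length vs = k"
  shows "dirD S (\<lambda>q. pull \<alpha> q vs) (1, 0) p =
     space_d S (\<lambda>q us. \<alpha> (\<Theta> q) (vel q # map (D\<theta> q) us)) p vs + dirD T (\<lambda>q. \<alpha> q (map (D\<theta> p) vs)) (1, 0) (\<Theta> p)"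
proof -
  let ?us = "(1::real, 0) # map (\<lambda>v. (0::real, v)) vs"
  have 1: "extd_on S (\<lambda>q us. \<alpha> (\<Theta> q) (map (\<lambda>u. dirD S \<theta> u q) us)) p ?us =
     dirD S (\<lambda>q. pull \<alpha> q vs) (1, 0) p - space_d S (\<lambda>q us. \<alpha> (\<Theta> q) (vel q # map (D\<theta> q) us)) p vs"
  proof -
    have "(\<Sum>i<length vs. (-1) ^ Suc i *\<^sub>R dirD S (\<lambda>y. \<alpha> (\<Theta> y) (map (\<lambda>u. dirD S \<theta> u y) (take (Suc i) ?us @ drop (Suc (Suc i)) ?us))) (?us ! Suc i) p)
       = - space_d S (\<lambda>q us. \<alpha> (\<Theta> q) (vel q # map (D\<theta> q) us)) p vs"
      unfolding space_d_def sum_negf[symmetric]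
      by (intro sum.cong refl) (simp add: remove_map o_def D\<theta>_def[abs_def] vel_def take_map drop_map)
    then show ?thesis
      unfolding extd_on_def length_Cons sum.lessThan_Suc_shift length_map by (simp add: pull_def o_def D\<theta>_def[abs_def])
  qed
  have lin: "linear (\<lambda>h. dirD T (\<lambda>q. \<alpha> q ws) h (\<Theta> p))" if "length ws = k" for ws
    using smooth_on_linear_fd[OF sm[OF that] \<Theta>_in[OF p]] .
  let ?W = "map (D\<theta> p) vs"
  have 2: "extd_on T (\<lambda>q us. \<alpha> q (map snd us)) (\<Theta> p) (map (\<lambda>u. (fst u, dirD S \<theta> u p)) ?us) =
     dirD T (\<lambda>q. \<alpha> q ?W) (1, vel p) (\<Theta> p) - (\<Sum>i<k. (-1) ^ i *\<^sub>R dirD T (\<lambda>q. \<alpha> q (vel p # take i ?W @ drop (Suc i) ?W)) (0, ?W ! i) (\<Theta> p))"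
  proof -
    let ?us' = "map (\<lambda>u. (fst u, dirD S \<theta> u p)) ?us"
    have "(\<Sum>i<k. (-1) ^ Suc i *\<^sub>R dirD T (\<lambda>q. \<alpha> q (map snd (take (Suc i) ?us' @ drop (Suc (Suc i)) ?us'))) (?us' ! Suc i) (\<Theta> p))
       = - (\<Sum>i<k. (-1) ^ i *\<^sub>R dirD T (\<lambda>q. \<alpha> q (vel p # take i ?W @ drop (Suc i) ?W)) (0, ?W ! i) (\<Theta> p))"
      unfolding sum_negf[symmetric]
      by (intro sum.cong refl) (use len in \<open>simp add: take_map drop_map o_def D\<theta>_def[abs_def] vel_def\<close>)
    then show ?thesis
      unfolding extd_on_def length_Cons length_map sum.lessThan_Suc_shift len by (simp add: o_def D\<theta>_def[abs_def] vel_def)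
  qed
  \<comment> \<open>Closedness at fixed time expresses the derivative in direction
    \<open>vel p\<close> by the sum in fact \<open>2\<close>, which therefore cancels.\<close>
  have "space_d T \<alpha> (\<Theta> p) (vel p # ?W) = dirD T (\<lambda>q. \<alpha> q ?W) (0, vel p) (\<Theta> p)
     - (\<Sum>i<k. (-1) ^ i *\<^sub>R dirD T (\<lambda>q. \<alpha> q (vel p # take i ?W @ drop (Suc i) ?W)) (0, ?W ! i) (\<Theta> p))"
    unfolding space_d_def length_Cons length_map sum.lessThan_Suc_shift len by (simp add: sum_negf)
  moreover have "space_d T \<alpha> (\<Theta> p) (vel p # ?W) = 0" by (rule closed) (simp add: len)
  moreover have "dirD T (\<lambda>q. \<alpha> q ?W) (1, vel p) (\<Theta> p) = dirD T (\<lambda>q. \<alpha> q ?W) (1, 0) (\<Theta> p) + dirD T (\<lambda>q. \<alpha> q ?W) (0, vel p) (\<Theta> p)"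
    using linear_add[OF lin, of ?W "(1, 0)" "(0, vel p)"] len by simp
  ultimately have "extd_on T (\<lambda>q us. \<alpha> q (map snd us)) (\<Theta> p) (map (\<lambda>u. (fst u, dirD S \<theta> u p)) ?us) = dirD T (\<lambda>q. \<alpha> q ?W) (1, 0) (\<Theta> p)"
    unfolding 2 by simp
  then show ?thesis using extd_on_lift[OF p al sm, of ?us] len unfolding 1 by (simp add: diff_eq_eq add.commute)
qed

end

subsection \<open>The flow in coordinates\<close>

lemma dirD_add:
  fixes f g :: "'a::euclidean_space \<Rightarrow> 'b::real_normed_vector"
  shows "nice S \<Longrightarrow> x \<in> S \<Longrightarrow> smooth_on S f \<Longrightarrow> smooth_on S g \<Longrightarrow> dirD S (\<lambda>y. f y + g y) v x = dirD S f v x + dirD S g v x"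
  using fd_eq[OF _ _ has_derivative_add[OF smooth_on_has_fd smooth_on_has_fd], of S x f g] by simp

lemma dirD_diff:
  fixes f g :: "'a::euclidean_space \<Rightarrow> 'b::real_normed_vector"
  shows "nice S \<Longrightarrow> x \<in> S \<Longrightarrow> smooth_on S f \<Longrightarrow> smooth_on S g \<Longrightarrow> dirD S (\<lambda>y. f y - g y) v x = dirD S f v x - dirD S g v x"
  using fd_eq[OF _ _ has_derivative_diff[OF smooth_on_has_fd smooth_on_has_fd], of S x f g] by simp

lemma dirD_cmult:
  fixes f :: "'a::euclidean_space \<Rightarrow> real"
  shows "nice S \<Longrightarrow> x \<in> S \<Longrightarrow> smooth_on S f \<Longrightarrow> dirD S (\<lambda>y. c * f y) v x = c * dirD S f v x"
  by (rule smooth_dirD_bl[OF _ _ bounded_linear_mult_right])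

lemma smooth_on_cmult:
  fixes f :: "'a::euclidean_space \<Rightarrow> real"
  shows "nice S \<Longrightarrow> smooth_on S f \<Longrightarrow> smooth_on S (\<lambda>y. c * f y)"
  by (rule smooth_on_bl[OF bounded_linear_mult_right])

lemma slice_has_derivative:
  fixes f :: "'a::real_normed_vector \<times> 'b::real_normed_vector \<Rightarrow> 'c::real_normed_vector"
  assumes "(f has_derivative f') (at (t, x) within S)" "open U" "x \<in> U" "\<And>y. y \<in> U \<Longrightarrow> (t, y) \<in> S"
  shows "((\<lambda>y. f (t, y)) has_derivative (\<lambda>v. f' (0, v))) (at x)"
proof -
  have "((\<lambda>y. (t, y)) has_derivative (\<lambda>v. (0, v))) (at x within U)"
    by (intro has_derivative_Pair has_derivative_const has_derivative_ident)
  from has_derivative_in_compose[OF this has_derivative_subset[OF assms(1)]] assms(4)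
  have "((\<lambda>y. f (t, y)) has_derivative (\<lambda>v. f' (0, v))) (at x within U)" by auto
  then show ?thesis using at_within_open[OF assms(3,2)] by simp
qed

context transported
begin

lemma alternating_pull: "q \<in> S \<Longrightarrow> alternating k (\<alpha> (\<Theta> q)) \<Longrightarrow> alternating k (pull \<alpha> q)"
  unfolding pull_def using alt_map[OF _ D\<theta>_linear] by blast

lemma smooth_vel: "smooth_on S vel" unfolding vel_def[abs_def] by (rule smooth_on_dirD[OF \<theta>])

lemma smooth_D\<theta>: "smooth_on S (\<lambda>q. D\<theta> q v)" unfolding D\<theta>_def[abs_def] by (rule smooth_on_dirD[OF \<theta>])

lemma smooth_along:
  fixes \<alpha> :: "real \<times> 'a \<Rightarrow> ('a, 'c::real_normed_vector) mform"
  assumes al: "\<And>p. p \<in> T \<Longrightarrow> alternating k (\<alpha> p)" and sm: "\<And>vs. length vs = k \<Longrightarrow> smooth_on T (\<lambda>p. \<alpha> p vs)"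
  shows "length us = k \<Longrightarrow> smooth_on S (\<lambda>q. pull \<alpha> q us)"
    and "Suc (length us) = k \<Longrightarrow> smooth_on S (\<lambda>q. \<alpha> (\<Theta> q) (vel q # map (D\<theta> q) us))"
proof -
  have sm': "smooth_on S (\<lambda>q. \<alpha> (\<Theta> q) vs)" if "length vs = k" for vs
    by (rule smooth_on_compose[OF S smooth_\<Theta> sm[OF that] \<Theta>_in])
  note base = smooth_on_form_map[OF S al[OF \<Theta>_in] sm']
  have fs: "smooth_on S f" if "f \<in> set (map (\<lambda>u q. D\<theta> q u) us)" for f us
    using that smooth_D\<theta> by auto
  show "length us = k \<Longrightarrow> smooth_on S (\<lambda>q. pull \<alpha> q us)"
    using base[of "map (\<lambda>u q. D\<theta> q u) us", OF _ _ fs] by (simp add: pull_def o_def)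
  have "smooth_on S f" if "f \<in> set (vel # map (\<lambda>u q. D\<theta> q u) us)" for f
    using that smooth_D\<theta> smooth_vel by auto
  then show "Suc (length us) = k \<Longrightarrow> smooth_on S (\<lambda>q. \<alpha> (\<Theta> q) (vel q # map (D\<theta> q) us))"
    using base[of "vel # map (\<lambda>u q. D\<theta> q u) us"] by (simp add: o_def)
qed

lemma space_d_1: "space_d R \<gamma> p [u, v] = dirD R (\<lambda>q. \<gamma> q [v]) (0, u) p - dirD R (\<lambda>q. \<gamma> q [u]) (0, v) p"
  by (simp add: space_d_def numeral_eq_Suc)
lemma space_d_2: "space_d R \<gamma> p [u, v, w] = dirD R (\<lambda>q. \<gamma> q [v, w]) (0, u) p - dirD R (\<lambda>q. \<gamma> q [u, w]) (0, v) p + dirD R (\<lambda>q. \<gamma> q [u, v]) (0, w) p"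
  by (simp add: space_d_def numeral_eq_Suc)
lemma space_d_3: "space_d R \<gamma> p [u, v, w, z] = dirD R (\<lambda>q. \<gamma> q [v, w, z]) (0, u) p - dirD R (\<lambda>q. \<gamma> q [u, w, z]) (0, v) p
    + dirD R (\<lambda>q. \<gamma> q [u, v, z]) (0, w) p - dirD R (\<lambda>q. \<gamma> q [u, v, w]) (0, z) p"
  by (simp add: space_d_def numeral_eq_Suc)

lemma reduced_time_derivative:
  fixes w bR \<gamma> :: "real \<times> 'a \<Rightarrow> ('a, real) mform"
  assumes p: "p \<in> S" and r: "linear r"
    and w: "\<And>q. q \<in> T \<Longrightarrow> alternating 2 (w q)" "\<And>vs. length vs = 2 \<Longrightarrow> smooth_on T (\<lambda>q. w q vs)"
      "\<And>q vs. q \<in> T \<Longrightarrow> length vs = 3 \<Longrightarrow> space_d T w q vs = 0"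
    and bR: "\<And>q. q \<in> T \<Longrightarrow> alternating 3 (bR q)" "\<And>vs. length vs = 3 \<Longrightarrow> smooth_on T (\<lambda>q. bR q vs)"
      "\<And>q vs. q \<in> T \<Longrightarrow> length vs = 4 \<Longrightarrow> space_d T bR q vs = 0"
      "\<And>q vs. q \<in> T \<Longrightarrow> length vs = 3 \<Longrightarrow> dirD T (\<lambda>q. bR q vs) (1, 0) q = 0"
    and \<gamma>: "\<And>q. q \<in> T \<Longrightarrow> alternating 1 (\<gamma> q)" "\<And>vs. length vs = 1 \<Longrightarrow> smooth_on T (\<lambda>q. \<gamma> q vs)"
    and tw: "\<And>q u v. q \<in> T \<Longrightarrow> dirD T (\<lambda>q. w q [u, v]) (1, 0) q = - 3 * space_d T \<gamma> q [u, v]"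
    and ctr: "\<And>q v. q \<in> S \<Longrightarrow> w (\<Theta> q) [vel q, D\<theta> q v] = \<gamma> (\<Theta> q) [D\<theta> q v]"
  shows "dirD S (\<lambda>q. pull bR q [v1, v2, v3] - wedge 1 (covector_form r) (pull w q) [v1, v2, v3]) (1, 0) p =
     space_d S (\<lambda>q us. bR (\<Theta> q) (vel q # map (D\<theta> q) us)
        - 2 * (r (us ! 0) * w (\<Theta> q) [vel q, D\<theta> q (us ! 1)] - r (us ! 1) * w (\<Theta> q) [vel q, D\<theta> q (us ! 0)])) p [v1, v2, v3]"
proof -
  note cov = alternating_covector[OF r]
  \<comment> \<open>One d\<gamma> comes from Cartan's formula through \<open>ctr\<close>, and - 3
    d\<gamma> from the explicit time dependence \<open>tw\<close>.\<close>
  have dw: "dirD S (\<lambda>q. pull w q [u, v]) (1, 0) p = - 2 * space_d S (pull \<gamma>) p [u, v]" for u v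
  proof -
    have "dirD S (\<lambda>q. pull w q [u, v]) (1, 0) p =
      space_d S (\<lambda>q us. w (\<Theta> q) (vel q # map (D\<theta> q) us)) p [u, v] + dirD T (\<lambda>q. w q (map (D\<theta> p) [u, v])) (1, 0) (\<Theta> p)"
      by (rule time_derivative_pull[OF p w(1,2)]) (use w(3) \<Theta>_in[OF p] in auto)
    also have "space_d S (\<lambda>q us. w (\<Theta> q) (vel q # map (D\<theta> q) us)) p [u, v] = space_d S (pull \<gamma>) p [u, v]"
      unfolding space_d_1
      using fd_cong(1)[OF p, of "\<lambda>q. w (\<Theta> q) [vel q, D\<theta> q u]" "\<lambda>q. \<gamma> (\<Theta> q) [D\<theta> q u]"]
        fd_cong(1)[OF p, of "\<lambda>q. w (\<Theta> q) [vel q, D\<theta> q v]" "\<lambda>q. \<gamma> (\<Theta> q) [D\<theta> q v]"] ctr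
      by (simp add: pull_def)
    also have "dirD T (\<lambda>q. w q (map (D\<theta> p) [u, v])) (1, 0) (\<Theta> p) = - 3 * space_d T \<gamma> (\<Theta> p) (map (D\<theta> p) [u, v])"
      using tw[OF \<Theta>_in[OF p]] by simp
    also have "space_d T \<gamma> (\<Theta> p) (map (D\<theta> p) [u, v]) = space_d S (pull \<gamma>) p [u, v]"
      by (rule space_d_pull[OF p \<gamma>, symmetric]) auto
    finally show ?thesis by simp
  qed
  have db: "dirD S (\<lambda>q. pull bR q [v1, v2, v3]) (1, 0) p = space_d S (\<lambda>q us. bR (\<Theta> q) (vel q # map (D\<theta> q) us)) p [v1, v2, v3]"
    using time_derivative_pull[OF p bR(1,2), of "[v1, v2, v3]"] bR(3,4) \<Theta>_in[OF p] by simp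
  have spw: "smooth_on S (\<lambda>q. pull w q [u, v])" for u v by (rule smooth_along(1)[OF w(1,2)]) auto
  have spb: "smooth_on S (\<lambda>q. pull bR q [u, v, z])" for u v z by (rule smooth_along(1)[OF bR(1,2)]) auto
  have svb: "smooth_on S (\<lambda>q. bR (\<Theta> q) [vel q, D\<theta> q u, D\<theta> q v])" for u v
    using smooth_along(2)[OF bR(1,2), of "[u, v]"] by simp
  have spg: "smooth_on S (\<lambda>q. pull \<gamma> q [u])" for u by (rule smooth_along(1)[OF \<gamma>]) auto
  note sm = smooth_on_diff[OF S] smooth_on_add[OF S] smooth_on_cmult[OF S] spw spb spg svb
  note dd = dirD_diff[OF S p] dirD_add[OF S p] dirD_cmult[OF S p]
  have lhs: "dirD S (\<lambda>q. pull bR q [v1, v2, v3] - wedge 1 (covector_form r) (pull w q) [v1, v2, v3]) (1, 0) p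
     = dirD S (\<lambda>q. pull bR q [v1, v2, v3] - (r v1 * pull w q [v2, v3] - r v2 * pull w q [v1, v3] + r v3 * pull w q [v1, v2])) (1, 0) p"
    using fd_cong(1)[OF p, of "\<lambda>q. pull bR q [v1, v2, v3] - wedge 1 (covector_form r) (pull w q) [v1, v2, v3]"
      "\<lambda>q. pull bR q [v1, v2, v3] - (r v1 * pull w q [v2, v3] - r v2 * pull w q [v1, v3] + r v3 * pull w q [v1, v2])"]
      wedge_1_2[OF cov alternating_pull[where \<alpha> = w, OF _ w(1)[OF \<Theta>_in]]] by simp
  also have "\<dots> = dirD S (\<lambda>q. pull bR q [v1, v2, v3]) (1, 0) p - (r v1 * dirD S (\<lambda>q. pull w q [v2, v3]) (1, 0) p
      - r v2 * dirD S (\<lambda>q. pull w q [v1, v3]) (1, 0) p + r v3 * dirD S (\<lambda>q. pull w q [v1, v2]) (1, 0) p)"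
    by (simp add: dd sm)
  also have "\<dots> = space_d S (\<lambda>q us. bR (\<Theta> q) (vel q # map (D\<theta> q) us)) p [v1, v2, v3]
     + 2 * (r v1 * space_d S (pull \<gamma>) p [v2, v3] - r v2 * space_d S (pull \<gamma>) p [v1, v3] + r v3 * space_d S (pull \<gamma>) p [v1, v2])"
    unfolding dw db by (simp add: algebra_simps)
  \<comment> \<open>As r is constant, d(r \<and> \<gamma>) = - r \<and> d\<gamma>; this accounts for
    the change of sign.\<close>
  also have "\<dots> = space_d S (\<lambda>q us. bR (\<Theta> q) (vel q # map (D\<theta> q) us)
        - 2 * (r (us ! 0) * w (\<Theta> q) [vel q, D\<theta> q (us ! 1)] - r (us ! 1) * w (\<Theta> q) [vel q, D\<theta> q (us ! 0)])) p [v1, v2, v3]"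
  proof -
    have e: "dirD S (\<lambda>q. bR (\<Theta> q) [vel q, D\<theta> q u, D\<theta> q v] - 2 * (r u * w (\<Theta> q) [vel q, D\<theta> q v] - r v * w (\<Theta> q) [vel q, D\<theta> q u])) h p
      = dirD S (\<lambda>q. bR (\<Theta> q) [vel q, D\<theta> q u, D\<theta> q v]) h p - 2 * (r u * dirD S (\<lambda>q. pull \<gamma> q [v]) h p - r v * dirD S (\<lambda>q. pull \<gamma> q [u]) h p)"
      for u v h
    proof -
      have "dirD S (\<lambda>q. bR (\<Theta> q) [vel q, D\<theta> q u, D\<theta> q v] - 2 * (r u * w (\<Theta> q) [vel q, D\<theta> q v] - r v * w (\<Theta> q) [vel q, D\<theta> q u])) h p
        = dirD S (\<lambda>q. bR (\<Theta> q) [vel q, D\<theta> q u, D\<theta> q v] - 2 * (r u * pull \<gamma> q [v] - r v * pull \<gamma> q [u])) h p"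
        by (rule fun_cong[OF fd_cong(1)[OF p]]) (simp add: ctr pull_def)
      also have "\<dots> = dirD S (\<lambda>q. bR (\<Theta> q) [vel q, D\<theta> q u, D\<theta> q v]) h p - 2 * (r u * dirD S (\<lambda>q. pull \<gamma> q [v]) h p - r v * dirD S (\<lambda>q. pull \<gamma> q [u]) h p)"
        by (simp add: dd sm)
      finally show ?thesis .
    qed
    let ?h = "\<lambda>u v q. bR (\<Theta> q) [vel q, D\<theta> q u, D\<theta> q v] - 2 * (r u * w (\<Theta> q) [vel q, D\<theta> q v] - r v * w (\<Theta> q) [vel q, D\<theta> q u])"
    have "space_d S (\<lambda>q us. bR (\<Theta> q) (vel q # map (D\<theta> q) us)
        - 2 * (r (us ! 0) * w (\<Theta> q) [vel q, D\<theta> q (us ! 1)] - r (us ! 1) * w (\<Theta> q) [vel q, D\<theta> q (us ! 0)])) p [v1, v2, v3]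
      = dirD S (?h v2 v3) (0, v1) p - dirD S (?h v1 v3) (0, v2) p + dirD S (?h v1 v2) (0, v3) p"
      by (simp add: space_d_2)
    then show ?thesis unfolding e space_d_2 space_d_1 by (simp add: algebra_simps)
  qed
  finally show ?thesis .
qed

end

lemma hodge_star_zero: "(\<And>vs. length vs = k \<Longrightarrow> \<beta> vs = 0) \<Longrightarrow> hodge_star g vol k \<beta> ws = 0"
  using hodge_star_cong[of k \<beta> "\<lambda>vs. 0" g vol ws] by (simp add: hodge_star_def)

lemma codiff_zero:
  assumes U: "open U" "x \<in> U" and z: "\<And>y vs. y \<in> U \<Longrightarrow> length vs = k \<Longrightarrow> \<alpha> c y vs = 0"
  shows "codiff \<phi> k \<alpha> c x ws = 0"
proof -
  define st where "st = (\<lambda>j \<beta> c x. hodge_star (g2_metric (\<phi> c x)) (g2_volume (\<phi> c x)) j (\<beta> c x))"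
  have "st k \<alpha> c y vs = 0" if "y \<in> U" for y vs unfolding st_def by (rule hodge_star_zero) (rule z[OF that])
  then have "frechet_derivative (\<lambda>y. st k \<alpha> c y vs) (at x) = frechet_derivative (\<lambda>y. 0) (at x)" for vs
    by (intro fd_cong_open[OF U]) auto
  then have "ext_d (st k \<alpha>) c x vs = 0" for vs by (simp add: ext_d_def)
  then show ?thesis unfolding codiff_def Let_def st_def[symmetric]
    by (simp add: hodge_star_zero st_def)
qed

context transported
begin

text \<open>
  The Laplacian of the transported 3-form is the exterior derivative of
  \<open>\<iota>\<^sub>V Re b - 2 r \<and> \<iota>\<^sub>V w\<close>, where \<open>V\<close> is the velocity field, and so is its time derivative.
\<close>

theorem local_flow:
  fixes w :: "real \<times> 'a \<Rightarrow> ('a, real) mform" and b :: "real \<times> 'a \<Rightarrow> ('a, complex) mform"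
    and \<phi> :: "real \<Rightarrow> ('m, 'a, real) form" and F :: "real \<times> 'a \<Rightarrow> real" and J :: "'a \<Rightarrow> 'a"
  assumes dim: "DIM('a) = 7" and S_open: "S = ({0..} \<times> UNIV) \<inter> Q" "open Q" and p: "(t, x) \<in> S" and r: "linear r" and J: "linear J"
    and w: "\<And>q. q \<in> T \<Longrightarrow> alternating 2 (w q)" "\<And>vs. length vs = 2 \<Longrightarrow> smooth_on T (\<lambda>q. w q vs)"
      "\<And>q vs. q \<in> T \<Longrightarrow> length vs = 3 \<Longrightarrow> space_d T w q vs = 0"
    and b: "\<And>q. q \<in> T \<Longrightarrow> alternating 3 (b q)" "\<And>vs. length vs = 3 \<Longrightarrow> smooth_on T (\<lambda>q. b q vs)"
      "\<And>q vs. q \<in> T \<Longrightarrow> length vs = 4 \<Longrightarrow> space_d T b q vs = 0"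
      "\<And>q vs. q \<in> T \<Longrightarrow> length vs = 3 \<Longrightarrow> dirD T (\<lambda>q. b q vs) (1, 0) q = 0"
    and F: "smooth_on T F"
    and tw: "\<And>q u v. q \<in> T \<Longrightarrow> dirD T (\<lambda>q. w q [u, v]) (1, 0) q = - 3 * space_d T (\<lambda>q us. dirD T F (0, J (us ! 0)) q) q [u, v]"
    and ctr: "\<And>q v. q \<in> S \<Longrightarrow> w (\<Theta> q) [vel q, v] = dirD T F (0, J v) (\<Theta> q)"
    and frames: "\<And>q. q \<in> T \<Longrightarrow> \<exists>e. reduced_frame r (w q) (b q) (1 / F q) e \<and> dirD T F (0, e 0) q = 0 \<and>
        (\<forall>j\<in>{1..3}. dirD T F (0, J (e j)) q = dirD T F (0, e (j + 3)) q \<and> dirD T F (0, J (e (j + 3))) q = - dirD T F (0, e j) q)"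
    and rD: "\<And>q v. q \<in> S \<Longrightarrow> r (D\<theta> q v) = r v" and rV: "\<And>q. q \<in> S \<Longrightarrow> r (vel q) = 0"
    and bij: "\<And>q. q \<in> S \<Longrightarrow> inj (D\<theta> q)"
    and \<phi>: "\<And>s y vs. (s, y) \<in> S \<Longrightarrow> length vs = 3 \<Longrightarrow>
        \<phi> s c y vs = Re (pull b (s, y) vs) - wedge 1 (covector_form r) (pull w (s, y)) vs"
  shows "hodge_laplacian (\<phi> t) 3 (\<phi> t) c x [v1, v2, v3] = dirD S (\<lambda>q. \<phi> (fst q) c (snd q) [v1, v2, v3]) (1, 0) (t, x)"
    and "positive_3form (\<phi> t c x)" and "length us = 4 \<Longrightarrow> ext_d (\<phi> t) c x us = 0"
    and "length vs = 3 \<Longrightarrow> smooth_on S (\<lambda>q. \<phi> (fst q) c (snd q) vs)"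
proof -
  \<comment> \<open>The slice of S at time t is open in space, so \<open>ext_d\<close> and
    \<open>codiff\<close> may be computed on it with ordinary derivatives.\<close>
  define U where "U = {y. (t, y) \<in> S}"
  have t0: "t \<ge> 0" using p S_open by auto
  have "U = Pair t -` Q" using t0 S_open by (auto simp: U_def)
  then have U: "open U" using open_vimage[OF S_open(2), of "Pair t"] by (simp add: continuous_on_Pair continuous_on_id continuous_on_const)
  have xU: "x \<in> U" using p by (simp add: U_def)
  have US: "(t, y) \<in> S" if "y \<in> U" for y using that by (simp add: U_def)
  define bR where "bR q vs = Re (b q vs)" for q vs
  have lRe: "bounded_linear Re" by (rule bounded_linear_Re)
  define \<gamma> where "\<gamma> q us = dirD T F (0, J (us ! 0)) q" for q us
  have DFlin: "linear (\<lambda>h. dirD T F h q)" if "q \<in> T" for q using smooth_on_linear_fd[OF F that] .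
  have \<gamma>1: "alternating 1 (\<gamma> q)" if "q \<in> T" for q
  proof -
    have "linear (\<lambda>v. dirD T F (0, J v) q)"
      using linear_compose[of "\<lambda>v. (0, J v)" "\<lambda>h. dirD T F h q"] J DFlin[OF that] by (simp add: o_def linear_iff)
    from alternating_covector[OF this] show ?thesis by (simp add: \<gamma>_def[abs_def])
  qed
  have \<gamma>2: "smooth_on T (\<lambda>q. \<gamma> q vs)" for vs unfolding \<gamma>_def by (rule smooth_on_dirD[OF F])
  have tw': "dirD T (\<lambda>q. w q [u, v]) (1, 0) q = - 3 * space_d T \<gamma> q [u, v]" if "q \<in> T" for q u v
    unfolding \<gamma>_def[abs_def] by (rule tw[OF that])
  have bR1: "alternating 3 (bR q)" if "q \<in> T" for q unfolding bR_def[abs_def] by (rule alternating_Re[OF b(1)[OF that]])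
  have bR2: "smooth_on T (\<lambda>q. bR q vs)" if "length vs = 3" for vs
    unfolding bR_def by (rule smooth_on_bl[OF lRe T b(2)[OF that]])
  have bRd: "dirD T (\<lambda>q. bR q vs) h q = Re (dirD T (\<lambda>q. b q vs) h q)" if "length vs = 3" "q \<in> T" for vs h q
    unfolding bR_def by (rule smooth_dirD_bl[OF T that(2) lRe b(2)[OF that(1)]])
  have bR3: "space_d T bR q vs = 0" if "q \<in> T" "length vs = 4" for q vs
  proof -
    have "space_d T bR q vs = Re (space_d T b q vs)"
      unfolding space_d_def Re_sum using that by (intro sum.cong refl) (simp add: bRd)
    then show ?thesis using b(3)[OF that] by simp
  qed
  have bR4: "dirD T (\<lambda>q. bR q vs) (1, 0) q = 0" if "q \<in> T" "length vs = 3" for q vs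
    using bRd[OF that(2,1)] b(4)[OF that] by simp
  have pullR: "Re (pull b q vs) = pull bR q vs" for q vs by (simp add: pull_def bR_def)
  note cov = alternating_covector[OF r]
  have pw2: "alternating 2 (pull w q)" if "q \<in> S" for q by (rule alternating_pull[where \<alpha> = w, OF that w(1)[OF \<Theta>_in[OF that]]])
  have pb3: "alternating 3 (pull b q)" if "q \<in> S" for q by (rule alternating_pull[where \<alpha> = b, OF that b(1)[OF \<Theta>_in[OF that]]])
  have spw: "smooth_on S (\<lambda>q. pull w q [u, v])" for u v by (rule smooth_along(1)[OF w(1,2)]) auto
  have spb: "smooth_on S (\<lambda>q. pull b q [u, v, z])" for u v z by (rule smooth_along(1)[OF b(1,2)]) auto
  have spbR: "smooth_on S (\<lambda>q. pull bR q [u, v, z])" for u v z by (rule smooth_along(1)[OF bR1 bR2]) auto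
  define f where "f q vs = pull bR q vs - wedge 1 (covector_form r) (pull w q) vs" for q vs
  have \<phi>f: "\<phi> s c y vs = f (s, y) vs" if "(s, y) \<in> S" "length vs = 3" for s y vs
    using \<phi>[OF that] by (simp add: f_def pullR)
  have f3: "f q [u, v, z] = pull bR q [u, v, z] - (r u * pull w q [v, z] - r v * pull w q [u, z] + r z * pull w q [u, v])" if "q \<in> S" for q u v z
    using wedge_1_2[OF cov pw2[OF that]] by (simp add: f_def)
  have sf: "smooth_on S (\<lambda>q. f q [u, v, z])" for u v z
    using f3 by (subst smooth_on_cong) (auto intro!: smooth_on_diff[OF S] smooth_on_add[OF S] smooth_on_cmult[OF S] spw spbR)
  have three: "\<exists>u v z. vs = [u, v, z]" if "length vs = 3" for vs :: "'a list" using that by (auto simp: numeral_eq_Suc length_Suc_conv)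
  have s\<phi>: "smooth_on S (\<lambda>q. \<phi> (fst q) c (snd q) vs)" if L: "length vs = 3" for vs
  proof -
    obtain u v z where vs: "vs = [u, v, z]" using three[OF L] by blast
    show ?thesis unfolding vs by (subst smooth_on_cong[OF \<phi>f[of "fst _" "snd _"]]) (auto intro: sf)
  qed
  then show "length vs = 3 \<Longrightarrow> smooth_on S (\<lambda>q. \<phi> (fst q) c (snd q) vs)" by simp
  have slice: "((\<lambda>y. g (t, y)) has_derivative (\<lambda>v. dirD S g (0, v) (t, y))) (at y)" if "smooth_on S g" "y \<in> U"
    for g :: "real \<times> 'a \<Rightarrow> 'x::real_normed_vector" and y
    by (rule slice_has_derivative[OF smooth_on_has_fd[OF that(1) US[OF that(2)]] U that(2) US])
  have slice_fd: "frechet_derivative (\<lambda>y. h y) (at y) v = dirD S g (0, v) (t, y)"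
    if "smooth_on S g" "y \<in> U" "\<And>y. y \<in> U \<Longrightarrow> h y = g (t, y)" for h g y v
  proof -
    have "frechet_derivative h (at y) = frechet_derivative (\<lambda>y. g (t, y)) (at y)" by (rule fd_cong_open[OF U that(2,3)])
    also have "\<dots> = (\<lambda>v. dirD S g (0, v) (t, y))" by (rule frechet_derivative_at[symmetric, OF slice[OF that(1,2)]])
    finally show ?thesis by simp
  qed
  have cw: "space_d S (pull w) q vs = 0" if "q \<in> S" "length vs = 3" for q vs
    using space_d_pull[OF that(1) w(1,2), of vs] w(3)[OF \<Theta>_in[OF that(1)], of "map (D\<theta> q) vs"] that(2) by simp
  have cb: "space_d S (pull b) q vs = 0" if "q \<in> S" "length vs = 4" for q vs
    using space_d_pull[OF that(1) b(1,2), of vs] b(3)[OF \<Theta>_in[OF that(1)], of "map (D\<theta> q) vs"] that(2) by simp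
  have cbR: "space_d S (pull bR) q vs = 0" if "q \<in> S" "length vs = 4" for q vs
    using space_d_pull[OF that(1) bR1 bR2, of vs] bR3[OF \<Theta>_in[OF that(1)], of "map (D\<theta> q) vs"] that(2) by simp
  have closed: "ext_d (\<phi> t) c y us = 0" if y: "y \<in> U" and us: "length us = 4" for y us
  proof -
    obtain a1 a2 a3 a4 where us: "us = [a1, a2, a3, a4]" using us by (auto simp: numeral_eq_Suc length_Suc_conv)
    have q: "(t, y) \<in> S" by (rule US[OF y])
    have fd: "frechet_derivative (\<lambda>y. \<phi> t c y [u, v, z]) (at y) h = dirD S (\<lambda>q. pull bR q [u, v, z]) (0, h) (t, y)
        - (r u * dirD S (\<lambda>q. pull w q [v, z]) (0, h) (t, y) - r v * dirD S (\<lambda>q. pull w q [u, z]) (0, h) (t, y) + r z * dirD S (\<lambda>q. pull w q [u, v]) (0, h) (t, y))"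
      for u v z h
    proof -
      have "frechet_derivative (\<lambda>y. \<phi> t c y [u, v, z]) (at y) h = dirD S (\<lambda>q. f q [u, v, z]) (0, h) (t, y)"
        by (rule slice_fd[OF sf y]) (simp add: \<phi>f US)
      also have "\<dots> = dirD S (\<lambda>q. pull bR q [u, v, z] - (r u * pull w q [v, z] - r v * pull w q [u, z] + r z * pull w q [u, v])) (0, h) (t, y)"
        by (rule fun_cong[OF fd_cong(1)[OF q f3]])
      finally show ?thesis
        by (simp add: dirD_diff[OF S q] dirD_add[OF S q] dirD_cmult[OF S q] smooth_on_diff[OF S] smooth_on_add[OF S] smooth_on_cmult[OF S] spw spbR)
    qed
    have "ext_d (\<phi> t) c y us = space_d S (pull bR) (t, y) [a1, a2, a3, a4] + (r a1 * space_d S (pull w) (t, y) [a2, a3, a4]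
        - r a2 * space_d S (pull w) (t, y) [a1, a3, a4] + r a3 * space_d S (pull w) (t, y) [a1, a2, a4] - r a4 * space_d S (pull w) (t, y) [a1, a2, a3])"
      by (simp add: ext_d_def us numeral_eq_Suc fd space_d_def algebra_simps)
    then show ?thesis using cw[OF q] cbR[OF q] by simp
  qed
  then show "length us = 4 \<Longrightarrow> ext_d (\<phi> t) c x us = 0" using xU by simp
  have al\<phi>: "alternating 3 (\<phi> t c y)" if "y \<in> U" for y
  proof -
    have "alternating 3 (\<lambda>vs. 1 * pull bR (t, y) vs + (- 1) * wedge 1 (covector_form r) (pull w (t, y)) vs)"
      using alternating_wedge[OF cov pw2[OF US[OF that]]] alternating_pull[where \<alpha> = bR, OF US[OF that] bR1[OF \<Theta>_in[OF US[OF that]]]]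
      by (intro alternating_lincomb) (auto simp: numeral_3_eq_3)
    then show ?thesis by (rule alt_subst) (simp add: \<phi>f[OF US[OF that]] f_def)
  qed
  define e0 where "e0 q = (SOME e. reduced_frame r (w q) (b q) (1 / F q) e \<and> dirD T F (0, e 0) q = 0 \<and>
        (\<forall>j\<in>{1..3}. dirD T F (0, J (e j)) q = dirD T F (0, e (j + 3)) q \<and> dirD T F (0, J (e (j + 3))) q = - dirD T F (0, e j) q))" for q
  have e0: "reduced_frame r (w q) (b q) (1 / F q) (e0 q)" "dirD T F (0, e0 q 0) q = 0"
      "\<And>j. j \<in> {1..3} \<Longrightarrow> dirD T F (0, J (e0 q j)) q = dirD T F (0, e0 q (j + 3)) q"
      "\<And>j. j \<in> {1..3} \<Longrightarrow> dirD T F (0, J (e0 q (j + 3))) q = - dirD T F (0, e0 q j) q" if "q \<in> T" for q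
    using someI_ex[OF frames[OF that]] unfolding e0_def[symmetric] by auto
  \<comment> \<open>The frame given at the image point is carried back by the inverse of the spatial
    derivative, because the metric of the pulled back form lives at the source point.\<close>
  define iD where "iD q = inv (D\<theta> q)" for q
  have iD: "D\<theta> q (iD q v) = v" if "q \<in> S" for q v
    unfolding iD_def by (rule surj_f_inv_f[OF linear_injective_imp_surjective[OF D\<theta>_linear[OF that] bij[OF that]]]) (rule refl)
  define e where "e q i = iD q (e0 (\<Theta> q) i)" for q i
  have fr: "reduced_frame r (pull w q) (pull b q) (1 / F (\<Theta> q)) (e q)" if q: "q \<in> S" for q
  proof -
    have "r (iD q v) = r v" for v using rD[OF q, of "iD q v"] iD[OF q, of v] by simp
    then show ?thesis
      using e0(1)[OF \<Theta>_in[OF q]] unfolding reduced_frame_def by (simp add: e_def pull_def iD[OF q] o_def)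
  qed
  show "positive_3form (\<phi> t c x)"
    by (rule g2_standard(1)[OF reduced_standard_frame[OF fr[OF p] r pw2[OF p] al\<phi>[OF xU]] reduced_coframe_dual[OF fr[OF p] r pw2[OF p] dim] dim])
      (use \<phi>[OF p] in auto)
  have cod: "codiff (\<phi> t) 3 (\<phi> t) c y [u, v] = bR (\<Theta> (t, y)) [vel (t, y), D\<theta> (t, y) u, D\<theta> (t, y) v]
      - 2 * (r u * w (\<Theta> (t, y)) [vel (t, y), D\<theta> (t, y) v] - r v * w (\<Theta> (t, y)) [vel (t, y), D\<theta> (t, y) u])"
    if y: "y \<in> U" for y u v
  proof -
    let ?q = "(t, y)"
    have q: "?q \<in> S" by (rule US[OF y])
    \<comment> \<open>The velocity seen at the source: contracting a pulled back form with Z is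
      contracting the form itself with \<open>vel\<close>.\<close>
    define Z where "Z = iD ?q (vel ?q)"
    have DZ: "D\<theta> ?q Z = vel ?q" by (simp add: Z_def iD[OF q])
    have sF: "smooth_on S (\<lambda>q. F (\<Theta> q))" by (rule smooth_on_compose[OF S smooth_\<Theta> F \<Theta>_in])
    define G' where "G' h = dirD T F (0, D\<theta> ?q h) (\<Theta> ?q)" for h
    have chain: "dirD S (\<lambda>q. F (\<Theta> q)) (0, h) ?q = G' h" for h
    proof -
      have "((\<lambda>q. F (\<Theta> q)) has_derivative (\<lambda>h. dirD T F (dirD S \<Theta> h ?q) (\<Theta> ?q))) (at ?q within S)"
        by (rule has_derivative_in_compose[OF smooth_on_has_fd[OF smooth_\<Theta> q] has_derivative_subset[OF smooth_on_has_fd[OF F \<Theta>_in[OF q]]]])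
          (use \<Theta>_in in auto)
      from fd_eq[OF S q this] show ?thesis by (simp add: dirD_\<Theta>[OF q] G'_def D\<theta>_def)
    qed
    have "codiff (\<phi> t) 3 (\<phi> t) c y [u, v] = Re (pull b (t, y) [Z, u, v]) - 2 * (r u * pull w (t, y) [Z, v] - r v * pull w (t, y) [Z, u])"
    proof (rule codiff_reduced[OF dim U y r, where G = "\<lambda>y. F (\<Theta> (t, y))" and e = "e ?q" and G' = G'
        and A = "\<lambda>u v h. dirD S (\<lambda>q. pull w q [u, v]) (0, h) ?q" and B = "\<lambda>u v z h. dirD S (\<lambda>q. pull b q [u, v, z]) (0, h) ?q"
        and a = "\<lambda>y. pull w (t, y)" and b = "\<lambda>y. pull b (t, y)"])
      show "alternating 2 (pull w (t, y))" if "y \<in> U" for y by (rule pw2[OF US[OF that]])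
      show "alternating 3 (pull b (t, y))" if "y \<in> U" for y by (rule pb3[OF US[OF that]])
      show "alternating 3 (\<phi> t c y)" if "y \<in> U" for y by (rule al\<phi>[OF that])
      show "\<phi> t c y vs = Re (pull b (t, y) vs) - wedge 1 (covector_form r) (pull w (t, y)) vs" if "y \<in> U" "length vs = 3" for y vs
        by (rule \<phi>[OF US[OF that(1)] that(2)])
      show "\<exists>e. reduced_frame r (pull w (t, y)) (pull b (t, y)) (1 / F (\<Theta> (t, y))) e" if "y \<in> U" for y
        using fr[OF US[OF that]] by blast
      show "((\<lambda>y. pull w (t, y) [u, v]) has_derivative (\<lambda>h. dirD S (\<lambda>q. pull w q [u, v]) (0, h) ?q)) (at y)" for u v
        by (rule slice[OF spw y])
      show "((\<lambda>y. pull b (t, y) [u, v, z]) has_derivative (\<lambda>h. dirD S (\<lambda>q. pull b q [u, v, z]) (0, h) ?q)) (at y)" for u v z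
        by (rule slice[OF spb y])
      show "((\<lambda>y. F (\<Theta> (t, y))) has_derivative G') (at y)"
        using slice[OF sF y] by (simp add: chain)
      show "dirD S (\<lambda>q. pull w q [v, z]) (0, u) ?q - dirD S (\<lambda>q. pull w q [u, z]) (0, v) ?q + dirD S (\<lambda>q. pull w q [u, v]) (0, z) ?q = 0" for u v z
        using cw[OF q, of "[u, v, z]"] by (simp add: space_d_2)
      show "dirD S (\<lambda>q. pull b q [v, z, z']) (0, u) ?q - dirD S (\<lambda>q. pull b q [u, z, z']) (0, v) ?q
          + dirD S (\<lambda>q. pull b q [u, v, z']) (0, z) ?q - dirD S (\<lambda>q. pull b q [u, v, z]) (0, z') ?q = 0" for u v z z'
        using cb[OF q, of "[u, v, z, z']"] by (simp add: space_d_3)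
      show "reduced_frame r (pull w ?q) (pull b ?q) (1 / F (\<Theta> ?q)) (e ?q)" by (rule fr[OF q])
      show "G' (e ?q 0) = 0" using e0(2)[OF \<Theta>_in[OF q]] by (simp add: G'_def e_def iD[OF q])
      have pZ: "pull w ?q [Z, e ?q i] = dirD T F (0, J (e0 (\<Theta> ?q) i)) (\<Theta> ?q)" for i
        using ctr[OF q, of "e0 (\<Theta> ?q) i"] by (simp add: pull_def DZ e_def iD[OF q])
      show "G' (e ?q j) = - pull w ?q [Z, e ?q (j + 3)]" if "j \<in> {1..3}" for j
        unfolding pZ using e0(4)[OF \<Theta>_in[OF q] that] by (simp add: G'_def e_def iD[OF q])
      show "G' (e ?q (j + 3)) = pull w ?q [Z, e ?q j]" if "j \<in> {1..3}" for j
        unfolding pZ using e0(3)[OF \<Theta>_in[OF q] that] by (simp add: G'_def e_def iD[OF q])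
      show "r Z = 0" using rD[OF q, of Z] rV[OF q] by (simp add: DZ)
    qed
    then show ?thesis by (simp add: pull_def DZ bR_def)
  qed
  define \<beta> where "\<beta> q us = bR (\<Theta> q) (vel q # map (D\<theta> q) us)
        - 2 * (r (us ! 0) * w (\<Theta> q) [vel q, D\<theta> q (us ! 1)] - r (us ! 1) * w (\<Theta> q) [vel q, D\<theta> q (us ! 0)])" for q us
  have s\<beta>: "smooth_on S (\<lambda>q. \<beta> q [u, v])" for u v
    unfolding \<beta>_def
    using smooth_along(2)[OF bR1 bR2, of "[u, v]"] smooth_along(2)[OF w(1,2), of "[u]"] smooth_along(2)[OF w(1,2), of "[v]"]
    by (auto intro!: smooth_on_diff[OF S] smooth_on_cmult[OF S])
  \<comment> \<open>The form is closed on the whole neighbourhood U, so this half of the Laplacian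
    vanishes.\<close>
  have "codiff (\<phi> t) (3 + 1) (ext_d (\<phi> t)) c x [v1, v2, v3] = 0"
    by (rule codiff_zero[OF U xU]) (use closed in simp)
  then have "hodge_laplacian (\<phi> t) 3 (\<phi> t) c x [v1, v2, v3] = ext_d (codiff (\<phi> t) 3 (\<phi> t)) c x [v1, v2, v3]"
    by (simp add: hodge_laplacian_def)
  also have "\<dots> = space_d S \<beta> (t, x) [v1, v2, v3]"
  proof -
    have "frechet_derivative (\<lambda>y. codiff (\<phi> t) 3 (\<phi> t) c y [u, v]) (at x) h = dirD S (\<lambda>q. \<beta> q [u, v]) (0, h) (t, x)" for u v h
      by (rule slice_fd[OF s\<beta> xU]) (simp add: cod \<beta>_def)
    then show ?thesis by (simp add: ext_d_def space_d_2 numeral_eq_Suc)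
  qed
  also have "\<dots> = dirD S (\<lambda>q. f q [v1, v2, v3]) (1, 0) (t, x)"
    unfolding f_def \<beta>_def
    by (rule reduced_time_derivative[symmetric, OF p r w bR1 bR2 bR3 bR4, where \<gamma> = \<gamma>])
      (use \<gamma>1 \<gamma>2 tw' ctr in \<open>auto simp: \<gamma>_def[of _ "[_]"]\<close>)
  also have "\<dots> = dirD S (\<lambda>q. \<phi> (fst q) c (snd q) [v1, v2, v3]) (1, 0) (t, x)"
    by (rule fun_cong[OF fd_cong(1)[OF p]]) (simp add: \<phi>f)
  finally show "hodge_laplacian (\<phi> t) 3 (\<phi> t) c x [v1, v2, v3] = dirD S (\<lambda>q. \<phi> (fst q) c (snd q) [v1, v2, v3]) (1, 0) (t, x)" .
qed

end

subsection \<open>Charts\<close>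

lemma cinv_in: "x \<in> cimg c \<Longrightarrow> cinv c x \<in> cdom c"
  unfolding cimg_def cinv_def by (rule inv_into_into)
lemma cmap_cinv: "x \<in> cimg c \<Longrightarrow> cmap c (cinv c x) = x"
  unfolding cimg_def cinv_def by (rule f_inv_into_f)
lemma cmap_in: "p \<in> cdom c \<Longrightarrow> cmap c p \<in> cimg c" by (simp add: cimg_def)

lemma valid_chart_inj: "valid_chart S c \<Longrightarrow> p \<in> cdom c \<Longrightarrow> cinv c (cmap c p) = p"
  unfolding valid_chart_def homeomorphism_def by blast

lemma overlap_iff:
  assumes "inj_on (cmap c) (cdom c)"
  shows "x \<in> overlap c c' \<longleftrightarrow> x \<in> cimg c \<and> cinv c x \<in> cdom c'"
proof
  assume "x \<in> overlap c c'"
  then obtain p where "p \<in> cdom c" "p \<in> cdom c'" "x = cmap c p" by (auto simp: overlap_def)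
  then show "x \<in> cimg c \<and> cinv c x \<in> cdom c'" using assms by (simp add: cimg_def cinv_def)
next
  assume "x \<in> cimg c \<and> cinv c x \<in> cdom c'"
  then show "x \<in> overlap c c'" unfolding overlap_def
    by (metis IntI cinv_in cmap_cinv imageI)
qed

locale complex_mfd =
  fixes X :: "('m::t2_space, complex^'n) atlas"
  assumes X: "complex_manifold X"
begin

lemma valid: "c \<in> X \<Longrightarrow> valid_chart (points X) c" using X by (simp add: complex_manifold_def)
lemma open_cimg: "c \<in> X \<Longrightarrow> open (cimg c)" using valid by (simp add: valid_chart_def)
lemma cinv_cmap: "c \<in> X \<Longrightarrow> p \<in> cdom c \<Longrightarrow> cinv c (cmap c p) = p" using valid valid_chart_inj by blast
lemma inj_cmap: "c \<in> X \<Longrightarrow> inj_on (cmap c) (cdom c)" using cinv_cmap by (metis inj_on_inverseI)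
lemma in_overlap: "c \<in> X \<Longrightarrow> x \<in> overlap c c' \<longleftrightarrow> x \<in> cimg c \<and> cinv c x \<in> cdom c'"
  by (rule overlap_iff[OF inj_cmap])

lemma cinv_continuous: "c \<in> X \<Longrightarrow> continuous_on (cimg c) (cinv c)"
  using valid by (auto simp: valid_chart_def homeomorphism_def)

lemma cdom_points: "c \<in> X \<Longrightarrow> cdom c \<subseteq> points X" by (auto simp: points_def)

lemma cinv_points: "c \<in> X \<Longrightarrow> x \<in> cimg c \<Longrightarrow> cinv c x \<in> points X"
  using cinv_in[of x c] cdom_points[of c] by blast

lemma open_overlap: assumes "c \<in> X" "c' \<in> X" shows "open (overlap c c')"
proof -
  obtain V where V: "open V" "cdom c' = points X \<inter> V"
    using valid[OF assms(2)] by (auto simp: valid_chart_def openin_open)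
  have "overlap c c' = cinv c -` V \<inter> cimg c"
  proof (rule set_eqI)
    fix x
    have "cinv c x \<in> points X" if "x \<in> cimg c" using cinv_in[OF that] cdom_points[OF assms(1)] by (rule subsetD[rotated])
    then show "x \<in> overlap c c' \<longleftrightarrow> x \<in> cinv c -` V \<inter> cimg c" using in_overlap[OF assms(1), of x c'] V(2) by auto
  qed
  then show ?thesis
    using continuous_open_preimage[OF cinv_continuous[OF assms(1)] open_cimg[OF assms(1)] V(1)] by (simp add: Int_commute)
qed

lemma transition_in: "c \<in> X \<Longrightarrow> c' \<in> X \<Longrightarrow> x \<in> overlap c c' \<Longrightarrow> transition c c' x \<in> overlap c' c"
  by (auto simp: in_overlap transition_def cmap_in cinv_cmap cinv_in)

lemma cinv_transition: "c \<in> X \<Longrightarrow> c' \<in> X \<Longrightarrow> x \<in> overlap c c' \<Longrightarrow> cinv c' (transition c c' x) = cinv c x"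
  by (auto simp: in_overlap transition_def cinv_cmap)

lemma smooth_transition: assumes "c \<in> X" "c' \<in> X" shows "smooth_on (overlap c c') (transition c c')"
proof -
  have n: "nice (overlap c c')" by (rule nice_open[OF open_overlap[OF assms]])
  have bl: "bounded_linear (\<lambda>z::complex. axis j z :: complex^'n)" for j
    by (auto simp: linear_conv_bounded_linear[symmetric] linear_iff axis_def vec_eq_iff)
  have "smooth_on (overlap c c') (\<lambda>x. \<Sum>j\<in>UNIV. axis j (transition c c' x $ j))"
    using X assms by (intro smooth_on_sum[OF n] smooth_on_bl[OF bl n]) (auto simp: complex_manifold_def holomorphic_fun_on_def)
  moreover have "(\<Sum>j\<in>UNIV. axis j (v $ j)) = v" for v :: "complex^'n"
    by (simp add: vec_eq_iff axis_def if_distrib cong: if_cong)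
  ultimately show ?thesis by simp
qed

lemma transition_has_derivative:
  assumes "c \<in> X" "c' \<in> X" "x \<in> overlap c c'"
  shows "(transition c c' has_derivative frechet_derivative (transition c c') (at x)) (at x)"
  using smooth_on_has_fd[OF smooth_transition[OF assms(1,2)] assms(3)] at_within_open[OF assms(3) open_overlap[OF assms(1,2)]] by simp

lemma transition_complex_linear:
  assumes "c \<in> X" "c' \<in> X" "x \<in> overlap c c'"
  shows "frechet_derivative (transition c c') (at x) (\<i> *s v) = \<i> *s frechet_derivative (transition c c') (at x) v"
proof -
  let ?D = "frechet_derivative (transition c c') (at x)"
  have D: "((\<lambda>x. transition c c' x $ j) has_derivative (\<lambda>v. ?D v $ j)) (at x)" for j
    by (rule bounded_linear.has_derivative[OF bounded_linear_vec_nth transition_has_derivative[OF assms]])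
  have "frechet_derivative (\<lambda>x. transition c c' x $ j) (at x) = (\<lambda>v. ?D v $ j)" for j
    by (rule frechet_derivative_at[OF D, symmetric])
  moreover have "frechet_derivative (\<lambda>x. transition c c' x $ j) (at x) (\<i> *s v) = \<i> * frechet_derivative (\<lambda>x. transition c c' x $ j) (at x) v" for j
    using X assms by (auto simp: complex_manifold_def holomorphic_fun_on_def)
  ultimately show ?thesis by (simp add: vec_eq_iff)
qed

definition form_law :: "nat \<Rightarrow> ('m, complex^'n, 'b) form \<Rightarrow> bool" where
  "form_law k \<alpha> \<longleftrightarrow> (\<forall>c\<in>X. \<forall>c'\<in>X. \<forall>x\<in>overlap c c'. \<forall>vs. length vs = k \<longrightarrow>
        \<alpha> c x vs = \<alpha> c' (transition c c' x) (map (frechet_derivative (transition c c') (at x)) vs))"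

text \<open>The transformation law makes the chart chosen in the definition of the pullback irrelevant.\<close>

lemma pullback_local:
  fixes h' :: "'e::real_normed_vector \<Rightarrow> complex^'n"
  assumes law: "form_law k \<alpha>" and c1: "c1 \<in> X" and V: "open V" "y \<in> V" "\<And>z. z \<in> V \<Longrightarrow> F (cinv C z) \<in> cdom c1"
    and h: "((\<lambda>z. cmap c1 (F (cinv C z))) has_derivative h') (at y)" and len: "length vs = k"
  shows "pullback X F \<alpha> C y vs = \<alpha> c1 (cmap c1 (F (cinv C y))) (map h' vs)"
proof -
  define c' where "c' = (SOME c'. c' \<in> X \<and> F (cinv C y) \<in> cdom c')"
  have "c' \<in> X \<and> F (cinv C y) \<in> cdom c'" unfolding c'_def by (rule someI[of _ c1]) (use c1 V in auto)
  then have c': "c' \<in> X" "F (cinv C y) \<in> cdom c'" by auto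
  let ?h = "\<lambda>z. cmap c1 (F (cinv C z))"
  have hy: "?h y \<in> overlap c1 c'" using c1 c' V by (simp add: in_overlap cmap_in cinv_cmap)
  have eq: "transition c1 c' (?h z) = cmap c' (F (cinv C z))" if "z \<in> V" for z
    using V(3)[OF that] c1 by (simp add: transition_def cinv_cmap)
  have "((\<lambda>z. transition c1 c' (?h z)) has_derivative (\<lambda>v. frechet_derivative (transition c1 c') (at (?h y)) (h' v))) (at y)"
    by (rule has_derivative_compose[OF h transition_has_derivative[OF c1 c'(1) hy]])
  then have "((\<lambda>z. cmap c' (F (cinv C z))) has_derivative (\<lambda>v. frechet_derivative (transition c1 c') (at (?h y)) (h' v))) (at y)"
    by (rule has_derivative_transform_within_open[OF _ V(1,2) eq])
  then have D: "frechet_derivative (\<lambda>z. cmap c' (F (cinv C z))) (at y) = (\<lambda>v. frechet_derivative (transition c1 c') (at (?h y)) (h' v))"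
    by (rule frechet_derivative_at[symmetric])
  have "pullback X F \<alpha> C y vs = \<alpha> c' (cmap c' (F (cinv C y))) (map (frechet_derivative (\<lambda>z. cmap c' (F (cinv C z))) (at y)) vs)"
    unfolding pullback_def c'_def[symmetric] Let_def ..
  also have "\<dots> = \<alpha> c' (transition c1 c' (?h y)) (map (frechet_derivative (transition c1 c') (at (?h y))) (map h' vs))"
    unfolding D eq[OF V(2)] by (simp add: o_def)
  also have "\<dots> = \<alpha> c1 (?h y) (map h' vs)"
    using law c1 c'(1) hy len unfolding form_law_def by simp
  finally show ?thesis .
qed

end

subsection \<open>Products with a torus\<close>

text \<open>Changes of chart are locally translations and hence do not affect coordinate
  differentials. The shift \<kappa> may depend on the point: two angle charts can differ by distinct
  multiples of 2 \<pi> on the components of their overlap.\<close>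

definition translation_atlas :: "('k, 'r::real_normed_vector) atlas \<Rightarrow> bool" where
  "translation_atlas D \<longleftrightarrow> (\<forall>d\<in>D. open (cimg d) \<and> inj_on (cmap d) (cdom d)) \<and>
    (\<forall>d\<in>D. \<forall>d'\<in>D. \<forall>r\<in>cimg d. cinv d r \<in> cdom d' \<longrightarrow>
       (\<exists>V \<kappa>. open V \<and> r \<in> V \<and> V \<subseteq> cimg d \<and> (\<forall>s\<in>V. cinv d s \<in> cdom d' \<and> cmap d' (cinv d s) = s + \<kappa>)))"

lemma prod_chart_simps:
  "cdom (prod_chart c d) = cdom c \<times> cdom d" "cmap (prod_chart c d) = map_prod (cmap c) (cmap d)"
  "cimg (prod_chart c d) = cimg c \<times> cimg d"
  by (auto simp: prod_chart_def cimg_def map_prod_def)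

lemma cinv_prod_chart:
  assumes "inj_on (cmap c) (cdom c)" "inj_on (cmap d) (cdom d)" "x \<in> cimg c" "y \<in> cimg d"
  shows "cinv (prod_chart c d) (x, y) = (cinv c x, cinv d y)"
proof -
  have "inj_on (map_prod (cmap c) (cmap d)) (cdom c \<times> cdom d)" by (rule map_prod_inj_on[OF assms(1,2)])
  moreover have "(cinv c x, cinv d y) \<in> cdom c \<times> cdom d" using cinv_in[OF assms(3)] cinv_in[OF assms(4)] by simp
  moreover have "map_prod (cmap c) (cmap d) (cinv c x, cinv d y) = (x, y)" using cmap_cinv[OF assms(3)] cmap_cinv[OF assms(4)] by simp
  ultimately show ?thesis unfolding cinv_def[of "prod_chart c d"] prod_chart_simps by (metis inv_into_f_f)
qed

lemma translation_atlas_prod: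
  fixes A :: "('k, 'r::real_normed_vector) atlas" and B :: "('l, 's::real_normed_vector) atlas"
  assumes "translation_atlas A" "translation_atlas B" shows "translation_atlas (prod_atlas A B)"
proof -
  have A: "open (cimg a)" "inj_on (cmap a) (cdom a)" if "a \<in> A" for a using assms(1) that by (auto simp: translation_atlas_def)
  have B: "open (cimg b)" "inj_on (cmap b) (cdom b)" if "b \<in> B" for b using assms(2) that by (auto simp: translation_atlas_def)
  show ?thesis unfolding translation_atlas_def
  proof (intro conjI ballI impI)
    fix d assume "d \<in> prod_atlas A B"
    then obtain a b where d: "d = prod_chart a b" "a \<in> A" "b \<in> B" by (auto simp: prod_atlas_def)
    show "open (cimg d)" "inj_on (cmap d) (cdom d)"
      using A[OF d(2)] B[OF d(3)] by (auto simp: d(1) prod_chart_simps open_Times intro: map_prod_inj_on)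
    fix d' r assume "d' \<in> prod_atlas A B" and r: "r \<in> cimg d" "cinv d r \<in> cdom d'"
    then obtain a' b' where d': "d' = prod_chart a' b'" "a' \<in> A" "b' \<in> B" by (auto simp: prod_atlas_def)
    obtain x y where xy: "r = (x, y)" "x \<in> cimg a" "y \<in> cimg b" using r(1) by (auto simp: d(1) prod_chart_simps)
    have ci: "cinv d (s, t) = (cinv a s, cinv b t)" if "s \<in> cimg a" "t \<in> cimg b" for s t
      unfolding d(1) by (rule cinv_prod_chart[OF A(2)[OF d(2)] B(2)[OF d(3)] that])
    have "cinv a x \<in> cdom a'" "cinv b y \<in> cdom b'" using r(2) ci[OF xy(2,3)] by (auto simp: xy(1) d'(1) prod_chart_simps)
    obtain V \<kappa> where V: "open V" "x \<in> V" "V \<subseteq> cimg a" "\<And>s. s \<in> V \<Longrightarrow> cinv a s \<in> cdom a' \<and> cmap a' (cinv a s) = s + \<kappa>"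
      using assms(1) d(2) d'(2) xy(2) \<open>cinv a x \<in> cdom a'\<close> unfolding translation_atlas_def by meson
    obtain W \<mu> where W: "open W" "y \<in> W" "W \<subseteq> cimg b" "\<And>s. s \<in> W \<Longrightarrow> cinv b s \<in> cdom b' \<and> cmap b' (cinv b s) = s + \<mu>"
      using assms(2) d(3) d'(3) xy(3) \<open>cinv b y \<in> cdom b'\<close> unfolding translation_atlas_def by meson
    show "\<exists>V \<kappa>. open V \<and> r \<in> V \<and> V \<subseteq> cimg d \<and> (\<forall>s\<in>V. cinv d s \<in> cdom d' \<and> cmap d' (cinv d s) = s + \<kappa>)"
    proof (intro exI[of _ "V \<times> W"] exI[of _ "(\<kappa>, \<mu>)"] conjI ballI)
      show "open (V \<times> W)" by (rule open_Times[OF V(1) W(1)])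
      show "r \<in> V \<times> W" using V W xy by simp
      show "V \<times> W \<subseteq> cimg d" using V W by (auto simp: d(1) prod_chart_simps)
      fix s assume "s \<in> V \<times> W"
      then obtain p q where s: "s = (p, q)" "p \<in> V" "q \<in> W" by blast
      have "cinv d s = (cinv a p, cinv b q)" using ci[of p q] s V(3) W(3) by auto
      then show "cinv d s \<in> cdom d'" "cmap d' (cinv d s) = s + (\<kappa>, \<mu>)"
        using V(4)[OF s(2)] W(4)[OF s(3)] by (auto simp: d'(1) prod_chart_simps s(1))
    qed
  qed
qed

lemma cis_inj_on_interval: "inj_on cis {a<..<a + 2 * pi}"
proof (rule inj_onI)
  fix x y assume xy: "x \<in> {a<..<a + 2 * pi}" "y \<in> {a<..<a + 2 * pi}" "cis x = cis y"
  then have "sin x = sin y \<and> cos x = cos y" by (auto simp: cis.ctr complex_eq_iff)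
  then obtain n :: int where "x = y + 2 * pi * n" using sin_cos_eq_iff[of x y] by auto
  moreover have "\<bar>x - y\<bar> < 2 * pi" using xy by auto
  ultimately have "\<bar>2 * pi * real_of_int n\<bar> < 2 * pi" by simp
  then have "\<bar>real_of_int n\<bar> < 1" by (simp add: abs_mult)
  then have "n = 0" by linarith
  then show "x = y" using \<open>x = y + 2 * pi * n\<close> by simp
qed

lemma circle_chart:
  assumes "d = Chart (cis ` {a<..<a + 2 * pi}) (inv_into {a<..<a + 2 * pi} cis)"
  shows "cimg d = {a<..<a + 2 * pi}" "inj_on (cmap d) (cdom d)" "\<And>s. s \<in> cimg d \<Longrightarrow> cinv d s = cis s"
    "\<And>s. s \<in> {a<..<a + 2 * pi} \<Longrightarrow> cis s \<in> cdom d \<and> cmap d (cis s) = s"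
proof -
  note inj = cis_inj_on_interval[of a]
  show 1: "cimg d = {a<..<a + 2 * pi}" using inj by (auto simp: assms cimg_def)
  show 2: "inj_on (cmap d) (cdom d)" by (auto simp: assms inj_on_inv_into)
  show 3: "cis s \<in> cdom d \<and> cmap d (cis s) = s" if "s \<in> {a<..<a + 2 * pi}" for s
    using inj that by (auto simp: assms)
  show "cinv d s = cis s" if "s \<in> cimg d" for s
    using that 1 3[of s] 2 unfolding cinv_def by (metis inv_into_f_f)
qed

lemma translation_atlas_circle: "translation_atlas circle"
  unfolding translation_atlas_def
proof (intro conjI ballI impI)
  fix d assume "d \<in> circle"
  then obtain a where a: "d = Chart (cis ` {a<..<a + 2 * pi}) (inv_into {a<..<a + 2 * pi} cis)" by (auto simp: circle_def)
  show "open (cimg d)" "inj_on (cmap d) (cdom d)" using circle_chart(1,2)[OF a] by auto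
  fix d' r assume "d' \<in> circle" and r: "r \<in> cimg d" "cinv d r \<in> cdom d'"
  then obtain b where b: "d' = Chart (cis ` {b<..<b + 2 * pi}) (inv_into {b<..<b + 2 * pi} cis)" by (auto simp: circle_def)
  have "cis r \<in> cis ` {b<..<b + 2 * pi}" using r circle_chart(3)[OF a r(1)] by (simp add: b)
  then obtain s where s: "s \<in> {b<..<b + 2 * pi}" "cis s = cis r" by auto
  define \<kappa> where "\<kappa> = s - r"
  have "cis \<kappa> = 1" using s(2) by (simp add: \<kappa>_def cis_divide[symmetric])
  then have cis: "cis (p + \<kappa>) = cis p" for p by (simp add: cis_mult[symmetric])
  \<comment> \<open>The angles of the first chart that the shift \<kappa> takes into the interval of
    the second.\<close>
  let ?V = "{a<..<a + 2 * pi} \<inter> {b - \<kappa><..<b + 2 * pi - \<kappa>}"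
  show "\<exists>V \<kappa>. open V \<and> r \<in> V \<and> V \<subseteq> cimg d \<and> (\<forall>s\<in>V. cinv d s \<in> cdom d' \<and> cmap d' (cinv d s) = s + \<kappa>)"
  proof (intro exI[of _ ?V] exI[of _ \<kappa>] conjI ballI)
    show "open ?V" by auto
    show "r \<in> ?V" using r(1) s(1) unfolding circle_chart(1)[OF a] \<kappa>_def greaterThanLessThan_iff Int_iff by linarith
    show "?V \<subseteq> cimg d" unfolding circle_chart(1)[OF a] by (rule Int_lower1)
    fix p assume p: "p \<in> ?V"
    then have "p \<in> cimg d" unfolding circle_chart(1)[OF a] by (rule IntD1)
    then have ci: "cinv d p = cis p" by (rule circle_chart(3)[OF a])
    have "p + \<kappa> \<in> {b<..<b + 2 * pi}" using p unfolding greaterThanLessThan_iff Int_iff by linarith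
    from circle_chart(4)[OF b this] show "cinv d p \<in> cdom d'" "cmap d' (cinv d p) = p + \<kappa>" by (auto simp: ci cis)
  qed
qed

text \<open>\<open>pullback\<close> picks some chart of the circle around the image point. It
  differs from d by a local translation, so the derivative is \<pi> whatever the choice.\<close>

lemma pullback_dangle:
  fixes \<pi> :: "'e::real_normed_vector \<Rightarrow> real"
  assumes d: "d \<in> circle" and V: "open V" "y \<in> V" "\<And>z. z \<in> V \<Longrightarrow> f (cinv C z) = cinv d (\<pi> z) \<and> \<pi> z \<in> cimg d"
    and \<pi>: "bounded_linear \<pi>" and len: "vs \<noteq> []"
  shows "pullback circle f dangle C y vs = \<pi> (vs ! 0)"
proof -
  define c' where "c' = (SOME c'. c' \<in> circle \<and> f (cinv C y) \<in> cdom c')"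
  have "c' \<in> circle \<and> f (cinv C y) \<in> cdom c'" unfolding c'_def
    by (rule someI[of _ d]) (use d V cinv_in[of "\<pi> y" d] in auto)
  then have c': "c' \<in> circle" "f (cinv C y) \<in> cdom c'" by auto
  then obtain W \<kappa> where W: "open W" "\<pi> y \<in> W" "W \<subseteq> cimg d" "\<And>s. s \<in> W \<Longrightarrow> cmap c' (cinv d s) = s + \<kappa>"
    using translation_atlas_circle d V(2,3) unfolding translation_atlas_def by (metis (no_types, lifting))
  have opn: "open (V \<inter> \<pi> -` W)"
    using V(1) W(1) linear_continuous_on[OF \<pi>, of UNIV] by (intro open_Int open_vimage) auto
  have "((\<lambda>z. \<pi> z + \<kappa>) has_derivative \<pi>) (at y)"
    using has_derivative_add[OF bounded_linear_imp_has_derivative[OF \<pi>] has_derivative_const[of \<kappa>]] by simp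
  then have "((\<lambda>z. cmap c' (f (cinv C z))) has_derivative \<pi>) (at y)"
    by (rule has_derivative_transform_within_open[OF _ opn]) (use V W in auto)
  from frechet_derivative_at[OF this]
  have "frechet_derivative (\<lambda>z. cmap c' (f (cinv C z))) (at y) = \<pi>" by simp
  then show ?thesis unfolding pullback_def c'_def[symmetric] Let_def dangle_def using len by simp
qed

lemma wedge_cong:
  assumes "\<And>us. length us = k \<Longrightarrow> \<alpha> us = \<alpha>' us" "\<And>us. length us = length vs - k \<Longrightarrow> \<beta> us = \<beta>' us"
  shows "wedge k \<alpha> \<beta> vs = wedge k \<alpha>' \<beta>' vs"
  unfolding wedge_def using assms by simp

context complex_mfd
begin

lemma pullback_snd:
  fixes D :: "('k, 'r::euclidean_space) atlas"
  assumes D: "translation_atlas D" "d \<in> D" and c: "c \<in> X" and law: "form_law k \<alpha>" and z: "r \<in> cimg d" "x \<in> cimg c" and len: "length vs = k"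
  shows "pullback X snd \<alpha> (prod_chart d c) (r, x) vs = \<alpha> c x (map snd vs)"
proof -
  have inj: "inj_on (cmap d) (cdom d)" "open (cimg d)" using D by (auto simp: translation_atlas_def)
  have ci: "cinv (prod_chart d c) z = (cinv d (fst z), cinv c (snd z))" if "z \<in> cimg d \<times> cimg c" for z
    using cinv_prod_chart[OF inj(1) inj_cmap[OF c], of "fst z" "snd z"] that by auto
  have opn: "open (cimg d \<times> cimg c)" by (rule open_Times[OF inj(2) open_cimg[OF c]])
  have "pullback X snd \<alpha> (prod_chart d c) (r, x) vs = \<alpha> c (cmap c (snd (cinv (prod_chart d c) (r, x)))) (map snd vs)"
  proof (rule pullback_local[OF law c opn _ _ _ len])
    show "(r, x) \<in> cimg d \<times> cimg c" using z by simp
    show "snd (cinv (prod_chart d c) z) \<in> cdom c" if "z \<in> cimg d \<times> cimg c" for z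
      using ci[OF that] cinv_in[of "snd z" c] that by auto
    have "(snd has_derivative snd) (at (r, x))" by (rule bounded_linear_imp_has_derivative[OF bounded_linear_snd])
    then show "((\<lambda>z. cmap c (snd (cinv (prod_chart d c) z))) has_derivative snd) (at (r, x))"
      by (rule has_derivative_transform_within_open[OF _ opn]) (use z ci in \<open>auto simp: cmap_cinv\<close>)
  qed
  then show ?thesis using ci[of "(r, x)"] z by (simp add: cmap_cinv)
qed

lemma product_overlap:
  fixes D :: "('k, 'r::euclidean_space) atlas"
  assumes D: "translation_atlas D" "d \<in> D" "d' \<in> D" and c: "c \<in> X" "c' \<in> X"
    and z: "(r, x) \<in> overlap (prod_chart d c) (prod_chart d' c')"
  shows "r \<in> cimg d" "x \<in> overlap c c'" "fst (transition (prod_chart d c) (prod_chart d' c') (r, x)) \<in> cimg d'"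
    "snd (transition (prod_chart d c) (prod_chart d' c') (r, x)) = transition c c' x"
    "frechet_derivative (transition (prod_chart d c) (prod_chart d' c')) (at (r, x)) = map_prod id (frechet_derivative (transition c c') (at x))"
proof -
  have inj: "inj_on (cmap d) (cdom d)" "open (cimg d)" "inj_on (cmap d') (cdom d')" using D by (auto simp: translation_atlas_def)
  have injp: "inj_on (cmap (prod_chart d c)) (cdom (prod_chart d c))"
    unfolding prod_chart_simps by (rule map_prod_inj_on[OF inj(1) inj_cmap[OF c(1)]])
  have zz: "r \<in> cimg d" "x \<in> cimg c" and ci: "cinv (prod_chart d c) (r, x) \<in> cdom (prod_chart d' c')"
    using z overlap_iff[OF injp] by (auto simp: prod_chart_simps)
  have cinv: "cinv (prod_chart d c) z = (cinv d (fst z), cinv c (snd z))" if "z \<in> cimg d \<times> cimg c" for z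
    using cinv_prod_chart[OF inj(1) inj_cmap[OF c(1)], of "fst z" "snd z"] that by auto
  show "r \<in> cimg d" by (rule zz(1))
  have dd: "cinv d r \<in> cdom d'" and cc: "cinv c x \<in> cdom c'" using ci cinv[of "(r, x)"] zz by (auto simp: prod_chart_simps)
  show x: "x \<in> overlap c c'" using cc zz by (simp add: in_overlap[OF c(1)])
  have tr: "transition (prod_chart d c) (prod_chart d' c') z = (cmap d' (cinv d (fst z)), transition c c' (snd z))" if "z \<in> cimg d \<times> cimg c" for z
    using cinv[OF that] by (simp add: transition_def prod_chart_simps)
  show "fst (transition (prod_chart d c) (prod_chart d' c') (r, x)) \<in> cimg d'"
    using tr[of "(r, x)"] zz dd by (simp add: cmap_in)
  show "snd (transition (prod_chart d c) (prod_chart d' c') (r, x)) = transition c c' x" using tr[of "(r, x)"] zz by simp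
  obtain V \<kappa> where V: "open V" "r \<in> V" "V \<subseteq> cimg d" "\<And>s. s \<in> V \<Longrightarrow> cmap d' (cinv d s) = s + \<kappa>"
    using D zz(1) dd unfolding translation_atlas_def by meson
  have "((\<lambda>z. (fst z + \<kappa>, transition c c' (snd z))) has_derivative (\<lambda>v. (fst v + 0, frechet_derivative (transition c c') (at x) (snd v)))) (at (r, x))"
  proof (rule has_derivative_Pair)
    show "((\<lambda>z. fst z + \<kappa>) has_derivative (\<lambda>v. fst v + 0)) (at (r, x))"
      by (intro has_derivative_add has_derivative_const bounded_linear_imp_has_derivative[OF bounded_linear_fst])
    show "((\<lambda>z. transition c c' (snd z)) has_derivative (\<lambda>v. frechet_derivative (transition c c') (at x) (snd v))) (at (r, x))"
      using has_derivative_compose[OF bounded_linear_imp_has_derivative[OF bounded_linear_snd], of "transition c c'" _ "(r, x)"]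
        transition_has_derivative[OF c x] by simp
  qed
  then have "(transition (prod_chart d c) (prod_chart d' c') has_derivative (\<lambda>v. (fst v + 0, frechet_derivative (transition c c') (at x) (snd v)))) (at (r, x))"
    by (rule has_derivative_transform_within_open[OF _ open_Times[OF V(1) open_cimg[OF c(1)]]])
      (use V zz tr in auto)
  from frechet_derivative_at[OF this]
  show "frechet_derivative (transition (prod_chart d c) (prod_chart d' c')) (at (r, x)) = map_prod id (frechet_derivative (transition c c') (at x))"
    by (simp add: fun_eq_iff)
qed

subsection \<open>Families of diffeomorphisms in charts\<close>

definition flow_dom :: "(real \<Rightarrow> 'm \<Rightarrow> 'm) \<Rightarrow> ('m, complex^'n) chart \<Rightarrow> ('m, complex^'n) chart \<Rightarrow> (real \<times> (complex^'n)) set" where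
  "flow_dom \<Theta> c c1 = {(t, x). 0 \<le> t \<and> x \<in> cimg c \<and> \<Theta> t (cinv c x) \<in> cdom c1}"

definition flow_map :: "(real \<Rightarrow> 'm \<Rightarrow> 'm) \<Rightarrow> ('m, complex^'n) chart \<Rightarrow> ('m, complex^'n) chart \<Rightarrow> real \<times> (complex^'n) \<Rightarrow> complex^'n" where
  "flow_map \<Theta> c c1 = (\<lambda>(t, x). cmap c1 (\<Theta> t (cinv c x)))"

text \<open>Joint continuity of the family makes the domain relatively open. A half-space
  intersected with an open set is the shape to which \<open>nice_Int_open\<close> and the slicing
  arguments apply.\<close>

lemma flow_dom_open:
  assumes \<Theta>: "smooth_family_of_diffeomorphisms X \<Theta>" and c: "c \<in> X" "c1 \<in> X"
  obtains Q where "open Q" "flow_dom \<Theta> c c1 = ({0..} \<times> UNIV) \<inter> Q"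
proof -
  have cont: "continuous_on ({0..} \<times> points X) (\<lambda>(t, p). \<Theta> t p)" using \<Theta> by (simp add: smooth_family_of_diffeomorphisms_def)
  have mp: "\<Theta> t p \<in> points X" if "t \<ge> 0" "p \<in> points X" for t p
    using \<Theta> that by (auto simp: smooth_family_of_diffeomorphisms_def diffeomorphism_def bij_betw_def)
  let ?g = "\<lambda>z. (\<lambda>(t, p). \<Theta> t p) (fst z, cinv c (snd z))"
  have "continuous_on ({0..} \<times> cimg c) (\<lambda>z. cinv c (snd z))"
    by (rule continuous_on_compose2[OF cinv_continuous[OF c(1)]]) (auto intro!: continuous_intros)
  then have g: "continuous_on ({0..} \<times> cimg c) ?g"
    by (intro continuous_on_compose2[OF cont] continuous_on_Pair continuous_on_fst continuous_on_id)
      (use subsetD[OF cdom_points[OF c(1)] cinv_in] in auto)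
  obtain V where V: "open V" "cdom c1 = points X \<inter> V"
    using valid[OF c(2)] by (auto simp: valid_chart_def openin_open)
  obtain Q where Q: "open Q" "Q \<inter> ({0..} \<times> cimg c) = ?g -` V \<inter> ({0..} \<times> cimg c)"
    using g V(1) unfolding continuous_on_open_invariant by blast
  show ?thesis
  proof
    show "open (Q \<inter> (UNIV \<times> cimg c))" using Q(1) open_cimg[OF c(1)] by (intro open_Int open_Times) auto
    have "\<Theta> t (cinv c x) \<in> cdom c1 \<longleftrightarrow> \<Theta> t (cinv c x) \<in> V" if "t \<ge> 0" "x \<in> cimg c" for t x
      using mp[OF that(1), of "cinv c x"] V(2) cinv_points[OF c(1) that(2)] by blast
    then have "flow_dom \<Theta> c c1 = ?g -` V \<inter> ({0..} \<times> cimg c)" unfolding flow_dom_def by auto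
    also have "\<dots> = ({0..} \<times> UNIV) \<inter> (Q \<inter> (UNIV \<times> cimg c))" unfolding Q(2)[symmetric] by blast
    finally show "flow_dom \<Theta> c c1 = ({0..} \<times> UNIV) \<inter> (Q \<inter> (UNIV \<times> cimg c))" .
  qed
qed

lemma smooth_flow_map:
  assumes "smooth_family_of_diffeomorphisms X \<Theta>" "c \<in> X" "c1 \<in> X" shows "smooth_on (flow_dom \<Theta> c c1) (flow_map \<Theta> c c1)"
  using assms unfolding smooth_family_of_diffeomorphisms_def flow_dom_def flow_map_def by blast

lemma flow_slice_open:
  assumes "smooth_family_of_diffeomorphisms X \<Theta>" "c \<in> X" "c1 \<in> X" "t \<ge> 0"
  shows "open {x. (t, x) \<in> flow_dom \<Theta> c c1}"
proof -
  obtain Q where Q: "open Q" "flow_dom \<Theta> c c1 = ({0..} \<times> UNIV) \<inter> Q" by (rule flow_dom_open[OF assms(1-3)])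
  have "{x. (t, x) \<in> flow_dom \<Theta> c c1} = Pair t -` Q" using assms(4) by (auto simp: Q(2))
  then show ?thesis using open_vimage[OF Q(1), of "Pair t"] by (simp add: continuous_on_Pair continuous_on_id continuous_on_const)
qed

lemma flow_slice_derivative:
  assumes "smooth_family_of_diffeomorphisms X \<Theta>" "c \<in> X" "c1 \<in> X" "(t, x) \<in> flow_dom \<Theta> c c1"
  shows "((\<lambda>y. cmap c1 (\<Theta> t (cinv c y))) has_derivative (\<lambda>v. dirD (flow_dom \<Theta> c c1) (flow_map \<Theta> c c1) (0, v) (t, x))) (at x)"
proof -
  have t: "t \<ge> 0" using assms(4) by (simp add: flow_dom_def)
  have "((\<lambda>y. flow_map \<Theta> c c1 (t, y)) has_derivative (\<lambda>v. dirD (flow_dom \<Theta> c c1) (flow_map \<Theta> c c1) (0, v) (t, x))) (at x)"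
    by (rule slice_has_derivative[OF smooth_on_has_fd[OF smooth_flow_map[OF assms(1-3)] assms(4)] flow_slice_open[OF assms(1-3) t]])
      (use assms(4) in simp_all)
  moreover have "(\<lambda>y. flow_map \<Theta> c c1 (t, y)) = (\<lambda>y. cmap c1 (\<Theta> t (cinv c y)))" by (simp add: flow_map_def)
  ultimately show ?thesis by (simp only:)
qed

lemma pullback_flow:
  assumes \<Theta>: "smooth_family_of_diffeomorphisms X \<Theta>" and c: "c \<in> X" "c1 \<in> X" and p: "(t, x) \<in> flow_dom \<Theta> c c1"
    and law: "form_law k \<alpha>" and len: "length vs = k"
  shows "pullback X (\<Theta> t) \<alpha> c x vs = \<alpha> c1 (flow_map \<Theta> c c1 (t, x)) (map (\<lambda>v. dirD (flow_dom \<Theta> c c1) (flow_map \<Theta> c c1) (0, v) (t, x)) vs)"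
proof -
  have t: "t \<ge> 0" using p by (simp add: flow_dom_def)
  show ?thesis
    using pullback_local[OF law c(2) flow_slice_open[OF \<Theta> c t] _ _ flow_slice_derivative[OF \<Theta> c p] len] p
    by (simp add: flow_map_def) (simp add: flow_dom_def)
qed

lemma flow_chart:
  assumes \<Theta>: "smooth_family_of_diffeomorphisms X \<Theta>" and c: "c \<in> X" and "t \<ge> 0" "x \<in> cimg c"
  obtains c1 where "c1 \<in> X" "(t, x) \<in> flow_dom \<Theta> c c1"
proof -
  have "\<Theta> t (cinv c x) \<in> points X"
    using \<Theta> assms(3) cinv_points[OF c assms(4)]
    by (auto simp: smooth_family_of_diffeomorphisms_def diffeomorphism_def bij_betw_def)
  then show ?thesis using that assms(3,4) by (auto simp: points_def flow_dom_def)
qed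

text \<open>The inverse diffeomorphism is smooth, so differentiating its composition with the map,
  which is the identity, yields a left inverse of the derivative.\<close>

lemma flow_derivative_inj:
  assumes \<Theta>: "smooth_family_of_diffeomorphisms X \<Theta>" and c: "c \<in> X" "c1 \<in> X" and p: "(t, x) \<in> flow_dom \<Theta> c c1"
  shows "inj (\<lambda>v. dirD (flow_dom \<Theta> c c1) (flow_map \<Theta> c c1) (0, v) (t, x))"
proof -
  have t: "t \<ge> 0" and x: "x \<in> cimg c" using p by (auto simp: flow_dom_def)
  let ?\<Psi> = "inv_into (points X) (\<Theta> t)"
  have bij: "bij_betw (\<Theta> t) (points X) (points X)" and sm: "smooth_map X X ?\<Psi>"
    using \<Theta> t by (auto simp: smooth_family_of_diffeomorphisms_def diffeomorphism_def)
  let ?W = "{y \<in> cimg c1. ?\<Psi> (cinv c1 y) \<in> cdom c}" and ?\<psi> = "\<lambda>y. cmap c (?\<Psi> (cinv c1 y))"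
  let ?U = "{y. (t, y) \<in> flow_dom \<Theta> c c1}" and ?\<theta> = "\<lambda>y. cmap c1 (\<Theta> t (cinv c y))"
  let ?D = "\<lambda>v. dirD (flow_dom \<Theta> c c1) (flow_map \<Theta> c c1) (0, v) (t, x)"
  have s\<psi>: "smooth_on ?W ?\<psi>" using sm c by (auto simp: smooth_map_def)
  have inv: "?\<Psi> (cinv c1 (?\<theta> y)) = cinv c y" if "y \<in> ?U" for y
  proof -
    have "cinv c y \<in> points X" using that cinv_points[OF c(1), of y] by (simp add: flow_dom_def)
    then show ?thesis using that bij by (auto simp: flow_dom_def cinv_cmap[OF c(2)] bij_betw_def)
  qed
  have W: "?\<theta> y \<in> ?W" if "y \<in> ?U" for y using that inv[OF that] by (auto simp: flow_dom_def cmap_in cinv_in)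
  have U: "open ?U" by (rule flow_slice_open[OF \<Theta> c t])
  have xU: "x \<in> ?U" using p by simp
  let ?P = "frechet_derivative ?\<psi> (at (?\<theta> x) within ?W)"
  have "(?\<theta> has_derivative ?D) (at x within ?U)"
    using flow_slice_derivative[OF \<Theta> c p] by (rule has_derivative_at_withinI)
  from has_derivative_in_compose[OF this has_derivative_subset[OF smooth_on_has_fd[OF s\<psi> W[OF xU]]]] W
  have "((\<lambda>y. ?\<psi> (?\<theta> y)) has_derivative (\<lambda>v. ?P (?D v))) (at x within ?U)" by blast
  then have "((\<lambda>y. ?\<psi> (?\<theta> y)) has_derivative (\<lambda>v. ?P (?D v))) (at x)" using at_within_open[OF xU U] by simp
  moreover have "?\<psi> (?\<theta> y) = y" if "y \<in> ?U" for y using inv[OF that] that by (simp add: cmap_cinv flow_dom_def)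
  ultimately have "((\<lambda>y. y) has_derivative (\<lambda>v. ?P (?D v))) (at x)"
    by (rule has_derivative_transform_within_open[OF _ U xU])
  then have "(\<lambda>v. ?P (?D v)) = (\<lambda>v. v)" using has_derivative_ident has_derivative_unique by blast
  then show ?thesis by (metis (no_types, lifting) injI)
qed

text \<open>Both coordinate expressions are computed with the same chart c1 at the image point; the
  law is then the chain rule for the change of chart at the source.\<close>

lemma form_law_pullback:
  assumes \<Theta>: "smooth_family_of_diffeomorphisms X \<Theta>" and t: "t \<ge> 0" and law: "form_law k \<alpha>"
  shows "form_law k (pullback X (\<Theta> t) \<alpha>)"
  unfolding form_law_def
proof (intro ballI allI impI)
  fix c c' x and vs :: "(complex^'n) list" assume c: "c \<in> X" "c' \<in> X" and x: "x \<in> overlap c c'" and len: "length vs = k"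
  let ?\<tau> = "transition c c'"
  have x': "x \<in> cimg c" and \<tau>x: "?\<tau> x \<in> cimg c'" using x transition_in[OF c x] by (auto simp: in_overlap[OF c(1)] in_overlap[OF c(2)])
  obtain c1 where c1: "c1 \<in> X" "(t, x) \<in> flow_dom \<Theta> c c1" by (rule flow_chart[OF \<Theta> c(1) t x'])
  have q: "(t, ?\<tau> x) \<in> flow_dom \<Theta> c' c1" using c1(2) \<tau>x cinv_transition[OF c x] by (simp add: flow_dom_def)
  have "((\<lambda>y. cmap c1 (\<Theta> t (cinv c' (?\<tau> y)))) has_derivative
      (\<lambda>v. dirD (flow_dom \<Theta> c' c1) (flow_map \<Theta> c' c1) (0, frechet_derivative ?\<tau> (at x) v) (t, ?\<tau> x))) (at x)"
    by (rule has_derivative_compose[OF transition_has_derivative[OF c x] flow_slice_derivative[OF \<Theta> c(2) c1(1) q]])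
  then have "((\<lambda>y. cmap c1 (\<Theta> t (cinv c y))) has_derivative
      (\<lambda>v. dirD (flow_dom \<Theta> c' c1) (flow_map \<Theta> c' c1) (0, frechet_derivative ?\<tau> (at x) v) (t, ?\<tau> x))) (at x)"
    by (rule has_derivative_transform_within_open[OF _ open_overlap[OF c] x]) (simp add: cinv_transition[OF c])
  from has_derivative_unique[OF flow_slice_derivative[OF \<Theta> c(1) c1] this]
  have D: "dirD (flow_dom \<Theta> c c1) (flow_map \<Theta> c c1) (0, v) (t, x) =
      dirD (flow_dom \<Theta> c' c1) (flow_map \<Theta> c' c1) (0, frechet_derivative ?\<tau> (at x) v) (t, ?\<tau> x)" for v
    by (rule fun_cong)
  have m: "flow_map \<Theta> c c1 (t, x) = flow_map \<Theta> c' c1 (t, ?\<tau> x)" by (simp add: flow_map_def cinv_transition[OF c x])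
  show "pullback X (\<Theta> t) \<alpha> c x vs = pullback X (\<Theta> t) \<alpha> c' (?\<tau> x) (map (frechet_derivative ?\<tau> (at x)) vs)"
    unfolding pullback_flow[OF \<Theta> c(1) c1 law len] D m
    using pullback_flow[OF \<Theta> c(2) c1(1) q law, of "map (frechet_derivative ?\<tau> (at x)) vs"] len by (simp add: o_def)
qed

end

subsection \<open>The complex Hessian\<close>

lemma i_scale_axis: "\<i> *s axis p 1 = (axis p \<i> :: complex^'n)" "\<i> *s axis p \<i> = - (axis p 1 :: complex^'n)"
  by (simp_all add: vec_eq_iff axis_def)
lemma i_scale_twice: "\<i> *s (\<i> *s v) = - (v :: complex^'n)" by (simp add: vec_eq_iff)
lemma linear_i_scale: "linear (\<lambda>v :: complex^'n. \<i> *s v)"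
  by (auto simp: linear_iff vec_eq_iff algebra_simps)

lemma alternating_2I:
  fixes B :: "('e::real_vector, 'b::real_vector) mform"
  assumes l1: "\<And>w. linear (\<lambda>v. B [v, w])" and l2: "\<And>v. linear (\<lambda>w. B [v, w])" and z: "\<And>v. B [v, v] = 0"
  shows "alternating 2 B"
  unfolding alternating_def
proof (intro conjI allI impI)
  fix vs :: "'e list" and i :: nat assume vs: "length vs = 2" "i < 2"
  then obtain a b where "vs = [a, b]" by (auto simp: numeral_2_eq_2 length_Suc_conv)
  with vs l1 l2 show "linear (\<lambda>v. B (vs[i := v]))" by (auto simp: less_2_cases_iff)
next
  fix vs :: "'e list" and i j :: nat assume vs: "length vs = 2" "i < j" "j < 2" "vs ! i = vs ! j"
  then obtain a b where "vs = [a, b]" by (auto simp: numeral_2_eq_2 length_Suc_conv)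
  with vs z show "B vs = 0" by (auto simp: less_2_cases_iff)
qed

definition hessian :: "'a::euclidean_space set \<Rightarrow> ('a \<Rightarrow> real) \<Rightarrow> 'a \<Rightarrow> 'a \<Rightarrow> 'a \<Rightarrow> real" where
  "hessian U g x a b = dirD U (dirD U g b) a x"

lemma hessian_sym: "nice U \<Longrightarrow> x \<in> U \<Longrightarrow> smooth_on U g \<Longrightarrow> hessian U g x a b = hessian U g x b a"
  unfolding hessian_def by (rule second_derivative_symmetric)

lemma hessian_linear:
  assumes "nice U" "x \<in> U" "smooth_on U g"
  shows "linear (\<lambda>a. hessian U g x a b)" "linear (\<lambda>b. hessian U g x a b)"
proof -
  show 1: "linear (\<lambda>a. hessian U g x a b)" for b
    unfolding hessian_def by (rule smooth_on_linear_fd[OF smooth_on_dirD[OF assms(3)] assms(2)])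
  show "linear (\<lambda>b. hessian U g x a b)" using 1[of a] hessian_sym[OF assms] by simp
qed

text \<open>B is - (1/2) d(dg o J), with J multiplication by \<i>; by \<open>i_ddbar_hessian\<close>
  this is the real expression of \<open>i_ddbar\<close>. Invariance under J follows from symmetry of
  the Hessian.\<close>

lemma ddbar_form_props:
  fixes g :: "complex^'n \<Rightarrow> real"
  assumes "nice U" "x \<in> U" "smooth_on U g"
  defines "B \<equiv> \<lambda>ws. (hessian U g x (ws ! 1) (\<i> *s (ws ! 0)) - hessian U g x (ws ! 0) (\<i> *s (ws ! 1))) / 2"
  shows "alternating 2 B" and "B [\<i> *s v, \<i> *s w] = B [v, w]"
proof -
  note l1 = hessian_linear(1)[OF assms(1-3)] and l2 = hessian_linear(2)[OF assms(1-3)] and sy = hessian_sym[OF assms(1-3)]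
  have l2i: "linear (\<lambda>b. hessian U g x a (\<i> *s b))" for a
    using linear_compose[OF linear_i_scale l2[of a]] by (simp add: o_def)
  show "alternating 2 B"
  proof (rule alternating_2I)
    have h: "linear (\<lambda>v. (f v - h v) / 2)" if "linear f" "linear h" for f h :: "complex^'n \<Rightarrow> real"
      using linear_compose_scale_right[OF linear_compose_sub[OF that], of "1/2"] by simp
    show "linear (\<lambda>v. B [v, w])" for w unfolding B_def using h[OF l2i[of w] l1[of "\<i> *s w"]] by simp
    show "linear (\<lambda>w. B [v, w])" for v unfolding B_def using h[OF l1[of "\<i> *s v"] l2i[of v]] by simp
    show "B [v, v] = 0" for v by (simp add: B_def)
  qed
  show "B [\<i> *s v, \<i> *s w] = B [v, w]"
    using sy[of "\<i> *s w" v] sy[of "\<i> *s v" w] linear_neg[OF l2[of "\<i> *s w"], of v] linear_neg[OF l2[of "\<i> *s v"], of w]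
    by (simp add: B_def i_scale_twice)
qed

text \<open>By symmetry of the Hessian, the Hermitian coefficients of the form on the right are the
  mixed Wirtinger derivatives; \<open>herm_coeff_expansion\<close> then identifies the two forms.
  Only real second derivatives remain.\<close>

lemma i_ddbar_hessian:
  fixes f :: "'m \<Rightarrow> real" and c :: "('m, complex^'n) chart"
  assumes U: "open U" "x \<in> U" and sm: "smooth_on U (\<lambda>y. f (cinv c y))"
  defines "g \<equiv> \<lambda>y. f (cinv c y)"
  assumes len: "length ws = 2"
  shows "i_ddbar f c x ws = (hessian U g x (ws ! 1) (\<i> *s (ws ! 0)) - hessian U g x (ws ! 0) (\<i> *s (ws ! 1))) / 2"
proof -
  have nU: "nice U" by (rule nice_open[OF U(1)])
  have g: "smooth_on U g" using sm by (simp add: g_def)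
  define B where "B ws = (hessian U g x (ws ! 1) (\<i> *s (ws ! 0)) - hessian U g x (ws ! 0) (\<i> *s (ws ! 1))) / 2" for ws
  have B: "alternating 2 B" "B [\<i> *s v, \<i> *s w] = B [v, w]" for v w
    unfolding B_def[abs_def] by (rule ddbar_form_props[OF nU U(2) g])+
  have at: "at y within U = at y" if "y \<in> U" for y by (rule at_within_open[OF that U(1)])
  have d1: "((\<lambda>y. complex_of_real (dirD U g b y)) has_derivative (\<lambda>a. complex_of_real (hessian U g y a b))) (at y)" if "y \<in> U" for y b
    using bounded_linear.has_derivative[OF bounded_linear_of_real smooth_on_has_fd[OF smooth_on_dirD[OF g, of b] that]]
    by (simp add: at[OF that] hessian_def)
  have d0: "frechet_derivative (\<lambda>y. complex_of_real (g y)) (at y) b = complex_of_real (dirD U g b y)" if "y \<in> U" for y b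
  proof -
    have "((\<lambda>y. complex_of_real (g y)) has_derivative (\<lambda>b. complex_of_real (dirD U g b y))) (at y)"
      using bounded_linear.has_derivative[OF bounded_linear_of_real smooth_on_has_fd[OF g that]] by (simp add: at[OF that])
    from fun_cong[OF frechet_derivative_at[OF this, symmetric]] show ?thesis .
  qed
  have zb: "d_zbar q (\<lambda>y. complex_of_real (g y)) y = (complex_of_real (dirD U g (axis q 1) y) + \<i> * complex_of_real (dirD U g (axis q \<i>) y)) / 2"
    if "y \<in> U" for y q using d0[OF that] by (simp add: d_zbar_def)
  have dd: "frechet_derivative (d_zbar q (\<lambda>y. complex_of_real (g y))) (at x) a
      = (complex_of_real (hessian U g x a (axis q 1)) + \<i> * complex_of_real (hessian U g x a (axis q \<i>))) / 2" for q a
  proof -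
    have "((\<lambda>y. (complex_of_real (dirD U g (axis q 1) y) + \<i> * complex_of_real (dirD U g (axis q \<i>) y)) / 2) has_derivative
       (\<lambda>a. (complex_of_real (hessian U g x a (axis q 1)) + \<i> * complex_of_real (hessian U g x a (axis q \<i>))) / 2)) (at x)"
      by (intro bounded_linear.has_derivative[OF bounded_linear_divide] has_derivative_add has_derivative_mult_right d1 U(2))
    then have "((d_zbar q (\<lambda>y. complex_of_real (g y))) has_derivative
       (\<lambda>a. (complex_of_real (hessian U g x a (axis q 1)) + \<i> * complex_of_real (hessian U g x a (axis q \<i>))) / 2)) (at x)"
      by (rule has_derivative_transform_within_open[OF _ U]) (simp add: zb)
    from fun_cong[OF frechet_derivative_at[OF this, symmetric]] show ?thesis .
  qed
  have H: "herm_coeff B $ p $ q = d_z p (d_zbar q (\<lambda>y. complex_of_real (g y))) x" for p q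
  proof -
    note l2 = hessian_linear(2)[OF nU U(2) g] and sy = hessian_sym[OF nU U(2) g]
    have n: "hessian U g x a (- axis q 1) = - hessian U g x a (axis q 1)" for a q
      using linear_neg[OF l2] .
    show ?thesis
      unfolding d_z_def dd herm_coeff_def B_def
      using sy[of "axis q 1" "axis p \<i>"] sy[of "axis q \<i>" "axis p 1"] sy[of "axis q \<i>" "axis p \<i>"] sy[of "axis q 1" "axis p 1"]
      by (simp add: i_scale_axis n complex_eq_iff) (simp add: field_simps)
  qed
  obtain v w where ws: "ws = [v, w]" using len by (auto simp: numeral_2_eq_2 length_Suc_conv)
  have "complex_of_real (B [v, w]) = \<i> * (\<Sum>p\<in>UNIV. \<Sum>q\<in>UNIV. herm_coeff B $ p $ q * (v $ p * cnj (w $ q) - w $ p * cnj (v $ q)))"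
    by (rule herm_coeff_expansion[OF B])
  then have "i_ddbar f c x ws = Re (complex_of_real (B [v, w]))"
    unfolding i_ddbar_def H ws by (simp add: g_def)
  then show ?thesis by (simp add: B_def ws)
qed

subsection \<open>Unitary frames\<close>

text \<open>Gram-Schmidt for the Hermitian form of B. The next vector has to satisfy 2 k real linear
  conditions in a space of larger real dimension and is then normalised.\<close>

lemma unitary_vectors:
  fixes B :: "(complex^'n, real) mform"
  assumes alt: "alternating 2 B" and inv: "\<And>v w. B [\<i> *s v, \<i> *s w] = B [v, w]" and pos: "\<And>v. v \<noteq> 0 \<Longrightarrow> B [v, \<i> *s v] > 0"
    and "k \<le> CARD('n)"
  shows "\<exists>\<epsilon>. \<forall>i<k. \<forall>j<k. B [\<epsilon> i, \<epsilon> j] = 0 \<and> B [\<epsilon> i, \<i> *s \<epsilon> j] = (if i = j then 1 else (0::real))"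
  using assms(4)
proof (induction k)
  case (Suc k)
  then obtain \<epsilon> where \<epsilon>: "\<And>i j. i < k \<Longrightarrow> j < k \<Longrightarrow> B [\<epsilon> i, \<epsilon> j] = 0 \<and> B [\<epsilon> i, \<i> *s \<epsilon> j] = (if i = j then 1 else 0)" by auto
  have l1: "linear (\<lambda>v. B [v, w])" for w using alt_linear_hd[OF alt, of "[w]"] by simp
  have l2: "linear (\<lambda>v. B [w, v])" for w using alt_linear_mid[OF alt, of "[w]" "[]"] by simp
  have anti: "B [v, w] = - B [w, v]" for v w using alt_swap[OF alt, of "[]" "[]" v w] by simp
  have J: "B [\<i> *s v, w] = - B [v, \<i> *s w]" for v w
    using inv[of v "\<i> *s w"] linear_neg[OF l2[of "\<i> *s v"], of w] by (simp add: i_scale_twice)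
  have symJ: "B [v, \<i> *s w] = B [w, \<i> *s v]" for v w using J[of w v] anti[of v "\<i> *s w"] by simp
  \<comment> \<open>Represents B [v, w] as the inner product of v with a vector, so that the
    conditions on v become orthogonality to fewer vectors than the dimension.\<close>
  define R where "R w = (\<Sum>b\<in>Basis. B [b, w] *\<^sub>R b)" for w :: "complex^'n"
  have riesz: "B [v, w] = v \<bullet> R w" for v w
  proof -
    have "B [v, w] = B [(\<Sum>b\<in>Basis. (v \<bullet> b) *\<^sub>R b), w]" by (simp only: euclidean_representation)
    also have "\<dots> = (\<Sum>b\<in>Basis. (v \<bullet> b) * B [b, w])" by (simp add: linear_sum[OF l1] linear_scale[OF l1])
    finally show ?thesis by (simp add: R_def inner_sum_right mult.commute)
  qed
  let ?S = "(\<lambda>i. R (\<epsilon> i)) ` {..<k} \<union> (\<lambda>i. R (\<i> *s \<epsilon> i)) ` {..<k}"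
  have "dim ?S \<le> card ?S" by (rule dim_le_card') auto
  also have "card ?S \<le> card {..<k} + card {..<k}"
    by (meson add_mono card_Un_le card_image_le finite_lessThan order_trans)
  also have "\<dots> < DIM(complex^'n)" using Suc.prems by simp
  finally obtain v where v: "v \<noteq> 0" "\<And>y. y \<in> span ?S \<Longrightarrow> orthogonal v y"
    using orthogonal_to_subspace_exists[of ?S] by blast
  have v0: "B [v, \<epsilon> i] = 0 \<and> B [v, \<i> *s \<epsilon> i] = 0" if "i < k" for i
    using v(2)[of "R (\<epsilon> i)"] v(2)[of "R (\<i> *s \<epsilon> i)"] that by (auto simp: riesz orthogonal_def intro!: span_base)
  define s where "s = 1 / sqrt (B [v, \<i> *s v])"
  have s: "s * s * B [v, \<i> *s v] = 1" using pos[OF v(1)] by (simp add: s_def field_simps)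
  define \<epsilon>' where "\<epsilon>' = \<epsilon>(k := s *\<^sub>R v)"
  have isc: "\<i> *s (s *\<^sub>R v) = s *\<^sub>R (\<i> *s v)" for v using linear_scale[OF linear_i_scale] .
  have sc: "B [s *\<^sub>R v, w] = s * B [v, w]" "B [w, s *\<^sub>R v] = s * B [w, v]" for v w
    using linear_scale[OF l1] linear_scale[OF l2] by auto
  have vv: "B [v, v] = 0" by (rule alt_eq_0[OF alt]) auto
  have "B [\<epsilon>' i, \<epsilon>' j] = 0 \<and> B [\<epsilon>' i, \<i> *s \<epsilon>' j] = (if i = j then 1 else 0)" if "i < Suc k" "j < Suc k" for i j
  proof (cases "i = k"; cases "j = k")
    assume "i = k" "j = k" then show ?thesis using s vv by (simp add: \<epsilon>'_def isc sc)
  next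
    assume "i = k" "j \<noteq> k" then show ?thesis using v0[of j] that by (simp add: \<epsilon>'_def isc sc)
  next
    assume "i \<noteq> k" "j = k"
    then show ?thesis using v0[of i] that anti[of "\<epsilon> i" v] symJ[of "\<epsilon> i" v] by (simp add: \<epsilon>'_def isc sc)
  next
    assume "i \<noteq> k" "j \<noteq> k" then show ?thesis using \<epsilon>[of i j] that by (simp add: \<epsilon>'_def)
  qed
  then show ?case by blast
qed simp

text \<open>The sesquilinear form k of the coefficients satisfies B(v, w) = \<i> (k(v, w) - k(w,
  v)). Replacing w by \<i> w gives a second equation, B(v, \<i> w) = k(v, w) + k(w, v), and the two
  determine k.\<close>

lemma herm_coeff_form:
  fixes B :: "(complex^'n, real) mform"
  assumes alt: "alternating 2 B" and inv: "\<And>v w. B [\<i> *s v, \<i> *s w] = B [v, w]"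
  shows "(\<Sum>p\<in>UNIV. \<Sum>q\<in>UNIV. herm_coeff B $ p $ q * (v $ p * cnj (w $ q))) = (complex_of_real (B [v, \<i> *s w]) - \<i> * complex_of_real (B [v, w])) / 2"
proof -
  define k where "k v w = (\<Sum>p\<in>UNIV. \<Sum>q\<in>UNIV. herm_coeff B $ p $ q * (v $ p * cnj (w $ q)))" for v w :: "complex^'n"
  have E: "complex_of_real (B [v, w]) = \<i> * (k v w - k w v)" for v w
    unfolding herm_coeff_expansion[OF assms] k_def by (simp add: sum_subtractf[symmetric] right_diff_distrib)
  have k1: "k v (\<i> *s w) = - \<i> * k v w" for v w by (simp add: k_def sum_distrib_left mult_ac sum_negf)
  have k2: "k (\<i> *s v) w = \<i> * k v w" for v w by (simp add: k_def sum_distrib_left mult_ac)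
  show ?thesis unfolding k_def[symmetric] E k1 k2 by (simp add: field_simps)
qed

text \<open>The frame vectors are the rows of A. Multiplying the coefficient matrix by A and by its
  conjugate transpose gives half the identity, since the sesquilinear form of the coefficients at
  (v, v) is half of B(v, \<i> v).\<close>

lemma det_unitary_frame:
  fixes B :: "(complex^'n, real) mform" and A :: "complex^'n^'n"
  assumes alt: "alternating 2 B" and inv: "\<And>v w. B [\<i> *s v, \<i> *s w] = B [v, w]"
    and A: "\<And>a b. B [A $ a, A $ b] = 0 \<and> B [A $ a, \<i> *s (A $ b)] = (if a = b then 1 else 0)"
  shows "complex_of_real ((cmod (det A))\<^sup>2) * det (herm_coeff B) = (1/2) ^ CARD('n)"
proof -
  let ?C = "(\<chi> i j. cnj (A $ j $ i)) :: complex^'n^'n"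
  have "(A ** herm_coeff B ** ?C) $ a $ b = (if a = b then 1/2 else 0)" for a b
  proof -
    have "(A ** herm_coeff B ** ?C) $ a $ b = (\<Sum>q\<in>UNIV. (\<Sum>p\<in>UNIV. A $ a $ p * herm_coeff B $ p $ q) * cnj (A $ b $ q))"
      by (simp add: matrix_matrix_mult_def)
    also have "\<dots> = (\<Sum>q\<in>UNIV. \<Sum>p\<in>UNIV. herm_coeff B $ p $ q * (A $ a $ p * cnj (A $ b $ q)))"
      unfolding sum_distrib_right by (intro sum.cong refl) (simp add: mult_ac)
    also have "\<dots> = (\<Sum>p\<in>UNIV. \<Sum>q\<in>UNIV. herm_coeff B $ p $ q * (A $ a $ p * cnj (A $ b $ q)))" by (rule sum.swap)
    also have "\<dots> = (complex_of_real (B [A $ a, \<i> *s A $ b]) - \<i> * complex_of_real (B [A $ a, A $ b])) / 2"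
      by (rule herm_coeff_form[OF alt inv])
    finally show ?thesis using A[of a b] by (cases "a = b") simp_all
  qed
  then have "det (A ** herm_coeff B ** ?C) = (\<Prod>i\<in>UNIV. (A ** herm_coeff B ** ?C) $ i $ i)"
    by (intro det_diagonal) simp
  also have "\<dots> = (1/2) ^ CARD('n)" using \<open>\<And>a b. (A ** herm_coeff B ** ?C) $ a $ b = _\<close> by simp
  finally have "det A * det (herm_coeff B) * det ?C = (1/2) ^ CARD('n)" by (simp only: det_mul)
  moreover have "det ?C = cnj (det A)"
  proof -
    have "?C = transpose (\<chi> i j. cnj (A $ i $ j))" by (simp add: transpose_def vec_eq_iff)
    then have "det ?C = det (\<chi> i j. cnj (A $ i $ j))" by (simp only: det_transpose)
    also have "\<dots> = cnj (det A)" by (simp add: det_def)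
    finally show ?thesis .
  qed
  moreover have "complex_of_real ((cmod (det A))\<^sup>2) = det A * cnj (det A)" by (rule complex_norm_square)
  ultimately show ?thesis by (simp add: mult_ac)
qed

section \<open>Determinants and complex multilinear forms over an unordered index type\<close>

lemma det_enum_2:
  fixes A :: "'b::comm_ring_1^'n^'n"
  assumes "UNIV = {p, q::'n}" "p \<noteq> q"
  shows "det A = A $ p $ p * A $ q $ q - A $ p $ q * A $ q $ p"
proof -
  have f12: "finite {q}" "p \<notin> {q}" using assms by auto
  show ?thesis
    unfolding det_def assms(1) sum_over_permutations_insert[OF f12] permutes_sing
    using assms(2) by (simp add: sign_swap_id sign_id swap_id_eq)
qed

lemma det_enum_3:
  fixes A :: "'b::comm_ring_1^'n^'n"
  assumes "UNIV = {p, q, s::'n}" "p \<noteq> q" "p \<noteq> s" "q \<noteq> s"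
  shows "det A = A $ p $ p * A $ q $ q * A $ s $ s + A $ p $ q * A $ q $ s * A $ s $ p + A $ p $ s * A $ q $ p * A $ s $ q
    - A $ p $ p * A $ q $ s * A $ s $ q - A $ p $ q * A $ q $ p * A $ s $ s - A $ p $ s * A $ q $ q * A $ s $ p"
proof -
  have f1: "finite {q, s}" "p \<notin> {q, s}" and f2: "finite {s}" "q \<notin> {s}" using assms by auto
  show ?thesis
    unfolding det_def assms(1) sum_over_permutations_insert[OF f1] sum_over_permutations_insert[OF f2] permutes_sing
    using assms(2-4) by (simp add: sign_swap_id permutation_swap_id sign_compose sign_id swap_id_eq)
qed

definition complex_multilinear :: "nat \<Rightarrow> (complex^'n, complex) mform \<Rightarrow> bool" where
  "complex_multilinear k Z \<longleftrightarrow> alternating k Z \<and>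
    (\<forall>vs a i. length vs = k \<longrightarrow> i < k \<longrightarrow> Z (vs[i := a *s (vs ! i)]) = a * Z vs)"

lemma complex_multilinear_slot:
  assumes "complex_multilinear k Z" "length xs + length ys + 1 = k"
  shows "Z (xs @ (a *s v) # ys) = a * Z (xs @ v # ys)"
  using assms(1)[unfolded complex_multilinear_def, THEN conjunct2, rule_format, of "xs @ v # ys" "length xs" a] assms(2) by simp

lemma vec_axis_sum: "(v :: complex^'n) = (\<Sum>p\<in>UNIV. v $ p *s axis p 1)"
  by (simp add: vec_eq_iff axis_def if_distrib cong: if_cong)

lemma complex_multilinear_det_2:
  fixes Z :: "(complex^'n, complex) mform" and A :: "complex^'n^'n"
  assumes Z: "complex_multilinear 2 Z" and U: "UNIV = {p, q::'n}" "p \<noteq> q"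
  shows "Z [A $ p, A $ q] = det A * Z [axis p 1, axis q 1]"
proof -
  have alt: "alternating 2 Z" using Z by (simp add: complex_multilinear_def)
  have l1: "linear (\<lambda>v. Z [v, w])" for w using alt_linear_hd[OF alt, of "[w]"] by simp
  have l2: "linear (\<lambda>v. Z [w, v])" for w using alt_linear_mid[OF alt, of "[w]" "[]"] by simp
  have s1: "Z [a *s v, w] = a * Z [v, w]" for a v w using complex_multilinear_slot[OF Z, of "[]" "[w]"] by simp
  have s2: "Z [w, a *s v] = a * Z [w, v]" for a v w using complex_multilinear_slot[OF Z, of "[w]" "[]"] by simp
  have z: "Z [v, v] = 0" for v by (rule alt_eq_0[OF alt]) auto
  have sw: "Z [axis q 1, axis p 1] = - Z [axis p 1, axis q 1]" 
    using alt_swap[OF alt, of "[]" "[]" "axis q 1" "axis p 1"] by simp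
  have e: "v = v $ p *s axis p 1 + v $ q *s axis q 1" for v :: "complex^'n"
  proof -
    have "v = (\<Sum>i\<in>{p, q}. v $ i *s axis i 1)" unfolding U(1)[symmetric] by (rule vec_axis_sum)
    also have "\<dots> = v $ p *s axis p 1 + v $ q *s axis q 1" using U(2) by simp
    finally show ?thesis .
  qed
  have "Z [A $ p, A $ q] = Z [A $ p $ p *s axis p 1 + A $ p $ q *s axis q 1, A $ q $ p *s axis p 1 + A $ q $ q *s axis q 1]"
    by (rule arg_cong[where f = Z]) (intro arg_cong2[where f = "(#)"] e refl)
  then show ?thesis
    unfolding det_enum_2[OF U] by (simp add: linear_add[OF l1] linear_add[OF l2] s1 s2 z sw algebra_simps)
qed

lemma complex_multilinear_det_3:
  fixes Z :: "(complex^'n, complex) mform" and A :: "complex^'n^'n"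
  assumes Z: "complex_multilinear 3 Z" and U: "UNIV = {p, q, s::'n}" "p \<noteq> q" "p \<noteq> s" "q \<noteq> s"
  shows "Z [A $ p, A $ q, A $ s] = det A * Z [axis p 1, axis q 1, axis s 1]"
proof -
  have alt: "alternating 3 Z" using Z by (simp add: complex_multilinear_def)
  have l1: "linear (\<lambda>v. Z [v, w, w'])" for w w' using alt_linear_hd[OF alt, of "[w, w']"] by simp
  have l2: "linear (\<lambda>v. Z [w, v, w'])" for w w' using alt_linear_mid[OF alt, of "[w]" "[w']"] by simp
  have l3: "linear (\<lambda>v. Z [w, w', v])" for w w' using alt_linear_mid[OF alt, of "[w, w']" "[]"] by simp
  have s1: "Z [a *s v, w, w'] = a * Z [v, w, w']" for a v w w' using complex_multilinear_slot[OF Z, of "[]" "[w, w']"] by simp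
  have s2: "Z [w, a *s v, w'] = a * Z [w, v, w']" for a v w w' using complex_multilinear_slot[OF Z, of "[w]" "[w']"] by simp
  have s3: "Z [w, w', a *s v] = a * Z [w, w', v]" for a v w w' using complex_multilinear_slot[OF Z, of "[w, w']" "[]"] by simp
  have z: "Z [v, v, w] = 0" "Z [v, w, v] = 0" "Z [w, v, v] = 0" for v w by (rule alt_eq_0[OF alt], simp, simp)+
  have w1: "Z [a, b, c] = - Z [b, a, c]" and w2: "Z [a, b, c] = - Z [a, c, b]" for a b c
    using alt_swap[OF alt, of "[]" "[c]" a b] alt_swap[OF alt, of "[a]" "[]" b c] by auto
  let ?p = "axis p 1 :: complex^'n" and ?q = "axis q 1 :: complex^'n" and ?s = "axis s 1 :: complex^'n"
  have sw: "Z [?p, ?s, ?q] = - Z [?p, ?q, ?s]" "Z [?q, ?p, ?s] = - Z [?p, ?q, ?s]" "Z [?q, ?s, ?p] = Z [?p, ?q, ?s]"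
    "Z [?s, ?p, ?q] = Z [?p, ?q, ?s]" "Z [?s, ?q, ?p] = - Z [?p, ?q, ?s]"
    using w2[of ?p ?s ?q] w1[of ?q ?p ?s] w2[of ?q ?s ?p] w1[of ?s ?p ?q] w1[of ?s ?q ?p] by simp_all
  have e: "v = v $ p *s ?p + v $ q *s ?q + v $ s *s ?s" for v :: "complex^'n"
  proof -
    have "v = (\<Sum>i\<in>{p, q, s}. v $ i *s axis i 1)" unfolding U(1)[symmetric] by (rule vec_axis_sum)
    also have "\<dots> = v $ p *s ?p + v $ q *s ?q + v $ s *s ?s" using U(2-4) by (simp add: add.assoc)
    finally show ?thesis .
  qed
  have "Z [A $ p, A $ q, A $ s] = Z [A $ p $ p *s ?p + A $ p $ q *s ?q + A $ p $ s *s ?s,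
     A $ q $ p *s ?p + A $ q $ q *s ?q + A $ q $ s *s ?s, A $ s $ p *s ?p + A $ s $ q *s ?q + A $ s $ s *s ?s]"
    by (rule arg_cong[where f = Z]) (intro arg_cong2[where f = "(#)"] e refl)
  then show ?thesis
    unfolding det_enum_3[OF U] by (simp add: linear_add[OF l1] linear_add[OF l2] linear_add[OF l3] s1 s2 s3 z sw algebra_simps)
qed

text \<open>The first vector of a unitary frame is rotated by a phase until Z is positive on the
  frame. The factor det A relates this value to the one on the standard basis, and
  \<open>det_unitary_frame\<close> expresses its modulus by the metric.\<close>

lemma unitary_frame:
  fixes B :: "(complex^'n, real) mform" and Z :: "(complex^'n, complex) mform"
  assumes n: "CARD('n) \<in> {2, 3}" and alt: "alternating 2 B" and inv: "\<And>v w. B [\<i> *s v, \<i> *s w] = B [v, w]" and pos: "\<And>v. v \<noteq> 0 \<Longrightarrow> B [v, \<i> *s v] > 0"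
    and Z: "complex_multilinear CARD('n) Z" and nz: "\<exists>vs. length vs = CARD('n) \<and> Z vs \<noteq> 0"
  obtains \<epsilon> f where "f > 0" "\<And>i j. i < CARD('n) \<Longrightarrow> j < CARD('n) \<Longrightarrow> B [\<epsilon> i, \<epsilon> j] = 0 \<and> B [\<epsilon> i, \<i> *s \<epsilon> j] = (if i = j then 1 else 0)"
    "Z (map \<epsilon> [0..<CARD('n)]) = complex_of_real f" "Im (det (herm_coeff B)) = 0" "Re (det (herm_coeff B)) > 0"
    "f\<^sup>2 = (cmod (Z std_basis))\<^sup>2 / (2 ^ CARD('n) * Re (det (herm_coeff B)))" "Z std_basis \<noteq> 0"
proof -
  define ps where "ps = (SOME ps::'n list. distinct ps \<and> set ps = UNIV)"
  have ps: "distinct ps" "set ps = UNIV"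
    using someI_ex[of "\<lambda>ps::'n list. distinct ps \<and> set ps = UNIV"] finite_distinct_list[of "UNIV::'n set"] by (auto simp: ps_def)
  have lps: "length ps = CARD('n)" using distinct_card[OF ps(1)] ps(2) by simp
  have std: "std_basis = map (\<lambda>p. axis p 1 :: complex^'n) ps" by (simp add: std_basis_def ps_def)
  have detZ: "Z (map (\<lambda>p. A $ p) ps) = det A * Z std_basis" for A :: "complex^'n^'n"
    using n
  proof (elim insertE emptyE)
    assume 2: "CARD('n) = 2"
    then obtain p q where "ps = [p, q]" using lps by (auto simp: numeral_2_eq_2 length_Suc_conv)
    then show ?thesis using complex_multilinear_det_2[of Z p q A] Z 2 ps by (auto simp: std)
  next
    assume 3: "CARD('n) = 3"
    then obtain p q s where "ps = [p, q, s]" using lps by (auto simp: numeral_3_eq_3 length_Suc_conv)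
    then show ?thesis using complex_multilinear_det_3[of Z p q s A] Z 3 ps by (auto simp: std)
  qed
  obtain \<epsilon>0 where \<epsilon>0: "\<And>i j. i < CARD('n) \<Longrightarrow> j < CARD('n) \<Longrightarrow> B [\<epsilon>0 i, \<epsilon>0 j] = 0 \<and> B [\<epsilon>0 i, \<i> *s \<epsilon>0 j] = (if i = j then 1 else (0::real))"
    using unitary_vectors[OF alt inv pos order_refl] by blast
  \<comment> \<open>Position of an index in the enumeration behind \<open>std_basis\<close>; it
    arranges the numbered frame as the rows of a matrix.\<close>
  define idx where "idx p = (THE i. i < CARD('n) \<and> ps ! i = p)" for p
  have idx: "idx (ps ! i) = i" if "i < CARD('n)" for i
    unfolding idx_def using that ps(1) lps by (intro the_equality) (auto simp: nth_eq_iff_index_eq)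
  have idxb: "idx p < CARD('n) \<and> ps ! idx p = p" for p
  proof -
    obtain i where "i < CARD('n)" "ps ! i = p" using ps(2) lps by (metis UNIV_I in_set_conv_nth)
    then show ?thesis using idx by auto
  qed
  define A where "A = (\<chi> p. \<epsilon>0 (idx p))"
  have "map (\<lambda>p. A $ p) ps = map \<epsilon>0 [0..<CARD('n)]"
    by (rule nth_equalityI) (auto simp: lps A_def idx)
  then have Ze: "Z (map \<epsilon>0 [0..<CARD('n)]) = det A * Z std_basis" using detZ[of A] by simp
  have "idx a = idx b \<longleftrightarrow> a = b" for a b using idxb by metis
  then have "B [A $ a, A $ b] = 0 \<and> B [A $ a, \<i> *s (A $ b)] = (if a = b then 1 else 0)" for a b
    using \<epsilon>0[of "idx a" "idx b"] idxb by (simp add: A_def)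
  from det_unitary_frame[OF alt inv this]
  have det: "complex_of_real ((cmod (det A))\<^sup>2) * det (herm_coeff B) = complex_of_real ((1/2) ^ CARD('n))" by simp
  then have dA: "(cmod (det A))\<^sup>2 > 0" by (auto simp: zero_less_power2)
  have dH: "(cmod (det A))\<^sup>2 * Re (det (herm_coeff B)) = (1/2) ^ CARD('n)" "(cmod (det A))\<^sup>2 * Im (det (herm_coeff B)) = 0"
    using arg_cong[OF det, of Re] arg_cong[OF det, of Im] by simp_all
  then have Im0: "Im (det (herm_coeff B)) = 0" using dA by simp
  have Re0: "Re (det (herm_coeff B)) > 0"
  proof (rule ccontr)
    assume "\<not> ?thesis"
    then have "(cmod (det A))\<^sup>2 * Re (det (herm_coeff B)) \<le> 0" using dA by (simp add: mult_nonneg_nonpos)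
    moreover have "(1/2::real) ^ CARD('n) > 0" by simp
    ultimately show False using dH(1) by linarith
  qed
  have Zs: "Z std_basis \<noteq> 0"
  proof
    assume 0: "Z std_basis = 0"
    obtain vs where vs: "length vs = CARD('n)" "Z vs \<noteq> 0" using nz by blast
    \<comment> \<open>Every list of n vectors forms the rows of some matrix, so vanishing on the
      standard basis would make Z vanish identically.\<close>
    have "map (\<lambda>p. (\<chi> p. vs ! idx p) $ p) ps = vs" by (rule nth_equalityI) (auto simp: lps vs(1) idx)
    then show False using detZ[of "\<chi> p. vs ! idx p"] 0 vs(2) by simp
  qed
  define z where "z = Z (map \<epsilon>0 [0..<CARD('n)])"
  have z: "z \<noteq> 0" unfolding z_def Ze using Zs dA by auto
  define f where "f = cmod z"
  \<comment> \<open>The phase that turns z into the positive number f.\<close>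
  define \<mu> where "\<mu> = complex_of_real f / z"
  have f: "f > 0" using z by (simp add: f_def)
  have \<mu>: "cnj \<mu> * \<mu> = 1" "\<mu> * z = complex_of_real f" 
    using z f complex_norm_square[of \<mu>] by (auto simp: \<mu>_def f_def norm_divide mult.commute)
  have l1: "linear (\<lambda>v. B [v, w])" for w using alt_linear_hd[OF alt, of "[w]"] by simp
  have l2: "linear (\<lambda>v. B [w, v])" for w using alt_linear_mid[OF alt, of "[w]" "[]"] by simp
  have J: "B [\<i> *s v, w] = - B [v, \<i> *s w]" for v w
    using inv[of v "\<i> *s w"] linear_neg[OF l2[of "\<i> *s v"], of w] by (simp add: i_scale_twice)
  have cs: "a *s v = Re a *\<^sub>R v + Im a *\<^sub>R (\<i> *s v)" for a and v :: "complex^'n"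
    by (simp add: vec_eq_iff complex_eq_iff)
  have B1: "B [a *s v, w] = Re a * B [v, w] - Im a * B [v, \<i> *s w]" for a v w
    unfolding cs[of a v] by (simp add: linear_add[OF l1] linear_scale[OF l1] J)
  have B2: "B [v, a *s w] = Re a * B [v, w] + Im a * B [v, \<i> *s w]" for a v w
    unfolding cs[of a w] by (simp add: linear_add[OF l2] linear_scale[OF l2])
  have neg2: "B [v, - w] = - B [v, w]" for v w using linear_neg[OF l2] .
  define \<epsilon> where "\<epsilon> = \<epsilon>0(0 := \<mu> *s \<epsilon>0 0)"
  have n0: "0 < CARD('n)" by simp
  have \<mu>1: "Re \<mu> * Re \<mu> + Im \<mu> * Im \<mu> = 1" using arg_cong[OF \<mu>(1), of Re] by simp
  have fr: "B [\<epsilon> i, \<epsilon> j] = 0 \<and> B [\<epsilon> i, \<i> *s \<epsilon> j] = (if i = j then 1 else 0)" if "i < CARD('n)" "j < CARD('n)" for i j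
    using \<epsilon>0[OF that] \<epsilon>0[OF n0 that(2)] \<epsilon>0[OF that(1) n0] \<epsilon>0[OF n0 n0] \<mu>1
    by (auto simp: \<epsilon>_def B1[of \<mu>] B2[of _ \<mu>] B2[of _ "\<i> * \<mu>"] i_scale_twice neg2 algebra_simps)
  have Zf: "Z (map \<epsilon> [0..<CARD('n)]) = complex_of_real f"
  proof -
    have u: "[0..<CARD('n)] = 0 # [1..<CARD('n)]" using n0 by (simp add: upt_conv_Cons)
    have "map \<epsilon> [0..<CARD('n)] = [] @ (\<mu> *s \<epsilon>0 0) # map \<epsilon>0 [1..<CARD('n)]" unfolding u by (auto simp: \<epsilon>_def)
    then have "Z (map \<epsilon> [0..<CARD('n)]) = \<mu> * Z ([] @ \<epsilon>0 0 # map \<epsilon>0 [1..<CARD('n)])"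
      using complex_multilinear_slot[OF Z, of "[]" "map \<epsilon>0 [1..<CARD('n)]" \<mu> "\<epsilon>0 0"] n0 by simp
    also have "\<dots> = \<mu> * z" unfolding z_def u by simp
    finally show ?thesis using \<mu>(2) by simp
  qed
  have "f\<^sup>2 = (cmod (det A))\<^sup>2 * (cmod (Z std_basis))\<^sup>2" by (simp add: f_def z_def Ze norm_mult power_mult_distrib)
  also have "(cmod (det A))\<^sup>2 = 1 / (2 ^ CARD('n) * Re (det (herm_coeff B)))"
    using dH(1) Re0 by (simp add: field_simps power_one_over)
  finally have f2: "f\<^sup>2 = (cmod (Z std_basis))\<^sup>2 / (2 ^ CARD('n) * Re (det (herm_coeff B)))" by simp
  show ?thesis by (rule that[OF f fr Zf Im0 Re0 f2 Zs])
qed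

subsection \<open>Space-time forms of the Monge-Ampere flow\<close>

lemma slice_half_line:
  fixes f :: "real \<times> 'a::euclidean_space \<Rightarrow> 'b::euclidean_space"
  assumes f: "smooth_on ({0..} \<times> U) f" and U: "open U" and t: "t \<ge> 0"
  shows "smooth_on U (\<lambda>y. f (t, y))" and "x \<in> U \<Longrightarrow> dirD U (\<lambda>y. f (t, y)) b x = dirD ({0..} \<times> U) f (0, b) (t, x)"
    and "x \<in> U \<Longrightarrow> ((\<lambda>y. f (t, y)) has_derivative (\<lambda>b. dirD ({0..} \<times> U) f (0, b) (t, x))) (at x)"
proof -
  have nU: "nice U" by (rule nice_open[OF U])
  have P: "smooth_on U (\<lambda>y. (t, y))" by (rule smooth_on_Pair[OF nU smooth_on_const[OF nU] smooth_on_id[OF nU]])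
  show "smooth_on U (\<lambda>y. f (t, y))" by (rule smooth_on_compose[OF nU P f]) (use t in auto)
  show d: "((\<lambda>y. f (t, y)) has_derivative (\<lambda>b. dirD ({0..} \<times> U) f (0, b) (t, x))) (at x)" if "x \<in> U" for x
    by (rule slice_has_derivative[OF smooth_on_has_fd[OF f] U that]) (use t that in auto)
  show "dirD U (\<lambda>y. f (t, y)) b x = dirD ({0..} \<times> U) f (0, b) (t, x)" if "x \<in> U"
    using fun_cong[OF frechet_derivative_at[OF d[OF that], symmetric], of b] by (simp add: at_within_open[OF that U])
qed

text \<open>\<open>gradient\<close> is a definite description. Positivity makes the map from v to
  h(v, .) injective, hence bijective in finite dimension, which gives both existence and
  uniqueness.\<close>

lemma gradient_spec:
  fixes h :: "'e::euclidean_space \<Rightarrow> 'e \<Rightarrow> real"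
  assumes l1: "\<And>w. linear (\<lambda>v. h v w)" and l2: "\<And>v. linear (h v)" and pos: "\<And>v. v \<noteq> 0 \<Longrightarrow> h v v > 0"
    and f: "(f has_derivative f') (at x)"
  shows "h (gradient h f x) w = f' w"
proof -
  have fd: "frechet_derivative f (at x) = f'" by (rule frechet_derivative_at[OF f, symmetric])
  have lf: "linear f'" using f by (simp add: has_derivative_bounded_linear bounded_linear.linear)
  define L where "L v = (\<Sum>b\<in>Basis. h v b *\<^sub>R b)" for v
  have L: "linear L" unfolding linear_iff L_def
    by (simp add: linear_add[OF l1] linear_scale[OF l1] scaleR_left_distrib sum.distrib scaleR_sum_right)
  have hL: "h v w = L v \<bullet> w" for v w
  proof -
    have "h v w = h v (\<Sum>b\<in>Basis. (w \<bullet> b) *\<^sub>R b)" by (simp only: euclidean_representation)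
    also have "\<dots> = (\<Sum>b\<in>Basis. (w \<bullet> b) * h v b)" by (simp add: linear_sum[OF l2] linear_scale[OF l2])
    finally show ?thesis by (simp add: L_def inner_sum_left inner_commute[of w] mult.commute)
  qed
  define G where "G = (\<Sum>b\<in>Basis. f' b *\<^sub>R b)"
  have f'L: "f' w = G \<bullet> w" for w
  proof -
    have "f' w = f' (\<Sum>b\<in>Basis. (w \<bullet> b) *\<^sub>R b)" by (simp only: euclidean_representation)
    also have "\<dots> = (\<Sum>b\<in>Basis. (w \<bullet> b) * f' b)" by (simp add: linear_sum[OF lf] linear_scale[OF lf])
    finally show ?thesis by (simp add: G_def inner_sum_left inner_commute[of w] mult.commute)
  qed
  have inj: "inj L"
  proof (rule injI)
    fix v v' assume "L v = L v'"
    then have "h (v - v') (v - v') = 0" by (simp add: hL linear_diff[OF L])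
    then show "v = v'" using pos[of "v - v'"] by fastforce
  qed
  then obtain Y where Y: "L Y = G"
    using linear_injective_imp_surjective[OF L] by (metis surj_def)
  have "\<forall>w. h (gradient h f x) w = f' w"
    unfolding gradient_def fd
  proof (rule theI)
    show "\<forall>w. h Y w = f' w" unfolding hL f'L Y by simp
    fix Z assume Z: "\<forall>w. h Z w = f' w"
    have "L Z = L Y" by (rule vector_eq_rdot[THEN iffD1]) (use Z in \<open>simp add: hL f'L Y\<close>)
    then show "Z = Y" using inj by (simp add: inj_eq)
  qed
  then show ?thesis by blast
qed

text \<open>This is why K has its value: K^3 cancels the factor 2^n that the Hermitian coefficients
  of a unitary frame bring into f^2.\<close>

lemma one_third_power: "K_const n > 0" "K_const n ^ 3 = 2 ^ n"
proof -
  show "K_const n > 0" by (simp add: K_const_def)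
  have "K_const n ^ 3 = 2 powr (real n)" by (simp add: K_const_def powr_power)
  then show "K_const n ^ 3 = 2 ^ n" by (simp add: powr_realpow)
qed

lemma cube_eq: "a > 0 \<Longrightarrow> b > 0 \<Longrightarrow> a ^ 3 = b ^ 3 \<Longrightarrow> a = (b::real)"
  using power_eq_imp_eq_base[of a 3 b] by simp

lemma complex_multilinear_coords_2:
  fixes Z :: "(complex^'n, complex) mform"
  assumes Z: "complex_multilinear 2 Z" and U: "UNIV = {p, q::'n}" "p \<noteq> q"
  shows "Z [v, w] = (v $ p * w $ q - v $ q * w $ p) * Z [axis p 1, axis q 1]"
  using complex_multilinear_det_2[OF Z U, of "\<chi> i. if i = p then v else w"] U(2) by (simp add: det_enum_2[OF U])

lemma complex_multilinear_coords_3: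
  fixes Z :: "(complex^'n, complex) mform"
  assumes Z: "complex_multilinear 3 Z" and U: "UNIV = {p, q, s::'n}" "p \<noteq> q" "p \<noteq> s" "q \<noteq> s"
  shows "Z [v, w, z] = (v $ p * w $ q * z $ s + v $ q * w $ s * z $ p + v $ s * w $ p * z $ q
    - v $ p * w $ s * z $ q - v $ q * w $ p * z $ s - v $ s * w $ q * z $ p) * Z [axis p 1, axis q 1, axis s 1]"
  using complex_multilinear_det_3[OF Z U, of "\<chi> i. if i = p then v else if i = q then w else z"] U(2-4) by (simp add: det_enum_3[OF U])

locale ma_flow = complex_mfd X for X :: "('m::t2_space, complex^'n) atlas" +
  fixes \<omega> :: "('m, complex^'n, real) form" and \<Omega> :: "('m, complex^'n, complex) form" and u :: "real \<Rightarrow> 'm \<Rightarrow> real"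
  assumes n: "CARD('n) \<in> {2, 3}" and \<omega>: "kaehler_form X \<omega>" and \<Omega>: "holomorphic_volume_form X \<Omega>" and u: "ma13_flow X \<omega> \<Omega> u"
begin

definition spacetime :: "('m, complex^'n) chart \<Rightarrow> (real \<times> (complex^'n)) set" where
  "spacetime c = {0..} \<times> cimg c"

definition potential :: "('m, complex^'n) chart \<Rightarrow> real \<times> (complex^'n) \<Rightarrow> real" where
  "potential c = (\<lambda>(t, x). u t (cinv c x))"

definition speed :: "('m, complex^'n) chart \<Rightarrow> real \<times> (complex^'n) \<Rightarrow> real" where
  "speed c q = dirD (spacetime c) (potential c) (1, 0) q / 6"

definition kform :: "real \<Rightarrow> ('m, complex^'n, real) form" where "kform t = add_i_ddbar \<omega> (u t)"

lemma nice_spacetime: "c \<in> X \<Longrightarrow> nice (spacetime c)" unfolding spacetime_def by (rule nice_half_line[OF open_cimg])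

lemma smooth_potential: "c \<in> X \<Longrightarrow> smooth_on (spacetime c) (potential c)"
  using u unfolding ma13_flow_def smooth_function_family_def spacetime_def potential_def by blast

lemma smooth_speed: assumes "c \<in> X" shows "smooth_on (spacetime c) (speed c)"
  using smooth_on_cmult[OF nice_spacetime[OF assms] smooth_on_dirD[OF smooth_potential[OF assms]], of "1/6" "(1, 0)"]
  by (simp add: speed_def[abs_def])

text \<open>The Hessian of the potential in two space directions, as a function on space-time so
  that it can be differentiated once more, also in time.\<close>

definition third :: "('m, complex^'n) chart \<Rightarrow> complex^'n \<Rightarrow> complex^'n \<Rightarrow> real \<times> (complex^'n) \<Rightarrow> real" where
  "third c a b = dirD (spacetime c) (dirD (spacetime c) (potential c) (0, b)) (0, a)"

lemma smooth_third: "c \<in> X \<Longrightarrow> smooth_on (spacetime c) (third c a b)"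
  unfolding third_def by (intro smooth_on_dirD smooth_potential)

lemma kform_third:
  assumes c: "c \<in> X" and t: "t \<ge> 0" and x: "x \<in> cimg c" and len: "length ws = 2"
  shows "kform t c x ws = \<omega> c x ws + (third c (ws ! 1) (\<i> *s (ws ! 0)) (t, x) - third c (ws ! 0) (\<i> *s (ws ! 1)) (t, x)) / 2"
proof -
  note sm = smooth_potential[OF c, unfolded spacetime_def]
  have s: "smooth_on (cimg c) (\<lambda>y. u t (cinv c y))" using slice_half_line(1)[OF sm open_cimg[OF c] t] by (simp add: potential_def)
  have h: "hessian (cimg c) (\<lambda>y. u t (cinv c y)) x a b = third c a b (t, x)" for a b
  proof -
    have e: "dirD (cimg c) (\<lambda>y. u t (cinv c y)) b y = dirD (spacetime c) (potential c) (0, b) (t, y)" if "y \<in> cimg c" for y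
      using slice_half_line(2)[OF sm open_cimg[OF c] t that] by (simp add: potential_def spacetime_def)
    have "dirD (cimg c) (dirD (cimg c) (\<lambda>y. u t (cinv c y)) b) a x = dirD (cimg c) (\<lambda>y. dirD (spacetime c) (potential c) (0, b) (t, y)) a x"
      by (rule fun_cong[OF fd_cong(1)[OF x e]])
    then show ?thesis
      using slice_half_line(2)[OF smooth_on_dirD[OF sm] open_cimg[OF c] t x, of "(0, b)" a] by (simp add: hessian_def third_def spacetime_def)
  qed
  show ?thesis unfolding kform_def add_i_ddbar_def i_ddbar_hessian[OF open_cimg[OF c] x s len] h ..
qed

lemma kform_props: assumes c: "c \<in> X" and t: "t \<ge> 0" and x: "x \<in> cimg c"
  shows kform_alternating: "alternating 2 (kform t c x)"
  and kform_invariant: "kform t c x [\<i> *s v, \<i> *s w] = kform t c x [v, w]"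
  and kform_positive: "v \<noteq> 0 \<Longrightarrow> kform t c x [v, \<i> *s v] > 0"
proof -
  note sm = smooth_potential[OF c, unfolded spacetime_def]
  have s: "smooth_on (cimg c) (\<lambda>y. u t (cinv c y))" using slice_half_line(1)[OF sm open_cimg[OF c] t] by (simp add: potential_def)
  note p = ddbar_form_props[OF nice_open[OF open_cimg[OF c]] x s]
  note e = i_ddbar_hessian[OF open_cimg[OF c] x s]
  have "alternating 2 (\<omega> c x)" using \<omega> c x by (simp add: kaehler_form_def smooth_form_def)
  from alt_sum_list_form[OF this p(1)] show "alternating 2 (kform t c x)"
    by (rule alt_subst) (simp add: kform_def add_i_ddbar_def e)
  show "kform t c x [\<i> *s v, \<i> *s w] = kform t c x [v, w]"
    using p(2)[of v w] \<omega> c x by (simp add: kform_def add_i_ddbar_def e kaehler_form_def)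
  show "v \<noteq> 0 \<Longrightarrow> kform t c x [v, \<i> *s v] > 0"
    using u t c x by (simp add: kform_def ma13_flow_def positive_form_def)
qed

lemma smooth_snd:
  fixes g :: "complex^'n \<Rightarrow> 'b::euclidean_space"
  assumes c: "c \<in> X" and g: "smooth_on (cimg c) g"
  shows "smooth_on (spacetime c) (\<lambda>q. g (snd q))"
  by (rule smooth_on_compose[OF nice_spacetime[OF c] smooth_on_bl[OF bounded_linear_snd nice_spacetime[OF c] smooth_on_id[OF nice_spacetime[OF c]]] g])
     (auto simp: spacetime_def)

lemma dirD_snd:
  fixes g :: "complex^'n \<Rightarrow> 'b::euclidean_space"
  assumes c: "c \<in> X" and g: "smooth_on (cimg c) g" and q: "q \<in> spacetime c"
  shows "dirD (spacetime c) (\<lambda>q. g (snd q)) (s, v) q = dirD (cimg c) g v (snd q)"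
proof -
  have "(snd has_derivative snd) (at q within spacetime c)" by (rule bounded_linear_imp_has_derivative[OF bounded_linear_snd])
  moreover have "(g has_derivative frechet_derivative g (at (snd q) within cimg c)) (at (snd q) within snd ` spacetime c)"
    by (rule has_derivative_subset[OF smooth_on_has_fd[OF g]]) (use q in \<open>auto simp: spacetime_def\<close>)
  ultimately have "((\<lambda>q. g (snd q)) has_derivative (\<lambda>h. dirD (cimg c) g (snd h) (snd q))) (at q within spacetime c)"
    by (rule has_derivative_in_compose)
  from fd_eq[OF nice_spacetime[OF c] q this] show ?thesis by simp
qed

lemma \<omega>_smooth: "c \<in> X \<Longrightarrow> length vs = 2 \<Longrightarrow> smooth_on (cimg c) (\<lambda>x. \<omega> c x vs)"
  using \<omega> by (simp add: kaehler_form_def smooth_form_def)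

lemma kform_smooth: assumes c: "c \<in> X" and len: "length ws = 2" shows "smooth_on (spacetime c) (\<lambda>q. kform (fst q) c (snd q) ws)"
proof -
  let ?f = "\<lambda>q. \<omega> c (snd q) ws + 1/2 * (third c (ws ! 1) (\<i> *s (ws ! 0)) q - third c (ws ! 0) (\<i> *s (ws ! 1)) q)"
  note N = nice_spacetime[OF c]
  have "smooth_on (spacetime c) ?f"
    by (intro smooth_on_add[OF N] smooth_on_cmult[OF N] smooth_on_diff[OF N] smooth_third[OF c] smooth_snd[OF c \<omega>_smooth[OF c len]])
  then show ?thesis by (subst smooth_on_cong[where g = ?f]) (auto simp: kform_third[OF c _ _ len] spacetime_def)
qed

lemma dirD_kform:
  assumes c: "c \<in> X" and q: "q \<in> spacetime c"
  shows "dirD (spacetime c) (\<lambda>q. kform (fst q) c (snd q) [v, w]) (s, a) q = dirD (cimg c) (\<lambda>x. \<omega> c x [v, w]) a (snd q)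
    + 1/2 * (dirD (spacetime c) (third c w (\<i> *s v)) (s, a) q - dirD (spacetime c) (third c v (\<i> *s w)) (s, a) q)"
proof -
  let ?f = "\<lambda>q. \<omega> c (snd q) [v, w] + 1/2 * (third c w (\<i> *s v) q - third c v (\<i> *s w) q)"
  note N = nice_spacetime[OF c]
  have sw: "smooth_on (cimg c) (\<lambda>x. \<omega> c x [v, w])" by (rule \<omega>_smooth[OF c]) simp
  have "dirD (spacetime c) (\<lambda>q. kform (fst q) c (snd q) [v, w]) (s, a) q = dirD (spacetime c) ?f (s, a) q"
    by (subst fd_cong(1)[OF q, where g = ?f]) (auto simp: kform_third[OF c] spacetime_def)
  also have "\<dots> = dirD (spacetime c) (\<lambda>q. \<omega> c (snd q) [v, w]) (s, a) q
     + 1/2 * (dirD (spacetime c) (third c w (\<i> *s v)) (s, a) q - dirD (spacetime c) (third c v (\<i> *s w)) (s, a) q)"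
    by (simp only: dirD_add[OF N q smooth_snd[OF c sw] smooth_on_cmult[OF N smooth_on_diff[OF N smooth_third[OF c] smooth_third[OF c]]]]
        dirD_cmult[OF N q smooth_on_diff[OF N smooth_third[OF c] smooth_third[OF c]]] dirD_diff[OF N q smooth_third[OF c] smooth_third[OF c]])
  finally show ?thesis unfolding dirD_snd[OF c sw q] .
qed

text \<open>The form \<omega> is closed, and the third derivatives of the potential cancel in pairs
  by symmetry.\<close>

lemma kform_closed:
  assumes c: "c \<in> X" and q: "q \<in> spacetime c"
  defines "D \<equiv> \<lambda>a v w. dirD (spacetime c) (\<lambda>q. kform (fst q) c (snd q) [v, w]) (0, a) q"
  shows "D a v w - D v a w + D w a v = 0"
proof -
  have x: "snd q \<in> cimg c" using q by (auto simp: spacetime_def)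
  have "ext_d \<omega> c (snd q) [a, v, w] = 0"
    using \<omega> c x by (simp add: kaehler_form_def closed_form_def form_eq_def)
  then have z: "dirD (cimg c) (\<lambda>x. \<omega> c x [v, w]) a (snd q) - dirD (cimg c) (\<lambda>x. \<omega> c x [a, w]) v (snd q) + dirD (cimg c) (\<lambda>x. \<omega> c x [a, v]) w (snd q) = 0"
    by (simp add: ext_d_def numeral_eq_Suc at_within_open[OF x open_cimg[OF c]])
  have s: "dirD (spacetime c) (third c a b) (0, v) q = dirD (spacetime c) (third c v b) (0, a) q" for a b v
    unfolding third_def by (rule second_derivative_symmetric[OF nice_spacetime[OF c] q smooth_on_dirD[OF smooth_potential[OF c]]])
  show ?thesis unfolding D_def dirD_kform[OF c q] using z s[of w "\<i> *s v" a] s[of v "\<i> *s w" a] s[of w "\<i> *s a" v]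
    by (simp add: algebra_simps)
qed

text \<open>The form \<omega> is independent of time, and the time derivative of the potential, 6
  times the speed, commutes with the two space derivatives. The factor 3 is this 6 times the 1/2 in
  \<open>kform_third\<close>.\<close>

lemma kform_time:
  assumes c: "c \<in> X" and q: "q \<in> spacetime c"
  shows "dirD (spacetime c) (\<lambda>q. kform (fst q) c (snd q) [v, w]) (1, 0) q =
    - 3 * (dirD (spacetime c) (dirD (spacetime c) (speed c) (0, \<i> *s w)) (0, v) q - dirD (spacetime c) (dirD (spacetime c) (speed c) (0, \<i> *s v)) (0, w) q)"
proof -
  have x: "snd q \<in> cimg c" using q by (auto simp: spacetime_def)
  note N = nice_spacetime[OF c] and sp = smooth_potential[OF c]
  have z: "dirD (cimg c) (\<lambda>x. \<omega> c x [v, w]) 0 (snd q) = 0"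
    by (rule linear_0[OF smooth_on_linear_fd[OF \<omega>_smooth[OF c] x]]) simp
  have "dirD (spacetime c) (third c a b) (1, 0) q = 6 * dirD (spacetime c) (dirD (spacetime c) (speed c) (0, b)) (0, a) q" for a b
  proof -
    have e: "dirD (spacetime c) (dirD (spacetime c) (potential c) (0, b)) (1, 0) p = 6 * dirD (spacetime c) (speed c) (0, b) p" if "p \<in> spacetime c" for p
    proof -
      have "dirD (spacetime c) (speed c) (0, b) p = dirD (spacetime c) (\<lambda>q. 1/6 * dirD (spacetime c) (potential c) (1, 0) q) (0, b) p"
        by (simp add: speed_def[abs_def])
      also have "\<dots> = 1/6 * dirD (spacetime c) (dirD (spacetime c) (potential c) (1, 0)) (0, b) p"
        by (rule dirD_cmult[OF N that smooth_on_dirD[OF sp]])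
      also have "dirD (spacetime c) (dirD (spacetime c) (potential c) (1, 0)) (0, b) p = dirD (spacetime c) (dirD (spacetime c) (potential c) (0, b)) (1, 0) p"
        by (rule second_derivative_symmetric[OF N that sp])
      finally show ?thesis by simp
    qed
    have "dirD (spacetime c) (third c a b) (1, 0) q = dirD (spacetime c) (dirD (spacetime c) (dirD (spacetime c) (potential c) (0, b)) (1, 0)) (0, a) q"
      unfolding third_def by (rule second_derivative_symmetric[OF N q smooth_on_dirD[OF sp]])
    also have "\<dots> = dirD (spacetime c) (\<lambda>p. 6 * dirD (spacetime c) (speed c) (0, b) p) (0, a) q"
      using fd_cong(1)[OF q e] by simp
    also have "\<dots> = 6 * dirD (spacetime c) (dirD (spacetime c) (speed c) (0, b)) (0, a) q"
      by (rule dirD_cmult[OF N q smooth_on_dirD[OF smooth_speed[OF c]]])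
    finally show ?thesis .
  qed
  then show ?thesis unfolding dirD_kform[OF c q] z by simp
qed

text \<open>In a chart \<open>i_ddbar\<close> is - (1/2) d of the 1-form du o J. Transition maps are
  holomorphic, so their derivatives commute with J and du o J transforms as a form;
  \<open>extd_on_pullback\<close> carries this over to its exterior derivative.\<close>

lemma kform_law: assumes t: "t \<ge> 0" shows "form_law 2 (kform t)"
  unfolding form_law_def
proof (intro ballI allI impI)
  fix c c' x and vs :: "(complex^'n) list" assume c: "c \<in> X" "c' \<in> X" and x: "x \<in> overlap c c'" and len: "length vs = 2"
  let ?\<tau> = "transition c c'" and ?U = "overlap c c'" and ?U' = "overlap c' c"
  let ?D = "\<lambda>y. frechet_derivative ?\<tau> (at y)"
  let ?g = "\<lambda>y. u t (cinv c y)" and ?g' = "\<lambda>y. u t (cinv c' y)"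
  have oU: "open ?U" "open ?U'" using open_overlap c by auto
  note nU = nice_open[OF oU(1)] and nU' = nice_open[OF oU(2)]
  have x': "?\<tau> x \<in> ?U'" by (rule transition_in[OF c x])
  have sm: "smooth_on (cimg d) (\<lambda>y. u t (cinv d y))" if "d \<in> X" for d
    using slice_half_line(1)[OF smooth_potential[OF that, unfolded spacetime_def] open_cimg[OF that] t] by (simp add: potential_def)
  have s: "smooth_on ?U ?g" using smooth_on_subset[OF sm[OF c(1)] _ nU] in_overlap[OF c(1)] by auto
  have s': "smooth_on ?U' ?g'" using smooth_on_subset[OF sm[OF c(2)] _ nU'] in_overlap[OF c(2)] by auto
  define \<gamma> where "\<gamma> y vs = dirD ?U ?g (\<i> *s (vs ! 0)) y" for y and vs :: "(complex^'n) list"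
  define \<gamma>' where "\<gamma>' y vs = dirD ?U' ?g' (\<i> *s (vs ! 0)) y" for y and vs :: "(complex^'n) list"
  have al: "alternating 1 (\<gamma>' y)" if "y \<in> ?U'" for y
  proof -
    have "linear (\<lambda>v. dirD ?U' ?g' (\<i> *s v) y)"
      using linear_compose[OF linear_i_scale smooth_on_linear_fd[OF s' that]] by (simp add: o_def)
    from alternating_covector[OF this] show ?thesis by (simp add: \<gamma>'_def[abs_def])
  qed
  have sg: "smooth_on ?U' (\<lambda>y. \<gamma>' y vs)" for vs unfolding \<gamma>'_def by (rule smooth_on_dirD[OF s'])
  have pull: "\<gamma> y [v] = \<gamma>' (?\<tau> y) (map (\<lambda>v. dirD ?U ?\<tau> v y) [v])" if y: "y \<in> ?U" for y v
  proof -
    have "(?\<tau> has_derivative ?D y) (at y)" by (rule transition_has_derivative[OF c y])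
    moreover have "(?g' has_derivative (\<lambda>v. dirD ?U' ?g' v (?\<tau> y))) (at (?\<tau> y))"
      using smooth_on_has_fd[OF s' transition_in[OF c y]] at_within_open[OF transition_in[OF c y] oU(2)] by simp
    ultimately have "((\<lambda>y. ?g' (?\<tau> y)) has_derivative (\<lambda>v. dirD ?U' ?g' (?D y v) (?\<tau> y))) (at y)"
      by (rule has_derivative_compose)
    then have "(?g has_derivative (\<lambda>v. dirD ?U' ?g' (?D y v) (?\<tau> y))) (at y)"
      by (rule has_derivative_transform_within_open[OF _ oU(1) y]) (simp add: cinv_transition[OF c])
    from fun_cong[OF frechet_derivative_at[OF this, symmetric]]
    show ?thesis by (simp add: \<gamma>_def \<gamma>'_def at_within_open[OF y oU(1)] transition_complex_linear[OF c y])
  qed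
  have dd: "i_ddbar (u t) c x vs = - 1/2 * extd_on ?U \<gamma> x vs"
    using i_ddbar_hessian[OF oU(1) x s len] len
    by (auto simp: numeral_2_eq_2 length_Suc_conv extd_on_def hessian_def \<gamma>_def field_simps)
  have dd': "i_ddbar (u t) c' (?\<tau> x) ws = - 1/2 * extd_on ?U' \<gamma>' (?\<tau> x) ws" if "length ws = 2" for ws
    using i_ddbar_hessian[OF oU(2) x' s' that] that
    by (auto simp: numeral_2_eq_2 length_Suc_conv extd_on_def hessian_def \<gamma>'_def field_simps)
  have "extd_on ?U \<gamma> x vs = extd_on ?U (\<lambda>y us. \<gamma>' (?\<tau> y) (map (\<lambda>v. dirD ?U ?\<tau> v y) us)) x vs"
    unfolding extd_on_def
  proof (intro sum.cong refl arg_cong2[where f = "(*\<^sub>R)"])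
    fix i assume "i \<in> {..<length vs}"
    then obtain v where v: "take i vs @ drop (Suc i) vs = [v]" using len
      by (auto simp: numeral_2_eq_2 length_Suc_conv less_Suc_eq)
    show "dirD ?U (\<lambda>y. \<gamma> y (take i vs @ drop (Suc i) vs)) (vs ! i) x
      = dirD ?U (\<lambda>y. \<gamma>' (?\<tau> y) (map (\<lambda>v. dirD ?U ?\<tau> v y) (take i vs @ drop (Suc i) vs))) (vs ! i) x"
      unfolding v using fd_cong(1)[OF x pull] by simp
  qed
  also have "\<dots> = extd_on ?U' \<gamma>' (?\<tau> x) (map (\<lambda>v. dirD ?U ?\<tau> v x) vs)"
    by (rule extd_on_pullback[OF nU smooth_transition[OF c] transition_in[OF c] al sg x]) (use len in auto)
  finally have E: "extd_on ?U \<gamma> x vs = extd_on ?U' \<gamma>' (?\<tau> x) (map (?D x) vs)" by (simp only: at_within_open[OF x oU(1)])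
  have "\<omega> c x vs = \<omega> c' (?\<tau> x) (map (?D x) vs)"
    using \<omega> c x len unfolding kaehler_form_def smooth_form_def by blast
  then show "kform t c x vs = kform t c' (?\<tau> x) (map (?D x) vs)"
    unfolding kform_def add_i_ddbar_def dd E using dd'[of "map (?D x) vs"] len by simp
qed

section \<open>The holomorphic volume form in charts\<close>

lemma \<Omega>_law: "form_law CARD('n) \<Omega>"
  using \<Omega> unfolding form_law_def holomorphic_volume_form_def smooth_form_def by blast

lemma \<Omega>_multilinear: assumes "c \<in> X" "x \<in> cimg c" shows "complex_multilinear CARD('n) (\<Omega> c x)" "\<exists>vs. length vs = CARD('n) \<and> \<Omega> c x vs \<noteq> 0"
  using \<Omega> assms unfolding complex_multilinear_def holomorphic_volume_form_def smooth_form_def by blast+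

lemma \<Omega>_smooth: "c \<in> X \<Longrightarrow> length vs = CARD('n) \<Longrightarrow> smooth_on (cimg c) (\<lambda>x. \<Omega> c x vs)"
  using \<Omega> by (simp add: holomorphic_volume_form_def smooth_form_def)

lemma \<Omega>_holomorphic: assumes c: "c \<in> X" and x: "x \<in> cimg c" and len: "length vs = CARD('n)"
  shows "dirD (cimg c) (\<lambda>x. \<Omega> c x vs) a x = (\<Sum>p\<in>UNIV. a $ p * dirD (cimg c) (\<lambda>x. \<Omega> c x vs) (axis p 1) x)"
proof -
  let ?L = "\<lambda>a. dirD (cimg c) (\<lambda>x. \<Omega> c x vs) a x"
  have L: "linear ?L" by (rule smooth_on_linear_fd[OF \<Omega>_smooth[OF c len] x])
  have i: "?L (\<i> *s a) = \<i> * ?L a" for a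
    using \<Omega> c x len by (simp add: holomorphic_volume_form_def holomorphic_fun_on_def at_within_open[OF x open_cimg[OF c]])
  have s: "?L (z *s a) = z * ?L a" for z a
  proof -
    have "z *s a = Re z *\<^sub>R a + Im z *\<^sub>R (\<i> *s a)" by (simp add: vec_eq_iff complex_eq_iff)
    then show ?thesis by (simp add: linear_add[OF L] linear_scale[OF L] i complex_eq_iff)
  qed
  have "?L a = ?L (\<Sum>p\<in>UNIV. a $ p *s axis p 1)" by (rule arg_cong[where f = ?L]) (rule vec_axis_sum)
  then show ?thesis by (simp only: linear_sum[OF L] s)
qed

text \<open>The coefficient has a complex linear derivative, so d\<Omega> is of type (3, 0) and
  vanishes in two complex variables. The version in dimension 3 is the same with type (4,
  0).\<close>

lemma \<Omega>_closed_2: assumes c: "c \<in> X" and x: "x \<in> cimg c" and 2: "CARD('n) = 2"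
  defines "D \<equiv> \<lambda>a v w. dirD (cimg c) (\<lambda>x. \<Omega> c x [v, w]) a x"
  shows "D a v w - D v a w + D w a v = 0"
proof -
  obtain p q where U: "UNIV = {p, q::'n}" "p \<noteq> q" using 2 by (auto simp: card_2_iff)
  let ?f = "\<lambda>x. \<Omega> c x [axis p 1, axis q 1]"
  have sf: "smooth_on (cimg c) ?f" using \<Omega>_smooth[OF c] 2 by simp
  have D1: "D a v w = (v $ p * w $ q - v $ q * w $ p) * dirD (cimg c) ?f a x" for a v w
  proof -
    have "D a v w = dirD (cimg c) (\<lambda>x. (v $ p * w $ q - v $ q * w $ p) * ?f x) a x"
      unfolding D_def by (rule fun_cong[OF fd_cong(1)[OF x]]) (rule complex_multilinear_coords_2[OF \<Omega>_multilinear(1)[OF c, unfolded 2] U])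
    also have "\<dots> = (v $ p * w $ q - v $ q * w $ p) * dirD (cimg c) ?f a x"
      by (rule smooth_dirD_bl[OF nice_open[OF open_cimg[OF c]] x bounded_linear_mult_right sf])
    finally show ?thesis .
  qed
  define L where "L i = dirD (cimg c) ?f (axis i 1) x" for i
  have D2: "dirD (cimg c) ?f a x = a $ p * L p + a $ q * L q" for a unfolding L_def
    using \<Omega>_holomorphic[OF c x, of "[axis p 1, axis q 1]" a] 2 U(2) unfolding U(1) by simp
  show ?thesis unfolding D1 D2 by (simp add: algebra_simps)
qed

lemma \<Omega>_closed_3: assumes c: "c \<in> X" and x: "x \<in> cimg c" and 3: "CARD('n) = 3"
  defines "D \<equiv> \<lambda>a v w z. dirD (cimg c) (\<lambda>x. \<Omega> c x [v, w, z]) a x"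
  shows "D a v w z - D v a w z + D w a v z - D z a v w = 0"
proof -
  obtain p q s where U: "UNIV = {p, q, s::'n}" "p \<noteq> q" "p \<noteq> s" "q \<noteq> s" using 3 by (auto simp: card_3_iff)
  let ?f = "\<lambda>x. \<Omega> c x [axis p 1, axis q 1, axis s 1]"
  have sf: "smooth_on (cimg c) ?f" using \<Omega>_smooth[OF c] 3 by simp
  define E where "E v w z = v $ p * w $ q * z $ s + v $ q * w $ s * z $ p + v $ s * w $ p * z $ q
    - v $ p * w $ s * z $ q - v $ q * w $ p * z $ s - v $ s * w $ q * z $ p" for v w z :: "complex^'n"
  have D1: "D a v w z = E v w z * dirD (cimg c) ?f a x" for a v w z
  proof -
    have "D a v w z = dirD (cimg c) (\<lambda>x. E v w z * ?f x) a x"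
      unfolding D_def E_def by (rule fun_cong[OF fd_cong(1)[OF x]]) (rule complex_multilinear_coords_3[OF \<Omega>_multilinear(1)[OF c, unfolded 3] U])
    also have "\<dots> = E v w z * dirD (cimg c) ?f a x"
      by (rule smooth_dirD_bl[OF nice_open[OF open_cimg[OF c]] x bounded_linear_mult_right sf])
    finally show ?thesis .
  qed
  define L where "L i = dirD (cimg c) ?f (axis i 1) x" for i
  have D2: "dirD (cimg c) ?f a x = a $ p * L p + a $ q * L q + a $ s * L s" for a unfolding L_def
    using \<Omega>_holomorphic[OF c x, of "[axis p 1, axis q 1, axis s 1]" a] 3 U(2-4) unfolding U(1) by (simp add: add.assoc)
  show ?thesis unfolding D1 D2 E_def by (simp add: algebra_simps)
qed

section \<open>The flow equation on unitary frames\<close>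

lemma speed_formula:
  assumes c: "c \<in> X" and t: "t \<ge> 0" and x: "x \<in> cimg c"
  shows "speed c (t, x) = K_const CARD('n) * root 3 (exp (- 2 * ln (norm_Omega \<omega> \<Omega> c x)) *
     Re (det (herm_coeff (kform t c x)) / det (herm_coeff (\<omega> c x))))" (is "_ = ?R")
proof -
  have p: "(t, x) \<in> spacetime c" using t x by (simp add: spacetime_def)
  have "((\<lambda>s. (s, x)) has_derivative (\<lambda>h. (h, 0))) (at t within {0..})"
    by (intro has_derivative_Pair has_derivative_const has_derivative_ident)
  from has_derivative_in_compose[OF this has_derivative_subset[OF smooth_on_has_fd[OF smooth_potential[OF c] p]]]
  have "((\<lambda>s. u s (cinv c x)) has_derivative (\<lambda>h. dirD (spacetime c) (potential c) (h, 0) (t, x))) (at t within {0..})"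
    using x by (auto simp: potential_def spacetime_def image_subset_iff)
  moreover have "dirD (spacetime c) (potential c) (h, 0) (t, x) = h *\<^sub>R (6 * speed c (t, x))" for h
    using linear_scale[OF smooth_on_linear_fd[OF smooth_potential[OF c] p], of h "(1, 0)"] by (simp add: speed_def)
  ultimately have 1: "((\<lambda>s. u s (cinv c x)) has_vector_derivative 6 * speed c (t, x)) (at t within {0..})"
    by (simp add: has_vector_derivative_def)
  have 2: "((\<lambda>s. u s (cinv c x)) has_vector_derivative 6 * ?R) (at t within {0..})"
    using u c t x unfolding ma13_flow_def kform_def has_real_derivative_iff_has_vector_derivative by (simp add: mult.assoc)
  \<comment> \<open>Time derivatives within the half-line are unique at every t, including the
    one-sided one at t = 0.\<close>
  have "t islimpt {0..}" by (rule islimpt_subset[OF islimpt_greaterThanLessThan1[of t "t + 1"]]) (use t in auto)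
  then have "at t within {0..} \<noteq> bot" by (simp add: trivial_limit_within)
  from vector_derivative_unique_within[OF this 1 2] show ?thesis by simp
qed

text \<open>Let a be the squared modulus of \<Omega> on the standard basis, D the determinant of the
  evolving metric and F the speed. The determinant of \<omega> cancels in the flow equation, so F^3
  = K^3 D / a. The frame has f^2 = a / (2^n D), and K^3 = 2^n gives F^3 f^2 = 1. Likewise the norm
  of \<Omega> to the power - 2/3 is the cube root of D / a, which is F / K.\<close>

lemma speed_frame:
  assumes c: "c \<in> X" and t: "t \<ge> 0" and x: "x \<in> cimg c"
  obtains \<epsilon> f where "f > 0" "speed c (t, x) > 0" "speed c (t, x) ^ 3 * f\<^sup>2 = 1"
    "\<And>i j. i < CARD('n) \<Longrightarrow> j < CARD('n) \<Longrightarrow> kform t c x [\<epsilon> i, \<epsilon> j] = 0 \<and> kform t c x [\<epsilon> i, \<i> *s \<epsilon> j] = (if i = j then 1 else 0)"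
    "\<Omega> c x (map \<epsilon> [0..<CARD('n)]) = complex_of_real f"
    "norm_Omega (kform t) \<Omega> c x powr (- 2 / 3) = speed c (t, x) / K_const CARD('n)"
proof (rule unitary_frame[OF n kform_alternating[OF c t x] kform_invariant[OF c t x] kform_positive[OF c t x] \<Omega>_multilinear[OF c x]])
  fix \<epsilon> :: "nat \<Rightarrow> complex^'n" and f :: real
  assume f: "f > 0" and fr: "\<And>i j. i < CARD('n) \<Longrightarrow> j < CARD('n) \<Longrightarrow> kform t c x [\<epsilon> i, \<epsilon> j] = 0 \<and> kform t c x [\<epsilon> i, \<i> *s \<epsilon> j] = (if i = j then 1 else 0)"
    and Zf: "\<Omega> c x (map \<epsilon> [0..<CARD('n)]) = complex_of_real f"
    and d: "Im (det (herm_coeff (kform t c x))) = 0" "Re (det (herm_coeff (kform t c x))) > 0"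
    and f2: "f\<^sup>2 = (cmod (\<Omega> c x std_basis))\<^sup>2 / (2 ^ CARD('n) * Re (det (herm_coeff (kform t c x))))" and Zs: "\<Omega> c x std_basis \<noteq> 0"
  have \<omega>x: "alternating 2 (\<omega> c x)" "\<And>v w. \<omega> c x [\<i> *s v, \<i> *s w] = \<omega> c x [v, w]" "\<And>v. v \<noteq> 0 \<Longrightarrow> \<omega> c x [v, \<i> *s v] > 0"
    using \<omega> c x by (auto simp: kaehler_form_def smooth_form_def)
  have d0: "Im (det (herm_coeff (\<omega> c x))) = 0 \<and> Re (det (herm_coeff (\<omega> c x))) > 0"
  proof (rule unitary_frame[OF n \<omega>x \<Omega>_multilinear[OF c x]])
    assume "Im (det (herm_coeff (\<omega> c x))) = 0" "Re (det (herm_coeff (\<omega> c x))) > 0"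
    then show ?thesis by (rule conjI)
  qed
  define a where "a = (cmod (\<Omega> c x std_basis))\<^sup>2"
  define D where "D = Re (det (herm_coeff (kform t c x)))"
  define D0 where "D0 = Re (det (herm_coeff (\<omega> c x)))"
  define K where "K = K_const CARD('n)"
  have a: "a > 0" using Zs by (simp add: a_def)
  have K: "K > 0" "K ^ 3 = 2 ^ CARD('n)" using one_third_power by (auto simp: K_def)
  have of_D: "det (herm_coeff (kform t c x)) = of_real D" "det (herm_coeff (\<omega> c x)) = of_real D0"
    using d d0 by (simp_all add: D_def D0_def complex_eq_iff)
  have D: "D > 0" "D0 > 0" using d d0 by (simp_all add: D_def D0_def)
  have N0: "norm_Omega \<omega> \<Omega> c x = sqrt (a / D0)" "norm_Omega (kform t) \<Omega> c x = sqrt (a / D)"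
    by (simp_all add: norm_Omega_def a_def D0_def D_def)
  have "ln (sqrt (a / D0)) = ln (a / D0) / 2" using a D by (simp add: ln_sqrt)
  then have "exp (- 2 * ln (sqrt (a / D0))) = exp (- ln (a / D0))" by simp
  also have "\<dots> = D0 / a" using a D by (simp add: exp_minus)
  finally have "exp (- 2 * ln (sqrt (a / D0))) = D0 / a" .
  have F: "speed c (t, x) = K * root 3 (D / a)"
    unfolding speed_formula[OF c t x] of_D N0 K_def[symmetric] \<open>exp (- 2 * ln (sqrt (a / D0))) = D0 / a\<close> using D by simp
  have Fp: "speed c (t, x) > 0" unfolding F using K a D by simp
  have F3: "speed c (t, x) ^ 3 = 2 ^ CARD('n) * (D / a)" unfolding F by (simp add: power_mult_distrib K odd_real_root_pow)
  have "speed c (t, x) ^ 3 * f\<^sup>2 = 1" unfolding F3 f2 a_def[symmetric] D_def[symmetric] using a D by simp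
  moreover have "norm_Omega (kform t) \<Omega> c x powr (- 2 / 3) = speed c (t, x) / K"
  proof (rule cube_eq)
    have N: "sqrt (a / D) > 0" using a D by simp
    then show "norm_Omega (kform t) \<Omega> c x powr (- 2 / 3) > 0" unfolding N0 using a D by simp
    show "speed c (t, x) / K > 0" using Fp K by simp
    have "(sqrt (a / D) powr (- 2 / 3)) ^ 3 = (sqrt (a / D) powr (- 2 / 3)) powr real 3"
      using N by (simp only: powr_realpow powr_gt_zero)
    also have "\<dots> = sqrt (a / D) powr (- 2)" by (simp only: powr_powr) simp
    also have "\<dots> = 1 / (sqrt (a / D))\<^sup>2" using N by (simp add: powr_minus powr_numeral divide_inverse)
    also have "\<dots> = D / a" using a D by simp
    finally show "(norm_Omega (kform t) \<Omega> c x powr (- 2 / 3)) ^ 3 = (speed c (t, x) / K) ^ 3"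
      unfolding N0 by (simp add: power_divide F3 K)
  qed
  ultimately show ?thesis using that[OF f Fp _ fr Zf] by (simp add: K_def)
qed

text \<open>The metric is B(v, \<i> w), and by \<open>speed_frame\<close> the factor K cancels, so Y
  is minus the gradient of the speed F. Inserting \<i> w for w in B(Y, \<i> w) = - dF(w) gives the
  claim.\<close>

lemma Y_contraction:
  assumes c: "c \<in> X" and t: "t \<ge> 0" and x: "x \<in> cimg c"
  shows "kform t c x [Y_field (kform t) \<Omega> c x, w] = dirD (spacetime c) (speed c) (0, \<i> *s w) (t, x)"
proof -
  let ?B = "kform t c x" and ?K = "K_const CARD('n)" and ?D = "\<lambda>w. dirD (spacetime c) (speed c) (0, w) (t, x)"
  note alt = kform_alternating[OF c t x] and inv = kform_invariant[OF c t x]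
  have l1: "linear (\<lambda>v. ?B [v, w])" for w using alt_linear_hd[OF alt, of "[w]"] by simp
  have l2: "linear (\<lambda>v. ?B [w, v])" for w using alt_linear_mid[OF alt, of "[w]" "[]"] by simp
  have h: "metric_of ?B v w = ?B [v, \<i> *s w]" for v w
    using inv[of "\<i> *s v" w] linear_neg[OF l1, of "\<i> *s v" w] linear_neg[OF l1, of v "\<i> *s w"] by (simp add: metric_of_def i_scale_twice)
  have d: "((\<lambda>y. speed c (t, y)) has_derivative ?D) (at x)"
    using slice_half_line(3)[OF smooth_speed[OF c, unfolded spacetime_def] open_cimg[OF c] t x] by (simp add: spacetime_def)
  have "((\<lambda>y. speed c (t, y) / ?K) has_derivative (\<lambda>w. ?D w / ?K)) (at x)"
    by (rule bounded_linear.has_derivative[OF bounded_linear_divide d])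
  then have d': "((\<lambda>y. norm_Omega (kform t) \<Omega> c y powr (- 2 / 3)) has_derivative (\<lambda>w. ?D w / ?K)) (at x)"
  proof (rule has_derivative_transform_within_open[OF _ open_cimg[OF c] x])
    fix y assume "y \<in> cimg c"
    then show "speed c (t, y) / ?K = norm_Omega (kform t) \<Omega> c y powr (- 2 / 3)"
      by (rule speed_frame[OF c t]) simp
  qed
  have "metric_of ?B (gradient (metric_of ?B) (\<lambda>y. norm_Omega (kform t) \<Omega> c y powr (- 2 / 3)) x) w = ?D w / ?K" for w
  proof (rule gradient_spec[OF _ _ _ d'])
    show "linear (\<lambda>v. metric_of ?B v w)" for w unfolding h by (rule l1)
    show "linear (metric_of ?B v)" for v unfolding h[abs_def] using linear_compose[OF linear_i_scale l2[of v]] by (simp add: o_def)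
    show "v \<noteq> 0 \<Longrightarrow> metric_of ?B v v > 0" for v unfolding h by (rule kform_positive[OF c t x])
  qed
  then have "?B [Y_field (kform t) \<Omega> c x, \<i> *s w] = - ?D w" for w
    unfolding Y_field_def h using one_third_power(1)[of "CARD('n)"] by (simp add: linear_scale[OF l1] linear_neg[OF l1])
  from this[of "\<i> *s w"] show ?thesis using linear_neg[OF l2, of _ w] by (simp add: i_scale_twice)
qed

end

subsection \<open>Uniqueness\<close>

text \<open>The flow equation is autonomous; the shift lets short-time uniqueness be applied at a
  later time.\<close>

lemma flow_shift:
  fixes A :: "('m, 'e::euclidean_space) atlas"
  assumes fl: "g2_laplacian_flow A I \<phi>" and op: "\<And>c. c \<in> A \<Longrightarrow> open (cimg c)" and sub: "\<And>s. s \<in> {0..<T} \<Longrightarrow> \<sigma> + s \<in> I"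
  shows "g2_laplacian_flow A {0..<T} (\<lambda>s. \<phi> (\<sigma> + s))"
  unfolding g2_laplacian_flow_def
proof (intro conjI ballI allI impI)
  show "g2_structure A (\<phi> (\<sigma> + t))" if "t \<in> {0..<T}" for t using fl sub[OF that] by (simp add: g2_laplacian_flow_def)
next
  fix c and vs :: "'e list" assume c: "c \<in> A" and len: "length vs = 3"
  have N: "nice ({0..<T} \<times> cimg c)" by (rule nice_interval[OF op[OF c]])
  have sm: "smooth_on (I \<times> cimg c) (\<lambda>(t, x). \<phi> t c x vs)" using fl c len by (simp add: g2_laplacian_flow_def)
  have sh: "smooth_on ({0..<T} \<times> cimg c) (\<lambda>q. (\<sigma> + fst q, snd q))"
    by (intro smooth_on_Pair[OF N] smooth_on_add[OF N] smooth_on_const[OF N] smooth_on_bl[OF bounded_linear_fst N smooth_on_id[OF N]]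
        smooth_on_bl[OF bounded_linear_snd N smooth_on_id[OF N]])
  have "smooth_on ({0..<T} \<times> cimg c) (\<lambda>q. (\<lambda>(t, x). \<phi> t c x vs) (\<sigma> + fst q, snd q))"
    by (rule smooth_on_compose[OF N sh sm]) (use sub in auto)
  then show "smooth_on ({0..<T} \<times> cimg c) (\<lambda>(t, x). \<phi> (\<sigma> + t) c x vs)" by (simp add: case_prod_unfold)
next
  fix t c x and vs :: "'e list" assume t: "t \<in> {0..<T}" and c: "c \<in> A" "x \<in> cimg c" and len: "length vs = 3"
  let ?H = "hodge_laplacian (\<phi> (\<sigma> + t)) 3 (\<phi> (\<sigma> + t)) c x vs"
  have "((\<lambda>s. \<phi> s c x vs) has_real_derivative ?H) (at (\<sigma> + t) within I)"
    using fl c len sub[OF t] by (simp add: g2_laplacian_flow_def)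
  then have "((\<lambda>s. \<phi> s c x vs) has_real_derivative ?H) (at (\<sigma> + t) within (\<lambda>s. \<sigma> + s) ` {0..<T})"
    by (rule DERIV_subset) (rule image_subsetI, rule sub)
  moreover have "((\<lambda>s. \<sigma> + s) has_real_derivative 1) (at t within {0..<T})" by (auto intro!: derivative_eq_intros)
  ultimately have "((\<lambda>s. \<phi> s c x vs) \<circ> (\<lambda>s. \<sigma> + s) has_real_derivative ?H * 1) (at t within {0..<T})"
    by (rule DERIV_image_chain)
  then show "((\<lambda>s. \<phi> (\<sigma> + s) c x vs) has_real_derivative ?H) (at t within {0..<T})" by (simp add: o_def)
qed

theorem flow_unique:
  fixes A :: "('m, 'e::euclidean_space) atlas"
  assumes stu: "short_time_uniqueness A" and op: "\<And>c. c \<in> A \<Longrightarrow> open (cimg c)"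
    and \<phi>: "g2_laplacian_flow A {0..} \<phi>" and closed: "\<And>t. t \<ge> 0 \<Longrightarrow> closed_form A 3 (\<phi> t)"
    and \<psi>: "g2_laplacian_flow A {0..<T} \<psi>" and eq0: "form_eq A 3 (\<psi> 0) (\<phi> 0)" and t: "t \<in> {0..<T}"
  shows "form_eq A 3 (\<psi> t) (\<phi> t)"
proof (rule ccontr)
  assume neq: "\<not> form_eq A 3 (\<psi> t) (\<phi> t)"
  define B where "B = {s. 0 \<le> s \<and> s < T \<and> \<not> form_eq A 3 (\<psi> s) (\<phi> s)}"
  define \<sigma> where "\<sigma> = Inf B"
  have tB: "t \<in> B" using neq t by (simp add: B_def)
  have bB: "bdd_below B" by (rule bdd_belowI[of _ 0]) (simp add: B_def)
  have "0 \<le> \<sigma>" unfolding \<sigma>_def by (rule cInf_greatest) (use tB in \<open>auto simp: B_def\<close>)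
  moreover have "\<sigma> \<le> t" unfolding \<sigma>_def by (rule cInf_lower[OF tB bB])
  ultimately have \<sigma>: "0 \<le> \<sigma>" "\<sigma> \<le> t" by auto
  have \<sigma>T: "\<sigma> < T" using \<sigma> t by simp
  have below: "form_eq A 3 (\<psi> s) (\<phi> s)" if "0 \<le> s" "s < \<sigma>" for s
  proof (rule ccontr)
    assume "\<not> ?thesis"
    then have "s \<in> B" using that \<sigma>T by (simp add: B_def)
    from cInf_lower[OF this bB] show False using that by (simp add: \<sigma>_def)
  qed
  \<comment> \<open>At the first time of disagreement the solutions still agree, by continuity in
    time or, if that time is 0, by the initial condition.\<close>
  have at\<sigma>: "form_eq A 3 (\<psi> \<sigma>) (\<phi> \<sigma>)"
  proof (cases "\<sigma> = 0")
    case False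
    show ?thesis unfolding form_eq_def
    proof (intro ballI allI impI)
      fix c x and vs :: "'e list" assume c: "c \<in> A" "x \<in> cimg c" and len: "length vs = 3"
      let ?f = "\<lambda>s. \<psi> s c x vs - \<phi> s c x vs"
      have "continuous_on {0..<T} (\<lambda>s. \<psi> s c x vs)"
        by (rule DERIV_continuous_on[of _ _ "\<lambda>t. hodge_laplacian (\<psi> t) 3 (\<psi> t) c x vs"]) (use \<psi> c len in \<open>simp add: g2_laplacian_flow_def\<close>)
      moreover have "continuous_on {0..} (\<lambda>s. \<phi> s c x vs)"
        by (rule DERIV_continuous_on[of _ _ "\<lambda>t. hodge_laplacian (\<phi> t) 3 (\<phi> t) c x vs"]) (use \<phi> c len in \<open>simp add: g2_laplacian_flow_def\<close>)
      ultimately have "continuous_on {0..\<sigma>} ?f"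
        using \<sigma>T by (intro continuous_on_diff) (auto elim!: continuous_on_subset)
      then have "closed {s \<in> {0..\<sigma>}. ?f s = 0}" by (rule continuous_closed_preimage_constant) simp
      moreover have "{0..<\<sigma>} \<subseteq> {s \<in> {0..\<sigma>}. ?f s = 0}" using below c len by (auto simp: form_eq_def)
      ultimately have "closure {0..<\<sigma>} \<subseteq> {s \<in> {0..\<sigma>}. ?f s = 0}" by (intro closure_minimal)
      moreover have "closure {0..<\<sigma>} = {0..\<sigma>}" using False \<sigma> by (intro closure_atLeastLessThan) simp
      ultimately show "\<psi> \<sigma> c x vs = \<phi> \<sigma> c x vs" using \<sigma> by auto
    qed
  qed (use eq0 in simp)
  have "g2_laplacian_flow A {0..<T - \<sigma>} (\<lambda>s. \<phi> (\<sigma> + s))" by (rule flow_shift[OF \<phi> op]) (use \<sigma> in auto)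
  moreover have "g2_laplacian_flow A {0..<T - \<sigma>} (\<lambda>s. \<psi> (\<sigma> + s))" by (rule flow_shift[OF \<psi> op]) (use \<sigma> in auto)
  \<comment> \<open>Short-time uniqueness asks for closed data at the new starting time, which
    \<phi> provides.\<close>
  moreover have "closed_form A 3 (\<phi> (\<sigma> + 0))" using closed \<sigma> by simp
  moreover have "form_eq A 3 (\<phi> (\<sigma> + 0)) (\<psi> (\<sigma> + 0))" using at\<sigma> by (simp add: form_eq_def)
  moreover have "T - \<sigma> > 0" using \<sigma>T by simp
  ultimately obtain \<epsilon> where \<epsilon>: "\<epsilon> > 0" "\<And>s. s \<in> {0..<\<epsilon>} \<Longrightarrow> form_eq A 3 (\<phi> (\<sigma> + s)) (\<psi> (\<sigma> + s))"
    using stu unfolding short_time_uniqueness_def by blast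
  \<comment> \<open>Times of disagreement come arbitrarily close to their infimum, in particular
    below \<sigma> + \<epsilon>.\<close>
  obtain s where s: "s \<in> B" "s < \<sigma> + \<epsilon>" using cInf_lessD[of B "\<sigma> + \<epsilon>"] tB \<epsilon>(1) unfolding \<sigma>_def by auto
  moreover have "s \<ge> \<sigma>" unfolding \<sigma>_def by (rule cInf_lower[OF s(1) bB])
  ultimately have "form_eq A 3 (\<phi> s) (\<psi> s)" using \<epsilon>(2)[of "s - \<sigma>"] by simp
  then have "form_eq A 3 (\<psi> s) (\<phi> s)" unfolding form_eq_def by (metis (no_types))
  then show False using s(1) by (simp add: B_def)
qed

text \<open>Passes from functions on the space-time of X to functions on the space-time of the
  product that are constant along the torus.\<close>

lemma lift_snd:
  fixes g :: "real \<times> 'a::euclidean_space \<Rightarrow> 'b::euclidean_space" and R :: "(real \<times> ('r::euclidean_space \<times> 'a)) set"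
  assumes R: "nice R" and g: "smooth_on S g" and RS: "\<forall>p\<in>R. (fst p, snd (snd p)) \<in> S"
  shows "smooth_on R (\<lambda>p. g (fst p, snd (snd p)))"
    and "p \<in> R \<Longrightarrow> dirD R (\<lambda>p. g (fst p, snd (snd p))) h p = dirD S g (fst h, snd (snd h)) (fst p, snd (snd p))"
proof -
  let ?L = "\<lambda>p :: real \<times> ('r \<times> 'a). (fst p, snd (snd p))"
  have L: "linear ?L" by (simp add: linear_iff)
  show "smooth_on R (\<lambda>p. g (?L p))" by (rule smooth_on_compose[OF R smooth_on_linear[OF L R] g]) (use RS in auto)
  assume p: "p \<in> R"
  have "(?L has_derivative ?L) (at p within R)" by (rule linear_imp_has_derivative[OF L])
  moreover have "(g has_derivative frechet_derivative g (at (?L p) within S)) (at (?L p) within ?L ` R)"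
    by (rule has_derivative_subset[OF smooth_on_has_fd[OF g RS[rule_format, OF p]]]) (use RS in auto)
  ultimately have "((\<lambda>p. g (?L p)) has_derivative (\<lambda>h. dirD S g (?L h) (?L p))) (at p within R)" by (rule has_derivative_in_compose)
  from fun_cong[OF fd_eq[OF R p this]] show "dirD R (\<lambda>p. g (?L p)) h p = dirD S g (?L h) (?L p)" .
qed

text \<open>Common setting for both products. The constant form \<kappa> on the torus completes the
  Kaehler form, and b turns \<Omega> into a complex 3-form; \<open>b_map\<close> and
  \<open>b_cong\<close> let b commute with pullbacks on X, and \<open>frame\<close> provides the
  normal form at every point and time. The form of the theorem, \<Phi>, is known only through its
  expression in product charts.\<close>

locale g2_reduction = ma_flow X \<omega> \<Omega> u for X :: "('m::t2_space, complex^'n) atlas" and \<omega> \<Omega> u +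
  fixes \<Theta> :: "real \<Rightarrow> 'm \<Rightarrow> 'm" and D :: "('k, 'r::euclidean_space) atlas" and r :: "'r \<Rightarrow> real" and \<kappa> :: "('r, real) mform"
    and b :: "(complex^'n, complex) mform \<Rightarrow> ('r \<times> (complex^'n), complex) mform"
    and \<Phi> :: "('m, complex^'n, real) form \<Rightarrow> ('m, complex^'n, complex) form \<Rightarrow> ('k \<times> 'm, 'r \<times> (complex^'n), real) form"
  assumes \<Theta>: "flow_of_time_dependent_field X (\<lambda>t. Y_field (kform t) \<Omega>) \<Theta>"
    and D: "translation_atlas D" and dim: "DIM('r \<times> (complex^'n)) = 7" and r: "linear r" and \<kappa>: "alternating 2 \<kappa>"
    and b_alternating: "\<And>Z. complex_multilinear CARD('n) Z \<Longrightarrow> alternating 3 (b Z)"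
    and b_map: "\<And>Z L vs. length vs = 3 \<Longrightarrow> b Z (map (map_prod id L) vs) = b (\<lambda>ws. Z (map L ws)) vs"
    and b_cong: "\<And>Z Z' vs. length vs = 3 \<Longrightarrow> (\<And>ws. length ws = CARD('n) \<Longrightarrow> Z ws = Z' ws) \<Longrightarrow> b Z vs = b Z' vs"
    and b_smooth: "\<And>c vs. c \<in> X \<Longrightarrow> length vs = 3 \<Longrightarrow> smooth_on (cimg c) (\<lambda>x. b (\<Omega> c x) vs)"
    and b_closed: "\<And>c x v0 v1 v2 v3. c \<in> X \<Longrightarrow> x \<in> cimg c \<Longrightarrow>
       dirD (cimg c) (\<lambda>x. b (\<Omega> c x) [v1, v2, v3]) (snd v0) x - dirD (cimg c) (\<lambda>x. b (\<Omega> c x) [v0, v2, v3]) (snd v1) x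
       + dirD (cimg c) (\<lambda>x. b (\<Omega> c x) [v0, v1, v3]) (snd v2) x - dirD (cimg c) (\<lambda>x. b (\<Omega> c x) [v0, v1, v2]) (snd v3) x = 0"
    and frame: "\<And>c t x. c \<in> X \<Longrightarrow> t \<ge> 0 \<Longrightarrow> x \<in> cimg c \<Longrightarrow>
       \<exists>e. reduced_frame (\<lambda>v. r (fst v)) (\<lambda>vs. kform t c x (map snd vs) + \<kappa> (map fst vs)) (b (\<Omega> c x)) (1 / speed c (t, x)) e
         \<and> snd (e 0) = 0 \<and> (\<forall>j\<in>{1..3}. snd (e (j + 3)) = \<i> *s snd (e j))"
    and \<Phi>: "\<And>\<alpha> \<beta> d c \<rho> x vs. form_law 2 \<alpha> \<Longrightarrow> form_law CARD('n) \<beta> \<Longrightarrow> d \<in> D \<Longrightarrow> c \<in> X \<Longrightarrow> \<rho> \<in> cimg d \<Longrightarrow> x \<in> cimg c \<Longrightarrow>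
       alternating 2 (\<alpha> c x) \<Longrightarrow> alternating CARD('n) (\<beta> c x) \<Longrightarrow> length vs = 3 \<Longrightarrow>
       \<Phi> \<alpha> \<beta> (prod_chart d c) (\<rho>, x) vs = Re (b (\<beta> c x) vs)
         - wedge 1 (covector_form (\<lambda>v. r (fst v))) (\<lambda>vs. \<alpha> c x (map snd vs) + \<kappa> (map fst vs)) vs"
begin

definition \<phi> :: "real \<Rightarrow> ('k \<times> 'm, 'r \<times> (complex^'n), real) form" where
  "\<phi> t = \<Phi> (pullback X (\<Theta> t) (kform t)) (pullback X (\<Theta> t) \<Omega>)"

definition target :: "('m, complex^'n) chart \<Rightarrow> (real \<times> ('r \<times> (complex^'n))) set" where
  "target c = {0..} \<times> (UNIV \<times> cimg c)"

definition source :: "('k, 'r) chart \<Rightarrow> ('m, complex^'n) chart \<Rightarrow> ('m, complex^'n) chart \<Rightarrow> (real \<times> ('r \<times> (complex^'n))) set" where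
  "source d c c1 = {p. fst (snd p) \<in> cimg d \<and> (fst p, snd (snd p)) \<in> flow_dom \<Theta> c c1}"

definition lifted_flow :: "('m, complex^'n) chart \<Rightarrow> ('m, complex^'n) chart \<Rightarrow> real \<times> ('r \<times> (complex^'n)) \<Rightarrow> 'r \<times> (complex^'n)" where
  "lifted_flow c c1 p = (fst (snd p), flow_map \<Theta> c c1 (fst p, snd (snd p)))"

definition a7 :: "('m, complex^'n) chart \<Rightarrow> real \<times> ('r \<times> (complex^'n)) \<Rightarrow> ('r \<times> (complex^'n), real) mform" where
  "a7 c q vs = kform (fst q) c (snd (snd q)) (map snd vs) + \<kappa> (map fst vs)"

definition b7 :: "('m, complex^'n) chart \<Rightarrow> real \<times> ('r \<times> (complex^'n)) \<Rightarrow> ('r \<times> (complex^'n), complex) mform" where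
  "b7 c q vs = b (\<Omega> c (snd (snd q))) vs"

lemma \<Theta>s: "smooth_family_of_diffeomorphisms X \<Theta>" using \<Theta> by (simp add: flow_of_time_dependent_field_def)

lemma open_cimg_D: "d \<in> D \<Longrightarrow> open (cimg d)" and inj_D: "d \<in> D \<Longrightarrow> inj_on (cmap d) (cdom d)"
  using D by (auto simp: translation_atlas_def)

lemma nice_target: "c \<in> X \<Longrightarrow> nice (target c)"
  unfolding target_def by (intro nice_half_line open_Times open_UNIV open_cimg)

lemma target_ball: "\<forall>p\<in>target c. (fst p, snd (snd p)) \<in> spacetime c" by (auto simp: target_def spacetime_def)

lemma target_base: "p \<in> target c \<Longrightarrow> (fst p, snd (snd p)) \<in> spacetime c" by (auto simp: target_def spacetime_def)

lemma source_open:
  assumes d: "d \<in> D" and c: "c \<in> X" "c1 \<in> X"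
  obtains Q where "open Q" "source d c c1 = ({0..} \<times> UNIV) \<inter> Q"
proof -
  obtain Q where Q: "open Q" "flow_dom \<Theta> c c1 = ({0..} \<times> UNIV) \<inter> Q" by (rule flow_dom_open[OF \<Theta>s c])
  let ?Q = "(\<lambda>p. fst (snd p)) -` cimg d \<inter> (\<lambda>p. (fst p, snd (snd p))) -` Q"
  have "open ?Q" by (intro open_Int open_vimage open_cimg_D[OF d] Q(1) continuous_intros)
  moreover have "source d c c1 = ({0..} \<times> UNIV) \<inter> ?Q" unfolding source_def Q(2) by auto
  ultimately show ?thesis by (rule that)
qed

lemma nice_source: assumes "d \<in> D" "c \<in> X" "c1 \<in> X" shows "nice (source d c c1)"
proof (rule source_open[OF assms])
  fix Q :: "(real \<times> ('r \<times> (complex^'n))) set" assume "open Q" "source d c c1 = ({0..} \<times> UNIV) \<inter> Q"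
  then show ?thesis using nice_Int_open[OF nice_half_line[OF open_UNIV]] by metis
qed

lemma source_ball: "\<forall>p\<in>source d c c1. (fst p, snd (snd p)) \<in> flow_dom \<Theta> c c1" by (simp add: source_def)

lemma source_in: "p \<in> source d c c1 \<Longrightarrow> (fst p, snd (snd p)) \<in> flow_dom \<Theta> c c1" by (simp add: source_def)

lemma lifted_flow_derivative:
  assumes dc: "d \<in> D" "c \<in> X" "c1 \<in> X" and p: "p \<in> source d c c1"
  shows "dirD (source d c c1) (lifted_flow c c1) h p
    = (fst (snd h), dirD (flow_dom \<Theta> c c1) (flow_map \<Theta> c c1) (fst h, snd (snd h)) (fst p, snd (snd p)))"
proof -
  note N = nice_source[OF dc]
  let ?g = "\<lambda>p. flow_map \<Theta> c c1 (fst p, snd (snd p))"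
  note l = lift_snd[OF N smooth_flow_map[OF \<Theta>s dc(2,3)] source_ball]
  have "linear (\<lambda>p :: real \<times> ('r \<times> (complex^'n)). fst (snd p))" by (simp add: linear_iff)
  from has_derivative_Pair[OF linear_imp_has_derivative[OF this] smooth_on_has_fd[OF l(1) p]]
  have "(lifted_flow c c1 has_derivative (\<lambda>h. (fst (snd h), dirD (source d c c1) ?g h p))) (at p within source d c c1)"
    by (simp add: lifted_flow_def[abs_def])
  from fun_cong[OF fd_eq[OF N p this], of h] show ?thesis unfolding l(2)[OF p] .
qed

lemma flow_in: assumes "c1 \<in> X" "p \<in> flow_dom \<Theta> c c1" shows "fst p \<ge> 0" "flow_map \<Theta> c c1 p \<in> cimg c1" "snd p \<in> cimg c"
  using assms by (auto simp: flow_dom_def flow_map_def cimg_def)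

lemma transported_source: assumes dc: "d \<in> D" "c \<in> X" "c1 \<in> X" shows "transported (source d c c1) (target c1) (lifted_flow c c1)"
proof
  show "nice (source d c c1)" "nice (target c1)" using nice_source[OF dc] nice_target dc by auto
  have "linear (\<lambda>p :: real \<times> ('r \<times> (complex^'n)). fst (snd p))" by (simp add: linear_iff)
  from smooth_on_Pair[OF nice_source[OF dc] smooth_on_linear[OF this nice_source[OF dc]] lift_snd(1)[OF nice_source[OF dc] smooth_flow_map[OF \<Theta>s dc(2,3)] source_ball]]
  show "smooth_on (source d c c1) (lifted_flow c c1)" by (simp add: lifted_flow_def[abs_def])
  show "(fst p, lifted_flow c c1 p) \<in> target c1" if "p \<in> source d c c1" for p
    using flow_in[OF dc(3) source_in[OF that]] by (simp add: target_def lifted_flow_def)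
qed

text \<open>Both sides are time derivatives of the same coordinate curve, one taken from the
  space-time map and one from the differential equation. The set \<open>?V\<close> keeps time near
  t, where the image stays in the chart c1, without affecting the derivative within the
  half-line.\<close>

lemma flow_velocity:
  assumes c: "c \<in> X" "c1 \<in> X" and p: "(t, x) \<in> flow_dom \<Theta> c c1"
  shows "dirD (flow_dom \<Theta> c c1) (flow_map \<Theta> c c1) (1, 0) (t, x) = Y_field (kform t) \<Omega> c1 (flow_map \<Theta> c c1 (t, x))"
proof -
  obtain Q where Q: "open Q" "flow_dom \<Theta> c c1 = ({0..} \<times> UNIV) \<inter> Q" by (rule flow_dom_open[OF \<Theta>s c])
  let ?V = "(\<lambda>s. (s, x)) -` Q"
  have V: "open ?V" "t \<in> ?V" using p Q by (auto intro!: open_vimage continuous_intros)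
  have t: "t \<ge> 0" "x \<in> cimg c" "\<Theta> t (cinv c x) \<in> cdom c1" using p by (auto simp: flow_dom_def)
  have w: "at t within ({0..} \<inter> ?V) = at t within {0..}" by (rule at_within_nhd[OF V(2,1)]) auto
  have L: "linear (\<lambda>h. dirD (flow_dom \<Theta> c c1) (flow_map \<Theta> c c1) h (t, x))" by (rule smooth_on_linear_fd[OF smooth_flow_map[OF \<Theta>s c] p])
  have "((\<lambda>s. (s, x)) has_derivative (\<lambda>h. (h, 0))) (at t within ({0..} \<inter> ?V))"
    by (intro has_derivative_Pair has_derivative_const has_derivative_ident)
  moreover have "(flow_map \<Theta> c c1 has_derivative (\<lambda>h. dirD (flow_dom \<Theta> c c1) (flow_map \<Theta> c c1) h (t, x))) (at (t, x) within (\<lambda>s. (s, x)) ` ({0..} \<inter> ?V))"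
    by (rule has_derivative_subset[OF smooth_on_has_fd[OF smooth_flow_map[OF \<Theta>s c] p]]) (use Q in auto)
  ultimately have d: "((\<lambda>s. flow_map \<Theta> c c1 (s, x)) has_derivative (\<lambda>h. dirD (flow_dom \<Theta> c c1) (flow_map \<Theta> c c1) (h, 0) (t, x))) (at t within ({0..} \<inter> ?V))"
    by (rule has_derivative_in_compose)
  have e: "(\<lambda>h. dirD (flow_dom \<Theta> c c1) (flow_map \<Theta> c c1) (h, 0) (t, x)) = (\<lambda>h. h *\<^sub>R dirD (flow_dom \<Theta> c c1) (flow_map \<Theta> c c1) (1, 0) (t, x))"
  proof
    fix h :: real
    show "dirD (flow_dom \<Theta> c c1) (flow_map \<Theta> c c1) (h, 0) (t, x) = h *\<^sub>R dirD (flow_dom \<Theta> c c1) (flow_map \<Theta> c c1) (1, 0) (t, x)"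
      using linear_scale[OF L, of h "(1, 0)"] by (simp only: scaleR_Pair scaleR_zero_right real_scaleR_def mult_1_right)
  qed
  have 1: "((\<lambda>s. cmap c1 (\<Theta> s (cinv c x))) has_vector_derivative dirD (flow_dom \<Theta> c c1) (flow_map \<Theta> c c1) (1, 0) (t, x)) (at t within {0..})"
    using d[unfolded e w] by (simp add: has_vector_derivative_def flow_map_def)
  have 2: "((\<lambda>s. cmap c1 (\<Theta> s (cinv c x))) has_vector_derivative Y_field (kform t) \<Omega> c1 (cmap c1 (\<Theta> t (cinv c x)))) (at t within {0..})"
    using \<Theta> t c cinv_points[OF c(1) t(2)] by (simp add: flow_of_time_dependent_field_def)
  have "t islimpt {0..}" by (rule islimpt_subset[OF islimpt_greaterThanLessThan1[of t "t + 1"]]) (use t in auto)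
  then have "at t within {0..} \<noteq> bot" by (simp add: trivial_limit_within)
  from vector_derivative_unique_within[OF this 1 2] show ?thesis by (simp add: flow_map_def)
qed

lemma a7_alternating: assumes "c \<in> X" "q \<in> target c" shows "alternating 2 (a7 c q)"
proof -
  have "alternating 2 (kform (fst q) c (snd (snd q)))" using kform_alternating assms by (auto simp: target_def)
  from alt_sum_list_form[OF alt_map[OF this linear_snd] alt_map[OF \<kappa> linear_fst]] show ?thesis by (simp add: a7_def[abs_def])
qed

lemma a7_smooth: assumes c: "c \<in> X" and len: "length vs = 2" shows "smooth_on (target c) (\<lambda>q. a7 c q vs)"
proof -
  have "smooth_on (spacetime c) (\<lambda>q. kform (fst q) c (snd q) (map snd vs))" by (rule kform_smooth[OF c]) (simp add: len)
  from lift_snd(1)[OF nice_target[OF c] this target_ball] show ?thesis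
    unfolding a7_def by (intro smooth_on_add[OF nice_target[OF c]] smooth_on_const[OF nice_target[OF c]]) simp
qed

lemma a7_derivative:
  assumes c: "c \<in> X" and q: "q \<in> target c"
  shows "dirD (target c) (\<lambda>q. a7 c q [v, w]) h q = dirD (spacetime c) (\<lambda>q. kform (fst q) c (snd q) [snd v, snd w]) (fst h, snd (snd h)) (fst q, snd (snd q))"
proof -
  have "smooth_on (spacetime c) (\<lambda>q. kform (fst q) c (snd q) [snd v, snd w])" by (rule kform_smooth[OF c]) simp
  note l = lift_snd[OF nice_target[OF c] this target_ball]
  have "dirD (target c) (\<lambda>q. a7 c q [v, w]) h q = dirD (target c) (\<lambda>q. kform (fst q) c (snd (snd q)) [snd v, snd w]) h q + dirD (target c) (\<lambda>q. \<kappa> [fst v, fst w]) h q"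
    using dirD_add[where v = h, OF nice_target[OF c] q l(1) smooth_on_const[OF nice_target[OF c], of "\<kappa> [fst v, fst w]"]] by (simp add: a7_def)
  moreover have "dirD (target c) (\<lambda>q. \<kappa> [fst v, fst w]) h q = 0"
    using fun_cong[OF fd_eq[OF nice_target[OF c] q has_derivative_const[of "\<kappa> [fst v, fst w]"]]] by simp
  ultimately show ?thesis using l(2)[OF q, of h] by simp
qed

lemma b7_smooth: assumes c: "c \<in> X" and len: "length vs = 3" shows "smooth_on (target c) (\<lambda>q. b7 c q vs)"
  using lift_snd(1)[OF nice_target[OF c] smooth_snd[OF c b_smooth[OF c len]] target_ball] by (simp add: b7_def)

lemma b7_derivative:
  assumes c: "c \<in> X" and len: "length vs = 3" and q: "q \<in> target c"
  shows "dirD (target c) (\<lambda>q. b7 c q vs) h q = dirD (cimg c) (\<lambda>x. b (\<Omega> c x) vs) (snd (snd h)) (snd (snd q))"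
  using lift_snd(2)[OF nice_target[OF c] smooth_snd[OF c b_smooth[OF c len]] target_ball q, of h]
    dirD_snd[OF c b_smooth[OF c len] target_base[OF q]] by (simp add: b7_def)

lemma pullback_alternating:
  assumes \<alpha>: "form_law k \<alpha>" "\<And>c x. c \<in> X \<Longrightarrow> x \<in> cimg c \<Longrightarrow> alternating k (\<alpha> c x)" and c: "c \<in> X" "x \<in> cimg c" and t: "t \<ge> 0"
  shows "alternating k (pullback X (\<Theta> t) \<alpha> c x)"
proof (rule flow_chart[OF \<Theta>s c(1) t c(2)])
  fix c1 assume c1: "c1 \<in> X" and p: "(t, x) \<in> flow_dom \<Theta> c c1"
  let ?L = "\<lambda>v. dirD (flow_dom \<Theta> c c1) (flow_map \<Theta> c c1) (0, v) (t, x)"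
  have "linear (\<lambda>v. (0 :: real, v :: complex^'n))" by (simp add: linear_iff)
  from linear_compose[OF this smooth_on_linear_fd[OF smooth_flow_map[OF \<Theta>s c(1) c1] p]] have "linear ?L" by (simp add: o_def)
  from alt_map[OF \<alpha>(2)[OF c1 flow_in(2)[OF c1 p]] this] show ?thesis
    by (rule alt_subst) (rule pullback_flow[OF \<Theta>s c(1) c1 p \<alpha>(1)])
qed

lemma \<Omega>_alternating: "c \<in> X \<Longrightarrow> x \<in> cimg c \<Longrightarrow> alternating CARD('n) (\<Omega> c x)"
  using \<Omega>_multilinear(1) by (simp add: complex_multilinear_def)

lemma \<phi>_rep:
  assumes "t \<ge> 0" "d \<in> D" "c \<in> X" "\<rho> \<in> cimg d" "x \<in> cimg c" "length vs = 3"
  shows "\<phi> t (prod_chart d c) (\<rho>, x) vs = Re (b (pullback X (\<Theta> t) \<Omega> c x) vs)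
    - wedge 1 (covector_form (\<lambda>v. r (fst v))) (\<lambda>vs. pullback X (\<Theta> t) (kform t) c x (map snd vs) + \<kappa> (map fst vs)) vs"
  unfolding \<phi>_def
  by (rule \<Phi>) (use assms form_law_pullback[OF \<Theta>s] kform_law \<Omega>_law pullback_alternating[OF kform_law] pullback_alternating[OF \<Omega>_law] kform_alternating \<Omega>_alternating in auto)

text \<open>This is the shape required by \<open>local_flow\<close>: naturality of b moves the
  derivative of the flow from the arguments of \<Omega> to the arguments of the 3-form.\<close>

lemma \<phi>_rep_flow:
  assumes dc: "d \<in> D" "c \<in> X" "c1 \<in> X" and p: "(t, y) \<in> source d c c1" and len: "length vs = 3"
  defines "L \<equiv> dirD (source d c c1) (lifted_flow c c1)"
  shows "\<phi> t (prod_chart d c) y vs = Re (b7 c1 (t, lifted_flow c c1 (t, y)) (map (\<lambda>v. L (0, v) (t, y)) vs))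
    - wedge 1 (covector_form (\<lambda>v. r (fst v))) (\<lambda>vs. a7 c1 (t, lifted_flow c c1 (t, y)) (map (\<lambda>v. L (0, v) (t, y)) vs)) vs"
proof -
  obtain \<rho> x where y: "y = (\<rho>, x)" by (cases y)
  have q: "(t, x) \<in> flow_dom \<Theta> c c1" and \<rho>: "\<rho> \<in> cimg d" using p by (auto simp: source_def y)
  have t: "t \<ge> 0" "x \<in> cimg c" using flow_in[OF dc(3) q] by auto
  let ?M = "\<lambda>v. dirD (flow_dom \<Theta> c c1) (flow_map \<Theta> c c1) (0, v) (t, x)"
  have L: "L (0, v) (t, y) = map_prod id ?M v" for v
    unfolding L_def lifted_flow_derivative[OF dc p] by (cases v) (simp add: y)
  have k: "pullback X (\<Theta> t) (kform t) c x ws = kform t c1 (flow_map \<Theta> c c1 (t, x)) (map ?M ws)" if "length ws = 2" for ws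
    by (rule pullback_flow[OF \<Theta>s dc(2,3) q kform_law[OF t(1)] that])
  have o: "pullback X (\<Theta> t) \<Omega> c x ws = \<Omega> c1 (flow_map \<Theta> c c1 (t, x)) (map ?M ws)" if "length ws = CARD('n)" for ws
    by (rule pullback_flow[OF \<Theta>s dc(2,3) q \<Omega>_law that])
  have "b (pullback X (\<Theta> t) \<Omega> c x) vs = b (\<lambda>ws. \<Omega> c1 (flow_map \<Theta> c c1 (t, x)) (map ?M ws)) vs"
    by (rule b_cong[OF len o])
  also have "\<dots> = b7 c1 (t, lifted_flow c c1 (t, y)) (map (\<lambda>v. L (0, v) (t, y)) vs)"
    unfolding L b7_def b_map[OF len, symmetric] by (simp add: lifted_flow_def y)
  finally have B: "b (pullback X (\<Theta> t) \<Omega> c x) vs = b7 c1 (t, lifted_flow c c1 (t, y)) (map (\<lambda>v. L (0, v) (t, y)) vs)" .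
  have W: "wedge 1 (covector_form (\<lambda>v. r (fst v))) (\<lambda>vs. pullback X (\<Theta> t) (kform t) c x (map snd vs) + \<kappa> (map fst vs)) vs
    = wedge 1 (covector_form (\<lambda>v. r (fst v))) (\<lambda>vs. a7 c1 (t, lifted_flow c c1 (t, y)) (map (\<lambda>v. L (0, v) (t, y)) vs)) vs"
    by (rule wedge_cong) (use len in \<open>simp_all add: k a7_def L[unfolded y] lifted_flow_def y o_def\<close>)
  show ?thesis using \<phi>_rep[OF t(1) dc(1,2) \<rho> t(2) len] unfolding B W y[symmetric] .
qed

theorem \<phi>_local:
  assumes dc: "d \<in> D" "c \<in> X" "c1 \<in> X" and p: "(t, x) \<in> source d c c1"
  shows "hodge_laplacian (\<phi> t) 3 (\<phi> t) (prod_chart d c) x [v1, v2, v3] = dirD (source d c c1) (\<lambda>q. \<phi> (fst q) (prod_chart d c) (snd q) [v1, v2, v3]) (1, 0) (t, x)" (is ?H)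
    and "positive_3form (\<phi> t (prod_chart d c) x)" (is ?P) and "length us = 4 \<Longrightarrow> ext_d (\<phi> t) (prod_chart d c) x us = 0" (is "_ \<Longrightarrow> ?E")
    and "length vs = 3 \<Longrightarrow> smooth_on (source d c c1) (\<lambda>q. \<phi> (fst q) (prod_chart d c) (snd q) vs)" (is "_ \<Longrightarrow> ?S")
proof -
  interpret tr: transported "source d c c1" "target c1" "lifted_flow c c1" by (rule transported_source[OF dc])
  obtain Q where Q: "open Q" "source d c c1 = ({0..} \<times> UNIV) \<inter> Q" by (rule source_open[OF dc])
  \<comment> \<open>J is multiplication by \<i> on X and 0 on the torus. The speed does not depend
    on torus coordinates, so its differential sees the X component only.\<close>
  let ?F = "\<lambda>q :: real \<times> ('r \<times> (complex^'n)). speed c1 (fst q, snd (snd q))" and ?J = "\<lambda>v :: 'r \<times> (complex^'n). (0 :: 'r, \<i> *s snd v)"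
  note N = nice_target[OF dc(3)] and ss = smooth_speed[OF dc(3)]
  note lF = lift_snd[OF N ss target_ball]
  have J: "linear ?J" using linear_i_scale by (simp add: linear_iff)
  have r7: "linear (\<lambda>v :: 'r \<times> (complex^'n). r (fst v))" using linear_compose[OF linear_fst r] by (simp add: o_def)
  have DF: "dirD (target c1) ?F (0, v) q = dirD (spacetime c1) (speed c1) (0, snd v) (fst q, snd (snd q))" if "q \<in> target c1" for v q
    using lF(2)[OF that, of "(0, v)"] by simp
  have DDF: "dirD (target c1) (\<lambda>q. dirD (target c1) ?F (0, ?J v) q) (0, w) q
     = dirD (spacetime c1) (dirD (spacetime c1) (speed c1) (0, \<i> *s snd v)) (0, snd w) (fst q, snd (snd q))" if q: "q \<in> target c1" for v w q
  proof -
    have "dirD (target c1) (\<lambda>q. dirD (target c1) ?F (0, ?J v) q) (0, w) q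
      = dirD (target c1) (\<lambda>q. dirD (spacetime c1) (speed c1) (0, \<i> *s snd v) (fst q, snd (snd q))) (0, w) q"
      by (rule fun_cong[OF fd_cong(1)[OF q]]) (simp add: DF)
    then show ?thesis using lift_snd(2)[OF N smooth_on_dirD[OF ss] target_ball q, of "(0, \<i> *s snd v)" "(0, w)"] by simp
  qed
  have vel: "tr.vel q = (0, Y_field (kform (fst q)) \<Omega> c1 (flow_map \<Theta> c c1 (fst q, snd (snd q))))" if "q \<in> source d c c1" for q
    unfolding tr.vel_def lifted_flow_derivative[OF dc that] using flow_velocity[OF dc(2,3) source_in[OF that]] by simp
  have D\<theta>: "tr.D\<theta> q v = (fst v, dirD (flow_dom \<Theta> c c1) (flow_map \<Theta> c c1) (0, snd v) (fst q, snd (snd q)))" if "q \<in> source d c c1" for q v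
    unfolding tr.D\<theta>_def lifted_flow_derivative[OF dc that] by simp
  have w3: "tr.space_d (target c1) (a7 c1) q vs = 0" if q: "q \<in> target c1" and len: "length vs = 3" for q vs
  proof -
    obtain v1 v2 v3 where vs: "vs = [v1, v2, v3]" using len by (auto simp: numeral_eq_Suc length_Suc_conv)
    show ?thesis unfolding vs tr.space_d_2 a7_derivative[OF dc(3) q] using kform_closed[OF dc(3) target_base[OF q]] by simp
  qed
  have b3: "tr.space_d (target c1) (b7 c1) q vs = 0" if q: "q \<in> target c1" and len: "length vs = 4" for q vs
  proof -
    obtain v0 v1 v2 v3 where vs: "vs = [v0, v1, v2, v3]" using len by (auto simp: numeral_eq_Suc length_Suc_conv)
    have l3: "length [a, b, c] = 3" for a b c :: "'r \<times> (complex^'n)" by simp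
    have "snd (snd q) \<in> cimg c1" using q by (auto simp: target_def)
    from b_closed[OF dc(3) this] show ?thesis unfolding vs tr.space_d_3 b7_derivative[OF dc(3) l3 q] by simp
  qed
  have b4: "dirD (target c1) (\<lambda>q. b7 c1 q vs) (1, 0) q = 0" if q: "q \<in> target c1" and len: "length vs = 3" for q vs
  proof -
    have "snd (snd q) \<in> cimg c1" using q by (auto simp: target_def)
    from linear_0[OF smooth_on_linear_fd[OF b_smooth[OF dc(3) len] this]] show ?thesis unfolding b7_derivative[OF dc(3) len q] by simp
  qed
  have tw: "dirD (target c1) (\<lambda>q. a7 c1 q [v, w]) (1, 0) q = - 3 * tr.space_d (target c1) (\<lambda>q us. dirD (target c1) ?F (0, ?J (us ! 0)) q) q [v, w]"
    if q: "q \<in> target c1" for q v w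
    unfolding tr.space_d_1 a7_derivative[OF dc(3) q] using kform_time[OF dc(3) target_base[OF q], of "snd v" "snd w"] DDF[OF q, of w v] DDF[OF q, of v w] by simp
  have ctr: "a7 c1 (tr.\<Theta> q) [tr.vel q, v] = dirD (target c1) ?F (0, ?J v) (tr.\<Theta> q)" if q: "q \<in> source d c c1" for q v
  proof -
    \<comment> \<open>The velocity has no torus component, so \<kappa> does not contribute to the
      contraction.\<close>
    have k0: "\<kappa> [0, z] = 0" for z using linear_0[OF alt_linear_hd[OF \<kappa>, of "[z]"]] by simp
    show ?thesis
      unfolding DF[OF tr.\<Theta>_in[OF q]] unfolding vel[OF q] a7_def tr.\<Theta>_def lifted_flow_def
      using Y_contraction[OF dc(3) flow_in(1,2)[OF dc(3) source_in[OF q]]] by (simp add: k0)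
  qed
  have fr: "\<exists>e. reduced_frame (\<lambda>v. r (fst v)) (a7 c1 q) (b7 c1 q) (1 / ?F q) e \<and> dirD (target c1) ?F (0, e 0) q = 0 \<and>
     (\<forall>j\<in>{1..3}. dirD (target c1) ?F (0, ?J (e j)) q = dirD (target c1) ?F (0, e (j + 3)) q \<and> dirD (target c1) ?F (0, ?J (e (j + 3))) q = - dirD (target c1) ?F (0, e j) q)"
    if q: "q \<in> target c1" for q
  proof -
    have L: "linear (\<lambda>h. dirD (spacetime c1) (speed c1) h (fst q, snd (snd q)))" by (rule smooth_on_linear_fd[OF ss target_base[OF q]])
    obtain e where e: "reduced_frame (\<lambda>v. r (fst v)) (\<lambda>vs. kform (fst q) c1 (snd (snd q)) (map snd vs) + \<kappa> (map fst vs)) (b (\<Omega> c1 (snd (snd q)))) (1 / speed c1 (fst q, snd (snd q))) e"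
      "snd (e 0) = 0" "\<And>j. j \<in> {1..3} \<Longrightarrow> snd (e (j + 3)) = \<i> *s snd (e j)"
      using frame[OF dc(3), of "fst q" "snd (snd q)"] q by (auto simp: target_def)
    show ?thesis
    proof (intro exI[of _ e] conjI ballI)
      show "reduced_frame (\<lambda>v. r (fst v)) (a7 c1 q) (b7 c1 q) (1 / ?F q) e" using e(1) by (simp add: a7_def[abs_def] b7_def[abs_def])
      show "dirD (target c1) ?F (0, e 0) q = 0" unfolding DF[OF q] e(2) using linear_0[OF L] by (simp add: zero_prod_def)
      fix j :: nat assume j: "j \<in> {1..3}"
      show "dirD (target c1) ?F (0, ?J (e j)) q = dirD (target c1) ?F (0, e (j + 3)) q" unfolding DF[OF q] e(3)[OF j] by simp
      show "dirD (target c1) ?F (0, ?J (e (j + 3))) q = - dirD (target c1) ?F (0, e j) q"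
        unfolding DF[OF q] e(3)[OF j] using linear_neg[OF L, of "(0, snd (e j))"] by (simp add: i_scale_twice)
    qed
  qed
  have inj: "inj (tr.D\<theta> q)" if q: "q \<in> source d c c1" for q
    using flow_derivative_inj[OF \<Theta>s dc(2,3) source_in[OF q]] by (auto simp: inj_def D\<theta>[OF q] prod_eq_iff)
  have rep: "\<phi> s (prod_chart d c) y vs = Re (tr.pull (b7 c1) (s, y) vs) - wedge 1 (covector_form (\<lambda>v. r (fst v))) (tr.pull (a7 c1) (s, y)) vs"
    if "(s, y) \<in> source d c c1" "length vs = 3" for s y vs
    using \<phi>_rep_flow[OF dc that] by (simp add: tr.pull_def[abs_def] tr.\<Theta>_def tr.D\<theta>_def[abs_def])
  have b1: "alternating 3 (b7 c1 q)" if "q \<in> target c1" for q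
    unfolding b7_def[abs_def] using that by (intro b_alternating \<Omega>_multilinear[OF dc(3)]) (auto simp: target_def)
  have rD: "r (fst (tr.D\<theta> q v)) = r (fst v)" if "q \<in> source d c c1" for q v using D\<theta>[OF that] by simp
  have rV: "r (fst (tr.vel q)) = 0" if "q \<in> source d c c1" for q using vel[OF that] linear_0[OF r] by simp
  note local = tr.local_flow[where w = "a7 c1" and b = "b7 c1" and F = ?F and J = ?J and r = "\<lambda>v. r (fst v)" and \<phi> = \<phi> and c = "prod_chart d c", OF dim Q(2,1) p r7 J a7_alternating[OF dc(3)] a7_smooth[OF dc(3)] w3 b1 b7_smooth[OF dc(3)] b3 b4 lF(1) tw ctr fr rD rV inj rep]
  show ?H by (rule local(1))
  show ?P by (rule local(2))
  show ?E if "length us = 4" by (rule local(3)) (use that in simp_all)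
  show ?S if "length vs = 3" by (rule local(4)) (use that in simp_all)
qed

section \<open>From the local statement to the flow on the product manifold\<close>

lemma product_chart_cases:
  assumes "C \<in> prod_atlas D X" obtains d c where "C = prod_chart d c" "d \<in> D" "c \<in> X"
  using assms by (auto simp: prod_atlas_def)

lemma open_product_chart: "C \<in> prod_atlas D X \<Longrightarrow> open (cimg C)"
  by (auto elim!: product_chart_cases simp: prod_chart_simps open_Times open_cimg open_cimg_D)

lemma source_subset: "source d c c1 \<subseteq> {0..} \<times> cimg (prod_chart d c)"
  by (auto simp: source_def prod_chart_simps flow_dom_def)

text \<open>Near each point a single chart around the image under the flow suffices, and smoothness
  within a set is local.\<close>

lemma \<phi>_smooth:
  assumes dc: "d \<in> D" "c \<in> X" and len: "length vs = 3"
  shows "smooth_on ({0..} \<times> cimg (prod_chart d c)) (\<lambda>q. \<phi> (fst q) (prod_chart d c) (snd q) vs)"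
proof (rule smooth_on_local)
  fix p :: "real \<times> ('r \<times> (complex^'n))" assume "p \<in> {0..} \<times> cimg (prod_chart d c)"
  then obtain t \<rho> x where p: "p = (t, \<rho>, x)" "t \<ge> 0" "\<rho> \<in> cimg d" "x \<in> cimg c" by (auto simp: prod_chart_simps)
  show "\<exists>O'. open O' \<and> p \<in> O' \<and> smooth_on (({0..} \<times> cimg (prod_chart d c)) \<inter> O') (\<lambda>q. \<phi> (fst q) (prod_chart d c) (snd q) vs)"
  proof (rule flow_chart[OF \<Theta>s dc(2) p(2,4)])
    fix c1 assume c1: "c1 \<in> X" and q: "(t, x) \<in> flow_dom \<Theta> c c1"
    have ps: "(t, \<rho>, x) \<in> source d c c1" using q p by (simp add: source_def)
    obtain Q where Q: "open Q" "source d c c1 = ({0..} \<times> UNIV) \<inter> Q" by (rule source_open[OF dc c1])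
    have "({0..} \<times> cimg (prod_chart d c)) \<inter> Q = source d c c1" using source_subset[of d c c1] unfolding Q(2) by auto
    then show ?thesis using \<phi>_local(4)[OF dc c1 ps len] Q(1) ps p(1) Q(2) by (intro exI[of _ Q]) auto
  qed
qed

lemma \<phi>_time_derivative:
  assumes dc: "d \<in> D" "c \<in> X" and len: "length vs = 3" and t: "t \<ge> 0" and z: "z \<in> cimg (prod_chart d c)"
  shows "((\<lambda>s. \<phi> s (prod_chart d c) z vs) has_real_derivative hodge_laplacian (\<phi> t) 3 (\<phi> t) (prod_chart d c) z vs) (at t within {0..})"
proof -
  let ?C = "prod_chart d c" and ?f = "\<lambda>q. \<phi> (fst q) (prod_chart d c) (snd q) vs"
  let ?W = "{0..} \<times> cimg ?C"
  obtain \<rho> x where zx: "z = (\<rho>, x)" "\<rho> \<in> cimg d" "x \<in> cimg c" using z by (auto simp: prod_chart_simps)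
  obtain c1 where c1: "c1 \<in> X" and q: "(t, x) \<in> flow_dom \<Theta> c c1" by (rule flow_chart[OF \<Theta>s dc(2) t zx(3)])
  have ps: "(t, z) \<in> source d c c1" using q zx by (simp add: source_def)
  obtain v1 v2 v3 where vs: "vs = [v1, v2, v3]" using len by (auto simp: numeral_eq_Suc length_Suc_conv)
  have dW: "(?f has_derivative (\<lambda>h. dirD ?W ?f h (t, z))) (at (t, z) within ?W)"
    by (rule smooth_on_has_fd[OF \<phi>_smooth[OF dc len]]) (use t z in simp)
  \<comment> \<open>The smaller set \<open>source d c c1\<close> is still \<open>nice\<close>, so
    the derivative within it is the one within the whole product.\<close>
  have "dirD (source d c c1) ?f h (t, z) = dirD ?W ?f h (t, z)" for h
    by (rule fun_cong[OF fd_eq[OF nice_source[OF dc c1] ps has_derivative_subset[OF dW source_subset]]])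
  then have H: "dirD ?W ?f (1, 0) (t, z) = hodge_laplacian (\<phi> t) 3 (\<phi> t) ?C z vs"
    unfolding vs \<phi>_local(1)[OF dc c1 ps] by simp
  have "((\<lambda>s. (s, z)) has_derivative (\<lambda>h. (h, 0))) (at t within {0..})"
    by (intro has_derivative_Pair has_derivative_const has_derivative_ident)
  moreover have "(?f has_derivative (\<lambda>h. dirD ?W ?f h (t, z))) (at (t, z) within (\<lambda>s. (s, z)) ` {0..})"
    by (rule has_derivative_subset[OF dW]) (use z in auto)
  ultimately have d: "((\<lambda>s. ?f (s, z)) has_derivative (\<lambda>h. dirD ?W ?f (h, 0) (t, z))) (at t within {0..})"
    by (rule has_derivative_in_compose)
  have L: "linear (\<lambda>h. dirD ?W ?f h (t, z))" using has_derivative_bounded_linear[OF dW] by (rule bounded_linear.linear)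
  have e: "(\<lambda>h. dirD ?W ?f (h, 0) (t, z)) = (*) (hodge_laplacian (\<phi> t) 3 (\<phi> t) ?C z vs)"
  proof
    fix h :: real
    show "dirD ?W ?f (h, 0) (t, z) = hodge_laplacian (\<phi> t) 3 (\<phi> t) ?C z vs * h"
      using linear_scale[OF L, of h "(1, 0)"] H
      by (simp only: scaleR_Pair scaleR_zero_right real_scaleR_def mult_1_right mult_1_left mult.commute)
  qed
  show ?thesis using d unfolding e has_field_derivative_def by simp
qed

text \<open>The change of a product chart has the identity as its derivative on the torus factor, so
  r and \<kappa> are preserved, while naturality of b and the laws on X settle the rest.\<close>

lemma \<phi>_law:
  assumes t: "t \<ge> 0" and dc: "d \<in> D" "c \<in> X" "d' \<in> D" "c' \<in> X" and z: "z \<in> overlap (prod_chart d c) (prod_chart d' c')" and len: "length vs = 3"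
  defines "\<tau> \<equiv> transition (prod_chart d c) (prod_chart d' c')"
  shows "\<phi> t (prod_chart d c) z vs = \<phi> t (prod_chart d' c') (\<tau> z) (map (frechet_derivative \<tau> (at z)) vs)"
proof -
  obtain \<rho> x where zx: "z = (\<rho>, x)" by (cases z)
  note po = product_overlap[OF D dc(1,3) dc(2,4) z[unfolded zx], folded \<tau>_def]
  let ?M = "frechet_derivative (transition c c') (at x)"
  have x: "x \<in> cimg c" using po(2) in_overlap[OF dc(2)] by simp
  have x': "transition c c' x \<in> cimg c'" using transition_in[OF dc(2,4) po(2)] in_overlap[OF dc(4)] by simp
  have \<tau>z: "\<tau> (\<rho>, x) = (fst (\<tau> (\<rho>, x)), transition c c' x)" using po(4) by (simp add: prod_eq_iff)
  let ?\<alpha> = "pullback X (\<Theta> t) (kform t)" and ?\<beta> = "pullback X (\<Theta> t) \<Omega>"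
  have k: "?\<alpha> c x ws = ?\<alpha> c' (transition c c' x) (map ?M ws)" if "length ws = 2" for ws
    using form_law_pullback[OF \<Theta>s t kform_law[OF t]] dc(2,4) po(2) that unfolding form_law_def by blast
  have o: "?\<beta> c x ws = ?\<beta> c' (transition c c' x) (map ?M ws)" if "length ws = CARD('n)" for ws
    using form_law_pullback[OF \<Theta>s t \<Omega>_law] dc(2,4) po(2) that unfolding form_law_def by blast
  have B: "b (?\<beta> c x) vs = b (?\<beta> c' (transition c c' x)) (map (map_prod id ?M) vs)"
    unfolding b_map[OF len] by (rule b_cong[OF len o])
  have al: "alternating 2 (\<lambda>vs. ?\<alpha> c y (map snd vs) + \<kappa> (map fst vs))" if "c \<in> X" "y \<in> cimg c" for c y
    by (rule alt_sum_list_form[OF alt_map[OF pullback_alternating[OF kform_law[OF t] kform_alternating that t] linear_snd] alt_map[OF \<kappa> linear_fst]]) (use t in auto)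
  have r7: "alternating 1 (covector_form (\<lambda>v :: 'r \<times> (complex^'n). r (fst v)))"
    by (rule alternating_covector) (use linear_compose[OF linear_fst r] in \<open>simp add: o_def\<close>)
  obtain v1 v2 v3 where vs: "vs = [v1, v2, v3]" using len by (auto simp: numeral_eq_Suc length_Suc_conv)
  have W: "wedge 1 (covector_form (\<lambda>v. r (fst v))) (\<lambda>vs. ?\<alpha> c x (map snd vs) + \<kappa> (map fst vs)) vs
     = wedge 1 (covector_form (\<lambda>v. r (fst v))) (\<lambda>vs. ?\<alpha> c' (transition c c' x) (map snd vs) + \<kappa> (map fst vs)) (map (map_prod id ?M) vs)"
    unfolding vs list.map wedge_1_2[OF r7 al[OF dc(2) x]] wedge_1_2[OF r7 al[OF dc(4) x']]
    by (simp add: k)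
  have "\<phi> t (prod_chart d c) (\<rho>, x) vs = Re (b (?\<beta> c x) vs) - wedge 1 (covector_form (\<lambda>v. r (fst v))) (\<lambda>vs. ?\<alpha> c x (map snd vs) + \<kappa> (map fst vs)) vs"
    by (rule \<phi>_rep[OF t dc(1,2) po(1) x len])
  also have "\<dots> = \<phi> t (prod_chart d' c') (fst (\<tau> (\<rho>, x)), transition c c' x) (map (map_prod id ?M) vs)"
    unfolding B W using \<phi>_rep[OF t dc(3,4) po(3) x', of "map (map_prod id ?M) vs"] len by simp
  finally show ?thesis unfolding zx \<tau>z[symmetric] po(5) .
qed

theorem \<phi>_flow: "g2_laplacian_flow (prod_atlas D X) {0..} \<phi>"
  unfolding g2_laplacian_flow_def
proof (intro conjI ballI allI impI)
  fix C and vs :: "('r \<times> (complex^'n)) list" assume C: "C \<in> prod_atlas D X" and len: "length vs = 3"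
  then show "smooth_on ({0..} \<times> cimg C) (\<lambda>(t, x). \<phi> t C x vs)"
    using \<phi>_smooth by (auto elim!: product_chart_cases simp: case_prod_unfold)
next
  fix t :: real and C x and vs :: "('r \<times> (complex^'n)) list" assume "t \<in> {0..}" "C \<in> prod_atlas D X" "x \<in> cimg C" and len: "length vs = 3"
  then show "((\<lambda>s. \<phi> s C x vs) has_real_derivative hodge_laplacian (\<phi> t) 3 (\<phi> t) C x vs) (at t within {0..})"
    by (auto elim!: product_chart_cases intro!: \<phi>_time_derivative)
next
  fix t :: real assume "t \<in> {0..}"
  then have t: "t \<ge> 0" by simp
  have pos: "positive_3form (\<phi> t C z)" if C: "C \<in> prod_atlas D X" "z \<in> cimg C" for C z
  proof (rule product_chart_cases[OF C(1)])
    fix d c assume dc: "C = prod_chart d c" "d \<in> D" "c \<in> X"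
    obtain \<rho> x where zx: "z = (\<rho>, x)" "\<rho> \<in> cimg d" "x \<in> cimg c" using C(2) dc by (auto simp: prod_chart_simps)
    obtain c1 where c1: "c1 \<in> X" and q: "(t, x) \<in> flow_dom \<Theta> c c1" by (rule flow_chart[OF \<Theta>s dc(3) t zx(3)])
    have ps: "(t, z) \<in> source d c c1" using q zx by (simp add: source_def)
    show ?thesis unfolding dc(1) by (rule \<phi>_local(2)[OF dc(2,3) c1 ps])
  qed
  have "smooth_form (prod_atlas D X) 3 (\<phi> t)"
    unfolding smooth_form_def
  proof (intro conjI ballI allI impI)
    fix C z assume "C \<in> prod_atlas D X" "z \<in> cimg C"
    then show "alternating 3 (\<phi> t C z)" using pos by (simp add: positive_3form_def)
  next
    fix C and vs :: "('r \<times> (complex^'n)) list" assume C: "C \<in> prod_atlas D X" and len: "length vs = 3"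
    then have "smooth_on ({0..} \<times> cimg C) (\<lambda>q. \<phi> (fst q) C (snd q) vs)" using \<phi>_smooth by (auto elim!: product_chart_cases)
    from slice_half_line(1)[OF this open_product_chart[OF C] t] show "smooth_on (cimg C) (\<lambda>x. \<phi> t C x vs)" by simp
  next
    fix C C' z and vs :: "('r \<times> (complex^'n)) list"
    assume "C \<in> prod_atlas D X" "C' \<in> prod_atlas D X" "z \<in> overlap C C'" "length vs = 3"
    then show "\<phi> t C z vs = \<phi> t C' (transition C C' z) (map (frechet_derivative (transition C C') (at z)) vs)"
      using \<phi>_law[OF t] by (elim product_chart_cases) simp
  qed
  then show "g2_structure (prod_atlas D X) (\<phi> t)" using pos by (simp add: g2_structure_def)
qed

lemma \<phi>_closed: assumes t: "t \<ge> 0" shows "closed_form (prod_atlas D X) 3 (\<phi> t)"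
  unfolding closed_form_def form_eq_def
proof (intro ballI allI impI)
  fix C z and vs :: "('r \<times> (complex^'n)) list" assume C: "C \<in> prod_atlas D X" "z \<in> cimg C" and len: "length vs = Suc 3"
  show "ext_d (\<phi> t) C z vs = 0"
  proof (rule product_chart_cases[OF C(1)])
    fix d c assume dc: "C = prod_chart d c" "d \<in> D" "c \<in> X"
    obtain \<rho> x where zx: "z = (\<rho>, x)" "\<rho> \<in> cimg d" "x \<in> cimg c" using C(2) dc by (auto simp: prod_chart_simps)
    obtain c1 where c1: "c1 \<in> X" and q: "(t, x) \<in> flow_dom \<Theta> c c1" by (rule flow_chart[OF \<Theta>s dc(3) t zx(3)])
    have ps: "(t, z) \<in> source d c c1" using q zx by (simp add: source_def)
    show ?thesis unfolding dc(1) by (rule \<phi>_local(3)[OF dc(2,3) c1 ps]) (simp add: len)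
  qed
qed

section \<open>Initial data and uniqueness\<close>

lemma pullback_initial:
  assumes law: "form_law k \<alpha>" and c: "c \<in> X" "x \<in> cimg c" and len: "length vs = k"
  shows "pullback X (\<Theta> 0) \<alpha> c x vs = \<alpha> c x vs"
proof -
  have \<Theta>0: "\<Theta> 0 (cinv c z) = cinv c z" if "z \<in> cimg c" for z
    using \<Theta> cinv_points[OF c(1) that] by (simp add: flow_of_time_dependent_field_def)
  have "((\<lambda>z. cmap c (\<Theta> 0 (cinv c z))) has_derivative (\<lambda>v. v)) (at x)"
    by (rule has_derivative_transform_within_open[OF has_derivative_ident open_cimg[OF c(1)] c(2)]) (simp add: \<Theta>0 cmap_cinv)
  from pullback_local[OF law c(1) open_cimg[OF c(1)] c(2) _ this len] show ?thesis
    using c by (simp add: \<Theta>0 cinv_in cmap_cinv)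
qed

lemma kform_initial: assumes c: "c \<in> X" "x \<in> cimg c" and len: "length vs = 2" shows "kform 0 c x vs = \<omega> c x vs"
proof -
  let ?U = "cimg c" and ?g = "\<lambda>y. u 0 (cinv c y)"
  note N = nice_open[OF open_cimg[OF c(1)]]
  have g0: "?g y = 0" if "y \<in> ?U" for y using u cinv_points[OF c(1) that] by (simp add: ma13_flow_def)
  have z: "dirD ?U (\<lambda>y. 0 :: real) v y = 0" if "y \<in> ?U" for v y
    using fun_cong[OF fd_eq[OF N that has_derivative_const[of "0 :: real"]]] by simp
  have d: "dirD ?U ?g v y = 0" if "y \<in> ?U" for v y
    by (simp add: fun_cong[OF fd_cong(1)[OF that g0]] z[OF that])
  have h: "hessian ?U ?g x v w = 0" for v w
    unfolding hessian_def by (simp add: fun_cong[OF fd_cong(1)[OF c(2) d]] z[OF c(2)])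
  have "smooth_on ?U ?g" using smooth_on_cong[of ?U ?g "\<lambda>_. 0"] g0 smooth_on_const[OF N] by blast
  from i_ddbar_hessian[OF open_cimg[OF c(1)] c(2) this len] show ?thesis by (simp add: kform_def add_i_ddbar_def h)
qed

lemma \<phi>_initial: "form_eq (prod_atlas D X) 3 (\<phi> 0) (\<Phi> \<omega> \<Omega>)"
  unfolding form_eq_def
proof (intro ballI allI impI)
  fix C z and vs :: "('r \<times> (complex^'n)) list" assume C: "C \<in> prod_atlas D X" "z \<in> cimg C" and len: "length vs = 3"
  show "\<phi> 0 C z vs = \<Phi> \<omega> \<Omega> C z vs"
  proof (rule product_chart_cases[OF C(1)])
    fix d c assume dc: "C = prod_chart d c" "d \<in> D" "c \<in> X"
    obtain \<rho> x where zx: "z = (\<rho>, x)" "\<rho> \<in> cimg d" "x \<in> cimg c" using C(2) dc by (auto simp: prod_chart_simps)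
    have \<omega>law: "form_law 2 \<omega>" using \<omega> unfolding form_law_def kaehler_form_def smooth_form_def by blast
    have \<omega>alt: "alternating 2 (\<omega> c x)" using \<omega> dc(3) zx(3) by (simp add: kaehler_form_def smooth_form_def)
    have k: "pullback X (\<Theta> 0) (kform 0) c x ws = \<omega> c x ws" if "length ws = 2" for ws
      using pullback_initial[OF kform_law[of 0] dc(3) zx(3) that] kform_initial[OF dc(3) zx(3) that] by simp
    have B: "b (pullback X (\<Theta> 0) \<Omega> c x) vs = b (\<Omega> c x) vs"
      by (rule b_cong[OF len pullback_initial[OF \<Omega>_law dc(3) zx(3)]])
    have W: "wedge 1 (covector_form (\<lambda>v. r (fst v))) (\<lambda>vs. pullback X (\<Theta> 0) (kform 0) c x (map snd vs) + \<kappa> (map fst vs)) vs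
      = wedge 1 (covector_form (\<lambda>v. r (fst v))) (\<lambda>vs. \<omega> c x (map snd vs) + \<kappa> (map fst vs)) vs"
      by (rule wedge_cong) (use len in \<open>simp_all add: k\<close>)
    show ?thesis
      unfolding dc(1) zx(1) \<Phi>[OF \<omega>law \<Omega>_law dc(2,3) zx(2,3) \<omega>alt \<Omega>_alternating[OF dc(3) zx(3)] len]
        \<phi>_rep[OF order_refl dc(2,3) zx(2,3) len] B W ..
  qed
qed

theorem \<phi>_unique:
  assumes stu: "short_time_uniqueness (prod_atlas D X)" and \<psi>: "g2_laplacian_flow (prod_atlas D X) {0..<T} \<psi>"
    and eq0: "form_eq (prod_atlas D X) 3 (\<psi> 0) (\<Phi> \<omega> \<Omega>)" and t: "t \<in> {0..<T}"
  shows "form_eq (prod_atlas D X) 3 (\<psi> t) (\<phi> t)"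
proof (rule flow_unique[OF stu open_product_chart \<phi>_flow \<phi>_closed \<psi> _ t])
  show "form_eq (prod_atlas D X) 3 (\<psi> 0) (\<phi> 0)" using eq0 \<phi>_initial by (simp add: form_eq_def)
qed

end

subsection \<open>The two product manifolds\<close>

lemma alternating_3I:
  fixes B :: "('e::real_vector, 'b::real_vector) mform"
  assumes l: "\<And>v w. linear (\<lambda>u. B [u, v, w])" "\<And>u w. linear (\<lambda>v. B [u, v, w])" "\<And>u v. linear (\<lambda>w. B [u, v, w])"
    and z: "\<And>v w. B [v, v, w] = 0" "\<And>v w. B [v, w, v] = 0" "\<And>v w. B [w, v, v] = 0"
  shows "alternating 3 B"
  unfolding alternating_def
proof (intro conjI allI impI)
  fix vs :: "'e list" and i :: nat assume vs: "length vs = 3" "i < 3"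
  then obtain a b c where "vs = [a, b, c]" by (auto simp: numeral_3_eq_3 length_Suc_conv)
  moreover have "i = 0 \<or> i = 1 \<or> i = 2" using vs by auto
  ultimately show "linear (\<lambda>v. B (vs[i := v]))" using l by auto
next
  fix vs :: "'e list" and i j :: nat assume vs: "length vs = 3" "i < j" "j < 3" "vs ! i = vs ! j"
  then obtain a b c where v: "vs = [a, b, c]" by (auto simp: numeral_3_eq_3 length_Suc_conv)
  have "i = 0 \<and> j = 1 \<or> i = 0 \<and> j = 2 \<or> i = 1 \<and> j = 2" using vs by auto
  then show "B vs = 0" using vs z unfolding v by auto
qed

lemma inj_on_chart: "translation_atlas A \<Longrightarrow> d \<in> A \<Longrightarrow> inj_on (cmap d) (cdom d)"
  unfolding translation_atlas_def by blast

text \<open>The square root of F^3 f^2 = 1, in the form in which three factors \<open>sqrt F\<close>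
  from stretched frame vectors appear.\<close>

lemma square_cube_one: "F > 0 \<Longrightarrow> f > 0 \<Longrightarrow> F ^ 3 * f\<^sup>2 = 1 \<Longrightarrow> sqrt F ^ 3 * f = (1::real)"
proof -
  assume a: "F > 0" "f > 0" "F ^ 3 * f\<^sup>2 = 1"
  have "(sqrt F ^ 3 * f)\<^sup>2 = (sqrt F)\<^sup>2 ^ 3 * f\<^sup>2" by (simp add: power_mult_distrib power_mult[symmetric] mult.commute)
  also have "\<dots> = 1\<^sup>2" using a by simp
  finally show ?thesis by (rule power2_eq_imp_eq) (use a in auto)
qed

context ma_flow
begin

lemma form_law_Re: "form_law k \<beta> \<Longrightarrow> form_law k (Re_form \<beta>)" and form_law_Im: "form_law k \<beta> \<Longrightarrow> form_law k (Im_form \<beta>)"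
  unfolding form_law_def Re_form_def Im_form_def by metis+

lemma kform_rules:
  assumes c: "c \<in> X" and t: "t \<ge> 0" and x: "x \<in> cimg c"
  shows "linear (\<lambda>v. kform t c x [v, w])" "linear (\<lambda>v. kform t c x [w, v])"
    "kform t c x [\<i> *s v, w] = - kform t c x [v, \<i> *s w]" "kform t c x [v, v] = 0"
    "kform t c x [0, w] = 0" "kform t c x [w, 0] = 0" 
proof -
  note alt = kform_alternating[OF c t x]
  show l1: "linear (\<lambda>v. kform t c x [v, w])" for w using alt_linear_hd[OF alt, of "[w]"] by simp
  show l2: "linear (\<lambda>v. kform t c x [w, v])" for w using alt_linear_mid[OF alt, of "[w]" "[]"] by simp
  show "kform t c x [\<i> *s v, w] = - kform t c x [v, \<i> *s w]"
    using kform_invariant[OF c t x, of v "\<i> *s w"] linear_neg[OF l2[of "\<i> *s v"], of w] by (simp add: i_scale_twice)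
  show "kform t c x [v, v] = 0" by (rule alt_eq_0[OF alt]) auto
  show "kform t c x [0, w] = 0" "kform t c x [w, 0] = 0" using linear_0[OF l1] linear_0[OF l2] by auto
qed

text \<open>Stretch the unitary frame by s = \<open>sqrt F\<close>, with F the speed: the Kaehler
  form takes the value F = 1/q on conjugate pairs and \<Omega> the value s^3 f = 1. The vector
  \<open>e 0\<close> has angle component 1/F, as r is the angle differential.\<close>

lemma frame_S1:
  assumes 3: "CARD('n) = 3" and c: "c \<in> X" and t: "t \<ge> 0" and x: "x \<in> cimg c"
  shows "\<exists>e. reduced_frame (\<lambda>v :: real \<times> (complex^'n). fst v) (\<lambda>vs. kform t c x (map snd vs) + 0) (\<lambda>vs. \<Omega> c x (map snd vs)) (1 / speed c (t, x)) e
         \<and> snd (e 0) = 0 \<and> (\<forall>j\<in>{1..3}. snd (e (j + 3)) = \<i> *s snd (e j))"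
proof (rule speed_frame[OF c t x])
  fix \<epsilon> :: "nat \<Rightarrow> complex^'n" and f :: real
  assume f: "f > 0" and F: "speed c (t, x) > 0" and Ff: "speed c (t, x) ^ 3 * f\<^sup>2 = 1"
    and fr: "\<And>i j. i < CARD('n) \<Longrightarrow> j < CARD('n) \<Longrightarrow> kform t c x [\<epsilon> i, \<epsilon> j] = 0 \<and> kform t c x [\<epsilon> i, \<i> *s \<epsilon> j] = (if i = j then 1 else 0)"
    and Zf: "\<Omega> c x (map \<epsilon> [0..<CARD('n)]) = complex_of_real f"
  define s where "s = sqrt (speed c (t, x))"
  have s: "s > 0" "s * s = speed c (t, x)" "s ^ 3 * f = 1" using F square_cube_one[OF F f Ff] by (auto simp: s_def)
  define Z where "Z = \<Omega> c x"
  have cm: "complex_multilinear 3 Z" using \<Omega>_multilinear(1)[OF c x] 3 by (simp add: Z_def)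
  then have alt: "alternating 3 Z" by (simp add: complex_multilinear_def)
  note k = kform_rules[OF c t x]
  define \<delta> where "\<delta> i = s *\<^sub>R \<epsilon> i" for i
  define e where "e i = (if i = 0 then (1 / speed c (t, x), 0) else if i \<le> 3 then (0, \<delta> (i - 1)) else (0, \<i> *s \<delta> (i - 4)))" for i :: nat
  have isc: "\<i> *s (a *\<^sub>R v) = a *\<^sub>R (\<i> *s v)" for a and v :: "complex^'n" using linear_scale[OF linear_i_scale] .
  have ks: "kform t c x [a *\<^sub>R v, w] = a * kform t c x [v, w]" "kform t c x [w, a *\<^sub>R v] = a * kform t c x [w, v]" for a v w
    using linear_scale[OF k(1)] linear_scale[OF k(2)] by auto
  have kn: "kform t c x [w, - v] = - kform t c x [w, v]" for v w using linear_neg[OF k(2)] by auto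
  have B: "kform t c x [\<delta> i, \<delta> j] = 0" "kform t c x [\<delta> i, \<i> *s \<delta> j] = (if i = j then speed c (t, x) else 0)" if "i \<in> {0, 1, 2}" "j \<in> {0, 1, 2}" for i j
    using fr[of i j] that 3 s(2) by (auto simp: \<delta>_def isc ks)
  have l: "linear (\<lambda>u. Z [u, v, w])" "linear (\<lambda>u. Z [v, u, w])" "linear (\<lambda>u. Z [v, w, u])" for v w
    using alt_linear_hd[OF alt, of "[v, w]"] alt_linear_mid[OF alt, of "[v]" "[w]"] alt_linear_mid[OF alt, of "[v, w]" "[]"] by simp_all
  have Z0: "Z [0, v, w] = 0" "Z [v, 0, w] = 0" "Z [v, w, 0] = 0" for v w using linear_0[OF l(1)] linear_0[OF l(2)] linear_0[OF l(3)] by auto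
  have Zs: "Z [a *\<^sub>R u, v, w] = of_real a * Z [u, v, w]" "Z [v, a *\<^sub>R u, w] = of_real a * Z [v, u, w]" "Z [v, w, a *\<^sub>R u] = of_real a * Z [v, w, u]" for a u v w
    using linear_scale[OF l(1)] linear_scale[OF l(2)] linear_scale[OF l(3)] by (simp_all add: scaleR_conv_of_real)
  have Zi: "Z [\<i> *s u, v, w] = \<i> * Z [u, v, w]" "Z [v, \<i> *s u, w] = \<i> * Z [v, u, w]" "Z [v, w, \<i> *s u] = \<i> * Z [v, w, u]" for u v w
    using complex_multilinear_slot[OF cm, of "[]" "[v, w]"] complex_multilinear_slot[OF cm, of "[v]" "[w]"] complex_multilinear_slot[OF cm, of "[v, w]" "[]"] by simp_all
  have Zz: "Z [v, v, w] = 0" "Z [v, w, v] = 0" "Z [w, v, v] = 0" for v w by (rule alt_eq_0[OF alt], simp, simp)+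
  have w1: "Z [a, b, c] = - Z [b, a, c]" and w2: "Z [a, b, c] = - Z [a, c, b]" for a b c
    using alt_swap[OF alt, of "[]" "[c]" a b] alt_swap[OF alt, of "[a]" "[]" b c] by auto
  have "Z [\<epsilon> 0, \<epsilon> 1, \<epsilon> 2] = complex_of_real f" using Zf by (simp add: 3 Z_def upt_rec numeral_2_eq_2)
  then have Z1: "Z [\<delta> 0, \<delta> 1, \<delta> 2] = 1"
    using s(3) by (simp add: \<delta>_def Zs flip: of_real_mult) (simp add: power3_eq_cube mult.assoc)
  have Zp: "Z [\<delta> 0, \<delta> 2, \<delta> 1] = - 1" "Z [\<delta> 1, \<delta> 0, \<delta> 2] = - 1" "Z [\<delta> 1, \<delta> 2, \<delta> 0] = 1"
    "Z [\<delta> 2, \<delta> 0, \<delta> 1] = 1" "Z [\<delta> 2, \<delta> 1, \<delta> 0] = - 1"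
    using Z1 w2[of "\<delta> 0" "\<delta> 2" "\<delta> 1"] w1[of "\<delta> 1" "\<delta> 0" "\<delta> 2"] w2[of "\<delta> 1" "\<delta> 2" "\<delta> 0"] w1[of "\<delta> 2" "\<delta> 0" "\<delta> 1"] w1[of "\<delta> 2" "\<delta> 1" "\<delta> 0"] by simp_all
  have e: "e 0 = (1 / speed c (t, x), 0)" "e 1 = (0, \<delta> 0)" "e 2 = (0, \<delta> 1)" "e 3 = (0, \<delta> 2)"
    "e 4 = (0, \<i> *s \<delta> 0)" "e 5 = (0, \<i> *s \<delta> 1)" "e 6 = (0, \<i> *s \<delta> 2)"
    by (simp_all add: e_def)
  show ?thesis
  proof (intro exI[of _ e] conjI)
    show "snd (e 0) = 0" by (simp add: e)
    have "{1..3::nat} = {1, 2, 3}" by auto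
    then show "\<forall>j\<in>{1..3}. snd (e (j + 3)) = \<i> *s snd (e j)" by (simp add: e e[simplified])
    have ab: "\<forall>i<7. \<forall>j<7. kform t c x (map snd [e i, e j]) + 0 = kaehler_coeff i j / (1 / speed c (t, x))"
      unfolding all_less_7 e list.map snd_conv
      by (simp add: kaehler_coeff_def k kn B B[simplified] i_scale_twice)
    have vol: "\<forall>I\<in>set (filter (\<lambda>I. length I = 3) (subseqs [0..<7])). \<Omega> c x (map snd (map e I)) = volume_coeff I"
      unfolding increasing_3 Z_def[symmetric]
      by (simp only: set_simps ball_simps list.map e snd_conv Z0 Zi Zz Z1 Zp) (simp add: volume_coeff_def)
    show "reduced_frame fst (\<lambda>vs. kform t c x (map snd vs) + 0) (\<lambda>vs. \<Omega> c x (map snd vs)) (1 / speed c (t, x)) e"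
      unfolding reduced_frame_def using ab vol F by (simp add: all_less_7 e e[simplified])
  qed
qed

text \<open>In the angle coordinates, \<open>torus_\<kappa>\<close> is - dr^2 \<and> dr^3,
  \<open>torus_\<zeta>\<close> is the 1-form \<zeta> = dr^2 - i dr^3, and \<open>torus_b Z\<close>
  is \<zeta> \<and> Z.\<close>

definition torus_\<kappa> :: "(real \<times> real \<times> real, real) mform" where
  "torus_\<kappa> \<rho>s = - (fst (snd (\<rho>s ! 0)) * snd (snd (\<rho>s ! 1)) - snd (snd (\<rho>s ! 0)) * fst (snd (\<rho>s ! 1)))"

definition torus_\<zeta> :: "(real \<times> real \<times> real) \<times> (complex^'n) \<Rightarrow> complex" where
  "torus_\<zeta> v = Complex (fst (snd (fst v))) (- snd (snd (fst v)))"

definition torus_b :: "(complex^'n, complex) mform \<Rightarrow> ((real \<times> real \<times> real) \<times> (complex^'n), complex) mform" where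
  "torus_b Z vs = torus_\<zeta> (vs ! 0) * Z [snd (vs ! 1), snd (vs ! 2)] - torus_\<zeta> (vs ! 1) * Z [snd (vs ! 0), snd (vs ! 2)]
     + torus_\<zeta> (vs ! 2) * Z [snd (vs ! 0), snd (vs ! 1)]"

lemma torus_b_list: "torus_b Z [v0, v1, v2] = torus_\<zeta> v0 * Z [snd v1, snd v2] - torus_\<zeta> v1 * Z [snd v0, snd v2] + torus_\<zeta> v2 * Z [snd v0, snd v1]"
  by (simp add: torus_b_def numeral_2_eq_2)

lemma linear_torus_\<zeta>: "linear torus_\<zeta>" by (simp add: linear_iff torus_\<zeta>_def complex_eq_iff)

lemma torus_b_alternating: assumes "alternating 2 Z" shows "alternating 3 (torus_b Z)"
proof -
  have l1: "linear (\<lambda>v. Z [v, w])" for w using alt_linear_hd[OF assms, of "[w]"] by simp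
  have l2: "linear (\<lambda>v. Z [w, v])" for w using alt_linear_mid[OF assms, of "[w]" "[]"] by simp
  have z: "Z [v, v] = 0" for v by (rule alt_eq_0[OF assms]) auto
  have sw: "Z [v, w] = - Z [w, v]" for v w using alt_swap[OF assms, of "[]" "[]" v w] by simp
  note simps = linear_iff torus_b_list linear_add[OF linear_torus_\<zeta>] linear_scale[OF linear_torus_\<zeta>] linear_add[OF l1] linear_add[OF l2]
    linear_scale[OF l1] linear_scale[OF l2] z algebra_simps
  show ?thesis
  proof (rule alternating_3I)
    show "torus_b Z [v, w, v] = 0" for v w using sw[of "snd w" "snd v"] by (simp add: torus_b_list z)
  qed (simp_all add: simps)
qed

text \<open>The plane of r^2 and r^3 acts as a third complex line: \<open>e 3\<close> and
  \<open>e 6\<close> are s \<partial>_2 and - s \<partial>_3 with s = \<open>sqrt F\<close>, so that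
  \<kappa> has the value s^2 = F on them and \<zeta> takes the values s and i s. On the stretched
  unitary pair \<Omega> is s^2 f = 1/s, hence \<zeta> \<and> \<Omega> is normalised. The sign of
  \<open>e 0\<close> belongs to r = - dr^1.\<close>

lemma frame_T3:
  assumes 2: "CARD('n) = 2" and c: "c \<in> X" and t: "t \<ge> 0" and x: "x \<in> cimg c"
  shows "\<exists>e. reduced_frame (\<lambda>v. - fst (fst v)) (\<lambda>vs. kform t c x (map snd vs) + torus_\<kappa> (map fst vs)) (torus_b (\<Omega> c x)) (1 / speed c (t, x)) e
         \<and> snd (e 0) = 0 \<and> (\<forall>j\<in>{1..3}. snd (e (j + 3)) = \<i> *s snd (e j))"
proof (rule speed_frame[OF c t x])
  fix \<epsilon> :: "nat \<Rightarrow> complex^'n" and f :: real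
  assume f: "f > 0" and F: "speed c (t, x) > 0" and Ff: "speed c (t, x) ^ 3 * f\<^sup>2 = 1"
    and fr: "\<And>i j. i < CARD('n) \<Longrightarrow> j < CARD('n) \<Longrightarrow> kform t c x [\<epsilon> i, \<epsilon> j] = 0 \<and> kform t c x [\<epsilon> i, \<i> *s \<epsilon> j] = (if i = j then 1 else 0)"
    and Zf: "\<Omega> c x (map \<epsilon> [0..<CARD('n)]) = complex_of_real f"
  define s where "s = sqrt (speed c (t, x))"
  have s: "s > 0" "s * s = speed c (t, x)" "s ^ 3 * f = 1" using F square_cube_one[OF F f Ff] by (auto simp: s_def)
  define Z where "Z = \<Omega> c x"
  have cm: "complex_multilinear 2 Z" using \<Omega>_multilinear(1)[OF c x] 2 by (simp add: Z_def)
  then have alt: "alternating 2 Z" by (simp add: complex_multilinear_def)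
  note k = kform_rules[OF c t x]
  define \<delta> where "\<delta> i = s *\<^sub>R \<epsilon> i" for i
  define e :: "nat \<Rightarrow> (real \<times> real \<times> real) \<times> (complex^'n)" where
    "e i = (if i = 0 then ((- 1 / speed c (t, x), 0, 0), 0) else if i = 3 then ((0, s, 0), 0) else if i = 6 then ((0, 0, - s), 0)
      else if i < 3 then (0, \<delta> (i - 1)) else (0, \<i> *s \<delta> (i - 4)))" for i :: nat
  have isc: "\<i> *s (a *\<^sub>R v) = a *\<^sub>R (\<i> *s v)" for a and v :: "complex^'n" using linear_scale[OF linear_i_scale] .
  have ks: "kform t c x [a *\<^sub>R v, w] = a * kform t c x [v, w]" "kform t c x [w, a *\<^sub>R v] = a * kform t c x [w, v]" for a v w
    using linear_scale[OF k(1)] linear_scale[OF k(2)] by auto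
  have kn: "kform t c x [w, - v] = - kform t c x [w, v]" for v w using linear_neg[OF k(2)] by auto
  have B: "kform t c x [\<delta> i, \<delta> j] = 0" "kform t c x [\<delta> i, \<i> *s \<delta> j] = (if i = j then speed c (t, x) else 0)" if "i \<in> {0, 1}" "j \<in> {0, 1}" for i j
    using fr[of i j] that 2 s(2) by (auto simp: \<delta>_def isc ks)
  have l: "linear (\<lambda>u. Z [u, v])" "linear (\<lambda>u. Z [v, u])" for v
    using alt_linear_hd[OF alt, of "[v]"] alt_linear_mid[OF alt, of "[v]" "[]"] by simp_all
  have Z0: "Z [0, v] = 0" "Z [v, 0] = 0" for v using linear_0[OF l(1)] linear_0[OF l(2)] by auto
  have Zs: "Z [a *\<^sub>R u, v] = of_real a * Z [u, v]" "Z [v, a *\<^sub>R u] = of_real a * Z [v, u]" for a u v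
    using linear_scale[OF l(1)] linear_scale[OF l(2)] by (simp_all add: scaleR_conv_of_real)
  have Zi: "Z [\<i> *s u, v] = \<i> * Z [u, v]" "Z [v, \<i> *s u] = \<i> * Z [v, u]" for u v
    using complex_multilinear_slot[OF cm, of "[]" "[v]"] complex_multilinear_slot[OF cm, of "[v]" "[]"] by simp_all
  have Zz: "Z [v, v] = 0" for v by (rule alt_eq_0[OF alt]) auto
  define \<sigma> where "\<sigma> = complex_of_real s"
  have \<sigma>: "\<sigma> \<noteq> 0" using s(1) by (simp add: \<sigma>_def)
  have "Z [\<epsilon> 0, \<epsilon> 1] = complex_of_real f" using Zf by (simp add: 2 Z_def upt_rec numeral_2_eq_2)
  moreover have "\<sigma> ^ 3 * complex_of_real f = 1" using s(3) unfolding \<sigma>_def by (simp flip: of_real_power of_real_mult)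
  ultimately have Z1: "Z [\<delta> 0, \<delta> 1] = 1 / \<sigma>"
    using \<sigma> by (simp add: \<delta>_def Zs field_simps power3_eq_cube \<sigma>_def[symmetric])
  have Z2: "Z [\<delta> 1, \<delta> 0] = - (1 / \<sigma>)" using Z1 alt_swap[OF alt, of "[]" "[]" "\<delta> 1" "\<delta> 0"] by simp
  have e: "e 0 = ((- 1 / speed c (t, x), 0, 0), 0)" "e 1 = (0, \<delta> 0)" "e 2 = (0, \<delta> 1)" "e 3 = ((0, s, 0), 0)"
    "e 4 = (0, \<i> *s \<delta> 0)" "e 5 = (0, \<i> *s \<delta> 1)" "e 6 = ((0, 0, - s), 0)"
    by (simp_all add: e_def)
  have z: "torus_\<zeta> (0, v) = 0" "torus_\<zeta> ((a, 0, 0), v) = 0" "torus_\<zeta> ((a, s, 0), v) = \<sigma>" "torus_\<zeta> ((a, 0, - s), v) = \<i> * \<sigma>" for a v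
    by (simp_all add: torus_\<zeta>_def \<sigma>_def complex_eq_iff)
  show ?thesis
  proof (intro exI[of _ e] conjI)
    show "snd (e 0) = 0" by (simp add: e)
    have "{1..3::nat} = {1, 2, 3}" by auto
    then show "\<forall>j\<in>{1..3}. snd (e (j + 3)) = \<i> *s snd (e j)" by (simp add: e e[simplified])
    have ab: "\<forall>i<7. \<forall>j<7. kform t c x (map snd [e i, e j]) + torus_\<kappa> (map fst [e i, e j]) = kaehler_coeff i j / (1 / speed c (t, x))"
      unfolding all_less_7 e list.map snd_conv fst_conv
      by (simp add: kaehler_coeff_def torus_\<kappa>_def k kn B B[simplified] i_scale_twice s(2))
    have vol: "\<forall>I\<in>set (filter (\<lambda>I. length I = 3) (subseqs [0..<7])). torus_b (\<Omega> c x) (map e I) = volume_coeff I"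
      unfolding increasing_3 Z_def[symmetric]
      by (simp only: set_simps ball_simps list.map torus_b_list z e snd_conv Z0 Zi Zz Z1 Z2) (simp add: volume_coeff_def \<sigma>)
    show "reduced_frame (\<lambda>v. - fst (fst v)) (\<lambda>vs. kform t c x (map snd vs) + torus_\<kappa> (map fst vs)) (torus_b (\<Omega> c x)) (1 / speed c (t, x)) e"
      unfolding reduced_frame_def using ab vol F by (simp add: all_less_7 e e[simplified])
  qed
qed

section \<open>The 3-forms of the theorem in product charts\<close>

lemma cinv_product:
  assumes D: "translation_atlas D" "d \<in> D" and c: "c \<in> X" and z: "z \<in> cimg d \<times> cimg c"
  shows "cinv (prod_chart d c) z = (cinv d (fst z), cinv c (snd z))"
proof -
  have "inj_on (cmap d) (cdom d)" using D by (simp add: translation_atlas_def)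
  from cinv_prod_chart[OF this inj_cmap[OF c], of "fst z" "snd z"] z show ?thesis by auto
qed

lemma open_product: "translation_atlas D \<Longrightarrow> d \<in> D \<Longrightarrow> c \<in> X \<Longrightarrow> open (cimg d \<times> cimg c)"
  by (intro open_Times open_cimg) (simp add: translation_atlas_def)

lemma phi_S1_representation:
  assumes law: "form_law 2 \<alpha>" "form_law CARD('n) \<beta>" and d: "d \<in> circle" and c: "c \<in> X" and z: "\<rho> \<in> cimg d" "x \<in> cimg c"
    and 3: "CARD('n) = 3" and len: "length vs = 3"
  shows "phi_S1 X \<alpha> \<beta> (prod_chart d c) (\<rho>, x) vs = Re (\<beta> c x (map snd vs))
    - wedge 1 (covector_form (\<lambda>v :: real \<times> (complex^'n). fst v)) (\<lambda>vs. \<alpha> c x (map snd vs) + 0) vs"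
proof -
  note ps = pullback_snd[OF translation_atlas_circle d c _ z]
  have "pullback X snd (Re_form \<beta>) (prod_chart d c) (\<rho>, x) vs = Re (\<beta> c x (map snd vs))"
    using ps[OF form_law_Re[OF law(2)]] 3 len by (simp add: Re_form_def)
  moreover have "wedge_form 1 (pullback circle fst dangle) (pullback X snd \<alpha>) (prod_chart d c) (\<rho>, x) vs
      = wedge 1 (covector_form (\<lambda>v :: real \<times> (complex^'n). fst v)) (\<lambda>vs. \<alpha> c x (map snd vs) + 0) vs"
    unfolding wedge_form_def
  proof (rule wedge_cong)
    fix us :: "(real \<times> (complex^'n)) list" assume "length us = 1"
    then show "pullback circle fst dangle (prod_chart d c) (\<rho>, x) us = fst (us ! 0)"
      by (intro pullback_dangle[OF d open_product[OF translation_atlas_circle d c] _ _ bounded_linear_fst])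
         (use z cinv_product[OF translation_atlas_circle d c] in auto)
  next
    fix us :: "(real \<times> (complex^'n)) list" assume "length us = length vs - 1"
    then show "pullback X snd \<alpha> (prod_chart d c) (\<rho>, x) us = \<alpha> c x (map snd us) + 0" using ps[OF law(1)] len by simp
  qed
  ultimately show ?thesis by (simp only: phi_S1_def)
qed

lemma translation_atlas_torus: "translation_atlas T3"
  by (intro translation_atlas_prod translation_atlas_circle)

text \<open>With r = - dr^1, the product - r \<and> (\<alpha> + \<kappa>) contributes dr^1 \<and>
  \<alpha> and - dr^1 \<and> dr^2 \<and> dr^3; the real part of (dr^2 - i dr^3) \<and> \<beta>
  contributes the two terms with Re \<beta> and Im \<beta>.\<close>

lemma phi_T3_representation:
  assumes law: "form_law 2 \<alpha>" "form_law CARD('n) \<beta>" and d: "d \<in> T3" and c: "c \<in> X" and z: "\<rho> \<in> cimg d" "x \<in> cimg c"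
    and alt: "alternating 2 (\<alpha> c x)" "alternating CARD('n) (\<beta> c x)" and 2: "CARD('n) = 2" and len: "length vs = 3"
  shows "phi_T3 X \<alpha> \<beta> (prod_chart d c) (\<rho>, x) vs = Re (torus_b (\<beta> c x) vs)
    - wedge 1 (covector_form (\<lambda>v. - fst (fst v))) (\<lambda>vs. \<alpha> c x (map snd vs) + torus_\<kappa> (map fst vs)) vs"
proof -
  let ?C = "prod_chart d c"
  note ps = pullback_snd[OF translation_atlas_torus d c _ z]
  note cp = cinv_product[OF translation_atlas_torus d c]
  note op = open_product[OF translation_atlas_torus d c]
  obtain d1 d2 d3 where dd: "d = prod_chart d1 (prod_chart d2 d3)" "d1 \<in> circle" "d2 \<in> circle" "d3 \<in> circle"
    using d by (auto simp: prod_atlas_def)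
  have inj: "inj_on (cmap d1) (cdom d1)" "inj_on (cmap d2) (cdom d2)" "inj_on (cmap d3) (cdom d3)"
    "inj_on (cmap (prod_chart d2 d3)) (cdom (prod_chart d2 d3))"
    using dd inj_on_chart[OF translation_atlas_circle] inj_on_chart[OF translation_atlas_prod[OF translation_atlas_circle translation_atlas_circle], of "prod_chart d2 d3"]
    by (auto simp: prod_atlas_def)
  have cd: "cinv d q = (cinv d1 (fst q), cinv d2 (fst (snd q)), cinv d3 (snd (snd q)))"
    and cdm: "fst q \<in> cimg d1" "fst (snd q) \<in> cimg d2" "snd (snd q) \<in> cimg d3" if "q \<in> cimg d" for q
    using that cinv_prod_chart[OF inj(1,4), of "fst q" "snd q"] cinv_prod_chart[OF inj(2,3), of "fst (snd q)" "snd (snd q)"]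
    unfolding dd(1) prod_chart_simps by auto
  have V: "(\<rho>, x) \<in> cimg d \<times> cimg c" using z by simp
  have ne: "us \<noteq> []" if "length us = 1" for us :: "((real \<times> real \<times> real) \<times> (complex^'n)) list" using that by auto
  have r1: "pullback circle (\<lambda>(r, p). fst r) dangle ?C (\<rho>, x) us = fst (fst (us ! 0))" if "length us = 1" for us
    by (rule pullback_dangle[OF dd(2) op V _ _ ne[OF that]])
       (use cp cd cdm in \<open>auto intro!: bounded_linear_intros simp: bounded_linear_compose\<close>)
  have r2: "pullback circle (\<lambda>(r, p). fst (snd r)) dangle ?C (\<rho>, x) us = fst (snd (fst (us ! 0)))" if "length us = 1" for us
    by (rule pullback_dangle[OF dd(3) op V _ _ ne[OF that]])
       (use cp cd cdm in \<open>auto intro!: bounded_linear_intros\<close>)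
  have r3: "pullback circle (\<lambda>(r, p). snd (snd r)) dangle ?C (\<rho>, x) us = snd (snd (fst (us ! 0)))" if "length us = 1" for us
    by (rule pullback_dangle[OF dd(4) op V _ _ ne[OF that]])
       (use cp cd cdm in \<open>auto intro!: bounded_linear_intros\<close>)
  let ?r1 = "\<lambda>v :: (real \<times> real \<times> real) \<times> (complex^'n). fst (fst v)" and ?r2 = "\<lambda>v :: (real \<times> real \<times> real) \<times> (complex^'n). fst (snd (fst v))"
    and ?r3 = "\<lambda>v :: (real \<times> real \<times> real) \<times> (complex^'n). snd (snd (fst v))"
  have lin: "linear ?r1" "linear ?r2" "linear ?r3" "linear (\<lambda>v :: (real \<times> real \<times> real) \<times> (complex^'n). - fst (fst v))" by (simp_all add: linear_iff)
  note cov = alternating_covector[OF lin(1)] alternating_covector[OF lin(2)] alternating_covector[OF lin(3)] alternating_covector[OF lin(4)]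
  obtain v0 v1 v2 where vs: "vs = [v0, v1, v2]" using len by (auto simp: numeral_eq_Suc length_Suc_conv)
  have altB: "alternating 2 (\<beta> c x)" using alt(2) 2 by simp
  have a23: "alternating 2 (\<lambda>us. ?r2 (us ! 0) * ?r3 (us ! 1) - ?r2 (us ! 1) * ?r3 (us ! 0))"
    by (rule alternating_2I) (simp_all add: linear_iff algebra_simps)
  have T1: "wedge_form 1 (pullback circle (\<lambda>(r, p). fst r) dangle) (wedge_form 1 (pullback circle (\<lambda>(r, p). fst (snd r)) dangle) (pullback circle (\<lambda>(r, p). snd (snd r)) dangle)) ?C (\<rho>, x) vs
    = wedge 1 (covector_form ?r1) (\<lambda>us. ?r2 (us ! 0) * ?r3 (us ! 1) - ?r2 (us ! 1) * ?r3 (us ! 0)) vs"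
    unfolding wedge_form_def
  proof (rule wedge_cong)
    fix us :: "((real \<times> real \<times> real) \<times> (complex^'n)) list" assume "length us = length vs - 1"
    then obtain a b where us: "us = [a, b]" using len by (auto simp: numeral_eq_Suc length_Suc_conv)
    have "wedge 1 (pullback circle (\<lambda>(r, p). fst (snd r)) dangle ?C (\<rho>, x)) (pullback circle (\<lambda>(r, p). snd (snd r)) dangle ?C (\<rho>, x)) us
       = wedge 1 (covector_form ?r2) (covector_form ?r3) us"
      by (rule wedge_cong) (simp_all add: r2 r3 us)
    then show "wedge 1 (pullback circle (\<lambda>(r, p). fst (snd r)) dangle ?C (\<rho>, x)) (pullback circle (\<lambda>(r, p). snd (snd r)) dangle ?C (\<rho>, x)) us
       = ?r2 (us ! 0) * ?r3 (us ! 1) - ?r2 (us ! 1) * ?r3 (us ! 0)"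
      using wedge_1_1[OF cov(2,3), of a b] by (simp add: us)
  qed (use r1 in simp)
  have T2: "wedge_form 1 (pullback circle (\<lambda>(r, p). fst r) dangle) (pullback X snd \<alpha>) ?C (\<rho>, x) vs = wedge 1 (covector_form ?r1) (\<lambda>us. \<alpha> c x (map snd us)) vs"
    unfolding wedge_form_def by (rule wedge_cong) (use r1 ps[OF law(1)] len in simp_all)
  have T3: "wedge_form 1 (pullback circle (\<lambda>(r, p). fst (snd r)) dangle) (pullback X snd (Re_form \<beta>)) ?C (\<rho>, x) vs = wedge 1 (covector_form ?r2) (\<lambda>us. Re (\<beta> c x (map snd us))) vs"
    unfolding wedge_form_def by (rule wedge_cong) (use r2 ps[OF form_law_Re[OF law(2)]] len 2 in \<open>simp_all add: Re_form_def\<close>)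
  have T4: "wedge_form 1 (pullback circle (\<lambda>(r, p). snd (snd r)) dangle) (pullback X snd (Im_form \<beta>)) ?C (\<rho>, x) vs = wedge 1 (covector_form ?r3) (\<lambda>us. Im (\<beta> c x (map snd us))) vs"
    unfolding wedge_form_def by (rule wedge_cong) (use r3 ps[OF form_law_Im[OF law(2)]] len 2 in \<open>simp_all add: Im_form_def\<close>)
  have a\<kappa>: "alternating 2 (\<lambda>us :: ((real \<times> real \<times> real) \<times> (complex^'n)) list. \<alpha> c x (map snd us) + torus_\<kappa> (map fst us))"
  proof (rule alt_sum_list_form[OF alt_map[OF alt(1) linear_snd]])
    show "alternating 2 (\<lambda>us :: ((real \<times> real \<times> real) \<times> (complex^'n)) list. torus_\<kappa> (map fst us))"
      by (rule alternating_2I) (simp_all add: linear_iff torus_\<kappa>_def algebra_simps)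
  qed
  show ?thesis
    unfolding phi_T3_def Let_def vs T1[unfolded vs] T2[unfolded vs] T3[unfolded vs] T4[unfolded vs]
    unfolding wedge_1_2[OF cov(1) a23] wedge_1_2[OF cov(1) alt_map[OF alt(1) linear_snd]] wedge_1_2[OF cov(2) alternating_Re[OF alt_map[OF altB linear_snd]]]
      wedge_1_2[OF cov(3) alternating_Im[OF alt_map[OF altB linear_snd]]] wedge_1_2[OF cov(4) a\<kappa>]
    by (simp add: torus_b_list torus_\<zeta>_def torus_\<kappa>_def algebra_simps)
qed

lemma torus_b_derivative:
  assumes 2: "CARD('n) = 2" and c: "c \<in> X" and x: "x \<in> cimg c"
  shows "smooth_on (cimg c) (\<lambda>x. torus_b (\<Omega> c x) [v0, v1, v2])"
    and "dirD (cimg c) (\<lambda>x. torus_b (\<Omega> c x) [v0, v1, v2]) a x = torus_\<zeta> v0 * dirD (cimg c) (\<lambda>x. \<Omega> c x [snd v1, snd v2]) a x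
      - torus_\<zeta> v1 * dirD (cimg c) (\<lambda>x. \<Omega> c x [snd v0, snd v2]) a x + torus_\<zeta> v2 * dirD (cimg c) (\<lambda>x. \<Omega> c x [snd v0, snd v1]) a x"
proof -
  note N = nice_open[OF open_cimg[OF c]]
  have s: "smooth_on (cimg c) (\<lambda>x. \<Omega> c x [v, w])" for v w by (rule \<Omega>_smooth[OF c]) (simp add: 2)
  note m = smooth_on_bl[OF bounded_linear_mult_right N s]
  show "smooth_on (cimg c) (\<lambda>x. torus_b (\<Omega> c x) [v0, v1, v2])" unfolding torus_b_list by (intro smooth_on_add[OF N] smooth_on_diff[OF N] m)
  show "dirD (cimg c) (\<lambda>x. torus_b (\<Omega> c x) [v0, v1, v2]) a x = torus_\<zeta> v0 * dirD (cimg c) (\<lambda>x. \<Omega> c x [snd v1, snd v2]) a x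
      - torus_\<zeta> v1 * dirD (cimg c) (\<lambda>x. \<Omega> c x [snd v0, snd v2]) a x + torus_\<zeta> v2 * dirD (cimg c) (\<lambda>x. \<Omega> c x [snd v0, snd v1]) a x"
    unfolding torus_b_list
    by (simp only: dirD_add[OF N x smooth_on_diff[OF N m m] m] dirD_diff[OF N x m m] smooth_dirD_bl[OF N x bounded_linear_mult_right s])
qed

theorem reduction_S1:
  assumes 3: "CARD('n) = 3" and \<Theta>: "flow_of_time_dependent_field X (\<lambda>t. Y_field (kform t) \<Omega>) \<Theta>"
  shows "g2_reduction X \<omega> \<Omega> u \<Theta> circle (\<lambda>\<rho>. \<rho>) (\<lambda>_. 0) (\<lambda>Z vs. Z (map snd vs)) (phi_S1 X)"
proof (intro g2_reduction.intro g2_reduction_axioms.intro ma_flow_axioms, goal_cases)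
  case 1 show ?case by (rule \<Theta>)
next
  case 2 show ?case by (rule translation_atlas_circle)
next
  case 3 show ?case using \<open>CARD('n) = 3\<close> by simp
next
  case 4 show ?case by (simp add: linear_iff)
next
  case 5 show ?case by (simp add: alternating_def linear_iff)
next
  case (6 Z) then show ?case using alt_map[OF _ linear_snd] 3 by (auto simp: complex_multilinear_def)
next
  case (7 Z L vs) show ?case by (simp add: o_def)
next
  case (8 vs Z Z') then show ?case using 3 by simp
next
  case (9 c vs) then show ?case using \<Omega>_smooth[of c "map snd vs"] 3 by simp
next
  case (10 c x v0 v1 v2 v3) then show ?case using \<Omega>_closed_3[OF _ _ 3, of c x "snd v1" "snd v2" "snd v3" "snd v0"] by simp
next
  case (11 c t x) then show ?case by (rule frame_S1[OF 3])
next
  case (12 \<alpha> \<beta> d c \<rho> x vs) then show ?case by (intro phi_S1_representation 3)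
qed

theorem reduction_T3:
  assumes 2: "CARD('n) = 2" and \<Theta>: "flow_of_time_dependent_field X (\<lambda>t. Y_field (kform t) \<Omega>) \<Theta>"
  shows "g2_reduction X \<omega> \<Omega> u \<Theta> T3 (\<lambda>\<rho>. - fst \<rho>) torus_\<kappa> torus_b (phi_T3 X)"
proof (intro g2_reduction.intro g2_reduction_axioms.intro ma_flow_axioms, goal_cases)
  case 1 show ?case by (rule \<Theta>)
next
  case 2 show ?case by (rule translation_atlas_torus)
next
  case 3 show ?case using \<open>CARD('n) = 2\<close> by simp
next
  case 4 show ?case by (simp add: linear_iff)
next
  case 5 show ?case by (rule alternating_2I) (simp_all add: linear_iff torus_\<kappa>_def algebra_simps)
next
  case (6 Z) then show ?case using torus_b_alternating 2 by (simp add: complex_multilinear_def)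
next
  case (7 vs Z L) then show ?case by (auto simp: numeral_3_eq_3 length_Suc_conv torus_b_list torus_\<zeta>_def)
next
  case (8 vs Z Z') then show ?case using 2 by (auto simp: torus_b_def)
next
  case (9 c vs)
  then obtain v0 v1 v2 where vs: "vs = [v0, v1, v2]" by (auto simp: numeral_3_eq_3 length_Suc_conv)
  have "smooth_on (cimg c) (\<lambda>x. \<Omega> c x [v, w])" for v w by (rule \<Omega>_smooth[OF 9(1)]) (simp add: 2)
  note m = smooth_on_bl[OF bounded_linear_mult_right nice_open[OF open_cimg[OF 9(1)]] this]
  show ?case unfolding vs torus_b_list by (intro smooth_on_add smooth_on_diff m nice_open open_cimg 9(1))
next
  case (10 c x v0 v1 v2 v3)
  \<comment> \<open>Here d(\<zeta> \<and> \<Omega>) = - \<zeta> \<and> d\<Omega> because \<zeta> is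
    constant: four instances of closedness of \<Omega>, weighted by the values of \<zeta>.\<close>
  note C = \<Omega>_closed_2[OF 10 2]
  show ?case unfolding torus_b_derivative(2)[OF 2 10]
    using arg_cong[OF C[of "snd v2" "snd v3" "snd v1"], of "(*) (torus_\<zeta> v0)"] arg_cong[OF C[of "snd v2" "snd v3" "snd v0"], of "(*) (torus_\<zeta> v1)"]
      arg_cong[OF C[of "snd v1" "snd v3" "snd v0"], of "(*) (torus_\<zeta> v2)"] arg_cong[OF C[of "snd v1" "snd v2" "snd v0"], of "(*) (torus_\<zeta> v3)"]
    by (simp add: algebra_simps)
next
  case (11 c t x) then show ?case by (rule frame_T3[OF 2])
next
  case (12 \<alpha> \<beta> d c \<rho> x vs) then show ?case by (intro phi_T3_representation 2)
qed

end

theorem mainTheorem3: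
  fixes X :: "('m::t2_space, complex^'n) atlas"
    and \<omega> :: "('m, complex^'n, real) form"
    and \<Omega> :: "('m, complex^'n, complex) form"
    and u :: "real \<Rightarrow> 'm \<Rightarrow> real"
    and \<Theta> :: "real \<Rightarrow> 'm \<Rightarrow> 'm"
  assumes "CARD('n) \<in> {2, 3}"
    and "complex_manifold X" and "compact (points X)"
    and "kaehler_form X \<omega>"
    and "holomorphic_volume_form X \<Omega>"
    and "ma13_flow X \<omega> \<Omega> u"
    and "flow_of_time_dependent_field X (\<lambda>t. Y_field (add_i_ddbar \<omega> (u t)) \<Omega>) \<Theta>"
  shows
    "(CARD('n) = 2 \<longrightarrow>
       (let M = prod_atlas T3 X;
            \<phi> = \<lambda>t. phi_T3 X (pullback X (\<Theta> t) (add_i_ddbar \<omega> (u t))) (pullback X (\<Theta> t) \<Omega>);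
            \<phi>\<^sub>0 = phi_T3 X \<omega> \<Omega>
        in g2_laplacian_flow M {0..} \<phi> \<and> form_eq M 3 (\<phi> 0) \<phi>\<^sub>0 \<and>
           (short_time_uniqueness M \<longrightarrow>
              (\<forall>T>0. \<forall>\<psi>. g2_laplacian_flow M {0..<T} \<psi> \<longrightarrow> form_eq M 3 (\<psi> 0) \<phi>\<^sub>0 \<longrightarrow>
                 (\<forall>t\<in>{0..<T}. form_eq M 3 (\<psi> t) (\<phi> t)))))) \<and>
     (CARD('n) = 3 \<longrightarrow>
       (let M = prod_atlas circle X;
            \<phi> = \<lambda>t. phi_S1 X (pullback X (\<Theta> t) (add_i_ddbar \<omega> (u t))) (pullback X (\<Theta> t) \<Omega>);
            \<phi>\<^sub>0 = phi_S1 X \<omega> \<Omega>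
        in g2_laplacian_flow M {0..} \<phi> \<and> form_eq M 3 (\<phi> 0) \<phi>\<^sub>0 \<and>
           (short_time_uniqueness M \<longrightarrow>
              (\<forall>T>0. \<forall>\<psi>. g2_laplacian_flow M {0..<T} \<psi> \<longrightarrow> form_eq M 3 (\<psi> 0) \<phi>\<^sub>0 \<longrightarrow>
                 (\<forall>t\<in>{0..<T}. form_eq M 3 (\<psi> t) (\<phi> t))))))"
proof -
  interpret ma_flow X \<omega> \<Omega> u by unfold_locales (use assms in auto)
  have \<Theta>: "flow_of_time_dependent_field X (\<lambda>t. Y_field (kform t) \<Omega>) \<Theta>" using assms(7) by (simp add: kform_def[abs_def])
  show ?thesis
  proof (intro conjI impI)
    assume 2: "CARD('n) = 2"
    interpret g2_reduction X \<omega> \<Omega> u \<Theta> T3 "\<lambda>\<rho>. - fst \<rho>" torus_\<kappa> torus_b "phi_T3 X" by (rule reduction_T3[OF 2 \<Theta>])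
    have \<phi>: "\<phi> = (\<lambda>t. phi_T3 X (pullback X (\<Theta> t) (add_i_ddbar \<omega> (u t))) (pullback X (\<Theta> t) \<Omega>))"
      by (intro ext) (simp add: \<phi>_def kform_def)
    show "let M = prod_atlas T3 X;
            \<phi> = \<lambda>t. phi_T3 X (pullback X (\<Theta> t) (add_i_ddbar \<omega> (u t))) (pullback X (\<Theta> t) \<Omega>);
            \<phi>\<^sub>0 = phi_T3 X \<omega> \<Omega>
        in g2_laplacian_flow M {0..} \<phi> \<and> form_eq M 3 (\<phi> 0) \<phi>\<^sub>0 \<and>
           (short_time_uniqueness M \<longrightarrow>
              (\<forall>T>0. \<forall>\<psi>. g2_laplacian_flow M {0..<T} \<psi> \<longrightarrow> form_eq M 3 (\<psi> 0) \<phi>\<^sub>0 \<longrightarrow>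
                 (\<forall>t\<in>{0..<T}. form_eq M 3 (\<psi> t) (\<phi> t))))"
      unfolding Let_def using \<phi>_flow[unfolded \<phi>] \<phi>_initial[unfolded \<phi>] \<phi>_unique[unfolded \<phi>] by blast
  next
    assume 3: "CARD('n) = 3"
    interpret g2_reduction X \<omega> \<Omega> u \<Theta> circle "\<lambda>\<rho>. \<rho>" "\<lambda>_. 0" "\<lambda>Z vs. Z (map snd vs)" "phi_S1 X" by (rule reduction_S1[OF 3 \<Theta>])
    have \<phi>: "\<phi> = (\<lambda>t. phi_S1 X (pullback X (\<Theta> t) (add_i_ddbar \<omega> (u t))) (pullback X (\<Theta> t) \<Omega>))"
      by (intro ext) (simp add: \<phi>_def kform_def)
    show "let M = prod_atlas circle X;
            \<phi> = \<lambda>t. phi_S1 X (pullback X (\<Theta> t) (add_i_ddbar \<omega> (u t))) (pullback X (\<Theta> t) \<Omega>);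
            \<phi>\<^sub>0 = phi_S1 X \<omega> \<Omega>
        in g2_laplacian_flow M {0..} \<phi> \<and> form_eq M 3 (\<phi> 0) \<phi>\<^sub>0 \<and>
           (short_time_uniqueness M \<longrightarrow>
              (\<forall>T>0. \<forall>\<psi>. g2_laplacian_flow M {0..<T} \<psi> \<longrightarrow> form_eq M 3 (\<psi> 0) \<phi>\<^sub>0 \<longrightarrow>
                 (\<forall>t\<in>{0..<T}. form_eq M 3 (\<psi> t) (\<phi> t))))"
      unfolding Let_def using \<phi>_flow[unfolded \<phi>] \<phi>_initial[unfolded \<phi>] \<phi>_unique[unfolded \<phi>] by blast
  qed
qed

end
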